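(* Let $\alpha,\beta\in\mathbb{R}$ be such that neither $\alpha$ nor $\beta$ is a negative integer and $\alpha+\beta>-1$. Let $u$ be a univalent sense-preserving $(\alpha,\beta)$-harmonic function on $\mathbb{D}$ with expansion $$u(z)=\sum_{k=0}^{\infty}c_{k}F(-\alpha,k-\beta;k+1;|z|^{2})z^{k}+\sum_{k=1}^{\infty}c_{-k}F(-\beta,k-\alpha;k+1;|z|^{2})\overline{z}^{k},$$ and suppose that $u$ maps $\mathbb{D}$ onto itself. Then $$\left(\frac{\Gamma(1+\alpha+\beta)}{\Gamma(1+\alpha)\Gamma(1+\beta)}\right)^2\left(\frac{|c_{1}|^2}{(1+\alpha)^2}+\frac{3\sqrt{3}}{\pi}|c_{0}|^2+\frac{|c_{-1}|^2}{(1+\beta)^2}\right)\geq \frac{27}{4\pi^2}.$$ The lower bound is asymptotically sharp as $\alpha,\beta\to 0$.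
   Context: $\mathbb{D}=\{z\in\mathbb{C}:|z|<1\}$. A complex-valued $u\in C^2(\mathbb{D})$ is $(\alpha,\beta)$-harmonic if $L_{\alpha,\beta}u=0$ on $\mathbb{D}$, where $$L_{\alpha,\beta}=(1-|z|^{2})\Big((1-|z|^{2})\frac{\partial^{2}}{\partial z\,\partial\overline z}+\alpha z\frac{\partial}{\partial z}+\beta\overline z\frac{\partial}{\partial\overline z}-\alpha\beta\Big).$$ It is known that $u$ is $(\alpha,\beta)$-harmonic if and only if it has a convergent expansion of the form displayed in the claim, for complex numbers $c_k$ ($k\in\mathbb{Z}$) with $\limsup_{|k|\to\infty}|c_k|^{1/|k|}\le 1$. Here $F(a,b;c;x)=\sum_{n\ge0}\frac{(a)_n(b)_n}{(c)_n}\frac{x^n}{n!}$ is the Gauss hypergeometric function. Univalent means injective; sense-preserving means $|u_z(z)|>|u_{\overline z}(z)|$ for all $z\in\mathbb{D}$. "Asymptotically sharp as $\alpha,\beta\to0$" means that for $\alpha=\beta=0$ the inequality reduces to one for harmonic functions in which the bound is best possible. *)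

theory Defs
  imports "HOL-Analysis.Analysis"
begin

abbreviation unit_disc :: "complex set" where
  "unit_disc \<equiv> ball 0 1"


subsection \<open>Real partial derivatives and Wirtinger derivatives\<close>

text \<open>The Frechet derivatives are those over the reals: a complex-valued function of
  \<open>z = x + \<i> y\<close> is regarded as a function of \<open>(x, y)\<close>. The values are only meaningful
  at points where the function is real differentiable.\<close>

definition partial_x :: "(complex \<Rightarrow> complex) \<Rightarrow> complex \<Rightarrow> complex" where
  "partial_x u z = frechet_derivative u (at z) 1"

definition partial_y :: "(complex \<Rightarrow> complex) \<Rightarrow> complex \<Rightarrow> complex" where
  "partial_y u z = frechet_derivative u (at z) \<i>"

definition wirtinger_z :: "(complex \<Rightarrow> complex) \<Rightarrow> complex \<Rightarrow> complex" where
  "wirtinger_z u z = (partial_x u z - \<i> * partial_y u z) / 2"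

definition wirtinger_zbar :: "(complex \<Rightarrow> complex) \<Rightarrow> complex \<Rightarrow> complex" where
  "wirtinger_zbar u z = (partial_x u z + \<i> * partial_y u z) / 2"

definition C1_on :: "complex set \<Rightarrow> (complex \<Rightarrow> complex) \<Rightarrow> bool" where
  "C1_on S u \<longleftrightarrow> (\<forall>z\<in>S. u differentiable (at z)) \<and>
     continuous_on S (partial_x u) \<and> continuous_on S (partial_y u)"

definition C2_on :: "complex set \<Rightarrow> (complex \<Rightarrow> complex) \<Rightarrow> bool" where
  "C2_on S u \<longleftrightarrow> C1_on S u \<and> C1_on S (partial_x u) \<and> C1_on S (partial_y u)"

definition sense_preserving :: "(complex \<Rightarrow> complex) \<Rightarrow> bool" where
  "sense_preserving u \<longleftrightarrow>
     (\<forall>z\<in>unit_disc. norm (wirtinger_z u z) > norm (wirtinger_zbar u z))"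


subsection \<open>\<open>(\<alpha>, \<beta>)\<close>-harmonic functions\<close>

definition L_op :: "real \<Rightarrow> real \<Rightarrow> (complex \<Rightarrow> complex) \<Rightarrow> complex \<Rightarrow> complex" where
  "L_op \<alpha> \<beta> u z = (1 - of_real ((norm z)\<^sup>2)) *
     ((1 - of_real ((norm z)\<^sup>2)) * wirtinger_z (wirtinger_zbar u) z
      + of_real \<alpha> * z * wirtinger_z u z
      + of_real \<beta> * cnj z * wirtinger_zbar u z
      - of_real (\<alpha> * \<beta>) * u z)"

definition ab_harmonic :: "real \<Rightarrow> real \<Rightarrow> (complex \<Rightarrow> complex) \<Rightarrow> bool" where
  "ab_harmonic \<alpha> \<beta> u \<longleftrightarrow> C2_on unit_disc u \<and> (\<forall>z\<in>unit_disc. L_op \<alpha> \<beta> u z = 0)"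


subsection \<open>The series expansion\<close>

definition gauss_hypergeo :: "real \<Rightarrow> real \<Rightarrow> real \<Rightarrow> real \<Rightarrow> real" where
  "gauss_hypergeo a b c x =
     (\<Sum>n. pochhammer a n * pochhammer b n / pochhammer c n * (x ^ n / fact n))"

lemma gauss_hypergeo_eq_eval_fps:
  "gauss_hypergeo a b c x = eval_fps (fps_hypergeo [a, b] [c] 1) x"
  by (simp add: gauss_hypergeo_def eval_fps_def)

definition pos_term ::
    "real \<Rightarrow> real \<Rightarrow> (int \<Rightarrow> complex) \<Rightarrow> complex \<Rightarrow> nat \<Rightarrow> complex" where
  "pos_term \<alpha> \<beta> c z k =
     c (int k) * of_real (gauss_hypergeo (- \<alpha>) (real k - \<beta>) (real k + 1) ((norm z)\<^sup>2)) * z ^ k"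

definition neg_term ::
    "real \<Rightarrow> real \<Rightarrow> (int \<Rightarrow> complex) \<Rightarrow> complex \<Rightarrow> nat \<Rightarrow> complex" where
  "neg_term \<alpha> \<beta> c z k =
     c (- int k) * of_real (gauss_hypergeo (- \<beta>) (real k - \<alpha>) (real k + 1) ((norm z)\<^sup>2)) * cnj z ^ k"

text \<open>The filter in the first conjunct is \<open>|k| \<rightarrow> \<infinity>\<close> on the integers. The series of the
  \<open>neg_term\<close>s starts at \<open>k = 1\<close>, hence the \<^const>\<open>Suc\<close>.\<close>

definition has_ab_expansion ::
    "real \<Rightarrow> real \<Rightarrow> (complex \<Rightarrow> complex) \<Rightarrow> (int \<Rightarrow> complex) \<Rightarrow> bool" where
  "has_ab_expansion \<alpha> \<beta> u c \<longleftrightarrow>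
     Limsup (filtercomap abs at_top)
       (\<lambda>k::int. ereal (norm (c k) powr (1 / real_of_int \<bar>k\<bar>))) \<le> 1 \<and>
     (\<forall>z\<in>unit_disc.
        summable (\<lambda>k. pos_term \<alpha> \<beta> c z k) \<and>
        summable (\<lambda>k. neg_term \<alpha> \<beta> c z (Suc k)) \<and>
        u z = (\<Sum>k. pos_term \<alpha> \<beta> c z k) + (\<Sum>k. neg_term \<alpha> \<beta> c z (Suc k)))"


subsection \<open>The functional bounded below\<close>

definition heinz_functional :: "real \<Rightarrow> real \<Rightarrow> (int \<Rightarrow> complex) \<Rightarrow> real" where
  "heinz_functional \<alpha> \<beta> c =
     (Gamma (1 + \<alpha> + \<beta>) / (Gamma (1 + \<alpha>) * Gamma (1 + \<beta>)))\<^sup>2 *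
     ((norm (c 1))\<^sup>2 / (1 + \<alpha>)\<^sup>2 + 3 * sqrt 3 / pi * (norm (c 0))\<^sup>2 + (norm (c (-1)))\<^sup>2 / (1 + \<beta>)\<^sup>2)"


subsection \<open>The case \<open>\<alpha> = \<beta> = 0\<close>: harmonic functions\<close>

lemma ab_harmonic_0_0:
  "ab_harmonic 0 0 u \<longleftrightarrow>
     C2_on unit_disc u \<and> (\<forall>z\<in>unit_disc. wirtinger_z (wirtinger_zbar u) z = 0)"
proof -
  have "1 - complex_of_real ((norm z)\<^sup>2) \<noteq> 0" if "z \<in> unit_disc" for z :: complex
  proof -
    have "(norm z)\<^sup>2 < 1"
      using that by (simp add: power_less_one_iff abs_square_less_1)
    then have "1 - (norm z)\<^sup>2 \<noteq> 0"
      by simp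
    then show ?thesis
      by (metis of_real_1 of_real_diff of_real_eq_0_iff)
  qed
  then show ?thesis
    by (auto simp: ab_harmonic_def L_op_def)
qed

lemma gauss_hypergeo_0_left: "gauss_hypergeo 0 b c x = 1"
proof -
  have "(\<lambda>n. pochhammer 0 n * pochhammer b n / pochhammer c n * (x ^ n / fact n)) sums
        (\<Sum>n\<in>{0}. pochhammer 0 n * pochhammer b n / pochhammer c n * (x ^ n / fact n))"
    by (rule sums_finite) (auto simp: pochhammer_0_left)
  then show ?thesis
    by (simp add: gauss_hypergeo_def sums_iff)
qed

lemma pos_term_0_0: "pos_term 0 0 c z k = c (int k) * z ^ k"
  by (simp add: pos_term_def gauss_hypergeo_0_left)

lemma neg_term_0_0: "neg_term 0 0 c z k = c (- int k) * cnj z ^ k"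
  by (simp add: neg_term_def gauss_hypergeo_0_left)

lemma heinz_functional_0_0:
  "heinz_functional 0 0 c = (norm (c 1))\<^sup>2 + 3 * sqrt 3 / pi * (norm (c 0))\<^sup>2 + (norm (c (-1)))\<^sup>2"
  by (simp add: heinz_functional_def)

end

theory Submission
  imports Defs "HOL-Complex_Analysis.Complex_Analysis" "HOL-Real_Asymp.Real_Asymp"
begin

text \<open>Lower bound. On circles, \<open>u (r cis t)\<close> is a Fourier series whose coefficients are \<open>c k\<close> times those of an
  explicit kernel, divided by Pochhammer symbols; after this normalisation they converge, as \<open>r \<rightarrow> 1\<close>, to those of
  a bounded boundary function \<open>w\<close>, and a Fatou argument gives radial limits almost everywhere. Since \<open>u\<close> is a
  homeomorphism of the disc, \<open>|w| = 1\<close> and the images of the rays do not cross, so \<open>w\<close> runs around the circle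
  once in cyclic order. Hence the squared chords of its values at finitely many points sum to at most 9.
  Averaging this over equally spaced points bounds the oscillation of \<open>w\<close>, and Hall's sine-weighted integral of
  the oscillation over \<open>[0, 2\<pi>/3]\<close>, computed by Parseval, isolates the coefficients with index -1, 0, 1.

  Sharpness. Take Poisson extensions of homeomorphisms of the circle that approach the three-valued step
  function. They are univalent and sense-preserving by Kneser's argument and map the disc onto itself.\<close>

subsection \<open>Symmetric Fourier series\<close>

text \<open>The Gamma quotient and the factors \<open>1 + \<alpha>\<close>,
  \<open>1 + \<beta>\<close> have one origin. Extending \<open>cis (k t)\<close> from the circle by
  the kernel multiplies it by \<open>kap \<alpha> \<beta> r k\<close>, and as r tends to 1 this
  tends to the Gamma quotient, the same number for every k. The expansion uses the same radial
  functions without the Pochhammer factor. So the Gamma quotient times c_1 / (1 + \<alpha>), c_0 and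
  c_(-1) / (1 + \<beta>) are Fourier coefficients of \<open>w\<close>, and what remains is a
  statement about functions on the circle. Two obstacles shape the proof. And \<open>w\<close> is
  known only almost everywhere, so no monotone lift of \<open>w\<close> is built: the topology of
  \<open>u\<close> enters through finitely many good rays at a time, and averaging over rotations
  avoids the bad ones. The constant belongs to the step function whose values are the cube roots of
  unity. Its first coefficient is 3 sqrt 3 / (2 pi), with square 27 / (4 pi^2), and it gives
  equality in the polygon inequality, in the oscillation bound and in the weights.\<close>

text \<open>Pairing n with -n turns a two-sided series into an ordinary one whose partial sums run
  over symmetric ranges. The case split keeps \<open>a 0\<close> from being counted twice.\<close>

definition fterm :: "(int \<Rightarrow> complex) \<Rightarrow> real \<Rightarrow> nat \<Rightarrow> complex" where
  "fterm a t n = (if n = 0 then a 0 else a (int n) * cis (real n * t) + a (- int n) * cis (- (real n * t)))"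

definition fsum :: "(int \<Rightarrow> complex) \<Rightarrow> real \<Rightarrow> complex" where
  "fsum a t = (\<Sum>n. fterm a t n)"

text \<open>At n = 0 the coefficient is counted twice, which is harmless for a summable
  majorant.\<close>

definition fnorm :: "(int \<Rightarrow> complex) \<Rightarrow> nat \<Rightarrow> real" where
  "fnorm a n = norm (a (int n)) + norm (a (- int n))"

lemma fnorm_nonneg: "0 \<le> fnorm a n"
  by (simp add: fnorm_def)

lemma norm_fterm_le: "norm (fterm a t n) \<le> fnorm a n"
proof -
  have "norm (a (int n) * cis (real n * t) + a (- int n) * cis (- (real n * t))) \<le> fnorm a n"
    unfolding fnorm_def by (rule order_trans[OF norm_triangle_ineq]) (simp add: norm_mult)
  then show ?thesis by (simp add: fterm_def fnorm_def)
qed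

lemma sum_fterm: "(\<Sum>n<N. fterm a t n) = (\<Sum>k\<in>{- int N<..<int N}. a k * cis (of_int k * t))"
proof (induction N)
  case (Suc N)
  show ?case
  proof (cases "N = 0")
    case True
    have "{- 1<..<1::int} = {0}" by auto
    then show ?thesis using True by (simp add: fterm_def)
  next
    case False
    have "{- int (Suc N)<..<int (Suc N)} = insert (int N) (insert (- int N) {- int N<..<int N})"
      using False by auto
    then have "(\<Sum>k\<in>{- int (Suc N)<..<int (Suc N)}. a k * cis (of_int k * t)) =
        a (int N) * cis (of_int (int N) * t) + (a (- int N) * cis (of_int (- int N) * t) + (\<Sum>k\<in>{- int N<..<int N}. a k * cis (of_int k * t)))"
      using False by (simp only:) (subst sum.insert, simp, simp, subst sum.insert, auto)
    then show ?thesis using Suc.IH False by (simp add: fterm_def)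
  qed
qed simp

lemma summable_fterm:
  assumes "summable (fnorm a)"
  shows "summable (\<lambda>n. norm (fterm a t n))" "summable (fterm a t)" "norm (fsum a t) \<le> suminf (fnorm a)"
proof -
  show 1: "summable (\<lambda>n. norm (fterm a t n))"
    by (rule summable_comparison_test'[OF assms, of 0]) (use norm_fterm_le in auto)
  then show "summable (fterm a t)" by (rule summable_norm_cancel)
  show "norm (fsum a t) \<le> suminf (fnorm a)"
    unfolding fsum_def
    by (rule order_trans[OF summable_norm[OF 1] suminf_le[OF norm_fterm_le 1 assms]])
qed

lemma uniform_limit_fsum:
  assumes "summable (fnorm a)"
  shows "uniform_limit UNIV (\<lambda>N t. \<Sum>k\<in>{- int N<..<int N}. a k * cis (of_int k * t)) (fsum a) sequentially"
  unfolding sum_fterm[symmetric] fsum_def[abs_def]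
  by (rule Weierstrass_m_test[OF norm_fterm_le assms])

lemma continuous_on_fsum:
  assumes "summable (fnorm a)"
  shows "continuous_on S (fsum a)"
proof -
  have "continuous_on UNIV (fsum a)"
    by (rule uniform_limit_theorem[OF _ uniform_limit_fsum[OF assms]])
       (auto intro!: always_eventually continuous_intros)
  then show ?thesis by (rule continuous_on_subset) simp
qed

lemma norm_fpoly_le:
  assumes "summable (fnorm a)"
  shows "norm (\<Sum>k\<in>{- int N<..<int N}. a k * cis (of_int k * t)) \<le> suminf (fnorm a)"
proof -
  have "norm (\<Sum>n<N. fterm a t n) \<le> (\<Sum>n<N. fnorm a n)"
    by (rule sum_norm_le) (rule norm_fterm_le)
  also have "\<dots> \<le> suminf (fnorm a)" by (rule sum_le_suminf[OF assms]) (auto simp: fnorm_nonneg)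
  finally show ?thesis by (simp add: sum_fterm)
qed

lemma fsum_periodic: "fsum a (t + 2 * pi) = fsum a t"
proof -
  have P: "cis (x + 2 * pi * k) = cis x" if "k \<in> \<int>" for x k
    by (simp only: cis_mult[symmetric] cis_multiple_2pi[OF that] mult_1_right)
  have "cis (real n * (t + 2 * pi)) = cis (real n * t)" "cis (- (real n * (t + 2 * pi))) = cis (- (real n * t))" for n
    using P[of "real n" "real n * t"] P[of "- real n" "- (real n * t)"] by (simp_all add: algebra_simps)
  then show ?thesis by (simp only: fsum_def fterm_def)
qed

lemma integral_cis_int:
  "integral {-pi..pi} (\<lambda>s. cis (of_int k * s)) = (if k = 0 then 2 * pi else 0)"
proof (cases "k = 0")
  case False
  have "((\<lambda>s. cis (of_int k * s)) has_integral (cis (of_int k * pi) / (\<i> * of_int k) - cis (of_int k * (-pi)) / (\<i> * of_int k))) {-pi..pi}"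
  proof (rule fundamental_theorem_of_calculus)
    fix x :: real
    show "((\<lambda>s. cis (of_int k * s) / (\<i> * of_int k)) has_vector_derivative cis (of_int k * x)) (at x within {-pi..pi})"
    proof -
      have "((\<lambda>z. exp (\<i> * (of_int k * z)) / (\<i> * of_int k)) has_field_derivative exp (\<i> * (of_int k * of_real x))) (at (of_real x))"
        using False by (auto intro!: derivative_eq_intros simp: mult_ac)
      then have "((\<lambda>s. exp (\<i> * (of_int k * of_real s)) / (\<i> * of_int k)) has_vector_derivative exp (\<i> * (of_int k * of_real x))) (at x within {-pi..pi})"
        by (rule has_vector_derivative_real_field)
      then show ?thesis by (simp add: cis_conv_exp)
    qed
  qed simp
  moreover have "cis (of_int k * pi) = cis (of_int k * (-pi))"
    using sin_npi_int[of k] by (simp add: complex_eq_iff mult.commute)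
  ultimately show ?thesis using False by (auto dest!: integral_unique)
qed (simp add: scaleR_conv_of_real)

text \<open>The angle 0 in \<open>fterm _ 0\<close> removes the exponentials and leaves the
  symmetric series of the numbers themselves. All partial sums are bounded by
  \<open>suminf (fnorm a)\<close>, so series and integral may be interchanged.\<close>

lemma fsum_integral_sums:
  assumes a: "summable (fnorm a)" and g: "continuous_on {b..c} g"
  shows "fterm (\<lambda>k. a k * integral {b..c} (\<lambda>s. g s * cis (of_int k * s))) 0 sums
         integral {b..c} (\<lambda>s. g s * fsum a s)"
proof -
  have "(\<lambda>N. integral {b..c} (\<lambda>s. g s * (\<Sum>k\<in>{- int N<..<int N}. a k * cis (of_int k * s)))) \<longlonglongrightarrow>
      integral {b..c} (\<lambda>s. g s * fsum a s)"
  proof (rule dominated_convergence(2)[where h = "\<lambda>s. norm (g s) * suminf (fnorm a)"])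
    fix s and N
    show "norm (g s * (\<Sum>k\<in>{- int N<..<int N}. a k * cis (of_int k * s))) \<le> norm (g s) * suminf (fnorm a)"
      unfolding norm_mult by (intro mult_left_mono norm_fpoly_le a) simp
    show "(\<lambda>N. g s * (\<Sum>k\<in>{- int N<..<int N}. a k * cis (of_int k * s))) \<longlonglongrightarrow> g s * fsum a s"
      by (intro tendsto_mult tendsto_const tendsto_uniform_limitI[OF uniform_limit_fsum[OF a]]) simp
  qed (use g in \<open>auto intro!: integrable_continuous_real continuous_intros\<close>)
  also have "(\<lambda>N. integral {b..c} (\<lambda>s. g s * (\<Sum>k\<in>{- int N<..<int N}. a k * cis (of_int k * s)))) =
      (\<lambda>N. \<Sum>n<N. fterm (\<lambda>k. a k * integral {b..c} (\<lambda>s. g s * cis (of_int k * s))) 0 n)"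
  proof
    fix N
    have "integral {b..c} (\<lambda>s. g s * (\<Sum>k\<in>{- int N<..<int N}. a k * cis (of_int k * s))) =
      integral {b..c} (\<lambda>s. \<Sum>k\<in>{- int N<..<int N}. a k * (g s * cis (of_int k * s)))"
      by (simp add: sum_distrib_left mult_ac)
    also have "\<dots> = (\<Sum>k\<in>{- int N<..<int N}. integral {b..c} (\<lambda>s. a k * (g s * cis (of_int k * s))))"
      by (rule integral_sum) (use g in \<open>auto intro!: integrable_continuous_real continuous_intros\<close>)
    also have "\<dots> = (\<Sum>k\<in>{- int N<..<int N}. a k * integral {b..c} (\<lambda>s. g s * cis (of_int k * s)))"
      by simp
    finally show "integral {b..c} (\<lambda>s. g s * (\<Sum>k\<in>{- int N<..<int N}. a k * cis (of_int k * s))) =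
      (\<Sum>n<N. fterm (\<lambda>k. a k * integral {b..c} (\<lambda>s. g s * cis (of_int k * s))) 0 n)"
      by (simp add: sum_fterm)
  qed
  finally show ?thesis by (simp add: sums_def)
qed

lemma fterm_single:
  assumes "\<And>k. k \<noteq> m \<Longrightarrow> a k = 0"
  shows "fterm a 0 sums (a m)"
proof -
  have *: "fterm a 0 n = (if n = nat \<bar>m\<bar> then a m else 0)" for n
  proof (cases "n = nat \<bar>m\<bar>")
    case True
    then show ?thesis using assms by (cases "m = 0"; cases "m > 0") (auto simp: fterm_def)
  next
    case False
    then have "int n \<noteq> m" "- int n \<noteq> m" by auto
    then show ?thesis using assms False by (auto simp: fterm_def)
  qed
  have "(\<lambda>n. if n = nat \<bar>m\<bar> then a m else 0) sums a m" by (rule sums_single)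
  then show ?thesis by (simp add: * cong: sums_cong)
qed

lemma fsum_coeff:
  fixes a :: "int \<Rightarrow> complex"
  assumes "summable (fnorm a)"
  shows "integral {-pi..pi} (\<lambda>s. fsum a s * cis (- (of_int m * s))) = 2 * of_real pi * a m"
proof -
  have I: "integral {-pi..pi} (\<lambda>s. cis (- (of_int m * s)) * cis (of_int k * s)) = (if k = m then 2 * pi else 0)" for k
    using integral_cis_int[of "k - m"] by (simp add: cis_mult algebra_simps)
  have "fterm (\<lambda>k. a k * integral {-pi..pi} (\<lambda>s. cis (- (of_int m * s)) * cis (of_int k * s))) 0 sums
      integral {-pi..pi} (\<lambda>s. cis (- (of_int m * s)) * fsum a s)"
    by (rule fsum_integral_sums[OF assms]) (intro continuous_intros)
  moreover have "fterm (\<lambda>k. a k * integral {-pi..pi} (\<lambda>s. cis (- (of_int m * s)) * cis (of_int k * s))) 0 sums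
     (a m * integral {-pi..pi} (\<lambda>s. cis (- (of_int m * s)) * cis (of_int m * s)))"
    by (rule fterm_single) (simp add: I)
  ultimately have "integral {-pi..pi} (\<lambda>s. cis (- (of_int m * s)) * fsum a s) =
      a m * integral {-pi..pi} (\<lambda>s. cis (- (of_int m * s)) * cis (of_int m * s))"
    by (rule sums_unique2)
  also have "\<dots> = 2 * of_real pi * a m" by (simp only: I) simp
  finally show ?thesis by (simp add: mult.commute)
qed

lemma fsum_coeff_bound:
  assumes "summable (fnorm a)" "\<And>s. norm (fsum a s) \<le> B"
  shows "norm (a m) \<le> B"
proof -
  have B: "0 \<le> B" using assms(2)[of 0] norm_ge_zero order_trans by blast
  have "norm (integral {-pi..pi} (\<lambda>s. fsum a s * cis (- (of_int m * s)))) \<le> B * (pi - (- pi))"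
    by (rule integral_bound) (use assms in \<open>auto simp: norm_mult intro!: continuous_intros continuous_on_fsum\<close>)
  then show ?thesis unfolding fsum_coeff[OF assms(1)] by (simp add: norm_mult)
qed

lemma fsum_convolution:
  assumes a: "summable (fnorm a)" and g: "continuous_on {-pi..pi} g"
  shows "integral {-pi..pi} (\<lambda>s. g s * fsum a (t - s)) =
     fsum (\<lambda>k. a k * integral {-pi..pi} (\<lambda>s. g s * cis (- (of_int k * s)))) t"
proof -
  \<comment> \<open>As a function of \<open>s\<close>, \<open>fsum a (t - s)\<close> is again such a
    series: the reflection swaps k with -k and the shift by \<open>t\<close> twists each
    coefficient.\<close>
  define b where "b = (\<lambda>k. a (- k) * cis (- (of_int k * t)))"
  have fn: "fnorm b = fnorm a" by (auto simp: fun_eq_iff fnorm_def b_def norm_mult)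
  have ft: "fterm a (t - s) n = fterm b s n" for s n
    by (simp add: fterm_def b_def cis_mult mult.assoc algebra_simps)
  have "fterm (\<lambda>k. b k * integral {-pi..pi} (\<lambda>s. g s * cis (of_int k * s))) 0 sums
      integral {-pi..pi} (\<lambda>s. g s * fsum b s)"
    by (rule fsum_integral_sums) (use a g fn in auto)
  moreover have "fterm (\<lambda>k. b k * integral {-pi..pi} (\<lambda>s. g s * cis (of_int k * s))) 0 =
     fterm (\<lambda>k. a k * integral {-pi..pi} (\<lambda>s. g s * cis (- (of_int k * s)))) t"
    by (rule ext) (simp add: fterm_def b_def algebra_simps)
  ultimately have "fterm (\<lambda>k. a k * integral {-pi..pi} (\<lambda>s. g s * cis (- (of_int k * s)))) t sums
      integral {-pi..pi} (\<lambda>s. g s * fsum b s)" by simp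
  moreover have "fsum b s = fsum a (t - s)" for s by (simp add: fsum_def ft)
  ultimately show ?thesis by (simp add: fsum_def sums_unique)
qed

lemma trig_poly_parseval:
  fixes b :: "int \<Rightarrow> complex"
  assumes "finite K"
  shows "integral {-pi..pi} (\<lambda>s. (norm (\<Sum>k\<in>K. b k * cis (of_int k * s)))^2) = 2 * pi * (\<Sum>k\<in>K. (norm (b k))^2)"
proof -
  have "of_real ((norm (\<Sum>k\<in>K. b k * cis (of_int k * s)))^2) = (\<Sum>k\<in>K. \<Sum>l\<in>K. b k * cnj (b l) * cis (of_int (k - l) * s))" for s
  proof -
    have "of_real ((norm (\<Sum>k\<in>K. b k * cis (of_int k * s)))^2) = (\<Sum>k\<in>K. b k * cis (of_int k * s)) * cnj (\<Sum>k\<in>K. b k * cis (of_int k * s))"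
      by (rule complex_norm_square)
    also have "\<dots> = (\<Sum>k\<in>K. \<Sum>l\<in>K. (b k * cis (of_int k * s)) * (cnj (b l) * cis (- (of_int l * s))))"
      by (simp add: sum_product cis_cnj)
    also have "\<dots> = (\<Sum>k\<in>K. \<Sum>l\<in>K. b k * cnj (b l) * (cis (of_int k * s) * cis (- (of_int l * s))))"
      by (simp add: mult_ac)
    also have "\<dots> = (\<Sum>k\<in>K. \<Sum>l\<in>K. b k * cnj (b l) * cis (of_int (k - l) * s))"
      by (simp add: cis_mult algebra_simps)
    finally show ?thesis .
  qed
  then have "integral {-pi..pi} (\<lambda>s. complex_of_real ((norm (\<Sum>k\<in>K. b k * cis (of_int k * s)))^2)) =
     integral {-pi..pi} (\<lambda>s. \<Sum>k\<in>K. \<Sum>l\<in>K. b k * cnj (b l) * cis (of_int (k - l) * s))" by simp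
  also have "\<dots> = (\<Sum>k\<in>K. integral {-pi..pi} (\<lambda>s. \<Sum>l\<in>K. b k * cnj (b l) * cis (of_int (k - l) * s)))"
    by (rule integral_sum[OF assms]) (auto intro!: integrable_continuous_real continuous_intros)
  also have "\<dots> = (\<Sum>k\<in>K. \<Sum>l\<in>K. integral {-pi..pi} (\<lambda>s. b k * cnj (b l) * cis (of_int (k - l) * s)))"
    by (intro sum.cong refl integral_sum[OF assms]) (auto intro!: integrable_continuous_real continuous_intros)
  also have "\<dots> = (\<Sum>k\<in>K. \<Sum>l\<in>K. if l = k then b k * cnj (b k) * (2 * pi) else 0)"
    by (intro sum.cong refl) (simp only: integral_mult_right integral_cis_int, auto)
  also have "\<dots> = (\<Sum>k\<in>K. b k * cnj (b k) * (2 * pi))"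
    using assms by (simp add: sum.delta)
  also have "\<dots> = of_real (2 * pi * (\<Sum>k\<in>K. (norm (b k))^2))"
    by (simp add: complex_norm_square[symmetric] sum_distrib_left mult_ac)
  finally have "integral {-pi..pi} (\<lambda>s. complex_of_real ((norm (\<Sum>k\<in>K. b k * cis (of_int k * s)))^2)) = of_real (2 * pi * (\<Sum>k\<in>K. (norm (b k))^2))" .
  moreover have "integral {-pi..pi} (\<lambda>s. complex_of_real ((norm (\<Sum>k\<in>K. b k * cis (of_int k * s)))^2)) =
     of_real (integral {-pi..pi} (\<lambda>s. (norm (\<Sum>k\<in>K. b k * cis (of_int k * s)))^2))"
    by (rule integral_linear[where h = "of_real :: real \<Rightarrow> complex", unfolded o_def])
       (auto intro!: integrable_continuous_real continuous_intros bounded_linear_of_real)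
  ultimately have "complex_of_real (integral {-pi..pi} (\<lambda>s. (norm (\<Sum>k\<in>K. b k * cis (of_int k * s)))^2)) = of_real (2 * pi * (\<Sum>k\<in>K. (norm (b k))^2))"
    by metis
  then show ?thesis unfolding of_real_eq_iff .
qed

text \<open>Setting the functions and the limit to 0 on the null set makes the convergence hold
  everywhere and leaves the integrals unchanged.\<close>

lemma dominated_convergence_ae_interval:
  fixes f :: "nat \<Rightarrow> real \<Rightarrow> 'm::euclidean_space"
  assumes f: "\<And>k. (f k) integrable_on {a..b}" and "negligible N"
    and le: "\<And>k x. x \<in> {a..b} \<Longrightarrow> norm (f k x) \<le> B"
    and conv: "\<And>x. x \<in> {a..b} - N \<Longrightarrow> (\<lambda>k. f k x) \<longlonglongrightarrow> g x"
  shows "g integrable_on {a..b}" "(\<lambda>k. integral {a..b} (f k)) \<longlonglongrightarrow> integral {a..b} g"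
proof -
  define f' where "f' = (\<lambda>k x. if x \<in> N then 0 else f k x)"
  define g' where "g' = (\<lambda>x. if x \<in> N then 0 else g x)"
  have I: "f' k integrable_on {a..b}" for k
    by (rule integrable_spike[OF f \<open>negligible N\<close>]) (auto simp: f'_def)
  have le': "norm (f' k x) \<le> norm B" if "x \<in> {a..b}" for k x
    using le[OF that, of k] by (auto simp: f'_def)
  have c: "(\<lambda>k. f' k x) \<longlonglongrightarrow> g' x" if "x \<in> {a..b}" for x
    using conv[of x] that by (auto simp: f'_def g'_def)
  have D: "g' integrable_on {a..b}" "(\<lambda>k. integral {a..b} (f' k)) \<longlonglongrightarrow> integral {a..b} g'"
    using dominated_convergence[of f' "{a..b}" "\<lambda>_. norm B" g'] I le' c by auto
  show "g integrable_on {a..b}"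
    by (rule integrable_spike[OF D(1) \<open>negligible N\<close>]) (auto simp: g'_def)
  have "integral {a..b} (f' k) = integral {a..b} (f k)" for k
    by (rule integral_spike[OF \<open>negligible N\<close>]) (auto simp: f'_def)
  moreover have "integral {a..b} g' = integral {a..b} g"
    by (rule integral_spike[OF \<open>negligible N\<close>]) (auto simp: g'_def)
  ultimately show "(\<lambda>k. integral {a..b} (f k)) \<longlonglongrightarrow> integral {a..b} g" using D(2) by simp
qed

lemma integral_periodic_shift:
  fixes f :: "real \<Rightarrow> 'a::banach"
  assumes f: "continuous_on UNIV f" and per: "\<And>x. f (x + 2 * pi) = f x"
  shows "integral {-pi..pi} (\<lambda>s. f (s + t)) = integral {-pi..pi} f"
proof -
  define G where "G = (\<lambda>t. integral {-pi + t..pi + t} f)"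
  have G: "integral {-pi..pi} (\<lambda>s. f (s + t)) = G t" for t
    using integral_shift_real_ivl[of "-pi + t" t "pi + t" f] by (simp add: G_def)
  have int: "f integrable_on {a..b}" for a b
    by (rule integrable_continuous_real) (rule continuous_on_subset[OF f], simp)
  have small: "G t = G 0" if "0 \<le> t" "t \<le> 2 * pi" for t
  proof -
    have "integral {-pi..-pi + t} f + integral {-pi + t..pi} f = integral {-pi..pi} f"
      by (rule Henstock_Kurzweil_Integration.integral_combine) (use that int in auto)
    moreover have "integral {-pi + t..pi} f + integral {pi..pi + t} f = integral {-pi + t..pi + t} f"
      by (rule Henstock_Kurzweil_Integration.integral_combine) (use that int in auto)
    moreover have "integral {-pi..-pi + t} f = integral {pi..pi + t} f"
      using integral_shift_real_ivl[of pi "2 * pi" "pi + t" f] per by simp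
    ultimately show ?thesis by (simp add: G_def algebra_simps)
  qed
  have per_n: "f (x + of_int n * (2 * pi)) = f x" for x n
  proof (induction n arbitrary: x rule: int_induct[where k=0])
    case (step1 i) then show ?case using per[of "x + of_int i * (2*pi)"] by (simp add: algebra_simps)
  next
    case (step2 i) then show ?case using per[of "x + (of_int i - 1) * (2*pi)"] by (simp add: algebra_simps)
  qed simp
  define n where "n = \<lfloor>t / (2 * pi)\<rfloor>"
  define r where "r = t - of_int n * (2 * pi)"
  have r: "0 \<le> r" "r \<le> 2 * pi"
  proof -
    have "of_int n \<le> t / (2 * pi)" "t / (2 * pi) < of_int n + 1" unfolding n_def by linarith+
    then show "0 \<le> r" "r \<le> 2 * pi" by (auto simp: r_def field_simps)
  qed
  have "f (s + t) = f (s + r)" for s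
    using per_n[of "s + r" n] by (simp add: r_def algebra_simps)
  then show ?thesis using G[of r] G[of 0] small[OF r] by simp
qed

subsection \<open>Hall's inequality\<close>

text \<open>Three times the angle is a multiple of 2 pi, so the cosine c solves 4 c^3 - 3 c - 1 = (c
  - 1) (2 c + 1)^2 = 0. This is why the integrals end at 2 pi / 3.\<close>

lemma cos_two_thirds_pi_int:
  "cos (of_int k * (2 * pi / 3)) \<ge> - (1/2 :: real)"
proof -
  define c where "c = cos (of_int k * (2 * pi / 3))"
  have "3 * (of_int k * (2 * pi / 3)) = 2 * pi * of_int k" by simp
  then have "cos (3 * (of_int k * (2 * pi / 3))) = 1" by (simp only: cos_int_2pin)
  then have "4 * c^3 - 3 * c = 1" unfolding cos_treble_cos c_def .
  then have "(c - 1) * (2 * c + 1)^2 = 0" by (simp add: power2_eq_square power3_eq_cube algebra_simps)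
  then have "c = 1 \<or> c = - 1/2" by (auto simp: add_eq_0_iff)
  then show ?thesis by (auto simp: c_def)
qed

lemma integral_cos_sin_ge2:
  assumes "k \<ge> 2"
  shows "((\<lambda>t. cos (of_int k * t) * sin (2 * pi / 3 - t)) has_integral
      (- (cos (of_int k * (2 * pi / 3)) + 1/2) / ((of_int k)^2 - 1))) {0..2 * pi / 3}"
proof -
  define K :: real where "K = of_int k"
  have K: "K \<ge> 2" using assms by (simp add: K_def)
  \<comment> \<open>The integrand is half of sin((K + 1) t + pi/3) - sin((K - 1) t - pi/3). The
    denominator K - 1 is why k = 1 has a lemma of its own.\<close>
  define F where "F = (\<lambda>t. (1/2) * (- cos ((K + 1) * t + pi / 3) / (K + 1) + cos ((K - 1) * t - pi / 3) / (K - 1)))"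
  have "((\<lambda>t. cos (K * t) * sin (2 * pi / 3 - t)) has_integral (F (2 * pi / 3) - F 0)) {0..2 * pi / 3}"
  proof (rule fundamental_theorem_of_calculus)
    fix t :: real
    have "((\<lambda>t. - cos ((K + 1) * t + pi / 3) / (K + 1)) has_real_derivative sin ((K + 1) * t + pi / 3)) (at t within {0..2 * pi / 3})"
      using K by (auto intro!: derivative_eq_intros)
    moreover have "((\<lambda>t. cos ((K - 1) * t - pi / 3) / (K - 1)) has_real_derivative - sin ((K - 1) * t - pi / 3)) (at t within {0..2 * pi / 3})"
      using K by (auto intro!: derivative_eq_intros)
    ultimately have "(F has_real_derivative (1/2) * (sin ((K + 1) * t + pi / 3) + - sin ((K - 1) * t - pi / 3))) (at t within {0..2 * pi / 3})"
      unfolding F_def by (intro DERIV_cmult DERIV_add)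
    then have "(F has_real_derivative (1/2) * (sin ((K + 1) * t + pi / 3) - sin ((K - 1) * t - pi / 3))) (at t within {0..2 * pi / 3})"
      by simp
    moreover have "(1/2) * (sin ((K + 1) * t + pi / 3) - sin ((K - 1) * t - pi / 3)) = cos (K * t) * sin (2 * pi / 3 - t)"
    proof -
      have "(K + 1) * t + pi / 3 = K * t + (t + pi/3)" "(K - 1) * t - pi / 3 = K * t - (t + pi/3)"
        by (simp_all add: algebra_simps)
      moreover have "sin (2 * pi / 3 - t) = sin (t + pi / 3)"
        using sin_pi_minus[of "t + pi/3"] by (simp add: field_simps)
      ultimately show ?thesis by (simp only: sin_add sin_diff) (simp add: algebra_simps)
    qed
    ultimately show "(F has_vector_derivative cos (K * t) * sin (2 * pi / 3 - t)) (at t within {0..2 * pi / 3})"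
      by (simp add: has_real_derivative_iff_has_vector_derivative)
  qed simp
  moreover have "F (2 * pi / 3) - F 0 = - (cos (K * (2 * pi / 3)) + 1/2) / (K^2 - 1)"
  proof -
    have "cos ((K + 1) * (2 * pi / 3) + pi / 3) = - cos (K * (2 * pi / 3))"
    proof -
      have "(K + 1) * (2 * pi / 3) + pi / 3 = K * (2 * pi / 3) + pi" by (simp add: field_simps)
      then show ?thesis by simp
    qed
    moreover have "cos ((K - 1) * (2 * pi / 3) - pi / 3) = - cos (K * (2 * pi / 3))"
    proof -
      have "(K - 1) * (2 * pi / 3) - pi / 3 = K * (2 * pi / 3) - pi" by (simp add: field_simps)
      then show ?thesis by (simp add: cos_diff)
    qed
    moreover have "K^2 - 1 = (K + 1) * (K - 1)" by (simp add: algebra_simps power2_eq_square)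
    ultimately show ?thesis using K by (simp add: F_def cos_60 divide_simps) (simp add: algebra_simps)
  qed
  ultimately show ?thesis by (simp add: K_def)
qed

lemma integral_cos_sin_0: "((\<lambda>t. sin (2 * pi / 3 - t)) has_integral (3/2)) {0..2 * pi / 3}"
proof -
  have "((\<lambda>t. sin (2 * pi / 3 - t)) has_integral (cos (2 * pi / 3 - 2 * pi / 3) - cos (2 * pi / 3 - 0))) {0..2 * pi / 3}"
    by (rule fundamental_theorem_of_calculus)
      (auto simp: has_real_derivative_iff_has_vector_derivative[symmetric] intro!: derivative_eq_intros)
  then show ?thesis by (simp add: cos_120)
qed

lemma integral_cos_sin_1: "((\<lambda>t. cos t * sin (2 * pi / 3 - t)) has_integral (pi * sqrt 3 / 6)) {0..2 * pi / 3}"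
proof -
  \<comment> \<open>Here the product is half of sin(2 pi/3 - 2 t) + sin(2 pi/3); the constant
    summand is the source of the linear term.\<close>
  define F where "F = (\<lambda>t. cos (2 * pi / 3 - 2 * t) / 4 + sqrt 3 / 4 * t)"
  have "((\<lambda>t. cos t * sin (2 * pi / 3 - t)) has_integral (F (2 * pi / 3) - F 0)) {0..2 * pi / 3}"
  proof (rule fundamental_theorem_of_calculus)
    fix t :: real
    have "(F has_real_derivative sin (2 * pi / 3 - 2 * t) / 2 + sqrt 3 / 4) (at t within {0..2 * pi / 3})"
      unfolding F_def by (auto intro!: derivative_eq_intros)
    moreover have "sin (2 * pi / 3 - 2 * t) / 2 + sqrt 3 / 4 = cos t * sin (2 * pi / 3 - t)"
    proof -
      have "sin (2 * pi / 3 - 2 * t) = sin ((2 * pi / 3 - t) - t)" by (simp add: algebra_simps)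
      also have "\<dots> = sin (2 * pi / 3 - t) * cos t - cos (2 * pi / 3 - t) * sin t" by (rule sin_diff)
      finally have 1: "sin (2 * pi / 3 - 2 * t) = sin (2 * pi / 3 - t) * cos t - cos (2 * pi / 3 - t) * sin t" .
      have "sin (2 * pi / 3) = sin ((2 * pi / 3 - t) + t)" by simp
      also have "\<dots> = sin (2 * pi / 3 - t) * cos t + cos (2 * pi / 3 - t) * sin t" by (rule sin_add)
      finally have "sqrt 3 / 2 = sin (2 * pi / 3 - t) * cos t + cos (2 * pi / 3 - t) * sin t" by (simp add: sin_120)
      with 1 show ?thesis by (simp add: field_simps)
    qed
    ultimately show "(F has_vector_derivative cos t * sin (2 * pi / 3 - t)) (at t within {0..2 * pi / 3})"
      by (simp add: has_real_derivative_iff_has_vector_derivative)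
  qed simp
  moreover have "F (2 * pi / 3) - F 0 = pi * sqrt 3 / 6"
  proof -
    have "2 * pi / 3 - 2 * (2 * pi / 3) = - (2 * pi / 3)" by simp
    then show ?thesis by (simp only: F_def cos_minus) simp
  qed
  ultimately show ?thesis by simp
qed

lemma integral_t_sin: "((\<lambda>t. t * sin (2 * pi / 3 - t)) has_integral (2 * pi / 3 - sqrt 3 / 2)) {0..2 * pi / 3}"
proof -
  define F where "F = (\<lambda>t. t * cos (2 * pi / 3 - t) + sin (2 * pi / 3 - t))"
  have "((\<lambda>t. t * sin (2 * pi / 3 - t)) has_integral (F (2 * pi / 3) - F 0)) {0..2 * pi / 3}"
    unfolding F_def by (rule fundamental_theorem_of_calculus)
      (auto simp: has_real_derivative_iff_has_vector_derivative[symmetric] intro!: derivative_eq_intros)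
  then show ?thesis by (simp add: F_def sin_120)
qed

text \<open>The factor with which |a_k|^2 enters the sine-weighted integral of the oscillation. The
  normalisation 2 sqrt 3 / pi is the one for which the weight at k = 1 lies exactly 1 below 3 sqrt 3
  / pi.\<close>

definition hall_weight :: "int \<Rightarrow> real" where
  "hall_weight k = 2 * sqrt 3 / pi * integral {0..2 * pi / 3} (\<lambda>t. (1 - cos (of_int k * t)) * sin (2 * pi / 3 - t))"

text \<open>The summand 1 of 1 - cos(k t) contributes 3 sqrt 3 / pi. The cosine costs 1 when |k| =
  1; when |k| \<ge> 2 its integral is at most 0 because cos(2 pi k / 3) \<ge> -1/2, so it can only
  increase the weight.\<close>

lemma hall_weight:
  "hall_weight 0 = 0" "\<bar>k\<bar> = 1 \<Longrightarrow> hall_weight k = 3 * sqrt 3 / pi - 1" "\<bar>k\<bar> \<ge> 2 \<Longrightarrow> hall_weight k \<ge> 3 * sqrt 3 / pi"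
proof -
  show "hall_weight 0 = 0" by (simp add: hall_weight_def)
  have abs: "hall_weight k = hall_weight \<bar>k\<bar>" for k by (cases "k \<ge> 0") (auto simp: hall_weight_def)
  have "((\<lambda>t. sin (2 * pi / 3 - t) - cos t * sin (2 * pi / 3 - t)) has_integral (3/2 - pi * sqrt 3 / 6)) {0..2 * pi / 3}"
    by (intro has_integral_diff integral_cos_sin_0 integral_cos_sin_1)
  then have 1: "hall_weight 1 = 3 * sqrt 3 / pi - 1"
    by (simp add: hall_weight_def algebra_simps integral_unique)
  then show "\<bar>k\<bar> = 1 \<Longrightarrow> hall_weight k = 3 * sqrt 3 / pi - 1" for k using abs[of k] by simp
  have "hall_weight k \<ge> 3 * sqrt 3 / pi" if "k \<ge> 2" for k
  proof -
    have "((\<lambda>t. sin (2 * pi / 3 - t) - cos (of_int k * t) * sin (2 * pi / 3 - t)) has_integral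
       (3/2 - (- (cos (of_int k * (2 * pi / 3)) + 1/2) / ((of_int k)^2 - 1)))) {0..2 * pi / 3}"
      by (intro has_integral_diff integral_cos_sin_0 integral_cos_sin_ge2 that)
    note E = integral_unique[OF this]
    have alg: "3/2 - (- (c + 1/2) / d) = 3/2 + (c + 1/2) / d" for c d :: real
      by (simp only: minus_divide_left[symmetric] diff_minus_eq_add)
    have "hall_weight k = 2 * sqrt 3 / pi * (3/2 + (cos (of_int k * (2 * pi / 3)) + 1/2) / ((of_int k)^2 - 1))"
      unfolding hall_weight_def left_diff_distrib mult_1_left E alg ..
    moreover have nn: "(cos (of_int k * (2 * pi / 3)) + 1/2) / ((of_int k)^2 - 1) \<ge> (0::real)"
    proof (rule divide_nonneg_nonneg)
      have "(1::real) \<le> (of_int k)^2" using that by (intro one_le_power) simp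
      then show "(0::real) \<le> (of_int k)^2 - 1" by simp
    qed (use cos_two_thirds_pi_int[of k] in simp)
    ultimately have "hall_weight k \<ge> 2 * sqrt 3 / pi * (3/2)"
      by (simp only:) (intro mult_left_mono, use nn in auto)
    then show ?thesis by simp
  qed
  then show "\<bar>k\<bar> \<ge> 2 \<Longrightarrow> hall_weight k \<ge> 3 * sqrt 3 / pi" for k using abs[of k] by simp
qed

text \<open>Half the mean square of the increment over \<open>t\<close>; with this normalisation the
  k-th mode contributes |a_k|^2 (1 - cos(k t)).\<close>

definition osc :: "(real \<Rightarrow> complex) \<Rightarrow> real \<Rightarrow> real" where
  "osc u t = integral {-pi..pi} (\<lambda>s. (norm (u (s + t) - u s))^2) / (4 * pi)"

lemma osc_fpoly:
  fixes a :: "int \<Rightarrow> complex"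
  assumes "finite K"
  shows "osc (\<lambda>s. \<Sum>k\<in>K. a k * cis (of_int k * s)) t = (\<Sum>k\<in>K. (norm (a k))^2 * (1 - cos (of_int k * t)))"
proof -
  have "(\<Sum>k\<in>K. a k * cis (of_int k * (s + t))) - (\<Sum>k\<in>K. a k * cis (of_int k * s)) =
     (\<Sum>k\<in>K. (a k * (cis (of_int k * t) - 1)) * cis (of_int k * s))" for s
    by (simp add: sum_subtractf[symmetric] distrib_left cis_mult[symmetric] algebra_simps)
  moreover have "(norm (cis x - 1))^2 = 2 * (1 - cos x)" for x
    using sin_cos_squared_add[of x] unfolding cmod_power2
    by (simp add: algebra_simps power2_eq_square del: sin_cos_squared_add)
  ultimately have "integral {-pi..pi} (\<lambda>s. (norm ((\<Sum>k\<in>K. a k * cis (of_int k * (s + t))) - (\<Sum>k\<in>K. a k * cis (of_int k * s))))^2) =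
     2 * pi * (\<Sum>k\<in>K. (norm (a k))^2 * (2 * (1 - cos (of_int k * t))))"
    by (simp add: trig_poly_parseval[OF assms] norm_mult power_mult_distrib)
  also have "\<dots> = (\<Sum>k\<in>K. (norm (a k))^2 * (1 - cos (of_int k * t))) * (4 * pi)"
    unfolding sum_distrib_left sum_distrib_right by (rule sum.cong) (auto simp: algebra_simps)
  finally show ?thesis by (simp add: osc_def)
qed

text \<open>Each weight is replaced by its lower bound. The result is 3 sqrt 3 / pi times the whole
  Parseval sum, less what the small weights fall short of it: everything at k = 0, and 1 at k = 1
  and at k = -1.\<close>

lemma hall_fpoly:
  fixes a :: "int \<Rightarrow> complex"
  assumes "finite K" "0 \<in> K" "1 \<in> K" "-1 \<in> K"
  defines "P \<equiv> \<lambda>s. \<Sum>k\<in>K. a k * cis (of_int k * s)"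
  shows "2 * sqrt 3 / pi * integral {0..2 * pi / 3} (\<lambda>t. osc P t * sin (2 * pi / 3 - t)) \<ge>
    3 * sqrt 3 / pi * (integral {-pi..pi} (\<lambda>s. (norm (P s))^2) / (2 * pi) - (norm (a 0))^2) - (norm (a 1))^2 - (norm (a (-1)))^2"
proof -
  let ?A = "3 * sqrt 3 / pi"
  have "2 * sqrt 3 / pi * integral {0..2 * pi / 3} (\<lambda>t. osc P t * sin (2 * pi / 3 - t)) =
     2 * sqrt 3 / pi * integral {0..2 * pi / 3} (\<lambda>t. \<Sum>k\<in>K. (norm (a k))^2 * ((1 - cos (of_int k * t)) * sin (2 * pi / 3 - t)))"
    unfolding P_def osc_fpoly[OF assms(1)] sum_distrib_right by (simp add: mult_ac)
  also have "\<dots> = 2 * sqrt 3 / pi * (\<Sum>k\<in>K. integral {0..2 * pi / 3} (\<lambda>t. (norm (a k))^2 * ((1 - cos (of_int k * t)) * sin (2 * pi / 3 - t))))"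
    by (subst integral_sum[OF assms(1)]) (auto intro!: integrable_continuous_real continuous_intros)
  also have "\<dots> = (\<Sum>k\<in>K. (norm (a k))^2 * hall_weight k)"
    unfolding hall_weight_def sum_distrib_left by (rule sum.cong) auto
  also have "\<dots> \<ge> (\<Sum>k\<in>K. (norm (a k))^2 * (if k = 0 then 0 else if k = 1 then ?A - 1 else if k = -1 then ?A - 1 else ?A))"
    by (intro sum_mono mult_left_mono) (auto simp: hall_weight intro!: hall_weight)
  also have "(\<Sum>k\<in>K. (norm (a k))^2 * (if k = 0 then 0 else if k = 1 then ?A - 1 else if k = -1 then ?A - 1 else ?A)) =
     (\<Sum>k\<in>K. ?A * (norm (a k))^2 - (if k = 0 then ?A * (norm (a 0))^2 else 0) - (if k = 1 then (norm (a 1))^2 else 0) - (if k = -1 then (norm (a (-1)))^2 else 0))"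
    by (rule sum.cong) (auto simp: algebra_simps)
  also have "\<dots> = ?A * (\<Sum>k\<in>K. (norm (a k))^2) - ?A * (norm (a 0))^2 - (norm (a 1))^2 - (norm (a (-1)))^2"
    using assms(1-4) by (simp add: sum_subtractf sum_distrib_left sum.delta)
  also have "(\<Sum>k\<in>K. (norm (a k))^2) = integral {-pi..pi} (\<lambda>s. (norm (P s))^2) / (2 * pi)"
    unfolding P_def trig_poly_parseval[OF assms(1)] by simp
  finally show ?thesis by (simp add: algebra_simps)
qed

lemma osc_tendsto:
  fixes u :: "nat \<Rightarrow> real \<Rightarrow> complex"
  assumes u: "\<And>n. continuous_on UNIV (u n)" "\<And>n s. norm (u n s) \<le> B"
   and N: "negligible N" and conv: "\<And>s. s \<notin> N \<Longrightarrow> (\<lambda>n. u n s) \<longlonglongrightarrow> w s"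
  shows "(\<lambda>n. osc (u n) t) \<longlonglongrightarrow> osc w t" "0 \<le> osc (u n) t" "osc (u n) t \<le> 2 * B^2"
proof -
  \<comment> \<open>Both \<open>s\<close> and \<open>s + t\<close> have to avoid N.\<close>
  have neg: "negligible (N \<union> (\<lambda>s. s - t) ` N)"
    using negligible_translation[OF N, of "- t"] N by (auto simp: negligible_Un)
  have B: "0 \<le> B" using u(2)[of 0 0] norm_ge_zero order_trans by blast
  have bd: "norm ((norm (u n (s + t) - u n s))^2) \<le> 4 * B^2" for n s
  proof -
    have "norm (u n (s + t) - u n s) \<le> 2 * B" using norm_triangle_ineq4[of "u n (s+t)" "u n s"] u(2)[of n s] u(2)[of n "s+t"] by linarith
    then have "(norm (u n (s + t) - u n s))^2 \<le> (2 * B)^2" by (intro power_mono) auto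
    then show ?thesis by (simp add: power_mult_distrib)
  qed
  have ci: "(\<lambda>s. (norm (u n (s + t) - u n s))^2) integrable_on {-pi..pi}" for n
    by (intro integrable_continuous_real continuous_intros continuous_on_compose2[OF u(1)[of n]]) auto
  have "(\<lambda>n. integral {-pi..pi} (\<lambda>s. (norm (u n (s + t) - u n s))^2)) \<longlonglongrightarrow> integral {-pi..pi} (\<lambda>s. (norm (w (s + t) - w s))^2)"
  proof (rule dominated_convergence_ae_interval(2)[OF ci neg bd])
    fix s assume "s \<in> {-pi..pi} - (N \<union> (\<lambda>s. s - t) ` N)"
    then have "s \<notin> N" "s + t \<notin> N" by (auto simp: image_iff)
    then show "(\<lambda>n. (norm (u n (s + t) - u n s))^2) \<longlonglongrightarrow> (norm (w (s + t) - w s))^2"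
      by (intro tendsto_intros conv)
  qed
  then show "(\<lambda>n. osc (u n) t) \<longlonglongrightarrow> osc w t" unfolding osc_def by (intro tendsto_intros) auto
  show "0 \<le> osc (u n) t" unfolding osc_def by (intro divide_nonneg_pos integral_nonneg ci) auto
  have "integral {-pi..pi} (\<lambda>s. (norm (u n (s + t) - u n s))^2) \<le> integral {-pi..pi} (\<lambda>s. 4 * B^2)"
    by (rule integral_le[OF ci]) (use bd in auto)
  then show "osc (u n) t \<le> 2 * B^2" by (simp add: osc_def divide_le_eq algebra_simps)
qed

lemma hall_fsum:
  assumes a: "summable (fnorm a)"
  shows "2 * sqrt 3 / pi * integral {0..2 * pi / 3} (\<lambda>t. osc (fsum a) t * sin (2 * pi / 3 - t)) \<ge>
    3 * sqrt 3 / pi * (integral {-pi..pi} (\<lambda>s. (norm (fsum a s))^2) / (2 * pi) - (norm (a 0))^2) - (norm (a 1))^2 - (norm (a (-1)))^2"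
proof -
  define P where "P = (\<lambda>N s. \<Sum>k\<in>{- int N<..<int N}. a k * cis (of_int k * s))"
  define B where "B = suminf (fnorm a)"
  have P: "continuous_on UNIV (P N)" "norm (P N s) \<le> B" for N s
    unfolding P_def B_def using norm_fpoly_le[OF a] by (auto intro!: continuous_intros)
  have conv: "(\<lambda>N. P N s) \<longlonglongrightarrow> fsum a s" for s
    unfolding P_def by (rule tendsto_uniform_limitI[OF uniform_limit_fsum[OF a]]) simp
  have osc: "(\<lambda>N. osc (P N) t) \<longlonglongrightarrow> osc (fsum a) t" "0 \<le> osc (P N) t" "osc (P N) t \<le> 2 * B^2" for t N
    using osc_tendsto[of P B "{}" "fsum a"] P conv by auto
  have 1: "(\<lambda>N. integral {0..2 * pi / 3} (\<lambda>t. osc (P N) t * sin (2 * pi / 3 - t))) \<longlonglongrightarrow>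
     integral {0..2 * pi / 3} (\<lambda>t. osc (fsum a) t * sin (2 * pi / 3 - t))"
  proof (rule dominated_convergence_ae_interval(2)[where N = "{}" and B = "2 * B^2"])
    show "(\<lambda>t. osc (P N) t * sin (2 * pi / 3 - t)) integrable_on {0..2 * pi / 3}" for N
      unfolding P_def osc_fpoly[OF finite_greaterThanLessThan_int] by (intro integrable_continuous_real continuous_intros)
    show "norm (osc (P N) t * sin (2 * pi / 3 - t)) \<le> 2 * B^2" for N t
    proof -
      have "\<bar>osc (P N) t\<bar> * \<bar>sin (2 * pi / 3 - t)\<bar> \<le> (2 * B^2) * 1"
        by (rule mult_mono) (use osc(2,3)[of N t] in auto)
      then show ?thesis by (simp add: abs_mult)
    qed
  qed (auto intro!: tendsto_intros osc)
  have 2: "(\<lambda>N. integral {-pi..pi} (\<lambda>s. (norm (P N s))^2)) \<longlonglongrightarrow> integral {-pi..pi} (\<lambda>s. (norm (fsum a s))^2)"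
  proof (rule dominated_convergence_ae_interval(2)[where N = "{}" and B = "B^2"])
    show "(\<lambda>s. (norm (P N s))^2) integrable_on {-pi..pi}" for N
      by (intro integrable_continuous_real continuous_intros continuous_on_subset[OF P(1)]) auto
    show "norm ((norm (P N s))^2) \<le> B^2" for N s
      using P(2)[of N s] by (simp add: power_mono)
  qed (auto intro!: tendsto_intros conv)
  show ?thesis
  proof (rule tendsto_le[OF trivial_limit_sequentially])
    show "(\<lambda>N. 2 * sqrt 3 / pi * integral {0..2 * pi / 3} (\<lambda>t. osc (P N) t * sin (2 * pi / 3 - t))) \<longlonglongrightarrow>
      2 * sqrt 3 / pi * integral {0..2 * pi / 3} (\<lambda>t. osc (fsum a) t * sin (2 * pi / 3 - t))"
      by (intro tendsto_intros 1)
    show "(\<lambda>N. 3 * sqrt 3 / pi * (integral {-pi..pi} (\<lambda>s. (norm (P N s))^2) / (2 * pi) - (norm (a 0))^2) - (norm (a 1))^2 - (norm (a (-1)))^2) \<longlonglongrightarrow>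
      3 * sqrt 3 / pi * (integral {-pi..pi} (\<lambda>s. (norm (fsum a s))^2) / (2 * pi) - (norm (a 0))^2) - (norm (a 1))^2 - (norm (a (-1)))^2"
      by (intro tendsto_intros 2) auto
    show "\<forall>\<^sub>F N in sequentially. 3 * sqrt 3 / pi * (integral {-pi..pi} (\<lambda>s. (norm (P N s))^2) / (2 * pi) - (norm (a 0))^2) - (norm (a 1))^2 - (norm (a (-1)))^2
      \<le> 2 * sqrt 3 / pi * integral {0..2 * pi / 3} (\<lambda>t. osc (P N) t * sin (2 * pi / 3 - t))"
      \<comment> \<open>From N = 2 on the range contains -1, 0 and 1, as \<open>hall_fpoly\<close>
        requires.\<close>
      using eventually_ge_at_top[of 2]
    proof eventually_elim
      case (elim N)
      then show ?case unfolding P_def by (intro hall_fpoly) auto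
    qed
  qed
qed

text \<open>The partition points \<open>j a\<close> and \<open>j a + t\<close> cut the circle into arcs of lengths \<open>t\<close> and \<open>a - t\<close>.\<close>

lemma osc_pair_le:
  fixes u :: "nat \<Rightarrow> real \<Rightarrow> complex"
  assumes u: "\<And>n. continuous_on UNIV (u n)" "\<And>n s. norm (u n s) \<le> B" "\<And>n s. u n (s + 2 * pi) = u n s"
   and N: "negligible N" and conv: "\<And>s. s \<notin> N \<Longrightarrow> (\<lambda>n. u n s) \<longlonglongrightarrow> w s"
   and polygon: "\<And>m t. 0 < m \<Longrightarrow> (\<And>i j. i < j \<Longrightarrow> j < m \<Longrightarrow> t i < t j) \<Longrightarrow> (\<And>i. i < m \<Longrightarrow> t i < t 0 + 2 * pi)
      \<Longrightarrow> (\<And>i. i < m \<Longrightarrow> t i \<notin> N) \<Longrightarrow> (\<Sum>i<m. (norm (w (t (Suc i mod m)) - w (t i)))^2) \<le> 9"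
   and K: "0 < K" and t: "0 < t" "t < 2 * pi / real K"
  shows "osc w t + osc w (2 * pi / real K - t) \<le> 9 / (2 * real K)"
proof -
  define a where "a = 2 * pi / real K"
  have a: "real K * a = 2 * pi" "0 < a" "t < a" using K t by (auto simp: a_def)
  define \<tau> where "\<tau> = (\<lambda>i::nat. real (i div 2) * a + (if even i then 0 else t))"
  define m where "m = 2 * K"
  have m: "0 < m" using K by (simp add: m_def)
  have step: "\<tau> (Suc i) - \<tau> i = (if even i then t else a - t)" for i
    by (auto simp: \<tau>_def algebra_simps elim!: evenE oddE)
  have \<tau>0: "\<tau> 0 = 0" and \<tau>m: "\<tau> m = 2 * pi" using a by (auto simp: \<tau>_def m_def)
  have mono: "strict_mono \<tau>" unfolding strict_mono_Suc_iff using step t a by (smt (verit))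
  \<comment> \<open>The rotations \<open>s\<close> that move some partition point into N.\<close>
  define neg where "neg = (\<Union>i\<in>{..<m}. (+) (- \<tau> i) ` N)"
  have "negligible neg" unfolding neg_def
    by (intro negligible_Union finite_imageI finite_lessThan) (use negligible_translation[OF N] in blast)
  have good: "\<tau> i + s \<notin> N" if "s \<notin> neg" "i < m" for i s
    using that unfolding neg_def by (force simp: image_iff)
  define T where "T = (\<lambda>(v :: real \<Rightarrow> complex) s. \<Sum>i<m. (norm (v (\<tau> (Suc i) + s) - v (\<tau> i + s)))^2)"
  \<comment> \<open>Only the approximants are assumed periodic. The polygon of \<open>w\<close> is
    therefore closed by wrapping the index, which for \<open>u n\<close> agrees with
    \<open>T\<close> by \<open>uper\<close>.\<close>
  define w' where "w' = (\<lambda>s. \<Sum>i<m. (norm (w (\<tau> (Suc i mod m) + s) - w (\<tau> i + s)))^2)"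
  have uper: "u n (\<tau> (Suc i) + s) = u n (\<tau> (Suc i mod m) + s)" if "i < m" for i s n
  proof (cases "Suc i = m")
    case True
    then show ?thesis using u(3)[of n s] \<tau>0 \<tau>m by (simp add: add.commute)
  next
    case False
    then show ?thesis using that by simp
  qed
  have Tint: "T (u n) integrable_on {-pi..pi}" for n
    unfolding T_def by (intro integrable_continuous_real continuous_intros continuous_on_compose2[OF u(1)[of n]]) auto
  have TI: "integral {-pi..pi} (T (u n)) = 4 * pi * (real K * (osc (u n) t + osc (u n) (a - t)))" for n
  proof -
    have 1: "integral {-pi..pi} (\<lambda>s. (norm (u n (\<tau> (Suc i) + s) - u n (\<tau> i + s)))^2) = 4 * pi * osc (u n) (\<tau> (Suc i) - \<tau> i)" for i
    proof -
      define f where "f = (\<lambda>s. (norm (u n (s + (\<tau> (Suc i) - \<tau> i)) - u n s))^2)"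
      have "continuous_on UNIV f" unfolding f_def
        by (intro continuous_intros continuous_on_compose2[OF u(1)[of n]]) auto
      moreover have "f (s + 2 * pi) = f s" for s
        using u(3)[of n s] u(3)[of n "s + (\<tau> (Suc i) - \<tau> i)"] by (simp add: f_def algebra_simps)
      ultimately have "integral {-pi..pi} (\<lambda>s. f (s + \<tau> i)) = integral {-pi..pi} f" by (rule integral_periodic_shift)
      moreover have "f (s + \<tau> i) = (norm (u n (\<tau> (Suc i) + s) - u n (\<tau> i + s)))^2" for s
        by (simp add: f_def algebra_simps)
      ultimately show ?thesis by (simp add: osc_def f_def)
    qed
    have "integral {-pi..pi} (T (u n)) = (\<Sum>i<m. 4 * pi * osc (u n) (\<tau> (Suc i) - \<tau> i))"
      unfolding T_def 1[symmetric]
      by (intro integral_sum integrable_continuous_real continuous_intros continuous_on_compose2[OF u(1)[of n]]) auto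
    also have "\<dots> = (\<Sum>i<2 * K. 4 * pi * osc (u n) (if even i then t else a - t))"
      unfolding step m_def ..
    also have "\<dots> = 4 * pi * (real K * (osc (u n) t + osc (u n) (a - t)))"
      by (induction K) (simp_all add: algebra_simps)
    finally show ?thesis .
  qed
  have Tb: "norm (T (u n) s) \<le> real m * (2 * B)^2" for n s
  proof -
    have "T (u n) s \<le> (\<Sum>i<m. (2 * B)^2)" unfolding T_def
    proof (intro sum_mono power_mono)
      fix i show "norm (u n (\<tau> (Suc i) + s) - u n (\<tau> i + s)) \<le> 2 * B"
        using norm_triangle_ineq4[of "u n (\<tau> (Suc i) + s)" "u n (\<tau> i + s)"] u(2)[of n "\<tau> (Suc i) + s"] u(2)[of n "\<tau> i + s"] by linarith
    qed auto
    moreover have "T (u n) s \<ge> 0" unfolding T_def by (intro sum_nonneg) auto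
    ultimately show ?thesis by simp
  qed
  have Tc: "(\<lambda>n. T (u n) s) \<longlonglongrightarrow> w' s" if "s \<in> {-pi..pi} - neg" for s
  proof -
    have "(\<lambda>n. \<Sum>i<m. (norm (u n (\<tau> (Suc i mod m) + s) - u n (\<tau> i + s)))^2) \<longlonglongrightarrow> w' s"
      unfolding w'_def by (intro tendsto_intros conv good) (use that m in auto)
    moreover have "T (u n) s = (\<Sum>i<m. (norm (u n (\<tau> (Suc i mod m) + s) - u n (\<tau> i + s)))^2)" for n
      unfolding T_def by (rule sum.cong) (simp_all add: uper)
    ultimately show ?thesis by simp
  qed
  have lim: "w' integrable_on {-pi..pi}" "(\<lambda>n. integral {-pi..pi} (T (u n))) \<longlonglongrightarrow> integral {-pi..pi} w'"
    using dominated_convergence_ae_interval[OF Tint \<open>negligible neg\<close> Tb Tc] by auto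
  have w'9: "w' s \<le> 9" if "s \<notin> neg" for s
    unfolding w'_def
  proof (rule polygon[OF m])
    show "\<tau> i + s < \<tau> j + s" if "i < j" "j < m" for i j using strict_monoD[OF mono that(1)] by simp
    show "\<tau> i + s < \<tau> 0 + s + 2 * pi" if "i < m" for i using strict_monoD[OF mono that] \<tau>0 \<tau>m by simp
    show "\<tau> i + s \<notin> N" if "i < m" for i using good[OF \<open>s \<notin> neg\<close> that] .
  qed
  \<comment> \<open>The bound 9 is known only off \<open>neg\<close>, so the values there are
    replaced by 0 before comparing.\<close>
  have "integral {-pi..pi} w' = integral {-pi..pi} (\<lambda>s. if s \<in> neg then 0 else w' s)"
    by (rule integral_spike[OF \<open>negligible neg\<close>]) auto
  also have "\<dots> \<le> integral {-pi..pi} (\<lambda>s. 9)"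
    by (rule integral_le) (use w'9 in \<open>auto intro: integrable_spike[OF lim(1) \<open>negligible neg\<close>]\<close>)
  finally have "integral {-pi..pi} w' \<le> 18 * pi" by simp
  moreover have "(\<lambda>n. integral {-pi..pi} (T (u n))) \<longlonglongrightarrow> 4 * pi * (real K * (osc w t + osc w (a - t)))"
    unfolding TI by (intro tendsto_intros osc_tendsto(1)[OF u(1,2) N conv])
  ultimately have "4 * pi * (real K * (osc w t + osc w (a - t))) \<le> 18 * pi"
    using LIMSEQ_unique[OF lim(2)] by simp
  then have "(4 * pi) * (real K * (osc w t + osc w (a - t))) \<le> (4 * pi) * (9 / 2)" by simp
  then have "real K * (osc w t + osc w (a - t)) \<le> 9 / 2" by (subst (asm) mult_le_cancel_left_pos) simp_all
  then have "osc w t + osc w (a - t) \<le> (9 / 2) / real K"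
    using K by (subst pos_le_divide_eq) (simp_all add: mult.commute)
  then show ?thesis by (simp add: a_def)
qed

text \<open>The two halves of \<open>{0..a}\<close> are paired by \<open>t \<mapsto> a - t\<close>. Iterated along \<open>a / 2 ^ p\<close>, the factors on the
  right multiply up to at most \<open>2 ^ p\<close>, while the integrals are \<open>O(4 ^ - p)\<close>.\<close>

lemma hall_halving:
  fixes D :: "real \<Rightarrow> real"
  assumes D: "\<And>a b f. continuous_on {a..b} f \<Longrightarrow> (\<lambda>t. D t * f t) integrable_on {a..b}"
    and le: "\<And>t. 0 < t \<Longrightarrow> t < a \<Longrightarrow> D t + D (a - t) \<le> 0"
    and a: "0 < a" "a < pi"
  shows "integral {0..a} (\<lambda>t. D t * sin (a - t)) \<le> 2 * cos (a / 2) * integral {0..a/2} (\<lambda>t. D t * sin (a / 2 - t))"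
proof -
  have Da: "(\<lambda>t. D (a - t) * f t) integrable_on {0..a/2}"
     "integral {0..a/2} (\<lambda>t. D (a - t) * f t) = integral {a/2..a} (\<lambda>t. D t * f (a - t))"
    if f: "continuous_on {0..a/2} f" for f
  proof -
    have I: "(\<lambda>t. D t * f (a - t)) integrable_on {a/2..a}"
      by (rule D) (auto intro!: continuous_intros continuous_on_compose2[OF f])
    have "((\<lambda>t. D (- t) * f (a + t)) has_integral integral {a/2..a} (\<lambda>t. D t * f (a - t))) {-a..-(a/2)}"
      using has_integral_reflect_real[THEN iffD2, OF integrable_integral[OF I]] by simp
    from has_integral_shift_real_ivl[OF this, of "-a"]
    have "((\<lambda>t. D (a - t) * f t) has_integral integral {a/2..a} (\<lambda>t. D t * f (a - t))) {0..a/2}"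
      by (simp add: add.commute)
    then show "(\<lambda>t. D (a - t) * f t) integrable_on {0..a/2}"
     "integral {0..a/2} (\<lambda>t. D (a - t) * f t) = integral {a/2..a} (\<lambda>t. D t * f (a - t))"
      by (auto simp: has_integral_integrable integral_unique)
  qed
  have "integral {0..a} (\<lambda>t. D t * sin (a - t)) = integral {0..a/2} (\<lambda>t. D t * sin (a - t)) + integral {a/2..a} (\<lambda>t. D t * sin (a - t))"
    by (rule Henstock_Kurzweil_Integration.integral_combine[symmetric])
      (use a in simp, use a in simp, intro D continuous_intros)
  also have "integral {a/2..a} (\<lambda>t. D t * sin (a - t)) = integral {0..a/2} (\<lambda>t. D (a - t) * sin t)"
    by (rule Da(2)[symmetric]) (intro continuous_intros)
  also have "\<dots> \<le> integral {0..a/2} (\<lambda>t. - (D t * sin t))"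
  proof (rule integral_le)
    show "(\<lambda>t. D (a - t) * sin t) integrable_on {0..a/2}" by (rule Da) (intro continuous_intros)
    show "(\<lambda>t. - (D t * sin t)) integrable_on {0..a/2}" by (intro integrable_neg D continuous_intros)
    fix t assume t: "t \<in> {0..a/2}"
    then have "0 \<le> sin t" using a by (intro sin_ge_zero) auto
    then show "D (a - t) * sin t \<le> - (D t * sin t)"
    proof (cases "t = 0")
      case False
      then have "D (a - t) \<le> - D t" using le[of t] t a by auto
      then show ?thesis using \<open>0 \<le> sin t\<close> mult_right_mono by fastforce
    qed simp
  qed
  also have "integral {0..a/2} (\<lambda>t. D t * sin (a - t)) + integral {0..a/2} (\<lambda>t. - (D t * sin t)) =
      integral {0..a/2} (\<lambda>t. D t * sin (a - t) + - (D t * sin t))"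
    by (rule integral_add[symmetric]) (auto intro!: integrable_neg D continuous_intros)
  also have "\<dots> = integral {0..a/2} (\<lambda>t. 2 * cos (a / 2) * (D t * sin (a / 2 - t)))"
  proof (rule integral_cong)
    fix t
    have e: "a / 2 + (a / 2 - t) = a - t" "a / 2 - (a / 2 - t) = t" by auto
    have "sin (a / 2 + (a / 2 - t)) - sin (a / 2 - (a / 2 - t)) = 2 * cos (a / 2) * sin (a / 2 - t)"
      by (simp only: sin_add[of "a/2"] sin_diff[of "a/2" "a/2-t"])
    then have "sin (a - t) - sin t = 2 * cos (a / 2) * sin (a / 2 - t)" unfolding e .
    then show "D t * sin (a - t) + - (D t * sin t) = 2 * cos (a / 2) * (D t * sin (a / 2 - t))"
      by (metis (no_types, opaque_lifting) add_uminus_conv_diff mult.left_commute right_diff_distrib)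
  qed
  also have "\<dots> = 2 * cos (a / 2) * integral {0..a/2} (\<lambda>t. D t * sin (a / 2 - t))" by simp
  finally show ?thesis by simp
qed

text \<open>Dividing by sin a turns the halving step into monotonicity: as sin a = 2 sin(a/2)
  cos(a/2), the quotient I(a) / sin a does not decrease when a is halved. Being O(a) it tends to 0,
  so its first value is at most 0.\<close>

lemma hall_dyadic:
  fixes D :: "real \<Rightarrow> real"
  assumes D: "\<And>a b f. continuous_on {a..b} f \<Longrightarrow> (\<lambda>t. D t * f t) integrable_on {a..b}"
    and bd: "\<And>t. 0 \<le> t \<Longrightarrow> t \<le> 2 * pi / 3 \<Longrightarrow> \<bar>D t\<bar> \<le> B"
    and le: "\<And>t p. 0 < t \<Longrightarrow> t < 2 * pi / 3 / 2 ^ p \<Longrightarrow> D t + D (2 * pi / 3 / 2 ^ p - t) \<le> 0"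
  shows "integral {0..2 * pi / 3} (\<lambda>t. D t * sin (2 * pi / 3 - t)) \<le> 0"
proof -
  define a where "a = (\<lambda>p::nat. 2 * pi / 3 / 2 ^ p)"
  define I where "I = (\<lambda>a. integral {0..a} (\<lambda>t. D t * sin (a - t)))"
  have a: "0 < a p" "a p \<le> 2 * pi / 3" "a (Suc p) = a p / 2" for p
  proof -
    show "0 < a p" by (simp add: a_def)
    have "2 * pi / 3 / 2 ^ p \<le> 2 * pi / 3 / 1" by (intro divide_left_mono) auto
    then show "a p \<le> 2 * pi / 3" by (simp add: a_def)
    show "a (Suc p) = a p / 2" by (simp add: a_def)
  qed
  have apos: "a p < pi" for p using a(2)[of p] pi_gt_zero by linarith
  have sin_pos: "sin (a p) > 0" for p using a(1)[of p] apos[of p] by (rule sin_gt_zero)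
  have step: "I (a p) / sin (a p) \<le> I (a (Suc p)) / sin (a (Suc p))" for p
  proof -
    have "I (a p) \<le> 2 * cos (a p / 2) * I (a p / 2)"
      unfolding I_def by (rule hall_halving[OF D _ a(1) apos]) (use le[of _ p] in \<open>auto simp: a_def\<close>)
    moreover have "sin (a p) = 2 * sin (a p / 2) * cos (a p / 2)" using sin_double[of "a p / 2"] by simp
    moreover have "cos (a p / 2) > 0" using a[of p] apos[of p] by (intro cos_gt_zero) auto
    ultimately show ?thesis using sin_pos[of p] sin_pos[of "Suc p"] unfolding a(3)
      by (simp add: divide_simps) (simp add: mult_ac)
  qed
  have "I (a 0) / sin (a 0) \<le> I (a p) / sin (a p)" for p
    by (induction p) (use step order_trans in blast)+
  moreover have "(\<lambda>p. I (a p) / sin (a p)) \<longlonglongrightarrow> 0"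
  proof (rule Lim_null_comparison)
    show "\<forall>\<^sub>F p in sequentially. norm (I (a p) / sin (a p)) \<le> B * a p"
      using eventually_ge_at_top[of 1]
    proof eventually_elim
      fix p :: nat assume p: "1 \<le> p"
      show "norm (I (a p) / sin (a p)) \<le> B * a p"
      proof -
        \<comment> \<open>One halving brings \<open>a p\<close> below pi / 2, where the sine
          increases.\<close>
        obtain q where q: "p = Suc q" using p not0_implies_Suc by (cases p) auto
        have sm: "sin (a p - t) \<le> sin (a p)" "0 \<le> sin (a p - t)" if "t \<in> {0..a p}" for t
        proof -
          have "a p \<le> pi / 2" using a(2)[of q] a(3)[of q] pi_gt_zero unfolding q by linarith
          then show "sin (a p - t) \<le> sin (a p)" using that by (intro sin_monotone_2pi_le) auto
          show "0 \<le> sin (a p - t)" using that apos[of p] by (intro sin_ge_zero) auto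
        qed
        have "norm (I (a p)) \<le> integral {0..a p} (\<lambda>t. B * sin (a p))"
          unfolding I_def
        proof (rule integral_norm_bound_integral)
          fix t assume t: "t \<in> {0..a p}"
          have "\<bar>D t\<bar> * \<bar>sin (a p - t)\<bar> \<le> B * sin (a p)"
            using bd[of t] t a(2)[of p] sm[OF t] by (intro mult_mono) (auto intro: order_trans[OF abs_ge_zero])
          then show "norm (D t * sin (a p - t)) \<le> B * sin (a p)" by (simp add: abs_mult)
        qed (auto intro!: D continuous_intros)
        also have "\<dots> = B * a p * sin (a p)" using a(1)[of p] by simp
        finally show ?thesis using sin_pos[of p] by (simp add: divide_le_eq)
      qed
    qed
    have "(\<lambda>p. B * (2 * pi / 3 * (1/2)^p)) \<longlonglongrightarrow> B * (2 * pi / 3 * 0)"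
      by (intro tendsto_intros) auto
    then show "(\<lambda>p. B * a p) \<longlonglongrightarrow> 0" by (simp add: a_def power_divide)
  qed
  ultimately have "I (a 0) / sin (a 0) \<le> 0"
    by (intro LIMSEQ_le_const) auto
  then show ?thesis using sin_pos[of 0] by (simp add: I_def a_def divide_le_0_iff)
qed

text \<open>\<open>w\<close> is merely an almost everywhere limit, so integrability of its
  oscillation in \<open>t\<close> is not evident; it is inherited from the approximants by dominated
  convergence.\<close>

lemma osc_times_integrable:
  fixes u :: "nat \<Rightarrow> real \<Rightarrow> complex"
  assumes u: "\<And>n. continuous_on UNIV (u n)" "\<And>n s. norm (u n s) \<le> B"
   and N: "negligible N" and conv: "\<And>s. s \<notin> N \<Longrightarrow> (\<lambda>n. u n s) \<longlonglongrightarrow> w s"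
   and f: "continuous_on {a..b} f"
   and int: "\<And>n. (\<lambda>t. osc (u n) t * f t) integrable_on {a..b}"
  shows "(\<lambda>t. osc w t * f t) integrable_on {a..b}"
    "(\<lambda>n. integral {a..b} (\<lambda>t. osc (u n) t * f t)) \<longlonglongrightarrow> integral {a..b} (\<lambda>t. osc w t * f t)"
proof -
  obtain M where M: "\<And>t. t \<in> {a..b} \<Longrightarrow> norm (f t) \<le> M"
    using compact_continuous_image[OF f compact_Icc] by (meson bounded_iff compact_imp_bounded imageI)
  have le: "norm (osc (u n) t * f t) \<le> 2 * B^2 * M" if "t \<in> {a..b}" for n t
    unfolding norm_mult using osc_tendsto(2,3)[OF u N conv, of n t] M[OF that] by (intro mult_mono) auto
  have c: "(\<lambda>n. osc (u n) t * f t) \<longlonglongrightarrow> osc w t * f t" for t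
    by (intro tendsto_intros osc_tendsto(1)[OF u N conv])
  show "(\<lambda>t. osc w t * f t) integrable_on {a..b}"
    "(\<lambda>n. integral {a..b} (\<lambda>t. osc (u n) t * f t)) \<longlonglongrightarrow> integral {a..b} (\<lambda>t. osc w t * f t)"
    using dominated_convergence_ae_interval[OF int negligible_empty le c] by auto
qed

lemma osc_fsum_integrable:
  assumes a: "summable (fnorm a)" and f: "continuous_on {b..c} f"
  shows "(\<lambda>t. osc (fsum a) t * f t) integrable_on {b..c}"
proof (rule osc_times_integrable(1))
  define P where "P = (\<lambda>N s. \<Sum>k\<in>{- int N<..<int N}. a k * cis (of_int k * s))"
  show "continuous_on UNIV (P N)" "norm (P N s) \<le> suminf (fnorm a)" for N s
    unfolding P_def using norm_fpoly_le[OF a] by (auto intro!: continuous_intros)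
  show "(\<lambda>N. P N s) \<longlonglongrightarrow> fsum a s" for s
    unfolding P_def by (rule tendsto_uniform_limitI[OF uniform_limit_fsum[OF a]]) simp
  show "(\<lambda>t. osc (P N) t * f t) integrable_on {b..c}" for N
    unfolding P_def osc_fpoly[OF finite_greaterThanLessThan_int]
    by (intro integrable_continuous_real continuous_intros f)
qed (use f negligible_empty in auto)

text \<open>Two estimates of one integral are compared. Parseval bounds it below by 3 sqrt 3 / pi
  minus the functional; the polygon inequality bounds it above by 3 sqrt 3 / pi - 27 / (4
  pi^2).\<close>

theorem hall_inequality:
  fixes a :: "nat \<Rightarrow> int \<Rightarrow> complex"
  assumes a: "\<And>n. summable (fnorm (a n))" "\<And>n s. norm (fsum (a n) s) \<le> 1"
   and N: "negligible N" and conv: "\<And>s. s \<notin> N \<Longrightarrow> (\<lambda>n. fsum (a n) s) \<longlonglongrightarrow> w s"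
   and polygon: "\<And>m t. 0 < m \<Longrightarrow> (\<And>i j. i < j \<Longrightarrow> j < m \<Longrightarrow> t i < t j) \<Longrightarrow> (\<And>i. i < m \<Longrightarrow> t i < t 0 + 2 * pi)
      \<Longrightarrow> (\<And>i. i < m \<Longrightarrow> t i \<notin> N) \<Longrightarrow> (\<Sum>i<m. (norm (w (t (Suc i mod m)) - w (t i)))^2) \<le> 9"
   and norm1: "(\<lambda>n. integral {-pi..pi} (\<lambda>s. (norm (fsum (a n) s))^2)) \<longlonglongrightarrow> 2 * pi"
   and C: "(\<lambda>n. a n 0) \<longlonglongrightarrow> C0" "(\<lambda>n. a n 1) \<longlonglongrightarrow> C1" "(\<lambda>n. a n (-1)) \<longlonglongrightarrow> C2"
  shows "27 / (4 * pi^2) \<le> (norm C1)^2 + 3 * sqrt 3 / pi * (norm C0)^2 + (norm C2)^2"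
proof -
  let ?u = "\<lambda>n. fsum (a n)"
  have u: "continuous_on UNIV (?u n)" for n by (rule continuous_on_fsum[OF a(1)])
  have int: "(\<lambda>t. osc w t * f t) integrable_on {b..c}"
    "(\<lambda>n. integral {b..c} (\<lambda>t. osc (?u n) t * f t)) \<longlonglongrightarrow> integral {b..c} (\<lambda>t. osc w t * f t)"
    if "continuous_on {b..c} f" for b c f
    using osc_times_integrable[OF u a(2) N conv that osc_fsum_integrable[OF a(1) that]] by auto
  have osc: "0 \<le> osc w t" "osc w t \<le> 2" for t
  proof -
    have *: "(\<lambda>n. osc (?u n) t) \<longlonglongrightarrow> osc w t" "0 \<le> osc (?u n) t" "osc (?u n) t \<le> 2" for n
      using osc_tendsto[OF u a(2) N conv, where t = t] by auto
    show "0 \<le> osc w t" by (rule LIMSEQ_le_const[OF *(1)]) (use *(2) in auto)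
    show "osc w t \<le> 2" by (rule LIMSEQ_le_const2[OF *(1)]) (use *(3) in auto)
  qed
  define D where "D = (\<lambda>t. osc w t - 9 * t / (4 * pi))"
  have D_int: "(\<lambda>t. D t * f t) integrable_on {b..c}" if f: "continuous_on {b..c} f" for b c f
    unfolding D_def left_diff_distrib
    by (intro integrable_diff int(1) f integrable_continuous_real continuous_intros) auto
  have "integral {0..2 * pi / 3} (\<lambda>t. D t * sin (2 * pi / 3 - t)) \<le> 0"
  proof (rule hall_dyadic[OF D_int])
    fix t :: real assume t: "0 \<le> t" "t \<le> 2 * pi / 3"
    then have "0 \<le> 9 * t / (4 * pi)" "9 * t / (4 * pi) \<le> 9 * (2 * pi / 3) / (4 * pi)"
      by (simp, intro divide_right_mono) (use t in auto)
    then show "\<bar>D t\<bar> \<le> 4" using osc[of t] by (simp add: D_def abs_le_iff)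
  next
    fix t :: real and p :: nat assume t: "0 < t" "t < 2 * pi / 3 / 2 ^ p"
    \<comment> \<open>K = 3 * 2^p makes the arc 2 pi / K the p-fold half of 2 pi / 3.\<close>
    have eq: "2 * pi / real (3 * 2 ^ p) = 2 * pi / 3 / 2 ^ p" by simp
    have "osc w t + osc w (2 * pi / real (3 * 2 ^ p) - t) \<le> 9 / (2 * real (3 * 2 ^ p))"
      by (rule osc_pair_le[OF u a(2) fsum_periodic N conv polygon]) (use t eq in auto)
    moreover have "9 * t / (4 * pi) + 9 * (2 * pi / 3 / 2 ^ p - t) / (4 * pi) = 9 / (2 * real (3 * 2 ^ p))"
      by (simp add: field_simps)
    ultimately show "D t + D (2 * pi / 3 / 2 ^ p - t) \<le> 0" unfolding eq D_def by linarith
  qed auto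
  moreover have "integral {0..2 * pi / 3} (\<lambda>t. D t * sin (2 * pi / 3 - t)) =
     integral {0..2 * pi / 3} (\<lambda>t. osc w t * sin (2 * pi / 3 - t)) - 9 / (4 * pi) * (2 * pi / 3 - sqrt 3 / 2)"
  proof -
    have "((\<lambda>t. osc w t * sin (2 * pi / 3 - t) - 9 / (4 * pi) * (t * sin (2 * pi / 3 - t))) has_integral
      (integral {0..2 * pi / 3} (\<lambda>t. osc w t * sin (2 * pi / 3 - t)) - 9 / (4 * pi) * (2 * pi / 3 - sqrt 3 / 2))) {0..2 * pi / 3}"
      by (intro has_integral_diff has_integral_mult_right integral_t_sin integrable_integral int(1) continuous_intros)
    moreover have "D t * sin (2 * pi / 3 - t) = osc w t * sin (2 * pi / 3 - t) - 9 / (4 * pi) * (t * sin (2 * pi / 3 - t))" for t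
      by (simp add: D_def left_diff_distrib)
    ultimately show ?thesis by (simp add: integral_unique)
  qed
  ultimately have "integral {0..2 * pi / 3} (\<lambda>t. osc w t * sin (2 * pi / 3 - t)) \<le> 9 / (4 * pi) * (2 * pi / 3 - sqrt 3 / 2)"
    by simp
  then have "2 * sqrt 3 / pi * integral {0..2 * pi / 3} (\<lambda>t. osc w t * sin (2 * pi / 3 - t)) \<le>
      2 * sqrt 3 / pi * (9 / (4 * pi) * (2 * pi / 3 - sqrt 3 / 2))"
    by (rule mult_left_mono) simp
  also have "\<dots> = 3 * sqrt 3 / pi - 27 / (4 * pi^2)"
  proof -
    have "sqrt 3 * sqrt 3 = (3::real)" by simp
    then show ?thesis by (simp add: field_simps power2_eq_square)
  qed
  finally have upper: "2 * sqrt 3 / pi * integral {0..2 * pi / 3} (\<lambda>t. osc w t * sin (2 * pi / 3 - t)) \<le> 3 * sqrt 3 / pi - 27 / (4 * pi^2)" .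
  have "3 * sqrt 3 / pi * (2 * pi / (2 * pi) - (norm C0)^2) - (norm C1)^2 - (norm C2)^2 \<le>
    2 * sqrt 3 / pi * integral {0..2 * pi / 3} (\<lambda>t. osc w t * sin (2 * pi / 3 - t))"
  proof (rule tendsto_le[OF trivial_limit_sequentially])
    show "(\<lambda>n. 2 * sqrt 3 / pi * integral {0..2 * pi / 3} (\<lambda>t. osc (?u n) t * sin (2 * pi / 3 - t))) \<longlonglongrightarrow>
      2 * sqrt 3 / pi * integral {0..2 * pi / 3} (\<lambda>t. osc w t * sin (2 * pi / 3 - t))"
      by (intro tendsto_intros int(2) continuous_intros)
    show "(\<lambda>n. 3 * sqrt 3 / pi * (integral {-pi..pi} (\<lambda>s. (norm (?u n s))^2) / (2 * pi) - (norm (a n 0))^2) - (norm (a n 1))^2 - (norm (a n (-1)))^2) \<longlonglongrightarrow>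
      3 * sqrt 3 / pi * (2 * pi / (2 * pi) - (norm C0)^2) - (norm C1)^2 - (norm C2)^2"
      by (intro tendsto_intros norm1 C) auto
  qed (use hall_fsum[OF a(1)] in auto)
  moreover have "3 * sqrt 3 / pi * (2 * pi / (2 * pi) - (norm C0)^2) = 3 * sqrt 3 / pi - 3 * sqrt 3 / pi * (norm C0)^2"
    by (simp add: right_diff_distrib)
  ultimately show ?thesis using upper by linarith
qed

subsection \<open>Radial limits of homeomorphisms of the disc\<close>

text \<open>Merging two angles whose sum is at most pi does not decrease the sum, and among four
  angles of total at most 2 pi either the first two or the last two can be merged. So at most three
  angles remain; for three the bound says that the vertex sum of a triangle in the unit circle has
  nonnegative squared norm.\<close>

lemma sum_one_minus_cos_le:
  fixes xs :: "real list"
  assumes "\<forall>x\<in>set xs. 0 \<le> x" "sum_list xs = 2 * pi"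
  shows "(\<Sum>x\<leftarrow>xs. 1 - cos x) \<le> 9 / 2"
  using assms
proof (induction "length xs" arbitrary: xs rule: less_induct)
  case less
  have merge: "(1 - cos x) + (1 - cos y) \<le> 1 - cos (x + y)"
    if "0 \<le> x" "0 \<le> y" "x + y \<le> pi" for x y :: real
  proof -
    have "sin (x/2) \<ge> 0" "sin (y/2) \<ge> 0" "cos ((x+y)/2) \<ge> 0"
      using that by (auto intro!: sin_ge_zero cos_ge_zero)
    then have "0 \<le> sin (x/2) * sin (y/2) * cos ((x+y)/2)" by simp
    also have "cos ((x+y)/2) = cos (x/2) * cos (y/2) - sin (x/2) * sin (y/2)"
      by (simp add: add_divide_distrib cos_add)
    finally have *: "0 \<le> sin (x/2) * sin (y/2) * (cos (x/2) * cos (y/2) - sin (x/2) * sin (y/2))" .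
    have "cos x = 1 - 2 * sin (x/2)^2" "cos y = 1 - 2 * sin (y/2)^2"
      using cos_double_sin[of "x/2"] cos_double_sin[of "y/2"] by auto
    moreover have "sin x = 2 * sin (x/2) * cos (x/2)" "sin y = 2 * sin (y/2) * cos (y/2)"
      using sin_double[of "x/2"] sin_double[of "y/2"] by auto
    moreover have "(1 - cos x) * (1 - cos y) = 4 * (sin (x/2) * sin (x/2) * sin (y/2) * sin (y/2))"
      unfolding calculation(1,2) by (simp add: power2_eq_square)
    ultimately show ?thesis using *
      by (simp add: cos_add algebra_simps power2_eq_square)
  qed
  consider "xs = []" | x where "xs = [x]" | x y where "xs = [x,y]" | x y z where "xs = [x,y,z]"
    | x y z w ys where "xs = x # y # z # w # ys"
    by (metis list.exhaust)
  then show ?case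
  proof cases
    case 1 then show ?thesis by simp
  next
    case (2 x) then show ?thesis using cos_ge_minus_one[of x] by (simp del: cos_ge_minus_one)
  next
    case (3 x y) then show ?thesis using cos_ge_minus_one[of x] cos_ge_minus_one[of y] by (simp del: cos_ge_minus_one)
  next
    case (4 x y z)
    then have z: "z = 2 * pi - (x + y)" using less.prems by simp
    have "cos z = cos (x + y)" unfolding z by (simp add: cos_diff)
    \<comment> \<open>The squared norm of 1 + cis x + cis(x + y).\<close>
    have "0 \<le> (1 + cos x + cos (x+y))^2 + (sin x + sin (x+y))^2" by simp
    also have "\<dots> = 3 + 2 * cos x + 2 * cos (x+y) + 2 * (cos x * cos (x+y) + sin x * sin (x+y))"
      using sin_cos_squared_add[of x] sin_cos_squared_add[of "x+y"]
      by (simp add: algebra_simps power2_eq_square del: sin_cos_squared_add)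
    also have "cos x * cos (x+y) + sin x * sin (x+y) = cos y"
      using cos_diff[of "x+y" x] by (simp add: algebra_simps)
    finally show ?thesis using \<open>cos z = cos (x + y)\<close> 4 by simp
  next
    case (5 x y z w ys)
    have nn: "0 \<le> x" "0 \<le> y" "0 \<le> z" "0 \<le> w" and "0 \<le> sum_list ys"
      using less.prems 5 by (auto intro: sum_list_nonneg)
    then have "x + y \<le> pi \<or> z + w \<le> pi" using less.prems 5 by auto
    then show ?thesis
    proof
      assume *: "x + y \<le> pi"
      have "(\<Sum>x\<leftarrow>(x+y) # z # w # ys. 1 - cos x) \<le> 9 / 2"
        by (rule less.hyps) (use 5 less.prems in auto)
      with merge[OF nn(1,2) *] 5 show ?thesis by simp
    next
      assume *: "z + w \<le> pi"
      have "(\<Sum>x\<leftarrow>x # y # (z + w) # ys. 1 - cos x) \<le> 9 / 2"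
        by (rule less.hyps) (use 5 less.prems in auto)
      with merge[OF nn(3,4) *] 5 show ?thesis by simp
    qed
  qed
qed

text \<open>A Cayley map sends the disc to the upper half-plane. Its pole \<open>e\<close> is put in
  the middle of the arc from \<open>cis d\<close> to \<open>cis (a + 2 pi)\<close>, away from the
  end points; these become four points in the order a, c, b, d on the bottom edge of a box, where
  the Fashoda theorem for interlaced end points applies.\<close>

lemma disc_paths_interlace:
  fixes f g :: "real \<Rightarrow> complex"
  assumes "path f" "path g"
    and f: "path_image f \<subseteq> ball 0 1 \<union> {pathstart f, pathfinish f}"
    and g: "path_image g \<subseteq> ball 0 1 \<union> {pathstart g, pathfinish g}"
    and ends: "pathstart f = cis a" "pathfinish f = cis b" "pathstart g = cis c" "pathfinish g = cis d"
    and ord: "a < c" "c < b" "b < d" "d < a + 2 * pi"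
  shows "path_image f \<inter> path_image g \<noteq> {}"
proof -
  define \<eta> where "\<eta> = (d + (a + 2 * pi)) / 2"
  define e where "e = cis \<eta>"
  have \<eta>: "d < \<eta>" "\<eta> < a + 2 * pi" using ord by (auto simp: \<eta>_def)
  define \<Phi> where "\<Phi> = (\<lambda>z. \<i> * (e + z) / (e - z))"
  define \<psi> where "\<psi> = (\<lambda>z. (\<chi> i. if i = 1 then Re (\<Phi> z) else Im (\<Phi> z)) :: real^2)"
  have \<psi>_nth: "\<psi> z $ 1 = Re (\<Phi> z)" "\<psi> z $ 2 = Im (\<Phi> z)" for z by (simp_all add: \<psi>_def)
  have bd: "\<Phi> (cis x) = of_real (- cot ((x - \<eta>) / 2))" "e \<noteq> cis x"
    if "a \<le> x" "x \<le> d" for x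
  proof -
    define h where "h = (x - \<eta>) / 2"
    have h: "- pi < h" "h < 0" using that \<eta> ord by (auto simp: h_def)
    have "sin (- h) > 0" using h by (intro sin_gt_zero) auto
    then have sn: "sin h \<noteq> 0" by simp
    have x: "cis x = e * (cis h)^2"
    proof -
      have "\<eta> + 2 * h = x" using h_def by (simp add: field_simps)
      then show ?thesis by (simp add: e_def Complex.DeMoivre cis_mult)
    qed
    have D: "e - cis x = e * cis h * (- 2 * \<i> * sin h)"
      unfolding x by (simp add: complex_eq_iff cis.ctr power2_eq_square algebra_simps)
        (use sin_cos_squared_add[of h] in \<open>simp add: power2_eq_square, algebra\<close>)
    have S: "e + cis x = e * cis h * (2 * cos h)"
      unfolding x by (simp add: complex_eq_iff cis.ctr power2_eq_square algebra_simps)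
        (use sin_cos_squared_add[of h] in \<open>simp add: power2_eq_square, algebra\<close>)
    have e0: "e \<noteq> 0" by (simp add: e_def)
    have "\<Phi> (cis x) = \<i> * (e * cis h * (2 * cos h)) / (e * cis h * (- 2 * \<i> * sin h))"
      by (simp only: \<Phi>_def D S)
    also have "\<dots> = of_real (- cot h)" using sn e0 by (simp add: cot_def field_simps)
    finally show "\<Phi> (cis x) = of_real (- cot ((x - \<eta>) / 2))" by (simp add: h_def)
    show "e \<noteq> cis x" using D sn e0 by auto
  qed
  have inn: "e \<noteq> z" "Im (\<Phi> z) > 0" if "z \<in> ball 0 1" for z
  proof -
    have ne: "norm e = 1" by (simp add: e_def)
    then show "e \<noteq> z" using that by auto
    then have p: "(norm (e - z))^2 > 0" by simp
    have "\<Phi> z = \<i> * ((e + z) * cnj (e - z)) / of_real ((norm (e - z))^2)"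
      unfolding \<Phi>_def by (subst complex_div_cnj) (simp add: mult.assoc)
    then have "Im (\<Phi> z) = Re ((e + z) * cnj (e - z)) / (norm (e - z))^2"
      by (simp only: Im_divide_of_real) simp
    also have "Re ((e + z) * cnj (e - z)) = (norm e)^2 - (norm z)^2"
      unfolding cmod_power2 by (simp add: algebra_simps power2_eq_square)
    finally show "Im (\<Phi> z) > 0" using p ne that by (simp add: power_less_one_iff abs_square_less_1)
  qed
  define U where "U = path_image f \<union> path_image g"
  have U: "z \<in> ball 0 1 \<or> (\<exists>x. a \<le> x \<and> x \<le> d \<and> z = cis x)" if "z \<in> U" for z
    using that f g ord ends unfolding U_def by (smt (verit) UnE insertE singletonD subsetD)
  have Ue: "e \<noteq> z" if "z \<in> U" for z using U[OF that] bd inn by auto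
  have c\<Phi>: "continuous_on U \<Phi>"
    unfolding \<Phi>_def by (intro continuous_intros) (use Ue in auto)
  then have cont: "continuous_on U \<psi>"
    unfolding \<psi>_def
  proof (intro continuous_on_vec_lambda)
    fix i :: 2 show "continuous_on U (\<lambda>x. if i = 1 then Re (\<Phi> x) else Im (\<Phi> x))"
      by (cases "i = 1") (use c\<Phi> in \<open>auto intro: continuous_intros\<close>)
  qed
  have "compact (\<psi> ` U)"
    by (intro compact_continuous_image[OF cont]) (auto simp: U_def compact_path_image assms)
  then obtain B where B: "\<And>v. v \<in> \<psi> ` U \<Longrightarrow> norm v \<le> B"
    by (meson bounded_iff compact_imp_bounded)
  have im: "Im (\<Phi> z) \<ge> 0" if "z \<in> U" for z using U[OF that] bd inn by (auto intro: less_imp_le)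
  have box: "\<psi> ` U \<subseteq> cbox (vector [-B, 0]) (vector [B, B])"
  proof
    fix v assume v: "v \<in> \<psi> ` U"
    then obtain z where z: "z \<in> U" "v = \<psi> z" by auto
    have "\<bar>v $ 1\<bar> \<le> B" "\<bar>v $ 2\<bar> \<le> B" using B[OF v] component_le_norm_cart[of v] by (meson order_trans)+
    then show "v \<in> cbox (vector [-B, 0]) (vector [B, B])"
      using im[OF z(1)] z by (auto simp: mem_box_cart forall_2 \<psi>_nth)
  qed
  \<comment> \<open>The half angles stay in (-pi, 0), a single branch of the cotangent, so the order
    on the circle is kept on the real line.\<close>
  have mono: "cot ((y - \<eta>) / 2) < cot ((x - \<eta>) / 2)" if "a \<le> x" "x < y" "y \<le> d" for x y
  proof -
    define h k where "h = (x - \<eta>) / 2" and "k = (y - \<eta>) / 2"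
    have hk: "- pi < h" "h < k" "k < 0" using that \<eta> by (auto simp: h_def k_def)
    have "sin (- h) > 0" "sin (- k) > 0" "sin (k - h) > 0" using hk by (auto intro!: sin_gt_zero simp del: sin_minus)
    then have "cos k / sin k < cos h / sin h"
      by (simp add: sin_diff field_simps divide_less_eq less_divide_eq)
    then show ?thesis by (simp add: cot_def h_def k_def)
  qed
  have vals: "\<psi> (cis x) $ 2 = 0" "\<psi> (cis x) $ 1 = - cot ((x - \<eta>) / 2)" if "a \<le> x" "x \<le> d" for x
    using bd[OF that] by (auto simp: \<psi>_nth)
  obtain z where "z \<in> path_image (\<psi> \<circ> f)" "z \<in> path_image (\<psi> \<circ> g)"
  proof (rule fashoda_interlace[of "\<psi> \<circ> f" "\<psi> \<circ> g" "vector [-B, 0]" "vector [B, B]"])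
    show "path (\<psi> \<circ> f)" "path (\<psi> \<circ> g)"
      by (auto intro!: path_continuous_image assms continuous_on_subset[OF cont] simp: U_def)
    show "path_image (\<psi> \<circ> f) \<subseteq> cbox (vector [-B, 0]) (vector [B, B])"
         "path_image (\<psi> \<circ> g) \<subseteq> cbox (vector [-B, 0]) (vector [B, B])"
      using box by (auto simp: path_image_compose U_def)
  qed (use ord in \<open>auto simp: pathstart_compose pathfinish_compose ends vals mono\<close>)
  then obtain x y where xy: "x \<in> path_image f" "y \<in> path_image g" "\<psi> x = \<psi> y"
    by (auto simp: path_image_compose)
  then have "Re (\<Phi> x) = Re (\<Phi> y)" "Im (\<Phi> x) = Im (\<Phi> y)"
    by (metis \<psi>_nth)+
  then have "\<Phi> x = \<Phi> y" by (simp add: complex_eq_iff)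
  moreover have "e \<noteq> x" "e \<noteq> y" using Ue xy by (auto simp: U_def)
  ultimately have "(e + x) * (e - y) = (e + y) * (e - x)" by (simp add: \<Phi>_def field_simps)
  then have "2 * e * x = 2 * e * y" by (simp add: algebra_simps)
  then have "x = y" by (simp add: e_def)
  then show ?thesis using xy by auto
qed

section \<open>Cyclic order of the images of rays\<close>

lemma cis_eqD:
  assumes "cis x = cis y" "\<bar>x - y\<bar> < 2 * pi" shows "x = y"
proof -
  have "sin (x - y) = 0" "cos (x - y) = 1"
    using assms(1) sin_cos_squared_add[of y] by (auto simp: complex_eq_iff sin_diff cos_diff power2_eq_square)
  then obtain n :: int where n: "x - y = n * 2 * pi" using cos_one_2pi_int by auto
  with assms(2) have "\<bar>real_of_int n\<bar> * (2 * pi) < 1 * (2 * pi)" by (simp add: abs_mult mult.assoc)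
  then have "\<bar>n\<bar> < 1" by (subst (asm) mult_less_cancel_right) auto
  then show ?thesis using n by simp
qed

text \<open>In the (radius, angle) plane this is a polygon with three axis-parallel sides: inwards
  along one ray, along an arc of radius r, outwards along the other ray.\<close>

lemma polar_path:
  assumes "x \<le> y" "0 < r" "r \<le> R1" "r \<le> R2"
  obtains p where "path p" "pathstart p = of_real R1 * cis x" "pathfinish p = of_real R2 * cis y"
    "path_image p \<subseteq> (\<lambda>R. of_real R * cis x) ` {r..R1} \<union> (\<lambda>\<theta>. of_real r * cis \<theta>) ` {x..y} \<union>
       (\<lambda>R. of_real R * cis y) ` {r..R2}"
proof -
  define P :: "real \<times> real \<Rightarrow> complex" where "P = (\<lambda>v. of_real (fst v) * cis (snd v))"
  define q where "q = linepath (R1, x) (r, x) +++ linepath (r, x) (r, y) +++ linepath (r, y) (R2, y)"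
  have q: "path q" "pathstart q = (R1, x)" "pathfinish q = (R2, y)"
    "path_image q = closed_segment (R1, x) (r, x) \<union> closed_segment (r, x) (r, y) \<union> closed_segment (r, y) (R2, y)"
    by (auto simp: q_def path_image_join)
  have seg: "closed_segment (R1, x) (r, x) = {r..R1} \<times> {x}" "closed_segment (r, x) (r, y) = {r} \<times> {x..y}"
    "closed_segment (r, y) (R2, y) = {r..R2} \<times> {y}"
    using assms by (auto simp: closed_segment_PairD closed_segment_same_fst closed_segment_same_snd closed_segment_eq_real_ivl)
  show ?thesis
  proof
    show "path (P \<circ> q)" by (intro path_continuous_image q) (auto simp: P_def intro!: continuous_intros)
    show "path_image (P \<circ> q) \<subseteq> (\<lambda>R. of_real R * cis x) ` {r..R1} \<union> (\<lambda>\<theta>. of_real r * cis \<theta>) ` {x..y} \<union>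
       (\<lambda>R. of_real R * cis y) ` {r..R2}"
      unfolding path_image_compose q(4) seg by (auto simp: P_def)
  qed (auto simp: pathstart_compose pathfinish_compose q P_def)
qed

text \<open>The direction of the first step propagates.\<close>

lemma monotone_if_consecutive_between:
  fixes f :: "nat \<Rightarrow> real"
  assumes "\<And>j. 1 \<le> j \<Longrightarrow> j + 2 < m \<Longrightarrow> (f j < f (j+1) \<and> f (j+1) < f (j+2)) \<or> (f j > f (j+1) \<and> f (j+1) > f (j+2))"
    and "\<And>j. 1 \<le> j \<Longrightarrow> j + 1 < m \<Longrightarrow> f j \<noteq> f (j+1)"
  shows "(\<forall>j\<ge>1. j + 1 < m \<longrightarrow> f j < f (j+1)) \<or> (\<forall>j\<ge>1. j + 1 < m \<longrightarrow> f j > f (j+1))"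
proof -
  have *: "j + 1 < m \<Longrightarrow> (f j < f (j+1) \<longleftrightarrow> f 1 < f 2)" if "1 \<le> j" for j
    using that
  proof (induction j rule: dec_induct)
    case base then show ?case by (simp add: numeral_2_eq_2)
  next
    case (step n)
    then show ?case using assms(1)[of n] by (auto simp: numeral_2_eq_2)
  qed
  show ?thesis
  proof (cases "f 1 < f 2")
    case True then show ?thesis using * by auto
  next
    case False then show ?thesis using * assms(2) by (metis linorder_neqE_linordered_idom)
  qed
qed

text \<open>Angles are measured from \<open>q 0\<close>. Were three consecutive later angles not
  monotone, two of the excluded pairs would separate each other. So the points run round the circle
  once in one direction, the gaps are nonnegative with sum 2 pi, and a squared chord is 2 (1 - cos
  gap).\<close>

lemma cyclic_sum_le:
  fixes q :: "nat \<Rightarrow> complex"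
  assumes m: "m > 0" and q: "\<And>i. i < m \<Longrightarrow> norm (q i) = 1" and inj: "inj_on q {..<m}"
   and nointer: "\<And>i j k l a b c d. \<lbrakk>i < j; j < k; k < l; l < m;
       (q i = cis a \<and> q j = cis b \<and> {cis c, cis d} = {q k, q l}) \<or>
       ({cis a, cis b} = {q l, q i} \<and> {cis c, cis d} = {q j, q k});
       a < c; c < b; b < d; d < a + 2 * pi\<rbrakk> \<Longrightarrow> False"
  shows "(\<Sum>i<m. (norm (q (Suc i mod m) - q i))^2) \<le> 9"
proof -
  define e0 where "e0 = Arg2pi (q 0)"
  have nz: "q i \<noteq> 0" if "i < m" for i using q[OF that] by auto
  define \<eta> where "\<eta> = (\<lambda>i. e0 + Arg2pi (q i / q 0))"
  have q\<eta>: "q i = cis (\<eta> i)" if "i < m" for i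
  proof -
    have "q i / q 0 = cis (Arg2pi (q i / q 0))" "q 0 = cis e0"
      using q[OF that] q[OF m] Arg2pi_eq[of "q i / q 0"] Arg2pi_eq[of "q 0"] unfolding e0_def cis_conv_exp
      by (auto simp: norm_divide)
    then have "q 0 * (q i / q 0) = cis e0 * cis (Arg2pi (q i / q 0))" by metis
    then show ?thesis using nz[OF m] by (simp add: \<eta>_def cis_mult)
  qed
  have \<eta>0: "\<eta> 0 = e0" using nz[OF m] Arg2pi_of_real[of 1] by (simp add: \<eta>_def)
  have \<eta>_ne: "\<eta> i \<noteq> \<eta> j" if "i < m" "j < m" "i \<noteq> j" for i j
    using that inj q\<eta> by (metis inj_on_def lessThan_iff)
  have \<eta>_rng: "e0 \<le> \<eta> i" "\<eta> i < e0 + 2 * pi" for i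
    using Arg2pi_ge_0 Arg2pi_lt_2pi by (auto simp: \<eta>_def)
  have \<eta>_gt: "e0 < \<eta> i" if "0 < i" "i < m" for i
    using \<eta>_rng(1)[of i] \<eta>_ne[of i 0] that \<eta>0 by fastforce
  have nrm: "(norm (cis x - cis y))^2 = 2 * (1 - cos (x - y))" for x y
    using sin_cos_squared_add[of x] sin_cos_squared_add[of y] unfolding cmod_power2
    by (simp add: cos_diff algebra_simps power2_eq_square del: sin_cos_squared_add)
  have betw: "(\<eta> j < \<eta> (j+1) \<and> \<eta> (j+1) < \<eta> (j+2)) \<or> (\<eta> j > \<eta> (j+1) \<and> \<eta> (j+1) > \<eta> (j+2))"
    if j: "1 \<le> j" "j + 2 < m" for j
  proof (rule ccontr)
    assume neg: "\<not> ?thesis"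
    have A: "0 < j" "j < j + 1" "j + 1 < j + 2" "j + 2 < m" using j by auto
    have B: "q 0 = cis (\<eta> 0)" "q j = cis (\<eta> j)" "q (j+1) = cis (\<eta> (j+1))" "q (j+2) = cis (\<eta> (j+2))"
      using j q\<eta> by auto
    have C: "\<eta> 0 < \<eta> j" "\<eta> 0 < \<eta> (j+1)" "\<eta> 0 < \<eta> (j+2)" using \<eta>_gt \<eta>0 j by auto
    have D: "\<eta> i < \<eta> 0 + 2 * pi" for i using \<eta>_rng \<eta>0 by auto
    have E: "\<eta> j \<noteq> \<eta> (j+1)" "\<eta> j \<noteq> \<eta> (j+2)" "\<eta> (j+1) \<noteq> \<eta> (j+2)" using \<eta>_ne j by auto
    \<comment> \<open>In the first two orders {0, j} separates {j+1, j+2}; in the last two {0, j+2}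
      separates {j, j+1}.\<close>
    consider "\<eta> (j+1) < \<eta> j" "\<eta> j < \<eta> (j+2)" | "\<eta> (j+2) < \<eta> j" "\<eta> j < \<eta> (j+1)"
      | "\<eta> j < \<eta> (j+2)" "\<eta> (j+2) < \<eta> (j+1)" | "\<eta> (j+1) < \<eta> (j+2)" "\<eta> (j+2) < \<eta> j"
      using neg E by linarith
    then show False
    proof cases
      case 1 show False
        by (rule nointer[OF A, of "\<eta> 0" "\<eta> j" "\<eta> (j+1)" "\<eta> (j+2)"]) (use 1 B C D in auto)
    next
      case 2 show False
        by (rule nointer[OF A, of "\<eta> 0" "\<eta> j" "\<eta> (j+2)" "\<eta> (j+1)"]) (use 2 B C D in auto)
    next
      case 3 show False
        by (rule nointer[OF A, of "\<eta> 0" "\<eta> (j+2)" "\<eta> j" "\<eta> (j+1)"]) (use 3 B C D in auto)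
    next
      case 4 show False
        by (rule nointer[OF A, of "\<eta> 0" "\<eta> (j+2)" "\<eta> (j+1)" "\<eta> j"]) (use 4 B C D in auto)
    qed
  qed
  have key: "(\<Sum>i<m. 1 - cos (\<theta> i)) \<le> 9/2"
    if "\<And>i. i < m \<Longrightarrow> 0 \<le> \<theta> i" "(\<Sum>i<m. \<theta> i) = 2 * pi" for \<theta> :: "nat \<Rightarrow> real"
    using sum_one_minus_cos_le[of "map \<theta> [0..<m]"] that
    by (simp add: sum_list_sum_nth interv_sum_list_conv_sum_set_nat o_def atLeast0LessThan)
  obtain n where mn: "m = Suc n" using m gr0_implies_Suc by blast
  have "(\<Sum>i<m. 1 - cos (\<eta> (Suc i mod m) - \<eta> i)) \<le> 9/2"
  proof (cases "n = 0")
    case True then show ?thesis using mn by simp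
  next
    case n: False
    consider (inc) "\<forall>j\<ge>1. j + 1 < m \<longrightarrow> \<eta> j < \<eta> (j+1)" | (dec) "\<forall>j\<ge>1. j + 1 < m \<longrightarrow> \<eta> j > \<eta> (j+1)"
      using monotone_if_consecutive_between[of m \<eta>] betw \<eta>_ne by fastforce
    then show ?thesis
    proof cases
      case inc
      define \<theta> where "\<theta> = (\<lambda>i. if i = n then e0 + 2 * pi - \<eta> n else \<eta> (Suc i) - \<eta> i)"
      have "(\<Sum>i<m. 1 - cos (\<theta> i)) \<le> 9/2"
      proof (rule key)
        fix i assume i: "i < m"
        show "0 \<le> \<theta> i"
        proof (cases "i = n \<or> i = 0")
          case True then show ?thesis using \<eta>_rng[of n] \<eta>_gt[of 1] \<eta>0 n mn by (auto simp: \<theta>_def)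
        next
          case False
          then have "\<eta> i < \<eta> (i+1)" using inc i mn by auto
          then show ?thesis using False by (simp add: \<theta>_def)
        qed
      next
        have "(\<Sum>i<n. \<theta> i) = (\<Sum>i<n. \<eta> (Suc i) - \<eta> i)" by (rule sum.cong) (auto simp: \<theta>_def)
        also have "\<dots> = \<eta> n - \<eta> 0" by (rule sum_lessThan_telescope)
        finally show "(\<Sum>i<m. \<theta> i) = 2 * pi" by (simp add: mn \<theta>_def \<eta>0)
      qed
      also have "(\<Sum>i<m. 1 - cos (\<theta> i)) = (\<Sum>i<m. 1 - cos (\<eta> (Suc i mod m) - \<eta> i))"
      proof (rule sum.cong)
        fix i assume "i \<in> {..<m}"
        then show "1 - cos (\<theta> i) = 1 - cos (\<eta> (Suc i mod m) - \<eta> i)"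
          using \<eta>0 by (auto simp: \<theta>_def mn cos_diff cos_add sin_add)
      qed simp
      finally show ?thesis .
    next
      case dec
      \<comment> \<open>The same gaps read backwards: the first step goes down from e0 + 2 pi, the
        last one closes up at e0.\<close>
      define \<theta> where "\<theta> = (\<lambda>i. if i = 0 then e0 + 2 * pi - \<eta> 1 else if i = n then \<eta> n - e0 else \<eta> i - \<eta> (Suc i))"
      have "(\<Sum>i<m. 1 - cos (\<theta> i)) \<le> 9/2"
      proof (rule key)
        fix i assume i: "i < m"
        show "0 \<le> \<theta> i"
        proof (cases "i = n \<or> i = 0")
          case True then show ?thesis using \<eta>_rng[of n] \<eta>_rng[of 1] n by (auto simp: \<theta>_def)
        next
          case False
          then have "\<eta> i > \<eta> (i+1)" using dec i mn by auto
          then show ?thesis using False by (simp add: \<theta>_def)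
        qed
      next
        obtain k where k: "n = Suc k" using n not0_implies_Suc by blast
        have "(\<Sum>i<k. \<theta> (Suc i)) = (\<Sum>i<k. \<eta> (Suc i) - \<eta> (Suc (Suc i)))" by (rule sum.cong) (auto simp: \<theta>_def k)
        also have "\<dots> = \<eta> 1 - \<eta> n" using sum_lessThan_telescope'[of "\<lambda>i. \<eta> (Suc i)" k] by (simp add: k)
        finally have *: "(\<Sum>i<k. \<theta> (Suc i)) = \<eta> 1 - \<eta> n" .
        have "(\<Sum>i<m. \<theta> i) = \<theta> 0 + ((\<Sum>i<k. \<theta> (Suc i)) + \<theta> (Suc k))"
          unfolding mn k by (subst sum.lessThan_Suc_shift, subst sum.lessThan_Suc) simp
        also have "\<dots> = 2 * pi" unfolding * by (simp add: \<theta>_def k)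
        finally show "(\<Sum>i<m. \<theta> i) = 2 * pi" .
      qed
      also have "(\<Sum>i<m. 1 - cos (\<theta> i)) = (\<Sum>i<m. 1 - cos (\<eta> (Suc i mod m) - \<eta> i))"
      proof (rule sum.cong)
        fix i assume "i \<in> {..<m}"
        then show "1 - cos (\<theta> i) = 1 - cos (\<eta> (Suc i mod m) - \<eta> i)"
          using \<eta>0 n by (auto simp: \<theta>_def mn cos_diff cos_add sin_add)
      qed simp
      finally show ?thesis .
    qed
  qed
  moreover have "(\<Sum>i<m. (norm (q (Suc i mod m) - q i))^2) = 2 * (\<Sum>i<m. 1 - cos (\<eta> (Suc i mod m) - \<eta> i))"
    unfolding sum_distrib_left by (rule sum.cong) (use m in \<open>auto simp: q\<eta> nrm\<close>)
  ultimately show ?thesis by simp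
qed

text \<open>The inverse is continuous by invariance of domain, so the preimage of
  \<open>cball 0 \<rho>\<close> is compact in the open disc and lies in a smaller concentric
  disc.\<close>

lemma homeo_disc_norm_tendsto_1:
  fixes u :: "complex \<Rightarrow> complex"
  assumes u: "continuous_on (ball 0 1) u" "inj_on u (ball 0 1)" "u ` ball 0 1 = ball 0 1" and "\<rho> < 1"
  obtains R where "0 \<le> R" "R < 1" "\<And>z. z \<in> ball 0 1 \<Longrightarrow> norm z > R \<Longrightarrow> norm (u z) > \<rho>"
proof -
  obtain v where v: "homeomorphism (ball 0 1) (u ` ball 0 1) u v"
    using invariance_of_domain_homeomorphism[OF open_ball u(1) _ u(2)] by auto
  have "compact (v ` cball 0 \<rho>)"
    by (rule compact_continuous_image) (use v \<open>\<rho> < 1\<close> in \<open>auto simp: homeomorphism_def u intro: continuous_on_subset\<close>)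
  moreover have sub: "v ` cball 0 \<rho> \<subseteq> ball 0 1"
  proof -
    have "cball 0 \<rho> \<subseteq> (ball 0 1 :: complex set)" using \<open>\<rho> < 1\<close> by auto
    then show ?thesis using homeomorphism_image2[OF v] u(3) by blast
  qed
  ultimately have "\<exists>R. 0 \<le> R \<and> R < 1 \<and> (\<forall>z\<in>v ` cball 0 \<rho>. norm z \<le> R)"
  proof (cases "v ` cball 0 \<rho> = {}")
    case True then show ?thesis by (intro exI[of _ 0]) auto
  next
    case False
    obtain z where "z \<in> v ` cball 0 \<rho>" "\<forall>y\<in>v ` cball 0 \<rho>. norm y \<le> norm z"
      using continuous_attains_sup[OF \<open>compact _\<close> False, of norm] by (auto intro: continuous_intros)
    then show ?thesis using sub by (intro exI[of _ "norm z"]) auto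
  qed
  then obtain R where R: "0 \<le> R" "R < 1" "\<And>z. z \<in> v ` cball 0 \<rho> \<Longrightarrow> norm z \<le> R" by blast
  show ?thesis
  proof (rule that[OF R(1,2)])
    fix z :: complex assume z: "z \<in> ball 0 1" "norm z > R"
    then have "v (u z) = z" using v by (auto simp: homeomorphism_def)
    then show "norm (u z) > \<rho>" using R(3)[of z] z by (metis image_eqI mem_cball_0 not_le)
  qed
qed

text \<open>The images of the rays, cut off where they first reach a circle of radius close to 1, cannot cross,
  so their endpoints follow each other around that circle exactly once. The worst case for the sum of the
  squared chords is an inscribed equilateral triangle.\<close>

lemma ray_limits_polygon:
  fixes u :: "complex \<Rightarrow> complex" and t :: "nat \<Rightarrow> real"
  assumes u: "continuous_on (ball 0 1) u" "inj_on u (ball 0 1)" "u ` ball 0 1 = ball 0 1"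
   and m: "0 < m" and t: "\<And>i j. i < j \<Longrightarrow> j < m \<Longrightarrow> t i < t j" "\<And>i. i < m \<Longrightarrow> t i < t 0 + 2 * pi"
   and lim: "\<And>i. i < m \<Longrightarrow> ((\<lambda>r. u (of_real r * cis (t i))) \<longlongrightarrow> w i) (at_left 1)"
  shows "(\<Sum>i<m. (norm (w (Suc i mod m) - w i))^2) \<le> 9"
proof -
  have approx: "\<exists>q. (\<forall>i<m. norm (q i - w i) < \<epsilon>) \<and> (\<Sum>i<m. (norm (q (Suc i mod m) - q i))^2) \<le> 9" if "\<epsilon> > 0" for \<epsilon> :: real
  proof -
    have "eventually (\<lambda>r. \<forall>i\<in>{..<m}. dist (u (of_real r * cis (t i))) (w i) < \<epsilon>) (at_left 1)"
      using lim tendstoD[OF _ that] by (intro eventually_ball_finite) auto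
    then obtain s where s: "s < 1" "\<And>r i. s < r \<Longrightarrow> r < 1 \<Longrightarrow> i < m \<Longrightarrow> dist (u (of_real r * cis (t i))) (w i) < \<epsilon>"
      unfolding eventually_at_left_field by auto
    \<comment> \<open>Beyond \<open>r0\<close> every ray image is within \<epsilon> of its limit, so
      the curves may be cut anywhere out there.\<close>
    define r0 where "r0 = (max s 0 + 1) / 2"
    have r0: "0 < r0" "r0 < 1" "s < r0" using s(1) by (auto simp: r0_def)
    have cs: "compact (u ` cball 0 r0)"
      by (rule compact_continuous_image[OF continuous_on_subset[OF u(1)]]) (use r0 in auto)
    obtain z0 where z0: "z0 \<in> cball 0 r0" "\<And>z. z \<in> cball 0 r0 \<Longrightarrow> norm (u z) \<le> norm (u z0)"
      using continuous_attains_sup[OF cs _ continuous_on_norm[OF continuous_on_id]] r0 by auto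
    have "u z0 \<in> u ` ball 0 1" using z0(1) r0 by (intro imageI) auto
    then have "norm (u z0) < 1" unfolding u(3) by simp
    \<comment> \<open>\<rho> exceeds |u| on the whole disc of radius \<open>r0\<close>, hence the
      level |u| = \<rho> is reached only beyond \<open>r0\<close>.\<close>
    define \<rho> where "\<rho> = (norm (u z0) + 1) / 2"
    have "\<rho> > norm (u z0)" and \<rho>: "\<rho> < 1" using \<open>norm (u z0) < 1\<close> by (auto simp: \<rho>_def)
    then have \<rho>0: "\<rho> > 0" by (smt (verit) norm_ge_zero)
    have inn: "norm (u z) < \<rho>" if "norm z \<le> r0" for z
      using z0(2)[of z] that \<open>\<rho> > norm (u z0)\<close> by simp
    obtain R where R: "0 \<le> R" "R < 1" "\<And>z. z \<in> ball 0 1 \<Longrightarrow> norm z > R \<Longrightarrow> norm (u z) > \<rho>"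
      using homeo_disc_norm_tendsto_1[OF u \<rho>] by blast
    have "\<exists>r. r0 < r \<and> r < 1 \<and> norm (u (of_real r * cis \<theta>)) = \<rho> \<and> (\<forall>r'. r0 \<le> r' \<and> r' < r \<longrightarrow> norm (u (of_real r' * cis \<theta>)) < \<rho>)" for \<theta>
    proof -
      define g where "g = (\<lambda>r. norm (u (of_real r * cis \<theta>)))"
      define R1 where "R1 = (max R r0 + 1) / 2"
      have R1: "R < R1" "r0 < R1" "R1 < 1" using R r0 by (auto simp: R1_def)
      have cg: "continuous_on {r0..R1} g"
        unfolding g_def using r0 R1
        by (intro continuous_on_norm continuous_on_compose2[OF u(1)] continuous_intros) (auto simp: norm_mult)
      define K where "K = {r\<in>{r0..R1}. \<rho> \<le> g r}"
      have "closed K" unfolding K_def by (intro continuous_on_closed_Collect_le continuous_intros cg closed_atLeastAtMost)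
      moreover have "bounded K" unfolding K_def by (rule bounded_subset[of "{r0..R1}"]) auto
      ultimately have "compact K" by (simp add: compact_eq_bounded_closed)
      moreover have "R1 \<in> K" using R(3)[of "of_real R1 * cis \<theta>"] R1 r0 R(1) by (auto simp: K_def g_def norm_mult)
      ultimately obtain r where r: "r \<in> K" "\<And>x. x \<in> K \<Longrightarrow> r \<le> x"
        using compact_attains_inf[of K] by auto
      have lt: "g r' < \<rho>" if "r0 \<le> r'" "r' < r" for r'
        using r(2)[of r'] that r(1) unfolding K_def by fastforce
      have "g r0 < \<rho>" unfolding g_def using r0 by (intro inn) (simp add: norm_mult)
      then have "r0 < r" using r(1) unfolding K_def by (cases "r = r0") auto
      have rR1: "r \<le> R1" using r(1) by (simp add: K_def)
      have "g r = \<rho>"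
      proof (rule ccontr)
        assume "g r \<noteq> \<rho>"
        then have "g r > \<rho>" using r(1) by (auto simp: K_def)
        then obtain x where "r0 \<le> x" "x \<le> r" "g x = \<rho>"
          using IVT'[of g r0 \<rho> r] \<open>g r0 < \<rho>\<close> \<open>r0 < r\<close> continuous_on_subset[OF cg, of "{r0..r}"] rR1 by auto
        then show False using lt[of x] \<open>g r > \<rho>\<close> by (cases "x = r") auto
      qed
      then show ?thesis using lt r(1) R1 \<open>r0 < r\<close> by (intro exI[of _ r]) (auto simp: g_def K_def)
    qed
    \<comment> \<open>\<open>h \<theta>\<close> is the first radius after \<open>r0\<close> at which
      the ray reaches this level.\<close>
    then have "\<exists>h. \<forall>\<theta>. r0 < h \<theta> \<and> h \<theta> < 1 \<and> norm (u (of_real (h \<theta>) * cis \<theta>)) = \<rho> \<and> (\<forall>r'. r0 \<le> r' \<and> r' < h \<theta> \<longrightarrow> norm (u (of_real r' * cis \<theta>)) < \<rho>)"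
      by (intro choice) blast
    then obtain h where h: "\<And>\<theta>. r0 < h \<theta>" "\<And>\<theta>. h \<theta> < 1" "\<And>\<theta>. norm (u (of_real (h \<theta>) * cis \<theta>)) = \<rho>"
      "\<And>\<theta> r. r0 \<le> r \<Longrightarrow> r < h \<theta> \<Longrightarrow> norm (u (of_real r * cis \<theta>)) < \<rho>" by blast
    define q where "q = (\<lambda>i. u (of_real (h (t i)) * cis (t i)))"
    \<comment> \<open>Down one ray, along the inner circle, up the other. The image under
      \<open>u / \<rho>\<close> is in the open unit disc except for its two ends, and disjoint
      angular ranges give disjoint sets.\<close>
    define Z where "Z = (\<lambda>x y. (\<lambda>R. of_real R * cis x) ` {r0..h x} \<union> (\<lambda>\<theta>. of_real r0 * cis \<theta>) ` {x..y} \<union>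
       (\<lambda>R. of_real R * cis y) ` {r0..h y})"
    have Zball: "Z x y \<subseteq> ball 0 1" for x y
    proof -
      have "norm (of_real R * cis \<theta> :: complex) < 1" if "r0 \<le> R" "R < 1" for R \<theta>
        using that r0 by (simp add: norm_mult)
      then show ?thesis using h(2)[of x] h(2)[of y] r0 unfolding Z_def by (force intro: le_less_trans)
    qed
    have Zpolar: "\<exists>R \<theta>. 0 < R \<and> x \<le> \<theta> \<and> \<theta> \<le> y \<and> z = of_real R * cis \<theta>" if zZ: "z \<in> Z x y" and xy: "x \<le> y" for x y z
    proof -
      consider R where "R \<in> {r0..h x}" "z = of_real R * cis x" | \<theta> where "\<theta> \<in> {x..y}" "z = of_real r0 * cis \<theta>"
        | R where "R \<in> {r0..h y}" "z = of_real R * cis y"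
        using zZ unfolding Z_def by blast
      then show ?thesis
      proof cases
        case (1 R) then show ?thesis using r0 xy by (intro exI[of _ R] exI[of _ x]) auto
      next
        case (2 \<theta>) then show ?thesis using r0 by (intro exI[of _ r0] exI[of _ \<theta>]) auto
      next
        case (3 R) then show ?thesis using r0 xy by (intro exI[of _ R] exI[of _ y]) auto
      qed
    qed
    have Zdisj: "Z x y \<inter> Z x' y' = {}" if o: "x \<le> y" "y < x'" "x' \<le> y'" "y' < x + 2 * pi" for x y x' y'
    proof (rule ccontr)
      assume "Z x y \<inter> Z x' y' \<noteq> {}"
      then obtain z where "z \<in> Z x y" "z \<in> Z x' y'" by auto
      then obtain R \<theta> R' \<theta>' where *: "0 < R" "x \<le> \<theta>" "\<theta> \<le> y" "z = of_real R * cis \<theta>"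
         "0 < R'" "x' \<le> \<theta>'" "\<theta>' \<le> y'" "z = of_real R' * cis \<theta>'" using Zpolar[of z x y] Zpolar[of z x' y'] o(1,3) by blast
      have "norm z = R" unfolding *(4) norm_mult using *(1) by simp
      moreover have "norm z = R'" unfolding *(8) norm_mult using *(5) by simp
      ultimately have "cis \<theta> = cis \<theta>'" using * by auto
      moreover have "\<bar>\<theta> - \<theta>'\<bar> < 2 * pi" using * o by auto
      ultimately have "\<theta> = \<theta>'" by (rule cis_eqD)
      then show False using * o by auto
    qed
    have Zpath: "\<exists>p. path p \<and> pathstart p = u (of_real (h x) * cis x) / \<rho> \<and> pathfinish p = u (of_real (h y) * cis y) / \<rho> \<and>
        path_image p \<subseteq> ball 0 1 \<union> {pathstart p, pathfinish p} \<and> path_image p \<subseteq> (\<lambda>z. u z / \<rho>) ` Z x y"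
      if xley: "x \<le> y" for x y
    proof -
      obtain p where p: "path p" "pathstart p = of_real (h x) * cis x" "pathfinish p = of_real (h y) * cis y"
         "path_image p \<subseteq> Z x y"
        using polar_path[OF xley r0(1), of "h x" "h y"] h(1)[of x] h(1)[of y] unfolding Z_def by (metis less_imp_le)
      have cnt: "continuous_on (ball 0 1) (\<lambda>z. u z / \<rho>)" using u(1) \<rho>0 by (intro continuous_intros) auto
      have nz: "norm (u z) < \<rho> \<or> z = of_real (h x) * cis x \<or> z = of_real (h y) * cis y" if zZ: "z \<in> Z x y" for z
      proof -
        consider R where "R \<in> {r0..h x}" "z = of_real R * cis x" | \<theta> where "\<theta> \<in> {x..y}" "z = of_real r0 * cis \<theta>"
          | R where "R \<in> {r0..h y}" "z = of_real R * cis y"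
          using zZ unfolding Z_def by blast
        then show ?thesis
        proof cases
          case (1 R) then show ?thesis using h(4)[of R x] by (cases "R = h x") auto
        next
          case (2 \<theta>) then show ?thesis using inn[of z] r0 by (auto simp: norm_mult)
        next
          case (3 R) then show ?thesis using h(4)[of R y] by (cases "R = h y") auto
        qed
      qed
      show ?thesis
      proof (intro exI conjI)
        show "path ((\<lambda>z. u z / \<rho>) \<circ> p)"
          by (rule path_continuous_image[OF p(1) continuous_on_subset[OF cnt]]) (use p(4) Zball in blast)
        show "path_image ((\<lambda>z. u z / \<rho>) \<circ> p) \<subseteq> (\<lambda>z. u z / \<rho>) ` Z x y" using p(4) by (auto simp: path_image_compose)
        show "path_image ((\<lambda>z. u z / \<rho>) \<circ> p) \<subseteq> ball 0 1 \<union> {pathstart ((\<lambda>z. u z / \<rho>) \<circ> p), pathfinish ((\<lambda>z. u z / \<rho>) \<circ> p)}"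
        proof
          fix v assume "v \<in> path_image ((\<lambda>z. u z / \<rho>) \<circ> p)"
          then obtain z where z: "z \<in> Z x y" "v = u z / \<rho>" using p(4) by (auto simp: path_image_compose)
          then show "v \<in> ball 0 1 \<union> {pathstart ((\<lambda>z. u z / \<rho>) \<circ> p), pathfinish ((\<lambda>z. u z / \<rho>) \<circ> p)}"
            using nz[OF z(1)] \<rho>0 by (auto simp: pathstart_compose pathfinish_compose p norm_divide)
        qed
      qed (auto simp: pathstart_compose pathfinish_compose p)
    qed
    \<comment> \<open>If the end points interlaced, the two image paths would meet, although
      \<open>u\<close> is injective and the two sets \<open>Z\<close> are disjoint.\<close>
    have nointer: False
      if xy: "x \<le> y" "y < x'" "x' \<le> y'" "y' < x + 2 * pi"
       and eq: "{cis a, cis b} = {u (of_real (h x) * cis x) / \<rho>, u (of_real (h y) * cis y) / \<rho>}"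
           "{cis c, cis d} = {u (of_real (h x') * cis x') / \<rho>, u (of_real (h y') * cis y') / \<rho>}"
       and ord: "a < c" "c < b" "b < d" "d < a + 2 * pi" for x y x' y' a b c d
    proof -
      have ex: "\<exists>p. path p \<and> pathstart p = cis a \<and> pathfinish p = cis b \<and>
        path_image p \<subseteq> ball 0 1 \<union> {pathstart p, pathfinish p} \<and> path_image p \<subseteq> (\<lambda>z. u z / \<rho>) ` Z x y"
        if xley: "x \<le> y" and ab: "{cis a, cis b} = {u (of_real (h x) * cis x) / \<rho>, u (of_real (h y) * cis y) / \<rho>}" for a b x y
      proof -
        obtain p where p: "path p" "pathstart p = u (of_real (h x) * cis x) / \<rho>" "pathfinish p = u (of_real (h y) * cis y) / \<rho>"
          "path_image p \<subseteq> ball 0 1 \<union> {pathstart p, pathfinish p}" "path_image p \<subseteq> (\<lambda>z. u z / \<rho>) ` Z x y"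
          using Zpath[OF xley] by blast
        have "{cis a, cis b} = {pathstart p, pathfinish p}" using ab p(2,3) by simp
        then consider "cis a = pathstart p" "cis b = pathfinish p" | "cis a = pathfinish p" "cis b = pathstart p"
          unfolding doubleton_eq_iff by blast
        then show ?thesis
        proof cases
          case 1 then show ?thesis using p(1,4,5) by (intro exI[of _ p]) simp
        next
          case 2 then show ?thesis using p(1,4,5)
            by (intro exI[of _ "reversepath p"]) (simp add: insert_commute)
        qed
      qed
      obtain f where f: "path f" "pathstart f = cis a" "pathfinish f = cis b"
        "path_image f \<subseteq> ball 0 1 \<union> {pathstart f, pathfinish f}" "path_image f \<subseteq> (\<lambda>z. u z / \<rho>) ` Z x y"
        using ex[OF xy(1) eq(1)] by blast
      obtain g where g: "path g" "pathstart g = cis c" "pathfinish g = cis d"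
        "path_image g \<subseteq> ball 0 1 \<union> {pathstart g, pathfinish g}" "path_image g \<subseteq> (\<lambda>z. u z / \<rho>) ` Z x' y'"
        using ex[OF xy(3) eq(2)] by blast
      have "path_image f \<inter> path_image g \<noteq> {}"
        by (rule disc_paths_interlace[OF f(1) g(1) f(4) g(4) f(2,3) g(2,3) ord])
      then obtain z z' where "z \<in> Z x y" "z' \<in> Z x' y'" "u z / \<rho> = u z' / \<rho>" using f(5) g(5) by blast
      then have "z = z'" using u(2) Zball \<rho>0 by (simp add: inj_on_def subset_iff)
      then show False using Zdisj[OF xy] \<open>z \<in> Z x y\<close> \<open>z' \<in> Z x' y'\<close> by auto
    qed
    have per: "q i = u (of_real (h (t i)) * cis (t i + 2 * pi))" for i by (simp add: q_def cis.ctr)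
    \<comment> \<open>\<open>h\<close> was obtained by choice, but as a first hitting radius it
      depends on \<open>cis \<theta>\<close> only.\<close>
    have hper: "h (\<theta> + 2 * pi) = h \<theta>" for \<theta>
    proof -
      have c: "cis (\<theta> + 2 * pi) = cis \<theta>" by (simp add: cis.ctr)
      have "\<not> h \<theta> < h (\<theta> + 2 * pi)"
        using h(1)[of \<theta>] h(3)[of \<theta>] h(4)[of "h \<theta>" "\<theta> + 2*pi"] unfolding c by auto
      moreover have "\<not> h (\<theta> + 2 * pi) < h \<theta>"
        using h(1)[of "\<theta> + 2*pi"] h(3)[of "\<theta> + 2 * pi"] h(4)[of "h (\<theta> + 2*pi)" \<theta>] unfolding c by auto
      ultimately show ?thesis by simp
    qed
    have "(\<Sum>i<m. (norm (q (Suc i mod m) / \<rho> - q i / \<rho>))^2) \<le> 9"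
    proof (rule cyclic_sum_le[OF m])
      fix i show "norm (q i / \<rho>) = 1" using h(3)[of "t i"] \<rho>0 by (simp add: q_def norm_divide)
    next
      show "inj_on (\<lambda>i. q i / \<rho>) {..<m}"
      proof (rule inj_onI, goal_cases)
        case (1 i j)
        have "of_real (h (t i)) * cis (t i) \<in> ball 0 1" for i using h(1,2)[of "t i"] r0 by (auto simp: norm_mult)
        then have eq: "of_real (h (t i)) * cis (t i) = of_real (h (t j)) * cis (t j)"
          using 1 u(2) \<rho>0 by (simp add: inj_on_def q_def)
        then have "norm (of_real (h (t i)) * cis (t i)) = norm (of_real (h (t j)) * cis (t j))" by simp
        then have "h (t i) = h (t j)" using h(1)[of "t i"] h(1)[of "t j"] r0 by (simp add: norm_mult)
        then have "cis (t i) = cis (t j)" using eq h(1)[of "t j"] r0 by auto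
        moreover have "\<bar>t i - t j\<bar> < 2 * pi"
        proof -
          have "t 0 \<le> t i" "t 0 \<le> t j" using t(1)[of 0 i] t(1)[of 0 j] 1 by (cases "i = 0"; cases "j = 0"; auto)+
          then show ?thesis using t(2)[of i] t(2)[of j] 1 by auto
        qed
        ultimately have "t i = t j" by (rule cis_eqD)
        then show "i = j" using t(1)[of i j] t(1)[of j i] 1 by (metis less_irrefl lessThan_iff linorder_neqE_nat)
      qed
    next
      fix i j k l a b c d
      assume ijkl: "i < j" "j < k" "k < l" "l < m" and ord: "a < c" "c < b" "b < d" "d < a + 2 * pi"
       and *: "(q i / \<rho> = cis a \<and> q j / \<rho> = cis b \<and> {cis c, cis d} = {q k / \<rho>, q l / \<rho>}) \<or>
       ({cis a, cis b} = {q l / \<rho>, q i / \<rho>} \<and> {cis c, cis d} = {q j / \<rho>, q k / \<rho>})"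
      have tt: "t i < t j" "t j < t k" "t k < t l" "t l < t i + 2 * pi"
      proof -
        show "t i < t j" "t j < t k" "t k < t l" using ijkl by (auto intro!: t(1))
        have "t 0 \<le> t i" using t(1)[of 0 i] ijkl by (cases "i = 0") auto
        then show "t l < t i + 2 * pi" using t(2)[OF ijkl(4)] by simp
      qed
      from * show False
      proof (elim disjE conjE)
        assume "q i / \<rho> = cis a" "q j / \<rho> = cis b" "{cis c, cis d} = {q k / \<rho>, q l / \<rho>}"
        then show False using nointer[of "t i" "t j" "t k" "t l" a b c d] tt ord by (auto simp: q_def)
      next
        assume A: "{cis a, cis b} = {q l / \<rho>, q i / \<rho>}" "{cis c, cis d} = {q j / \<rho>, q k / \<rho>}"
        \<comment> \<open>The pair l, i uses the arc from \<open>t l\<close> through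
          \<open>t i + 2 pi\<close>, which comes after the arc from \<open>t j\<close> to
          \<open>t k\<close>. The chords therefore swap roles, and the order a < c < b < d becomes c
          < b < d < a + 2 pi.\<close>
        have "cis (t i + 2 * pi) = cis (t i)" by (simp add: cis.ctr)
        with A have "{cis c, cis d} = {u (of_real (h (t j)) * cis (t j)) / \<rho>, u (of_real (h (t k)) * cis (t k)) / \<rho>}"
          "{cis a, cis b} = {u (of_real (h (t l)) * cis (t l)) / \<rho>, u (of_real (h (t i + 2 * pi)) * cis (t i + 2 * pi)) / \<rho>}"
          "{cis b, cis (a + 2 * pi)} = {u (of_real (h (t l)) * cis (t l)) / \<rho>, u (of_real (h (t i + 2 * pi)) * cis (t i + 2 * pi)) / \<rho>}"
          by (auto simp: q_def hper cis.ctr)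
        then show False using nointer[of "t j" "t k" "t l" "t i + 2 * pi" c d b "a + 2 * pi"] tt ord by auto
      qed
    qed
    also have "(\<Sum>i<m. (norm (q (Suc i mod m) / \<rho> - q i / \<rho>))^2) = (\<Sum>i<m. (norm (q (Suc i mod m) - q i))^2) / \<rho>^2"
      using \<rho>0 by (simp add: diff_divide_distrib[symmetric] norm_divide power_divide sum_divide_distrib)
    finally have "(\<Sum>i<m. (norm (q (Suc i mod m) - q i))^2) \<le> 9 * \<rho>^2" using \<rho>0 by (simp add: divide_le_eq)
    also have "\<dots> \<le> 9" using \<rho>0 \<rho> by (simp add: power_le_one)
    finally have "(\<Sum>i<m. (norm (q (Suc i mod m) - q i))^2) \<le> 9" .
    moreover have "norm (q i - w i) < \<epsilon>" if "i < m" for i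
      using s(2)[of "h (t i)" i] h(1,2)[of "t i"] r0 that by (simp add: q_def dist_norm)
    ultimately show ?thesis by blast
  qed
  then have "\<exists>q. (\<forall>i<m. norm (q i - w i) < 1 / Suc n) \<and> (\<Sum>i<m. (norm (q (Suc i mod m) - q i))^2) \<le> 9" for n
    by (intro approx) simp
  then obtain q where q: "\<And>n i. i < m \<Longrightarrow> norm (q n i - w i) < 1 / Suc n"
    "\<And>n. (\<Sum>i<m. (norm (q n (Suc i mod m) - q n i))^2) \<le> 9" by metis
  have "(\<lambda>n. q n i) \<longlonglongrightarrow> w i" if "i < m" for i
  proof -
    have "(\<lambda>n. q n i - w i) \<longlonglongrightarrow> 0"
      by (rule Lim_null_comparison[OF _ LIMSEQ_inverse_real_of_nat])
         (use q(1)[OF that] in \<open>auto simp: inverse_eq_divide intro!: always_eventually less_imp_le\<close>)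
    then show ?thesis by (simp add: LIM_zero_iff)
  qed
  then have "(\<lambda>n. \<Sum>i<m. (norm (q n (Suc i mod m) - q n i))^2) \<longlonglongrightarrow> (\<Sum>i<m. (norm (w (Suc i mod m) - w i))^2)"
    using m by (intro tendsto_intros) auto
  then show ?thesis by (rule LIMSEQ_le_const2) (use q(2) in auto)
qed

subsection \<open>Differentiability of Lipschitz functions\<close>

lemma emeasure_UN_countable_mono:
  assumes "countable C" "disjoint_family_on A C"
    and "\<And>i. i \<in> C \<Longrightarrow> A i \<in> sets M" "\<And>i. i \<in> C \<Longrightarrow> A i \<in> sets N"
    and le: "\<And>i. i \<in> C \<Longrightarrow> emeasure M (A i) \<le> k * emeasure N (A i)"
  shows "emeasure M (\<Union>i\<in>C. A i) \<le> k * emeasure N (\<Union>i\<in>C. A i)"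
proof -
  have "emeasure M (\<Union>i\<in>C. A i) = (\<integral>\<^sup>+i. emeasure M (A i) \<partial>count_space C)"
    using assms by (intro emeasure_UN_countable) auto
  also have "\<dots> \<le> (\<integral>\<^sup>+i. k * emeasure N (A i) \<partial>count_space C)"
    by (rule nn_integral_mono) (use le in auto)
  also have "\<dots> = k * (\<integral>\<^sup>+i. emeasure N (A i) \<partial>count_space C)"
    by (rule nn_integral_cmult) auto
  also have "(\<integral>\<^sup>+i. emeasure N (A i) \<partial>count_space C) = emeasure N (\<Union>i\<in>C. A i)"
    using assms by (intro emeasure_UN_countable[symmetric]) auto
  finally show ?thesis .
qed

text \<open>Vitali's theorem is used twice for the Stieltjes measure of \<open>g\<close>. Intervals
  of slope at most p cover almost all of E inside an open set of measure at most m + \<epsilon>;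
  inside these, intervals of slope at least q cover almost all of E again. Hence q m \<le> p (m +
  \<epsilon>) for the outer measure m of E, which forces m = 0.\<close>

lemma negligible_two_slopes:
  fixes g :: "real \<Rightarrow> real"
  assumes g: "mono g" "continuous_on UNIV g" and pq: "0 < p" "p < q"
    and E: "E \<subseteq> {-n..n}"
    and lo: "\<And>x d. x \<in> E \<Longrightarrow> d > 0 \<Longrightarrow> \<exists>c r. 0 < r \<and> r < d \<and> x \<in> cball c r \<and> g (c + r) - g (c - r) \<le> p * (2 * r)"
    and hi: "\<And>x d. x \<in> E \<Longrightarrow> d > 0 \<Longrightarrow> \<exists>c r. 0 < r \<and> r < d \<and> x \<in> cball c r \<and> g (c + r) - g (c - r) \<ge> q * (2 * r)"
  shows "negligible E"
proof -
  define \<nu> where "\<nu> = interval_measure g"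
  have sets\<nu>: "sets \<nu> = sets borel" by (simp add: \<nu>_def)
  have \<nu>: "emeasure \<nu> (cball c r) = ennreal (g (c + r) - g (c - r))" if "0 < r" for c r
    unfolding \<nu>_def cball_eq_atLeastAtMost using that g
    by (intro emeasure_interval_measure_Icc) (auto simp: mono_def intro: continuous_on_subset)
  have leb: "emeasure lebesgue (cball c r) = ennreal (2 * r)" if "0 < r" for c r :: real
    unfolding cball_eq_atLeastAtMost using that by simp
  \<comment> \<open>E is not known to be measurable, so its outer measure and a measurable hull B
    stand in for it.\<close>
  define m where "m = outer_measure_of lebesgue E"
  obtain B where B: "B \<in> sets lebesgue" "E \<subseteq> B" "m = emeasure lebesgue B"
    using outer_measure_of_attain[of E lebesgue] by (auto simp: m_def)
  have "m \<le> outer_measure_of lebesgue {-n..n}" unfolding m_def by (rule outer_measure_of_mono[OF E])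
  also have "\<dots> < \<infinity>" by (simp add: outer_measure_of_eq emeasure_lborel_Icc_eq)
  finally have mfin: "m < \<infinity>" .
  have Blm: "B \<in> lmeasurable" using B mfin by (auto intro: fmeasurableI)
  have main: "ennreal q * m \<le> ennreal p * (m + ennreal \<epsilon>)" if eps: "\<epsilon> > 0" for \<epsilon>
  proof -
    obtain G where G: "open G" "B \<subseteq> G" "G - B \<in> lmeasurable" "emeasure lebesgue (G - B) < ennreal \<epsilon>"
      using sets_lebesgue_outer_open[OF B(1) eps] by metis
    have "emeasure lebesgue G = emeasure lebesgue (B \<union> (G - B))" using G(2) by (simp add: Un_absorb1)
    also have "\<dots> \<le> emeasure lebesgue B + emeasure lebesgue (G - B)"
      by (rule emeasure_subadditive) (use B G in auto)
    also have "\<dots> \<le> m + ennreal \<epsilon>" using G(4) B(3) by (intro add_mono) auto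
    finally have mG: "emeasure lebesgue G \<le> m + ennreal \<epsilon>" .
    have cover: "\<exists>C. countable C \<and> C \<subseteq> {(c,r). 0 < r \<and> cball c r \<subseteq> T \<and> P c r} \<and>
        pairwise (\<lambda>i j. disjnt (cball (fst i) (snd i)) (cball (fst j) (snd j))) C \<and>
        negligible (S - (\<Union>i\<in>C. cball (fst i) (snd i)))"
      if T: "open T" "S \<subseteq> T"
        and P: "\<And>x d. x \<in> S \<Longrightarrow> d > 0 \<Longrightarrow> \<exists>c r. 0 < r \<and> r < d \<and> x \<in> cball c r \<and> P c r"
      for S T :: "real set" and P
    proof -
      let ?K = "{(c,r). 0 < r \<and> cball c r \<subseteq> T \<and> P c r}"
      have 1: "\<exists>i. i \<in> ?K \<and> x \<in> cball (fst i) (snd i) \<and> snd i < d" if xd: "x \<in> S" "d > 0" for x d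
      proof -
        obtain e where e: "e > 0" "ball x e \<subseteq> T" using T xd openE by blast
        obtain c r where cr: "0 < r" "r < min d (e / 2)" "x \<in> cball c r" "P c r"
          using P[OF xd(1), of "min d (e/2)"] xd e by auto
        have "cball c r \<subseteq> ball x e"
        proof
          fix y assume "y \<in> cball c r"
          then have "dist x y \<le> 2 * r" using cr(3) dist_triangle2[of x y c] by (simp add: dist_commute)
          then show "y \<in> ball x e" using cr(2) by simp
        qed
        then show ?thesis using cr e by (intro exI[of _ "(c,r)"]) auto
      qed
      show ?thesis
        by (rule Vitali_covering_theorem_cballs[of ?K snd S fst]) (use 1 in auto)
    qed
    obtain C1 where C1: "countable C1" "C1 \<subseteq> {(c,r). 0 < r \<and> cball c r \<subseteq> G \<and> g (c + r) - g (c - r) \<le> p * (2 * r)}"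
       "pairwise (\<lambda>i j. disjnt (cball (fst i) (snd i)) (cball (fst j) (snd j))) C1"
       "negligible (E - (\<Union>i\<in>C1. cball (fst i) (snd i)))"
      using cover[of G E "\<lambda>c r. g (c + r) - g (c - r) \<le> p * (2 * r)"] G B lo by blast
    \<comment> \<open>The second cover needs an open set to live in; passing to open intervals loses
      only countably many end points.\<close>
    define O1 where "O1 = (\<Union>i\<in>C1. ball (fst i) (snd i))"
    have "E - O1 \<subseteq> (E - (\<Union>i\<in>C1. cball (fst i) (snd i))) \<union> (\<Union>i\<in>C1. sphere (fst i) (snd i))"
      unfolding O1_def by (force simp: le_less)
    moreover have "negligible (\<Union>i\<in>C1. sphere (fst i) (snd i))"
      using C1(1) by (auto intro: negligible_sphere)
    ultimately have neg1: "negligible (E - O1)" using C1(4) negligible_Un negligible_subset by metis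
    have oO1: "open O1" by (auto simp: O1_def)
    obtain C2 where C2: "countable C2" "C2 \<subseteq> {(c,r). 0 < r \<and> cball c r \<subseteq> O1 \<and> g (c + r) - g (c - r) \<ge> q * (2 * r)}"
       "pairwise (\<lambda>i j. disjnt (cball (fst i) (snd i)) (cball (fst j) (snd j))) C2"
       "negligible ((E \<inter> O1) - (\<Union>i\<in>C2. cball (fst i) (snd i)))"
      using cover[of O1 "E \<inter> O1" "\<lambda>c r. g (c + r) - g (c - r) \<ge> q * (2 * r)"] oO1 hi by blast
    let ?U1 = "\<Union>i\<in>C1. cball (fst i) (snd i)" and ?U2 = "\<Union>i\<in>C2. cball (fst i) (snd i)"
    have "E - ?U2 \<subseteq> (E - O1) \<union> ((E \<inter> O1) - ?U2)" by auto
    then have neg2: "negligible (E - ?U2)" using neg1 C2(4) negligible_Un negligible_subset by metis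
    have disj: "disjoint_family_on (\<lambda>i. cball (fst i) (snd i)) C1" "disjoint_family_on (\<lambda>i. cball (fst i) (snd i)) C2"
      using C1(3) C2(3) by (auto simp: disjoint_family_on_def pairwise_def disjnt_def)
    have meas: "?U1 \<in> sets lebesgue" "?U2 \<in> sets lebesgue" "?U1 \<in> sets \<nu>" "?U2 \<in> sets \<nu>"
      using C1(1) C2(1) by (auto simp: sets\<nu> intro!: sets.countable_UN')
    have "m \<le> outer_measure_of lebesgue (?U2 \<union> (E - ?U2))"
      unfolding m_def by (rule outer_measure_of_mono) auto
    also have "\<dots> = emeasure lebesgue (?U2 \<union> (E - ?U2))"
      by (rule outer_measure_of_eq[OF sets.Un[OF meas(2) negligible_imp_sets[OF neg2]]])
    also have "\<dots> = emeasure lebesgue ?U2"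
      by (rule emeasure_Un_null_set[OF meas(2)]) (use neg2 in \<open>simp only: negligible_iff_null_sets\<close>)
    finally have "ennreal q * m \<le> ennreal q * emeasure lebesgue ?U2" by (rule mult_left_mono) simp
    also have "\<dots> \<le> emeasure \<nu> ?U2"
    proof -
      have "emeasure lebesgue ?U2 \<le> ennreal (1 / q) * emeasure \<nu> ?U2"
      proof (rule emeasure_UN_countable_mono[OF C2(1) disj(2)])
        fix i assume "i \<in> C2"
        then have *: "0 < snd i" "g (fst i + snd i) - g (fst i - snd i) \<ge> q * (2 * snd i)" using C2(2) by auto
        show "emeasure lebesgue (cball (fst i) (snd i)) \<le> ennreal (1 / q) * emeasure \<nu> (cball (fst i) (snd i))"
        proof -
          have "2 * snd i \<le> 1 / q * (g (fst i + snd i) - g (fst i - snd i))" using * pq by (simp add: field_simps)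
          then show ?thesis unfolding \<nu>[OF *(1)] leb[OF *(1)] using * pq
            by (subst ennreal_mult'[symmetric]) (auto intro: ennreal_leI)
        qed
      qed (auto simp: sets\<nu>)
      then have "ennreal q * emeasure lebesgue ?U2 \<le> ennreal q * (ennreal (1 / q) * emeasure \<nu> ?U2)"
        by (rule mult_left_mono) simp
      also have "\<dots> = emeasure \<nu> ?U2" using pq by (simp add: mult.assoc[symmetric] ennreal_mult[symmetric])
      finally show ?thesis .
    qed
    also have "\<dots> \<le> emeasure \<nu> ?U1"
    proof (rule emeasure_mono[OF _ meas(3)])
      have "cball (fst i) (snd i) \<subseteq> O1" if "i \<in> C2" for i using subsetD[OF C2(2) that] by (simp add: case_prod_beta)
      then have "?U2 \<subseteq> O1" by (rule UN_least)
      also have "O1 \<subseteq> ?U1" unfolding O1_def by (intro UN_mono) auto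
      finally show "?U2 \<subseteq> ?U1" .
    qed
    also have "\<dots> \<le> ennreal p * emeasure lebesgue ?U1"
    proof (rule emeasure_UN_countable_mono[OF C1(1) disj(1)])
      fix i assume "i \<in> C1"
      then have *: "0 < snd i" "g (fst i + snd i) - g (fst i - snd i) \<le> p * (2 * snd i)" using C1(2) by auto
      show "emeasure \<nu> (cball (fst i) (snd i)) \<le> ennreal p * emeasure lebesgue (cball (fst i) (snd i))"
        unfolding \<nu>[OF *(1)] leb[OF *(1)] using * pq by (subst ennreal_mult'[symmetric]) (auto intro: ennreal_leI)
    qed (auto simp: sets\<nu>)
    also have "\<dots> \<le> ennreal p * emeasure lebesgue G"
    proof (intro mult_left_mono emeasure_mono UN_least)
      show "cball (fst i) (snd i) \<subseteq> G" if "i \<in> C1" for i using subsetD[OF C1(2) that] by (simp add: case_prod_beta)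
    qed (use G(1) in auto)
    also have "\<dots> \<le> ennreal p * (m + ennreal \<epsilon>)" by (intro mult_left_mono mG) simp
    finally show ?thesis .
  qed
  obtain M where M: "m = ennreal M" "0 \<le> M" using mfin by (cases m) auto
  have "q * M \<le> p * (M + \<epsilon>)" if "\<epsilon> > 0" for \<epsilon>
    using main[OF that] M pq that by (simp add: ennreal_mult[symmetric] ennreal_plus[symmetric] del: ennreal_plus)
  then have "q * M \<le> p * (M + e / p)" if "e > 0" for e using that pq by simp
  then have *: "q * M \<le> p * M + e" if "e > 0" for e using that pq by (simp add: distrib_left)
  have "q * M \<le> p * M" by (rule field_le_epsilon) (rule *)
  then have "M = 0" using pq M by (smt (verit) mult_strict_right_mono)
  then have "B \<in> null_sets lebesgue" using B M by auto
  then show ?thesis using B(2) by (metis negligible_iff_null_sets negligible_subset)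
qed

text \<open>Adding (L + 1) x makes all difference quotients lie in [1, 2 L + 1], so the function is
  increasing. Where it is not differentiable, the lower and upper limits of the quotient are
  separated by rationals p < q, which leaves countably many sets of the preceding kind.\<close>

lemma lipschitz_real_negligible_nondifferentiable:
  fixes f :: "real \<Rightarrow> real"
  assumes L: "\<And>x y. \<bar>f x - f y\<bar> \<le> L * \<bar>x - y\<bar>"
  shows "negligible {x. \<not> f differentiable (at x)}"
proof -
  define g where "g = (\<lambda>x. f x + (L + 1) * x)"
  have L0: "L \<ge> 0" using L[of 0 1] by simp
  have g_lo: "g y - g x \<ge> y - x" and g_hi: "g y - g x \<le> (2 * L + 1) * (y - x)" if "x \<le> y" for x y
    using L[of y x] that by (auto simp: g_def algebra_simps abs_le_iff)
  have mono: "mono g" using g_lo by (fastforce simp: mono_def)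
  have cont: "continuous_on UNIV g"
  proof (rule lipschitz_on_continuous_on)
    show "(2 * L + 1)-lipschitz_on UNIV g"
    proof (rule lipschitz_onI)
      fix x y show "dist (g x) (g y) \<le> (2 * L + 1) * dist x y"
        using g_lo[of x y] g_hi[of x y] g_lo[of y x] g_hi[of y x]
        by (cases "x \<le> y") (auto simp: dist_real_def abs_if)
    qed (use L0 in auto)
  qed
  define Q where "Q = (\<lambda>x h. (g (x + h) - g x) / h)"
  have Q: "1 \<le> Q x h" "Q x h \<le> 2 * L + 1" if "h \<noteq> 0" for x h
    using that g_lo[of x "x+h"] g_hi[of x "x+h"] g_lo[of "x+h" x] g_hi[of "x+h" x]
    by (auto simp: Q_def field_simps neq_iff)
  define E where "E = (\<lambda>p q::real. {x. (\<exists>\<^sub>F h in at 0. Q x h < p) \<and> (\<exists>\<^sub>F h in at 0. q < Q x h)})"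
  have neg: "negligible (E p q \<inter> {-real n..real n})" if pq: "0 < p" "p < q" for p q n
  proof (rule negligible_two_slopes[OF mono cont pq])
    have slope: "\<exists>c r. 0 < r \<and> r < d \<and> x \<in> cball c r \<and> P ((g (c + r) - g (c - r)) / (2 * r))"
      if fr: "\<exists>\<^sub>F h in at 0. P (Q x h)" and "d > 0" for x d P
    proof -
      have "eventually (\<lambda>h::real. h \<noteq> 0 \<and> \<bar>h\<bar> < d) (at 0)"
        unfolding eventually_at using \<open>d > 0\<close> by (auto simp: dist_real_def)
      then obtain h where h: "P (Q x h)" "h \<noteq> 0" "\<bar>h\<bar> < d"
        using frequently_eventually_frequently[OF fr] frequently_ex by force
      show ?thesis
      proof (intro exI conjI)
        \<comment> \<open>The interval with ends x and x + h, written as a ball around its midpoint;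
          for either sign of h its secant slope is \<open>Q x h\<close>.\<close>
        show "P ((g (x + h/2 + \<bar>h\<bar>/2) - g (x + h/2 - \<bar>h\<bar>/2)) / (2 * (\<bar>h\<bar>/2)))"
        proof (cases "h > 0")
          case True
          then have "x + h/2 + \<bar>h\<bar>/2 = x + h" "x + h/2 - \<bar>h\<bar>/2 = x" by auto
          then show ?thesis using h True by (simp add: Q_def add.commute)
        next
          case False
          then have e: "x + h/2 + \<bar>h\<bar>/2 = x" "x + h/2 - \<bar>h\<bar>/2 = x + h" "2 * (\<bar>h\<bar>/2) = - h" by auto
          have "(g (x + h/2 + \<bar>h\<bar>/2) - g (x + h/2 - \<bar>h\<bar>/2)) / (2 * (\<bar>h\<bar>/2)) = Q x h"
            unfolding e Q_def using h(2) by (simp add: divide_simps)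
          then show ?thesis using h by simp
        qed
      qed (use h in \<open>auto simp: dist_real_def\<close>)
    qed
    fix x d :: real assume x: "x \<in> E p q \<inter> {-real n..real n}" and d: "d > 0"
    show "\<exists>c r. 0 < r \<and> r < d \<and> x \<in> cball c r \<and> g (c + r) - g (c - r) \<le> p * (2 * r)"
    proof -
      obtain c r where "0 < r" "r < d" "x \<in> cball c r" "(g (c + r) - g (c - r)) / (2 * r) < p"
        using slope[of "\<lambda>t. t < p" x d] x d unfolding E_def by auto
      then show ?thesis by (intro exI[of _ c] exI[of _ r]) (simp add: divide_less_eq)
    qed
    show "\<exists>c r. 0 < r \<and> r < d \<and> x \<in> cball c r \<and> g (c + r) - g (c - r) \<ge> q * (2 * r)"
    proof -
      obtain c r where "0 < r" "r < d" "x \<in> cball c r" "(g (c + r) - g (c - r)) / (2 * r) > q"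
        using slope[of "\<lambda>t. t > q" x d] x d unfolding E_def by auto
      then show ?thesis by (intro exI[of _ c] exI[of _ r]) (simp add: less_divide_eq)
    qed
  qed auto
  have sub: "{x. \<not> f differentiable (at x)} \<subseteq> (\<Union>(p,q,n)\<in>{(p,q,n). p \<in> \<rat> \<and> q \<in> \<rat> \<and> 0 < p \<and> p < q}. E p q \<inter> {-real n..real n})"
  proof (clarify, rule ccontr)
    fix x assume nd: "\<not> f differentiable (at x)"
      and *: "x \<notin> (\<Union>(p,q,n)\<in>{(p,q,n). p \<in> \<rat> \<and> q \<in> \<rat> \<and> 0 < p \<and> p < q}. E p q \<inter> {-real n..real n})"
    obtain n where "\<bar>x\<bar> \<le> real n" using real_arch_simple by blast
    then have noE: "x \<notin> E p q" if "p \<in> \<rat>" "q \<in> \<rat>" "0 < p" "p < q" for p q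
      using * that by (auto simp: abs_le_iff)
    define l where "l = Liminf (at 0) (\<lambda>h. ereal (Q x h))"
    define u where "u = Limsup (at 0) (\<lambda>h. ereal (Q x h))"
    have ev: "eventually (\<lambda>h::real. h \<noteq> 0) (at 0)" by (simp add: eventually_at_filter)
    have "l \<ge> 1" unfolding l_def
      by (rule Liminf_bounded) (use ev Q(1) in \<open>auto elim!: eventually_mono simp: one_ereal_def\<close>)
    have "u \<le> ereal (2 * L + 1)" unfolding u_def
      by (rule Limsup_bounded) (use ev Q(2) in \<open>auto elim!: eventually_mono\<close>)
    have "l \<le> u" unfolding l_def u_def by (rule Liminf_le_Limsup) simp
    have "l = u"
    proof (rule ccontr)
      assume "l \<noteq> u"
      then have "l < u" using \<open>l \<le> u\<close> by simp
      obtain p where p: "p \<in> \<rat>" "l < ereal p" "ereal p < u"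
        using ereal_dense3[OF \<open>l < u\<close>] by (metis Rats_of_rat)
      obtain q where q: "q \<in> \<rat>" "ereal p < ereal q" "ereal q < u"
        using ereal_dense3[OF p(3)] by (metis Rats_of_rat)
      have "1 < ereal p" using \<open>l \<ge> 1\<close> p(2) by (rule le_less_trans)
      then have "0 < p" by (simp add: one_ereal_def)
      have 1: "\<exists>\<^sub>F h in at 0. Q x h < p"
      proof (rule ccontr)
        assume "\<not> (\<exists>\<^sub>F h in at 0. Q x h < p)"
        then have "ereal p \<le> l" unfolding l_def by (intro Liminf_bounded) (simp add: not_frequently not_less)
        then show False using p by simp
      qed
      have 2: "\<exists>\<^sub>F h in at 0. q < Q x h"
      proof (rule ccontr)
        assume "\<not> (\<exists>\<^sub>F h in at 0. q < Q x h)"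
        then have "u \<le> ereal q" unfolding u_def by (intro Limsup_bounded) (simp add: not_frequently not_less)
        then show False using q by simp
      qed
      show False using noE[OF p(1) q(1) \<open>0 < p\<close>] q(2) 1 2 by (auto simp: E_def)
    qed
    then obtain D where D: "l = ereal D" "u = ereal D"
      using \<open>l \<ge> 1\<close> \<open>u \<le> ereal (2 * L + 1)\<close> by (cases l) auto
    have "((\<lambda>h. ereal (Q x h)) \<longlongrightarrow> ereal D) (at 0)"
      using D by (intro Liminf_eq_Limsup) (auto simp: l_def u_def)
    then have "((\<lambda>h. Q x h) \<longlongrightarrow> D) (at 0)" by simp
    then have "(g has_field_derivative D) (at x)" by (simp add: DERIV_def Q_def)
    then have "((\<lambda>y. g y - (L + 1) * y) has_field_derivative (D - (L + 1))) (at x)"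
      by (auto intro!: derivative_eq_intros)
    then have "f differentiable (at x)" by (simp add: g_def real_differentiable_def) blast
    then show False using nd by simp
  qed
  have "countable {(p,q,n::nat). p \<in> (\<rat>::real set) \<and> q \<in> (\<rat>::real set) \<and> 0 < p \<and> p < q}" (is "countable ?I")
  proof (rule countable_subset)
    show "?I \<subseteq> \<rat> \<times> \<rat> \<times> (UNIV::nat set)" by auto
  qed (simp add: countable_rat)
  then have "negligible (\<Union>(p,q,n)\<in>?I. E p q \<inter> {-real n..real n})"
    by (rule negligible_countable_Union[OF countable_image]) (use neg in auto)
  then show ?thesis using sub by (rule negligible_subset)
qed

subsection \<open>The kernel of the \<open>(\<alpha>, \<beta>)\<close>-harmonic extension\<close>

definition hyper_coeff :: "real \<Rightarrow> real \<Rightarrow> real \<Rightarrow> nat \<Rightarrow> real" where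
  "hyper_coeff a b c n = pochhammer a n * pochhammer b n / (pochhammer c n * fact n)"

lemma gauss_hypergeo_altdef: "gauss_hypergeo a b c x = (\<Sum>n. hyper_coeff a b c n * x ^ n)"
  by (simp add: gauss_hypergeo_def hyper_coeff_def)

lemma hyper_coeff_Suc:
  assumes "c > 0"
  shows "hyper_coeff a b c (Suc n) = hyper_coeff a b c n * ((a + n) * (b + n) / ((c + n) * (n + 1)))"
  by (simp add: hyper_coeff_def pochhammer_Suc field_simps)

lemma summable_hyper_coeff:
  assumes "c > 0" "\<bar>x\<bar> < 1"
  shows "summable (\<lambda>n. \<bar>hyper_coeff a b c n * x ^ n\<bar>)"
proof -
  define q where "q = (1 + \<bar>x\<bar>) / 2"
  have q: "\<bar>x\<bar> < q" "q < 1" using assms by (auto simp: q_def)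
  have "(\<lambda>n. \<bar>(a + real n) * (b + real n) / ((c + real n) * (real n + 1))\<bar>) \<longlonglongrightarrow> \<bar>1\<bar>"
    by (intro tendsto_rabs) real_asymp
  then have "(\<lambda>n. \<bar>(a + real n) * (b + real n) / ((c + real n) * (real n + 1))\<bar> * \<bar>x\<bar>) \<longlonglongrightarrow> \<bar>1\<bar> * \<bar>x\<bar>"
    by (rule tendsto_mult[OF _ tendsto_const])
  then have "\<forall>\<^sub>F n in sequentially. \<bar>(a + real n) * (b + real n) / ((c + real n) * (real n + 1))\<bar> * \<bar>x\<bar> < q"
    by (rule order_tendstoD) (use q in simp)
  then obtain N where N: "\<And>n. n \<ge> N \<Longrightarrow> \<bar>(a + real n) * (b + real n) / ((c + real n) * (real n + 1))\<bar> * \<bar>x\<bar> < q"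
    by (auto simp: eventually_sequentially)
  show ?thesis
  proof (rule summable_ratio_test[OF q(2)])
    fix n assume "N \<le> n"
    have "\<bar>hyper_coeff a b c (Suc n) * x ^ Suc n\<bar> =
      (\<bar>(a + real n) * (b + real n) / ((c + real n) * (real n + 1))\<bar> * \<bar>x\<bar>) * \<bar>hyper_coeff a b c n * x ^ n\<bar>"
      unfolding hyper_coeff_Suc[OF assms(1)] by (simp add: abs_mult abs_divide mult_ac add_ac)
    also have "\<dots> \<le> q * \<bar>hyper_coeff a b c n * x ^ n\<bar>"
      by (rule mult_right_mono) (use N[OF \<open>N \<le> n\<close>] in auto)
    finally show "norm \<bar>hyper_coeff a b c (Suc n) * x ^ Suc n\<bar> \<le> q * norm \<bar>hyper_coeff a b c n * x ^ n\<bar>"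
      by simp
  qed
qed

lemma hypergeometric_ode_nth:
  fixes y :: "real fps"
  shows "(fps_X * (1 - fps_X) * fps_deriv (fps_deriv y) + (fps_const c - fps_const (a + b + 1) * fps_X) * fps_deriv y
      - fps_const (a * b) * y) $ n =
    (real n + 1) * (real n + c) * y $ (Suc n) - (real n + a) * (real n + b) * y $ n"
proof -
  have "fps_X * (1 - fps_X) * fps_deriv (fps_deriv y) + (fps_const c - fps_const (a + b + 1) * fps_X) * fps_deriv y
      - fps_const (a * b) * y =
    fps_X * fps_deriv (fps_deriv y) - fps_X * (fps_X * fps_deriv (fps_deriv y)) + fps_const c * fps_deriv y
      - fps_const (a + b + 1) * (fps_X * fps_deriv y) - fps_const (a * b) * y"
    by (simp add: algebra_simps)
  then show ?thesis
    by (cases n; cases "n - 1") (auto simp: algebra_simps)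
qed

text \<open>The first factor is the formal series of (1 - X)^(c - a - b). The product satisfies the
  hypergeometric equation for a, b, c; its coefficient recursion, free of zero divisors since c > 0,
  determines the series from its constant term.\<close>

lemma fps_euler_transformation:
  fixes a b c :: real
  assumes c: "c > 0"
  shows "Abs_fps (\<lambda>n. pochhammer (a + b - c) n / fact n) * Abs_fps (hyper_coeff (c - a) (c - b) c) = Abs_fps (hyper_coeff a b c)"
proof -
  define s where "s = c - a - b"
  define G where "G = Abs_fps (\<lambda>n. pochhammer (- s) n / fact n)"
  define H where "H = Abs_fps (hyper_coeff (c - a) (c - b) c)"
  define y where "y = G * H"
  let ?X = "fps_X :: real fps"
  have dG: "(1 - ?X) * fps_deriv G = - fps_const s * G"
  proof (rule fps_ext)
    fix n
    have "((1 - ?X) * fps_deriv G) $ n = real (Suc n) * G $ (Suc n) - real n * G $ n"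
      by (cases n) (auto simp: left_diff_distrib)
    also have "real (Suc n) * G $ (Suc n) = (real n - s) * G $ n"
    proof -
      have "G $ (Suc n) = (pochhammer (- s) n / fact n) * ((real n - s) / real (Suc n))"
        by (simp add: G_def pochhammer_Suc)
      then show ?thesis by (simp add: G_def)
    qed
    finally show "((1 - ?X) * fps_deriv G) $ n = (- fps_const s * G) $ n" by (simp add: algebra_simps)
  qed
  then have "fps_deriv ((1 - ?X) * fps_deriv G) = fps_deriv (- fps_const s * G)" by simp
  then have ddG: "(1 - ?X) * fps_deriv (fps_deriv G) - fps_deriv G = - fps_const s * fps_deriv G"
    by (simp add: algebra_simps)
  have H: "?X * (1 - ?X) * fps_deriv (fps_deriv H) + (fps_const c - fps_const ((c - a) + (c - b) + 1) * ?X) * fps_deriv H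
      - fps_const ((c - a) * (c - b)) * H = 0"
  proof (rule fps_ext)
    fix n
    have "(c + real n) * (real n + 1) \<noteq> 0" using c by simp
    then have "(real n + 1) * (real n + c) * H $ (Suc n) = (real n + (c - a)) * (real n + (c - b)) * H $ n"
      using hyper_coeff_Suc[OF c, of "c - a" "c - b" n] by (simp add: H_def add.commute mult_ac)
    then show "(?X * (1 - ?X) * fps_deriv (fps_deriv H) + (fps_const c - fps_const ((c - a) + (c - b) + 1) * ?X) * fps_deriv H
      - fps_const ((c - a) * (c - b)) * H) $ n = 0 $ n"
      unfolding hypergeometric_ode_nth by simp
  qed
  define A B C where "A = fps_const a" and "B = fps_const b" and "C = fps_const c"
  define G1 G2 H1 H2 where "G1 = fps_deriv G" and "G2 = fps_deriv (fps_deriv G)" and "H1 = fps_deriv H" and "H2 = fps_deriv (fps_deriv H)"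
  have cst: "fps_const s = C - A - B" "fps_const ((c - a) + (c - b) + 1) = 2 * C - A - B + 1"
     "fps_const ((c - a) * (c - b)) = (C - A) * (C - B)" "fps_const (a + b + 1) = A + B + 1" "fps_const (a * b) = A * B"
    by (simp_all add: s_def A_def B_def C_def numeral_fps_const algebra_simps flip: fps_const_add fps_const_sub fps_const_mult)
  have g1: "(1 - ?X) * G1 = - (C - A - B) * G" and g2: "(1 - ?X) * G2 - G1 = - (C - A - B) * G1"
    and h: "?X * (1 - ?X) * H2 + (C - (2 * C - A - B + 1) * ?X) * H1 - ((C - A) * (C - B)) * H = 0"
    using dG ddG H unfolding cst G1_def G2_def H1_def H2_def C_def[symmetric] by simp_all
  have y': "fps_deriv y = G1 * H + G * H1" "fps_deriv (fps_deriv y) = G2 * H + 2 * G1 * H1 + G * H2"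
    by (simp_all add: y_def G1_def G2_def H1_def H2_def algebra_simps)
  \<comment> \<open>The derivative of G is known only after multiplication by 1 - X, so the equation
    is proved with this extra factor, which is then cancelled.\<close>
  have "(1 - ?X) * (?X * (1 - ?X) * (G2 * H + 2 * G1 * H1 + G * H2) + (C - (A + B + 1) * ?X) * (G1 * H + G * H1)
      - (A * B) * (G * H)) = 0"
    using g1 g2 h by algebra
  moreover have "1 - ?X \<noteq> 0"
  proof
    assume "1 - ?X = 0"
    then have "fps_nth (1 - ?X) 0 = fps_nth 0 0" by (simp only:)
    then show False by simp
  qed
  ultimately have ode: "?X * (1 - ?X) * fps_deriv (fps_deriv y) + (fps_const c - fps_const (a + b + 1) * ?X) * fps_deriv y
      - fps_const (a * b) * y = 0"
    unfolding y'(2) unfolding y'(1) cst C_def[symmetric] by (simp add: y_def)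
  have "y $ n = hyper_coeff a b c n" for n
  proof (induction n)
    case 0 then show ?case by (simp add: y_def G_def H_def hyper_coeff_def)
  next
    case (Suc n)
    have "(real n + 1) * (real n + c) * y $ (Suc n) - (real n + a) * (real n + b) * y $ n = 0"
      using hypergeometric_ode_nth[where y = y and c = c and a = a and b = b and n = n] ode by simp
    moreover have "(real n + 1) * (real n + c) \<noteq> 0" using c by simp
    ultimately have "y $ (Suc n) = (real n + a) * (real n + b) / ((real n + 1) * (real n + c)) * y $ n"
      by (simp add: field_simps)
    then show ?case unfolding Suc.IH hyper_coeff_Suc[OF c] by (simp add: add.commute mult.commute)
  qed
  moreover have "- s = a + b - c" by (simp add: s_def)
  ultimately show ?thesis by (simp add: fps_eq_iff y_def G_def H_def)
qed

lemma binomial_pochhammer_sums: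
  fixes x :: real
  assumes "\<bar>x\<bar> < 1"
  shows "(\<lambda>n. pochhammer a n / fact n * x ^ n) sums ((1 - x) powr (- a))"
proof -
  have "(\<lambda>n. ((- a) gchoose n) * (- x) ^ n) sums ((1 + (- x)) powr (- a))"
    by (rule gen_binomial_real) (use assms in simp)
  moreover have "((- a) gchoose n) * (- x) ^ n = pochhammer a n / fact n * x ^ n" for n
    by (simp add: gbinomial_pochhammer power_minus[of x] mult_ac flip: power_add)
  ultimately show ?thesis by simp
qed

lemma binomial_pochhammer_sums_complex:
  fixes z :: complex
  assumes "norm z < 1"
  shows "(\<lambda>n. of_real (pochhammer a n / fact n) * z ^ n) sums ((1 - z) powr (- of_real a))"
proof -
  have "(\<lambda>n. ((- of_real a) gchoose n) * (- z) ^ n) sums ((1 + (- z)) powr (- of_real a))"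
    by (rule gen_binomial_complex) (use assms in simp)
  moreover have "((- of_real a) gchoose n) * (- z) ^ n = of_real (pochhammer a n / fact n) * z ^ n" for n
    by (simp add: gbinomial_pochhammer power_minus[of z] mult_ac pochhammer_of_real flip: power_add)
  ultimately show ?thesis by simp
qed

lemma summable_binomial_pochhammer:
  fixes x :: real
  assumes "\<bar>x\<bar> < 1"
  shows "summable (\<lambda>n. \<bar>pochhammer a n / fact n * x ^ n\<bar>)"
  using summable_hyper_coeff[of 1 x a 1] assms by (simp add: hyper_coeff_def pochhammer_fact[symmetric])

text \<open>It rewrites the radial factor F(-\<alpha>, k - \<beta>; k + 1; x) as (1 - x)^(1 +
  \<alpha> + \<beta>) F(1 + \<alpha> + k, 1 + \<beta>; k + 1; x), the form that arises when two
  binomial series are multiplied.\<close>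

theorem euler_transformation:
  assumes c: "c > 0" and x: "\<bar>x\<bar> < 1"
  shows "gauss_hypergeo a b c x = (1 - x) powr (c - a - b) * gauss_hypergeo (c - a) (c - b) c x"
proof -
  let ?g = "\<lambda>n. pochhammer (a + b - c) n / fact n * x ^ n" and ?h = "\<lambda>n. hyper_coeff (c - a) (c - b) c n * x ^ n"
  have "(\<lambda>k. \<Sum>i\<le>k. ?g i * ?h (k - i)) sums ((\<Sum>k. ?g k) * (\<Sum>k. ?h k))"
    by (rule Cauchy_product_sums) (use summable_binomial_pochhammer[OF x] summable_hyper_coeff[OF c x] in auto)
  moreover have "(\<Sum>i\<le>k. ?g i * ?h (k - i)) = hyper_coeff a b c k * x ^ k" for k
  proof -
    have "(\<Sum>i\<le>k. ?g i * ?h (k - i)) = (\<Sum>i\<le>k. pochhammer (a + b - c) i / fact i * hyper_coeff (c - a) (c - b) c (k - i)) * x ^ k"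
      unfolding sum_distrib_right by (rule sum.cong) (auto simp: power_add[symmetric] mult_ac)
    also have "(\<Sum>i\<le>k. pochhammer (a + b - c) i / fact i * hyper_coeff (c - a) (c - b) c (k - i)) = hyper_coeff a b c k"
      using arg_cong[OF fps_euler_transformation[OF c, of a b], of "\<lambda>f. f $ k"] by (simp add: fps_mult_nth atLeast0AtMost)
    finally show ?thesis .
  qed
  moreover have "(\<Sum>k. ?g k) = (1 - x) powr (c - a - b)"
    using binomial_pochhammer_sums[OF x, of "a + b - c"] by (simp add: sums_iff algebra_simps)
  ultimately show ?thesis by (simp add: gauss_hypergeo_altdef sums_iff)
qed

text \<open>The point is a bound uniform in k. In the ratio of consecutive coefficients k occurs
  only in (k - b + n) / (k + 1 + n), which is at most (1 + |b| + n) / (1 + n) in modulus.\<close>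

lemma hyper_coeff_bound:
  "\<bar>hyper_coeff (- a) (real k - b) (real k + 1) n\<bar> \<le> hyper_coeff \<bar>a\<bar> (1 + \<bar>b\<bar>) 1 n"
proof (induction n)
  case 0 then show ?case by (simp add: hyper_coeff_def)
next
  case (Suc n)
  have "\<bar>(- a + n) * (real k - b + n) / ((real k + 1 + n) * (n + 1))\<bar> \<le> (\<bar>a\<bar> + n) * (1 + \<bar>b\<bar> + n) / ((1 + n) * (n + 1))"
  proof -
    have "\<bar>(real k - b + n) / (real k + 1 + n)\<bar> \<le> (1 + \<bar>b\<bar> + n) / (1 + n)"
    proof -
      have "\<bar>real k - b + n\<bar> \<le> k + \<bar>b\<bar> + n" by simp
      then have "\<bar>(real k - b + n) / (real k + 1 + n)\<bar> \<le> (k + \<bar>b\<bar> + n) / (real k + 1 + n)"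
        by (simp add: abs_divide divide_right_mono)
      also have "\<dots> \<le> (1 + \<bar>b\<bar> + n) / (1 + n)"
        by (simp add: divide_simps) (simp add: algebra_simps)
      finally show ?thesis .
    qed
    moreover have "\<bar>(- a + n) / (n + 1)\<bar> \<le> (\<bar>a\<bar> + n) / (n + 1)" by (simp add: abs_divide divide_right_mono)
    ultimately have "\<bar>(- a + n) / (n + 1)\<bar> * \<bar>(real k - b + n) / (real k + 1 + n)\<bar> \<le> (\<bar>a\<bar> + n) / (n + 1) * ((1 + \<bar>b\<bar> + n) / (1 + n))"
      by (intro mult_mono) auto
    also have "\<bar>(- a + n) / (n + 1)\<bar> * \<bar>(real k - b + n) / (real k + 1 + n)\<bar> = \<bar>(- a + n) * (real k - b + n) / ((real k + 1 + n) * (n + 1))\<bar>"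
      by (simp only: abs_mult[symmetric] times_divide_times_eq mult.commute[of "real (n + 1)"])
    also have "(\<bar>a\<bar> + n) / (n + 1) * ((1 + \<bar>b\<bar> + n) / (1 + n)) = (\<bar>a\<bar> + n) * (1 + \<bar>b\<bar> + n) / ((1 + n) * (n + 1))"
      by (simp add: times_divide_times_eq mult_ac) (simp add: algebra_simps)
    finally show ?thesis .
  qed
  then have "\<bar>hyper_coeff (- a) (real k - b) (real k + 1) n\<bar> * \<bar>(- a + n) * (real k - b + n) / ((real k + 1 + n) * (n + 1))\<bar> \<le>
     hyper_coeff \<bar>a\<bar> (1 + \<bar>b\<bar>) 1 n * ((\<bar>a\<bar> + n) * (1 + \<bar>b\<bar> + n) / ((1 + n) * (n + 1)))"
    using Suc.IH by (intro mult_mono) auto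
  then show ?case
    by (subst hyper_coeff_Suc, simp, subst hyper_coeff_Suc, simp) (simp only: abs_mult of_nat_mult of_nat_add of_nat_1)
qed

lemma gauss_hypergeo_bound:
  assumes x: "0 \<le> x" "x < 1"
  shows "\<bar>gauss_hypergeo (- a) (real k - b) (real k + 1) x\<bar> \<le> gauss_hypergeo \<bar>a\<bar> (1 + \<bar>b\<bar>) 1 x"
proof -
  have s: "summable (\<lambda>n. \<bar>hyper_coeff (- a) (real k - b) (real k + 1) n * x ^ n\<bar>)"
    "summable (\<lambda>n. hyper_coeff \<bar>a\<bar> (1 + \<bar>b\<bar>) 1 n * x ^ n)"
    using summable_hyper_coeff[of "real k + 1" x "- a" "real k - b"] summable_hyper_coeff[of 1 x "\<bar>a\<bar>" "1 + \<bar>b\<bar>"] x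
    by (auto intro: summable_rabs_cancel)
  have "\<bar>gauss_hypergeo (- a) (real k - b) (real k + 1) x\<bar> \<le> (\<Sum>n. \<bar>hyper_coeff (- a) (real k - b) (real k + 1) n * x ^ n\<bar>)"
    unfolding gauss_hypergeo_altdef by (rule summable_rabs[OF s(1)])
  also have "\<dots> \<le> gauss_hypergeo \<bar>a\<bar> (1 + \<bar>b\<bar>) 1 x"
    unfolding gauss_hypergeo_altdef
    by (rule suminf_le[OF _ s]) (use x hyper_coeff_bound in \<open>auto simp: abs_mult intro!: mult_right_mono\<close>)
  finally show ?thesis .
qed

text \<open>The weights \<open>b n\<close> have a divergent generating function \<open>(1 - x) powr (- s)\<close>, so only the tail ratio matters.\<close>

lemma abelian_ratio_limit:
  fixes a :: "nat \<Rightarrow> real"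
  assumes s: "s > 0"
    and ratio: "(\<lambda>n. a n / (pochhammer s n / fact n)) \<longlonglongrightarrow> L"
    and sum: "\<And>x. 0 \<le> x \<Longrightarrow> x < 1 \<Longrightarrow> summable (\<lambda>n. \<bar>a n * x ^ n\<bar>)"
  shows "((\<lambda>x. (1 - x) powr s * (\<Sum>n. a n * x ^ n)) \<longlongrightarrow> L) (at_left 1)"
proof -
  define b where "b = (\<lambda>n. pochhammer s n / fact n)"
  have b: "b n > 0" for n using s by (simp add: b_def pochhammer_pos)
  show ?thesis
  proof (rule tendstoI)
    fix e :: real assume e: "e > 0"
    have "\<forall>\<^sub>F n in sequentially. dist (a n / b n) L < e / 2"
      using tendstoD[OF ratio, of "e/2"] e by (simp add: b_def)
    then obtain N where N: "\<And>n. n \<ge> N \<Longrightarrow> dist (a n / b n) L < e / 2" by (auto simp: eventually_sequentially)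
    define C where "C = (\<Sum>n<N. \<bar>a n - L * b n\<bar>)"
    have C: "C \<ge> 0" by (simp add: C_def sum_nonneg)
    have bound: "\<bar>(1 - x) powr s * (\<Sum>n. a n * x ^ n) - L\<bar> \<le> C * (1 - x) powr s + e / 2" if x: "0 < x" "x < 1" for x
    proof -
      have sb: "(\<lambda>n. b n * x ^ n) sums ((1 - x) powr (- s))"
        using binomial_pochhammer_sums[of x s] x by (simp add: b_def)
      have sa: "summable (\<lambda>n. a n * x ^ n)" using sum[of x] x by (auto intro: summable_rabs_cancel)
      have "(\<Sum>n. a n * x ^ n) - L * (1 - x) powr (- s) = (\<Sum>n. (a n - L * b n) * x ^ n)"
        using suminf_diff[OF sa summable_mult[OF sums_summable[OF sb], of L]] sb
        by (simp add: sums_iff suminf_mult left_diff_distrib mult.assoc)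
      also have "\<bar>\<dots>\<bar> \<le> C + e / 2 * (1 - x) powr (- s)"
      proof -
        \<comment> \<open>The first N terms are bounded crudely with x^n \<le> 1; in the tail |a n -
          L b n| \<le> e/2 b n, which sums to e/2 (1 - x)^(-s).\<close>
        define d where "d = (\<lambda>n. (if n < N then \<bar>a n - L * b n\<bar> else 0) + e / 2 * (b n * x ^ n))"
        have dle: "\<bar>(a n - L * b n) * x ^ n\<bar> \<le> d n" for n
        proof (cases "n < N")
          case True
          have "\<bar>(a n - L * b n) * x ^ n\<bar> \<le> \<bar>a n - L * b n\<bar> * 1"
            unfolding abs_mult by (intro mult_left_mono) (use x in \<open>auto simp: power_le_one\<close>)
          moreover have "0 \<le> e / 2 * (b n * x ^ n)" using e b[of n] x by (simp add: less_imp_le)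
          ultimately show ?thesis using True by (simp add: d_def)
        next
          case False
          then have "\<bar>a n / b n - L\<bar> < e / 2" using N[of n] by (simp add: dist_real_def)
          then have "\<bar>a n / b n - L\<bar> * b n \<le> e / 2 * b n" using b[of n] by (intro mult_right_mono) auto
          also have "\<bar>a n / b n - L\<bar> * b n = \<bar>(a n / b n - L) * b n\<bar>" using b[of n] by (simp add: abs_mult)
          also have "(a n / b n - L) * b n = a n - L * b n" using b[of n] by (simp add: field_simps)
          finally have "\<bar>a n - L * b n\<bar> * x ^ n \<le> e / 2 * b n * x ^ n" using x by (intro mult_right_mono) auto
          then show ?thesis using False x by (simp add: d_def abs_mult)
        qed
        have "d sums (C + e / 2 * (1 - x) powr (- s))"
          unfolding d_def C_def
          by (intro sums_add sums_mult sb) (use sums_If_finite_set[of "{..<N}" "\<lambda>n. \<bar>a n - L * b n\<bar>"] in simp)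
        then have "summable d" "suminf d = C + e / 2 * (1 - x) powr (- s)" by (auto simp: sums_iff)
        moreover have "summable (\<lambda>n. \<bar>(a n - L * b n) * x ^ n\<bar>)"
          by (rule summable_comparison_test'[OF \<open>summable d\<close>, of 0]) (use dle in auto)
        moreover from this have "\<bar>\<Sum>n. (a n - L * b n) * x ^ n\<bar> \<le> (\<Sum>n. \<bar>(a n - L * b n) * x ^ n\<bar>)"
          by (rule summable_rabs)
        moreover have "(\<Sum>n. \<bar>(a n - L * b n) * x ^ n\<bar>) \<le> suminf d"
          by (rule suminf_le[OF dle]) fact+
        ultimately show ?thesis by linarith
      qed
      finally have "\<bar>(\<Sum>n. a n * x ^ n) - L * (1 - x) powr (- s)\<bar> * (1 - x) powr s \<le> (C + e / 2 * (1 - x) powr (- s)) * (1 - x) powr s"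
        by (rule mult_right_mono) simp
      moreover have p: "(1 - x) powr (- s) * (1 - x) powr s = 1" using x by (simp flip: powr_add)
      moreover have "\<bar>(\<Sum>n. a n * x ^ n) - L * (1 - x) powr (- s)\<bar> * (1 - x) powr s =
        \<bar>((\<Sum>n. a n * x ^ n) - L * (1 - x) powr (- s)) * (1 - x) powr s\<bar>" by (simp add: abs_mult)
      moreover have "((\<Sum>n. a n * x ^ n) - L * (1 - x) powr (- s)) * (1 - x) powr s = (1 - x) powr s * (\<Sum>n. a n * x ^ n) - L"
        using p by algebra
      moreover have "(C + e / 2 * (1 - x) powr (- s)) * (1 - x) powr s = C * (1 - x) powr s + e / 2"
        using p by (simp add: distrib_right mult.assoc)
      ultimately show ?thesis by linarith
    qed
    have "((\<lambda>x::real. C * (1 - x) powr s) \<longlongrightarrow> C * 0) (at_left 1)"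
      using s by (intro tendsto_mult tendsto_const) real_asymp
    then have "\<forall>\<^sub>F x in at_left 1. C * (1 - x) powr s < e / 2" by (rule order_tendstoD) (use e in simp)
    moreover have "\<forall>\<^sub>F x in at_left (1::real). 0 < x \<and> x < 1"
      using eventually_at_left_real[of 0 "1::real"] by (auto elim: eventually_mono)
    ultimately show "\<forall>\<^sub>F x in at_left 1. dist ((1 - x) powr s * (\<Sum>n. a n * x ^ n)) L < e"
    proof eventually_elim
      case (elim x)
      then show ?case using bound[of x] by (simp add: dist_real_def)
    qed
  qed
qed

text \<open>In the sequences approximating 1 / Gamma the powers of n cancel because a + b = c + d.
  With reciprocals, a and b may be poles of Gamma.\<close>

lemma pochhammer_ratio_limit:
  fixes a b c d :: real
  assumes "a + b = c + d" "c > 0" "d > 0"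
  shows "(\<lambda>n. (pochhammer a n * pochhammer b n) / (pochhammer c n * pochhammer d n)) \<longlonglongrightarrow> rGamma a * rGamma b / (rGamma c * rGamma d)"
proof -
  have "(\<lambda>n. (rGamma_series a n * rGamma_series b n) / (rGamma_series c n * rGamma_series d n)) \<longlonglongrightarrow> rGamma a * rGamma b / (rGamma c * rGamma d)"
    by (intro tendsto_intros) (use assms in \<open>auto simp: rGamma_eq_zero_iff elim!: nonpos_Ints_cases\<close>)
  also have "(\<lambda>n. (rGamma_series a n * rGamma_series b n) / (rGamma_series c n * rGamma_series d n)) =
     (\<lambda>n. (pochhammer a (Suc n) * pochhammer b (Suc n)) / (pochhammer c (Suc n) * pochhammer d (Suc n)))"
  proof
    fix n
    have "exp (a * ln (real n)) * exp (b * ln (real n)) = exp (c * ln (real n)) * exp (d * ln (real n))"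
      using assms(1) by (simp flip: exp_add distrib_right)
    moreover have "rGamma_series a n * rGamma_series b n / (rGamma_series c n * rGamma_series d n) =
      (pochhammer a (Suc n) * pochhammer b (Suc n)) / (pochhammer c (Suc n) * pochhammer d (Suc n)) *
      ((exp (c * ln (real n)) * exp (d * ln (real n))) / (exp (a * ln (real n)) * exp (b * ln (real n))))"
      by (simp add: rGamma_series_def field_simps)
    ultimately show "(rGamma_series a n * rGamma_series b n) / (rGamma_series c n * rGamma_series d n) =
      (pochhammer a (Suc n) * pochhammer b (Suc n)) / (pochhammer c (Suc n) * pochhammer d (Suc n))" by simp
  qed
  finally show ?thesis by (rule filterlim_sequentially_Suc[THEN iffD1])
qed

definition kap :: "real \<Rightarrow> real \<Rightarrow> real \<Rightarrow> int \<Rightarrow> real" where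
  "kap \<alpha> \<beta> r k =
    (if 0 \<le> k then pochhammer (1 + \<alpha>) (nat k) / fact (nat k) * gauss_hypergeo (- \<alpha>) (real (nat k) - \<beta>) (real (nat k) + 1) (r\<^sup>2) * r ^ nat k
     else pochhammer (1 + \<beta>) (nat (- k)) / fact (nat (- k)) * gauss_hypergeo (- \<beta>) (real (nat (- k)) - \<alpha>) (real (nat (- k)) + 1) (r\<^sup>2) * r ^ nat (- k))"

text \<open>For \<open>\<alpha>\<close>, \<open>\<beta>\<close> fixed, \<open>kap \<alpha> \<beta> r k\<close> is the \<open>k\<close>-th Fourier coefficient of the kernel below, which is the
  Poisson kernel for \<open>\<alpha> = \<beta> = 0\<close>.\<close>

definition ab_kernel :: "real \<Rightarrow> real \<Rightarrow> real \<Rightarrow> real \<Rightarrow> complex" where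
  "ab_kernel \<alpha> \<beta> r s = of_real ((1 - r\<^sup>2) powr (1 + \<alpha> + \<beta>)) *
     (1 - of_real r * cis s) powr (- of_real (1 + \<alpha>)) * (1 - of_real r * cis (- s)) powr (- of_real (1 + \<beta>))"

definition ab_limit :: "real \<Rightarrow> real \<Rightarrow> real" where
  "ab_limit \<alpha> \<beta> = Gamma (1 + \<alpha> + \<beta>) / (Gamma (1 + \<alpha>) * Gamma (1 + \<beta>))"

lemma kap_neg: "k < 0 \<Longrightarrow> kap \<alpha> \<beta> r k = kap \<beta> \<alpha> r (- k)"
  by (simp add: kap_def)

lemma kap_altdef:
  assumes "0 \<le> r" "r < 1" "0 \<le> k"
  defines "n \<equiv> nat k"
  shows "kap \<alpha> \<beta> r k = pochhammer (1 + \<alpha>) n / fact n * ((1 - r\<^sup>2) powr (1 + \<alpha> + \<beta>) *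
    gauss_hypergeo (1 + \<alpha> + real n) (1 + \<beta>) (real n + 1) (r\<^sup>2)) * r ^ n"
proof -
  have "r\<^sup>2 < 1" using assms by (simp add: power_less_one_iff abs_square_less_1)
  then have "gauss_hypergeo (- \<alpha>) (real n - \<beta>) (real n + 1) (r\<^sup>2) = (1 - r\<^sup>2) powr (1 + \<alpha> + \<beta>) *
    gauss_hypergeo (1 + \<alpha> + real n) (1 + \<beta>) (real n + 1) (r\<^sup>2)"
    using euler_transformation[of "real n + 1" "r\<^sup>2" "- \<alpha>" "real n - \<beta>"] by (simp add: algebra_simps)
  then show ?thesis using assms by (simp add: kap_def)
qed

text \<open>After Euler's transformation the coefficients are compared with those of (1 - x)^(-(1 +
  \<alpha> + \<beta>)). The limit of the ratio depends on k, and the factor (1 + \<alpha>)_k / k! in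
  \<open>kap\<close> is what cancels this dependence.\<close>

lemma kap_tendsto:
  assumes s: "1 + \<alpha> + \<beta> > 0"
  shows "((\<lambda>r. kap \<alpha> \<beta> r k) \<longlongrightarrow> ab_limit \<alpha> \<beta>) (at_left 1)"
proof -
  have main: "((\<lambda>r. kap \<alpha> \<beta> r k) \<longlongrightarrow> ab_limit \<alpha> \<beta>) (at_left 1)"
    if k: "0 \<le> k" and s: "1 + \<alpha> + \<beta> > 0" for \<alpha> \<beta> k
  proof -
    define n where "n = nat k"
    let ?L = "rGamma (1 + \<alpha> + real n) * rGamma (1 + \<beta>) / (rGamma (real n + 1) * rGamma (1 + \<alpha> + \<beta>))"
    have "(\<lambda>m. (pochhammer (1 + \<alpha> + real n) m * pochhammer (1 + \<beta>) m) / (pochhammer (real n + 1) m * pochhammer (1 + \<alpha> + \<beta>) m)) \<longlonglongrightarrow> ?L"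
      by (rule pochhammer_ratio_limit) (use s in auto)
    then have "(\<lambda>m. hyper_coeff (1 + \<alpha> + real n) (1 + \<beta>) (real n + 1) m / (pochhammer (1 + \<alpha> + \<beta>) m / fact m)) \<longlonglongrightarrow> ?L"
      by (simp add: hyper_coeff_def field_simps)
    then have "((\<lambda>x. (1 - x) powr (1 + \<alpha> + \<beta>) * gauss_hypergeo (1 + \<alpha> + real n) (1 + \<beta>) (real n + 1) x) \<longlongrightarrow> ?L) (at_left 1)"
      unfolding gauss_hypergeo_altdef using summable_hyper_coeff[of "real n + 1"] s
      by (intro abelian_ratio_limit) auto
    moreover have "filterlim (\<lambda>r::real. r\<^sup>2) (at_left 1) (at_left 1)" by real_asymp
    ultimately have "((\<lambda>r. (1 - r\<^sup>2) powr (1 + \<alpha> + \<beta>) * gauss_hypergeo (1 + \<alpha> + real n) (1 + \<beta>) (real n + 1) (r\<^sup>2)) \<longlongrightarrow> ?L) (at_left 1)"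
      by (rule filterlim_compose)
    moreover have "((\<lambda>r::real. r ^ n) \<longlongrightarrow> 1 ^ n) (at_left 1)"
      by (intro tendsto_intros)
    ultimately have T: "((\<lambda>r. pochhammer (1 + \<alpha>) n / fact n * ((1 - r\<^sup>2) powr (1 + \<alpha> + \<beta>) * gauss_hypergeo (1 + \<alpha> + real n) (1 + \<beta>) (real n + 1) (r\<^sup>2)) * r ^ n) \<longlongrightarrow>
      pochhammer (1 + \<alpha>) n / fact n * ?L * 1 ^ n) (at_left 1)"
      by (intro tendsto_intros)
    have E: "pochhammer (1 + \<alpha>) n / fact n * ?L * 1 ^ n = ab_limit \<alpha> \<beta>"
    proof -
      have "rGamma (1 + \<alpha>) = pochhammer (1 + \<alpha>) n * rGamma (1 + \<alpha> + real n)" by (rule pochhammer_rGamma)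
      moreover have "rGamma (real n + 1) = 1 / fact n" using rGamma_inverse_Gamma[of "real n + 1"] Gamma_fact[of n, where 'a = real]
        by (simp add: add.commute field_simps)
      moreover have "ab_limit \<alpha> \<beta> = rGamma (1 + \<alpha>) * rGamma (1 + \<beta>) / rGamma (1 + \<alpha> + \<beta>)"
        by (simp add: ab_limit_def Gamma_def field_simps)
      ultimately show ?thesis by simp
    qed
    have EV: "\<forall>\<^sub>F r in at_left 1. pochhammer (1 + \<alpha>) n / fact n * ((1 - r\<^sup>2) powr (1 + \<alpha> + \<beta>) * gauss_hypergeo (1 + \<alpha> + real n) (1 + \<beta>) (real n + 1) (r\<^sup>2)) * r ^ n = kap \<alpha> \<beta> r k"
    proof -
      have "\<forall>\<^sub>F r in at_left (1::real). r \<in> {0<..<1}" by (rule eventually_at_left_real) simp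
      then show ?thesis
      proof eventually_elim
        case (elim r) then show ?case using k by (simp add: kap_altdef n_def)
      qed
    qed
    show ?thesis using Lim_transform_eventually[OF T EV] unfolding E .
  qed
  show ?thesis
  proof (cases "0 \<le> k")
    case True then show ?thesis using main s by blast
  next
    case False
    then have "((\<lambda>r. kap \<beta> \<alpha> r (- k)) \<longlongrightarrow> ab_limit \<beta> \<alpha>) (at_left 1)" using s by (intro main) auto
    then show ?thesis using False by (simp add: kap_neg ab_limit_def add_ac mult.commute)
  qed
qed

section \<open>The kernel and its Fourier coefficients\<close>

lemma one_minus_cis_nonneg:
  assumes "norm z < 1" shows "1 - z \<notin> \<real>\<^sub>\<le>\<^sub>0" "Re (1 - z) > 0"
proof -
  show "Re (1 - z) > 0" using assms complex_Re_le_cmod[of z] by simp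
  then show "1 - z \<notin> \<real>\<^sub>\<le>\<^sub>0" by (auto simp: complex_nonpos_Reals_iff)
qed

lemma continuous_on_binomial_kernel:
  assumes "0 \<le> r" "r < 1"
  shows "continuous_on S (\<lambda>s. (1 - of_real r * cis (e * s)) powr a)"
proof -
  have p: "r * cos (e * s) < 1" for s
    using one_minus_cis_nonneg(2)[of "of_real r * cis (e * s)"] assms by (simp add: norm_mult)
  have "of_real r * cis (e * s) \<noteq> 1" for s
  proof
    assume "of_real r * cis (e * s) = 1"
    then have "Re (of_real r * cis (e * s)) = Re 1" by (rule arg_cong)
    then show False using p[of s] by simp
  qed
  then show ?thesis
    by (intro continuous_on_powr_complex continuous_intros) (auto intro: less_imp_le p)
qed

lemma continuous_on_ab_kernel:
  assumes "0 \<le> r" "r < 1"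
  shows "continuous_on S (ab_kernel \<alpha> \<beta> r)"
proof -
  have "continuous_on S (\<lambda>s. (1 - of_real r * cis s) powr a)" "continuous_on S (\<lambda>s. (1 - of_real r * cis (- s)) powr a)" for a
    using continuous_on_binomial_kernel[OF assms, of S 1 a] continuous_on_binomial_kernel[OF assms, of S "-1" a] by simp_all
  then show ?thesis unfolding ab_kernel_def[abs_def] by (intro continuous_on_mult continuous_on_const)
qed

text \<open>Expand the second factor of the kernel and read off the Fourier coefficients of the first.\<close>

lemma ab_kernel_coeff:
  assumes r: "0 \<le> r" "r < 1"
  shows "integral {-pi..pi} (\<lambda>s. ab_kernel \<alpha> \<beta> r s * cis (- (of_int k * s))) = 2 * of_real pi * of_real (kap \<alpha> \<beta> r k)"
proof -
  have main: "integral {-pi..pi} (\<lambda>s. ab_kernel \<alpha> \<beta> r s * cis (- (of_int k * s))) = 2 * of_real pi * of_real (kap \<alpha> \<beta> r k)"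
    if k: "0 \<le> k" for \<alpha> \<beta> k
  proof -
    define A where "A = (\<lambda>s. (1 - of_real r * cis s) powr (- of_real (1 + \<alpha>)))"
    \<comment> \<open>Coefficients of the two binomial factors: \<open>a\<close> lives on the
      nonnegative frequencies, \<open>b\<close> on the nonpositive ones.\<close>
    define a where "a = (\<lambda>n::int. if 0 \<le> n then of_real (pochhammer (1 + \<alpha>) (nat n) / fact (nat n) * r ^ nat n) else (0::complex))"
    define b where "b = (\<lambda>n::int. if n \<le> 0 then of_real (pochhammer (1 + \<beta>) (nat (- n)) / fact (nat (- n)) * r ^ nat (- n)) else (0::complex))"
    have cA: "continuous_on S A" for S
      unfolding A_def using continuous_on_binomial_kernel[OF r, of S 1] by (simp only: mult_1_left)
    have fn: "summable (fnorm a)" "summable (fnorm b)"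
    proof -
      have *: "summable (\<lambda>n. 2 * \<bar>pochhammer (1 + c) n / fact n * r ^ n\<bar>)" for c
        using summable_binomial_pochhammer[of r] r by (intro summable_mult) auto
      have "fnorm a n \<le> 2 * \<bar>pochhammer (1 + \<alpha>) n / fact n * r ^ n\<bar>" for n
      proof -
        have "norm (a (int n)) = \<bar>pochhammer (1 + \<alpha>) n / fact n * r ^ n\<bar>"
          by (simp only: a_def nat_int of_nat_0_le_iff if_True norm_of_real)
        moreover have "norm (a (- int n)) \<le> \<bar>pochhammer (1 + \<alpha>) n / fact n * r ^ n\<bar>"
          by (cases "n = 0") (auto simp: a_def)
        ultimately show ?thesis unfolding fnorm_def by linarith
      qed
      moreover have "fnorm b n \<le> 2 * \<bar>pochhammer (1 + \<beta>) n / fact n * r ^ n\<bar>" for n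
      proof -
        have "norm (b (- int n)) = \<bar>pochhammer (1 + \<beta>) n / fact n * r ^ n\<bar>"
          by (simp only: b_def minus_minus nat_int neg_le_0_iff_le of_nat_0_le_iff if_True norm_of_real)
        moreover have "norm (b (int n)) \<le> \<bar>pochhammer (1 + \<beta>) n / fact n * r ^ n\<bar>"
          by (cases "n = 0") (auto simp: b_def)
        ultimately show ?thesis unfolding fnorm_def by linarith
      qed
      ultimately have "fnorm a n \<le> 2 * \<bar>pochhammer (1 + \<alpha>) n / fact n * r ^ n\<bar>" "fnorm b n \<le> 2 * \<bar>pochhammer (1 + \<beta>) n / fact n * r ^ n\<bar>" for n by auto
      then have le: "norm (fnorm a n) \<le> 2 * \<bar>pochhammer (1 + \<alpha>) n / fact n * r ^ n\<bar>" "norm (fnorm b n) \<le> 2 * \<bar>pochhammer (1 + \<beta>) n / fact n * r ^ n\<bar>" for n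
        by (simp_all only: real_norm_def abs_of_nonneg[OF fnorm_nonneg])
      show "summable (fnorm a)" by (rule summable_comparison_test'[OF *[of \<alpha>]]) (rule le)
      show "summable (fnorm b)" by (rule summable_comparison_test'[OF *[of \<beta>]]) (rule le)
    qed
    have fa: "fsum a s = A s" for s
    proof -
      have "(\<lambda>n. of_real (pochhammer (1 + \<alpha>) n / fact n) * (of_real r * cis s) ^ n) sums A s"
        unfolding A_def by (rule binomial_pochhammer_sums_complex) (use r in \<open>simp add: norm_mult\<close>)
      moreover have "of_real (pochhammer (1 + \<alpha>) n / fact n) * (of_real r * cis s) ^ n = fterm a s n" for n
        by (auto simp: fterm_def a_def power_mult_distrib Complex.DeMoivre)
      ultimately show ?thesis by (simp add: fsum_def sums_iff)
    qed
    have fb: "fsum b s = (1 - of_real r * cis (- s)) powr (- of_real (1 + \<beta>))" for s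
    proof -
      have "(\<lambda>n. of_real (pochhammer (1 + \<beta>) n / fact n) * (of_real r * cis (- s)) ^ n) sums ((1 - of_real r * cis (- s)) powr (- of_real (1 + \<beta>)))"
        by (rule binomial_pochhammer_sums_complex) (use r in \<open>simp add: norm_mult\<close>)
      moreover have "of_real (pochhammer (1 + \<beta>) n / fact n) * (of_real r * cis (- s)) ^ n = fterm b s n" for n
        by (auto simp: fterm_def b_def power_mult_distrib Complex.DeMoivre)
      ultimately show ?thesis by (simp add: fsum_def sums_iff)
    qed
    define g where "g = (\<lambda>s. A s * cis (- (of_int k * s)))"
    have cg: "continuous_on S g" for S unfolding g_def by (intro continuous_intros cA)
    have gi: "integral {-pi..pi} (\<lambda>s. g s * cis (of_int j * s)) = 2 * of_real pi * a (k - j)" for j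
      using fsum_coeff[OF fn(1), of "k - j"] by (simp add: g_def fa cis_mult mult.assoc algebra_simps)
    define n where "n = nat k"
    have kn: "k = int n" using k by (simp add: n_def)
    have S1: "fterm (\<lambda>j. b j * (2 * of_real pi * a (k - j))) 0 sums integral {-pi..pi} (\<lambda>s. g s * fsum b s)"
      using fsum_integral_sums[OF fn(2) cg, of "-pi" pi] by (simp add: gi)
    \<comment> \<open>Of each pair m, -m only -m survives. Splitting (1 + \<alpha>)_(n+m) and (n+m)!
      at n leaves the m-th hypergeometric coefficient.\<close>
    have FT: "fterm (\<lambda>j. b j * (2 * of_real pi * a (k - j))) 0 m =
      of_real (2 * pi * (pochhammer (1 + \<alpha>) n / fact n * r ^ n) * (hyper_coeff (1 + \<alpha> + real n) (1 + \<beta>) (real n + 1) m * (r\<^sup>2) ^ m))" for m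
    proof -
      have "fterm (\<lambda>j. b j * (2 * of_real pi * a (k - j))) 0 m = b (- int m) * (2 * of_real pi * a (k + int m))"
        by (auto simp: fterm_def b_def)
      also have "a (k + int m) = of_real (pochhammer (1 + \<alpha>) (n + m) / fact (n + m) * r ^ (n + m))"
        by (simp add: a_def kn nat_add_distrib flip: of_nat_add)
      also have "b (- int m) = of_real (pochhammer (1 + \<beta>) m / fact m * r ^ m)"
        by (simp add: b_def)
      also have "of_real (pochhammer (1 + \<beta>) m / fact m * r ^ m) * (2 * of_real pi * of_real (pochhammer (1 + \<alpha>) (n + m) / fact (n + m) * r ^ (n + m))) =
         complex_of_real (2 * pi * (pochhammer (1 + \<alpha>) n / fact n * r ^ n) * (hyper_coeff (1 + \<alpha> + real n) (1 + \<beta>) (real n + 1) m * (r\<^sup>2) ^ m))"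
      proof -
        have p: "pochhammer (1 + \<alpha>) (n + m) = pochhammer (1 + \<alpha>) n * pochhammer (1 + \<alpha> + real n) m"
          by (rule pochhammer_product')
        have f: "fact (n + m) = fact n * pochhammer (real n + 1) m"
          using pochhammer_product'[of "1::real" n m] by (simp add: pochhammer_fact[symmetric] add.commute)
        have pw: "r ^ (n + m) * r ^ m = r ^ n * (r\<^sup>2) ^ m" by (simp add: power_add power_mult[symmetric] power_mult_distrib power2_eq_square)
        have "pochhammer (1 + \<beta>) m / fact m * r ^ m * (2 * pi * (pochhammer (1 + \<alpha>) (n + m) / fact (n + m) * r ^ (n + m))) =
          2 * pi * (pochhammer (1 + \<beta>) m / fact m * (pochhammer (1 + \<alpha>) (n + m) / fact (n + m))) * (r ^ (n + m) * r ^ m)" by (simp add: mult_ac)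
        also have "\<dots> = 2 * pi * (pochhammer (1 + \<alpha>) n / fact n * r ^ n) * (hyper_coeff (1 + \<alpha> + real n) (1 + \<beta>) (real n + 1) m * (r\<^sup>2) ^ m)"
          unfolding p f pw hyper_coeff_def by (simp add: mult_ac)
        finally show ?thesis by (metis of_real_mult of_real_numeral)
      qed
      finally show ?thesis .
    qed
    have S2: "(\<lambda>m. complex_of_real (2 * pi * (pochhammer (1 + \<alpha>) n / fact n * r ^ n) * (hyper_coeff (1 + \<alpha> + real n) (1 + \<beta>) (real n + 1) m * (r\<^sup>2) ^ m))) sums
       of_real (2 * pi * (pochhammer (1 + \<alpha>) n / fact n * r ^ n) * gauss_hypergeo (1 + \<alpha> + real n) (1 + \<beta>) (real n + 1) (r\<^sup>2))"
    proof (intro sums_of_real sums_mult)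
      have "r\<^sup>2 < 1" using r by (simp add: power_less_one_iff abs_square_less_1)
      then show "(\<lambda>m. hyper_coeff (1 + \<alpha> + real n) (1 + \<beta>) (real n + 1) m * (r\<^sup>2) ^ m) sums gauss_hypergeo (1 + \<alpha> + real n) (1 + \<beta>) (real n + 1) (r\<^sup>2)"
        unfolding gauss_hypergeo_altdef using summable_hyper_coeff[of "real n + 1" "r\<^sup>2"]
        by (intro summable_sums) (auto intro: summable_rabs_cancel)
    qed
    have I: "integral {-pi..pi} (\<lambda>s. g s * fsum b s) =
      of_real (2 * pi * (pochhammer (1 + \<alpha>) n / fact n * r ^ n) * gauss_hypergeo (1 + \<alpha> + real n) (1 + \<beta>) (real n + 1) (r\<^sup>2))"
      by (rule sums_unique2[OF sums_cong[OF FT, THEN iffD1, OF S1] S2])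
    have "integral {-pi..pi} (\<lambda>s. ab_kernel \<alpha> \<beta> r s * cis (- (of_int k * s))) =
       integral {-pi..pi} (\<lambda>s. of_real ((1 - r\<^sup>2) powr (1 + \<alpha> + \<beta>)) * (g s * fsum b s))"
      by (simp add: ab_kernel_def g_def A_def fb mult_ac)
    also have "\<dots> = of_real ((1 - r\<^sup>2) powr (1 + \<alpha> + \<beta>)) * integral {-pi..pi} (\<lambda>s. g s * fsum b s)" by simp
    also have "\<dots> = of_real (2 * pi * kap \<alpha> \<beta> r k)"
      unfolding I kap_altdef[OF r k] n_def[symmetric] of_real_mult[symmetric] by (simp only: mult_ac)
    finally show ?thesis by simp
  qed
  show ?thesis
  proof (cases "0 \<le> k")
    case True then show ?thesis by (rule main)
  next
    case False
    \<comment> \<open>For negative k the reflection of s exchanges \<alpha> and \<beta>.\<close>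
    have "integral {-pi..pi} (\<lambda>s. ab_kernel \<alpha> \<beta> r s * cis (- (of_int k * s))) = integral {-pi..pi} (\<lambda>s. ab_kernel \<alpha> \<beta> r (- s) * cis (- (of_int k * (- s))))"
      using Henstock_Kurzweil_Integration.integral_reflect_real[of pi "- pi" "\<lambda>s. ab_kernel \<alpha> \<beta> r s * cis (- (of_int k * s))"] by simp
    also have "\<dots> = integral {-pi..pi} (\<lambda>s. ab_kernel \<beta> \<alpha> r s * cis (- (of_int (- k) * s)))"
      by (simp add: ab_kernel_def mult_ac add_ac)
    also have "\<dots> = 2 * of_real pi * of_real (kap \<beta> \<alpha> r (- k))" using False by (intro main) simp
    finally show ?thesis using False by (simp add: kap_neg)
  qed
qed

lemma kap_bound:
  assumes "0 \<le> r" "r < 1"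
  shows "\<exists>M\<ge>0. \<forall>n. \<bar>kap \<alpha> \<beta> r (int n)\<bar> \<le> M * \<bar>pochhammer (1 + \<alpha>) n / fact n * r ^ n\<bar> \<and>
    \<bar>gauss_hypergeo (- \<alpha>) (real n - \<beta>) (real n + 1) (r\<^sup>2)\<bar> \<le> M"
proof (intro exI conjI allI)
  let ?M = "gauss_hypergeo \<bar>\<alpha>\<bar> (1 + \<bar>\<beta>\<bar>) 1 (r\<^sup>2)"
  have r2: "0 \<le> r\<^sup>2" "r\<^sup>2 < 1" using assms by (auto simp: power_less_one_iff abs_square_less_1)
  show b: "\<bar>gauss_hypergeo (- \<alpha>) (real n - \<beta>) (real n + 1) (r\<^sup>2)\<bar> \<le> ?M" for n
    by (rule gauss_hypergeo_bound[OF r2])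
  show "0 \<le> ?M" using b[of 0] abs_ge_zero order_trans by blast
  show "\<bar>kap \<alpha> \<beta> r (int n)\<bar> \<le> ?M * \<bar>pochhammer (1 + \<alpha>) n / fact n * r ^ n\<bar>" for n
  proof -
    have "\<bar>kap \<alpha> \<beta> r (int n)\<bar> = \<bar>gauss_hypergeo (- \<alpha>) (real n - \<beta>) (real n + 1) (r\<^sup>2)\<bar> * \<bar>pochhammer (1 + \<alpha>) n / fact n * r ^ n\<bar>"
      by (simp add: kap_def abs_mult abs_divide mult_ac)
    also have "\<dots> \<le> ?M * \<bar>pochhammer (1 + \<alpha>) n / fact n * r ^ n\<bar>" by (intro mult_right_mono b) simp
    finally show ?thesis .
  qed
qed

lemma summable_kap:
  assumes r: "0 \<le> r" "r < 1"
  shows "summable (fnorm (\<lambda>k. of_real (kap \<alpha> \<beta> r k)))"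
proof -
  obtain M1 where M1: "\<And>n. \<bar>kap \<alpha> \<beta> r (int n)\<bar> \<le> M1 * \<bar>pochhammer (1 + \<alpha>) n / fact n * r ^ n\<bar>" using kap_bound[OF r] by blast
  obtain M2 where M2: "\<And>n. \<bar>kap \<beta> \<alpha> r (int n)\<bar> \<le> M2 * \<bar>pochhammer (1 + \<beta>) n / fact n * r ^ n\<bar>" using kap_bound[OF r] by blast
  have "summable (\<lambda>n. \<bar>kap \<alpha> \<beta> r (int n)\<bar>)"
    by (rule summable_comparison_test'[OF summable_mult[OF summable_binomial_pochhammer], where N = 0]) (use r M1 in auto)
  moreover have "summable (\<lambda>n. \<bar>kap \<beta> \<alpha> r (int n)\<bar>)"
    by (rule summable_comparison_test'[OF summable_mult[OF summable_binomial_pochhammer], where N = 0]) (use r M2 in auto)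
  ultimately have "summable (\<lambda>n. \<bar>kap \<alpha> \<beta> r (int n)\<bar> + \<bar>kap \<beta> \<alpha> r (int n)\<bar>)" by (rule summable_add)
  then have "summable (\<lambda>n. \<bar>kap \<alpha> \<beta> r (int (Suc n))\<bar> + \<bar>kap \<beta> \<alpha> r (int (Suc n))\<bar>)"
    by (subst summable_Suc_iff)
  moreover have "kap \<alpha> \<beta> r (- int (Suc n)) = kap \<beta> \<alpha> r (int (Suc n))" for n by (subst kap_neg) (auto simp: add.commute)
  ultimately have "summable (\<lambda>n. fnorm (\<lambda>k. complex_of_real (kap \<alpha> \<beta> r k)) (Suc n))" by (simp only: fnorm_def norm_of_real)
  then show ?thesis by (simp only: summable_Suc_iff)
qed

subsection \<open>Radial limits\<close>

text \<open>With y = x / 2 \<le> pi / 4: sin x = 2 sin y cos y \<ge> 2 y (cos y)^2 \<ge> y.\<close>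

lemma sin_ge_half:
  assumes "0 \<le> x" "x \<le> pi / 2" shows "x / 2 \<le> sin (x::real)"
proof -
  define y where "y = x / 2"
  have y: "0 \<le> y" "y \<le> pi / 4" using assms by (auto simp: y_def)
  have "sin 0 - 0 * cos 0 \<le> sin y - y * cos y"
  proof (rule DERIV_nonneg_imp_nondecreasing[OF y(1), of "\<lambda>y. sin y - y * cos y"])
    fix z assume z: "0 \<le> z" "z \<le> y"
    have "((\<lambda>y. sin y - y * cos y) has_real_derivative z * sin z) (at z)"
      by (auto intro!: derivative_eq_intros)
    moreover have "0 \<le> z * sin z" using z y pi_gt_zero by (intro mult_nonneg_nonneg sin_ge_zero) auto
    ultimately show "\<exists>D. ((\<lambda>y. sin y - y * cos y) has_real_derivative D) (at z) \<and> 0 \<le> D" by blast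
  qed
  then have "y * cos y \<le> sin y" by simp
  have c: "sqrt 2 / 2 \<le> cos y" using cos_monotone_0_pi_le[of y "pi/4"] y by (simp add: cos_45)
  have "x / 2 = 2 * y * (sqrt 2 / 2 * (sqrt 2 / 2))" by (simp add: y_def)
  also have "\<dots> \<le> 2 * y * (cos y * cos y)"
    using y by (intro mult_left_mono mult_mono c) (auto intro: order_trans[OF _ c])
  also have "\<dots> = 2 * (y * cos y) * cos y" by simp
  also have "\<dots> \<le> 2 * sin y * cos y"
    by (intro mult_right_mono) (use \<open>y * cos y \<le> sin y\<close> c in \<open>auto intro: order_trans[OF _ c]\<close>)
  also have "\<dots> = sin x" using sin_double[of y] by (simp add: y_def)
  finally show ?thesis .
qed

text \<open>The squared norm equals (1 - r)^2 + 4 r sin(s/2)^2, and r \<ge> 1/2 keeps the second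
  summand comparable to s^2.\<close>

lemma norm_one_minus_cis_ge:
  assumes "1/2 \<le> r" "r < 1" "\<bar>s\<bar> \<le> pi"
  shows "((1 - r) + \<bar>s\<bar>) / 4 \<le> norm (1 - of_real r * cis s)"
proof -
  have "\<bar>s\<bar> / 2 / 2 \<le> sin (\<bar>s\<bar> / 2)" using assms by (intro sin_ge_half) auto
  then have "(\<bar>s\<bar> / 4)^2 \<le> (sin (\<bar>s\<bar> / 2))^2" by (intro power_mono) auto
  also have "(sin (\<bar>s\<bar> / 2))^2 = (sin (s / 2))^2" by (cases "s \<ge> 0") auto
  finally have sn: "(\<bar>s\<bar> / 4)^2 \<le> (sin (s / 2))^2" .
  have "(norm (1 - of_real r * cis s))^2 = (1 - r)^2 + 2 * r * (1 - cos s)"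
  proof -
    have "(norm (1 - of_real r * cis s))^2 = (1 - r * cos s)^2 + (r * sin s)^2" unfolding cmod_power2 by simp
    also have "\<dots> = (1 - r)^2 + 2 * r * (1 - cos s)" using sin_cos_squared_add[of s] by algebra
    finally show ?thesis .
  qed
  also have "1 - cos s = 2 * (sin (s / 2))^2" using cos_double_sin[of "s / 2"] by simp
  finally have n: "(norm (1 - of_real r * cis s))^2 = (1 - r)^2 + 4 * r * (sin (s / 2))^2" by simp
  have "(((1 - r) + \<bar>s\<bar>) / 4)^2 \<le> (1 - r)^2 + 2 * (\<bar>s\<bar> / 4)^2"
  proof -
    have "((e + a) / 4)^2 \<le> e^2 + 2 * (a / 4)^2" for e a :: real
    proof -
      have "16 * ((e + a) / 4)^2 = e^2 + 2 * e * a + a^2" "16 * (2 * (a / 4)^2) = 2 * a^2"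
        by (simp_all add: power2_eq_square field_simps)
      then have "16 * ((e + a) / 4)^2 \<le> 16 * (e^2 + 2 * (a / 4)^2)"
        using sum_squares_bound[of e a] zero_le_power2[of e] unfolding distrib_left by linarith
      then show ?thesis by simp
    qed
    then show ?thesis .
  qed
  also have "\<dots> \<le> (1 - r)^2 + 4 * r * (sin (s / 2))^2"
  proof -
    have "2 * (\<bar>s\<bar> / 4)^2 \<le> 2 * (sin (s / 2))^2" using sn by simp
    also have "\<dots> \<le> 4 * r * (sin (s / 2))^2" using assms by (intro mult_right_mono) auto
    finally show ?thesis by simp
  qed
  finally have "(((1 - r) + \<bar>s\<bar>) / 4)^2 \<le> (norm (1 - of_real r * cis s))^2" unfolding n .
  then show ?thesis by (rule power2_le_imp_le) simp
qed

lemma has_vector_derivative_binomial_kernel: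
  fixes a e r :: real
  assumes "0 \<le> r" "r < 1"
  shows "((\<lambda>s. (1 - of_real r * cis (e * s)) powr (- of_real a)) has_vector_derivative
    of_real a * (\<i> * of_real e) * of_real r * cis (e * s) * (1 - of_real r * cis (e * s)) powr (- of_real a - 1)) (at s within S)"
proof -
  have nz: "1 - of_real r * exp (\<i> * (of_real e * of_real s)) \<notin> \<real>\<^sub>\<le>\<^sub>0"
    by (rule one_minus_cis_nonneg) (use assms in \<open>simp add: norm_mult\<close>)
  have "((\<lambda>w. (1 - of_real r * exp (\<i> * (of_real e * w))) powr (- of_real a)) has_field_derivative
    (- of_real a * (1 - of_real r * exp (\<i> * (of_real e * of_real s))) powr (- of_real a - 1)) * (- (of_real r * (exp (\<i> * (of_real e * of_real s)) * (\<i> * of_real e))))) (at (of_real s))"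
    by (rule DERIV_chain2[where f = "\<lambda>z. z powr (- of_real a)" and g = "\<lambda>w. 1 - of_real r * exp (\<i> * (of_real e * w))", OF has_field_derivative_powr[OF nz]]) (auto intro!: derivative_eq_intros)
  from has_vector_derivative_real_field[OF this, of S]
  show ?thesis by (simp add: cis_conv_exp mult_ac)
qed

text \<open>With \<sigma> = 1 + \<alpha> + \<beta> and q = |1 - r cis s| the kernel has size (1 -
  r)^\<sigma> q^(-1-\<sigma>) up to constants. Differentiation costs one more power of q, and q is
  at least a quarter of (1 - r) + |s|. At s = pi and s = -pi, q = 1 + r, so the boundary terms
  vanish in the limit.\<close>

lemma ab_kernel_has_derivative_bound:
  assumes \<sigma>: "1 + \<alpha> + \<beta> > 0"
  shows "\<exists>C K'. 0 \<le> C \<and> (\<forall>r. 1/2 \<le> r \<longrightarrow> r < 1 \<longrightarrow>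
    (\<forall>s. (ab_kernel \<alpha> \<beta> r has_vector_derivative K' r s) (at s)) \<and>
    (\<forall>s. \<bar>s\<bar> \<le> pi \<longrightarrow> norm (K' r s) \<le> C * (1 - r) powr (1 + \<alpha> + \<beta>) * ((1 - r) + \<bar>s\<bar>) powr (- (2 + (1 + \<alpha> + \<beta>)))) \<and>
    norm (ab_kernel \<alpha> \<beta> r pi) \<le> C * (1 - r) powr (1 + \<alpha> + \<beta>) \<and>
    norm (ab_kernel \<alpha> \<beta> r (-pi)) \<le> C * (1 - r) powr (1 + \<alpha> + \<beta>))"
proof -
  define \<sigma> where "\<sigma> = 1 + \<alpha> + \<beta>"
  have s0: "\<sigma> > 0" using assms by (simp add: \<sigma>_def)
  define A where "A = (\<lambda>r s. (1 - of_real r * cis s) powr (- complex_of_real (1 + \<alpha>)))"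
  define B where "B = (\<lambda>r s. (1 - of_real r * cis (- s)) powr (- complex_of_real (1 + \<beta>)))"
  define A' where "A' = (\<lambda>r s. of_real (1 + \<alpha>) * \<i> * of_real r * cis s * (1 - of_real r * cis s) powr (- complex_of_real (1 + \<alpha>) - 1))"
  define B' where "B' = (\<lambda>r s. of_real (1 + \<beta>) * (- \<i>) * of_real r * cis (- s) * (1 - of_real r * cis (- s)) powr (- complex_of_real (1 + \<beta>) - 1))"
  define K' where "K' = (\<lambda>r s. of_real ((1 - r\<^sup>2) powr \<sigma>) * (A r s * B' r s + A' r s * B r s))"
  define C where "C = max (2 powr \<sigma>) ((\<bar>1 + \<alpha>\<bar> + \<bar>1 + \<beta>\<bar>) * 2 powr \<sigma> * 4 powr (2 + \<sigma>))"
  have dA: "(A r has_vector_derivative A' r s) (at s)" "(B r has_vector_derivative B' r s) (at s)" if "0 \<le> r" "r < 1" for r s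
    using has_vector_derivative_binomial_kernel[OF that, of 1 "1 + \<alpha>" s UNIV] has_vector_derivative_binomial_kernel[OF that, of "-1" "1 + \<beta>" s UNIV]
    by (simp_all add: A_def A'_def B_def B'_def)
  have K: "ab_kernel \<alpha> \<beta> r s = of_real ((1 - r\<^sup>2) powr \<sigma>) * (A r s * B r s)" for r s
    by (simp add: ab_kernel_def A_def B_def \<sigma>_def mult.assoc)
  have cj: "norm (1 - of_real r * cis (- s)) = norm (1 - of_real r * cis s)" for r s
  proof -
    have "1 - of_real r * cis (- s) = cnj (1 - of_real r * cis s)" by (simp add: cis_cnj)
    then show ?thesis by (simp only: complex_mod_cnj)
  qed
  have nA: "norm (A r s) = norm (1 - of_real r * cis s) powr (- (1 + \<alpha>))" "norm (B r s) = norm (1 - of_real r * cis s) powr (- (1 + \<beta>))"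
    "norm (A' r s) = \<bar>1 + \<alpha>\<bar> * \<bar>r\<bar> * norm (1 - of_real r * cis s) powr (- (2 + \<alpha>))"
    "norm (B' r s) = \<bar>1 + \<beta>\<bar> * \<bar>r\<bar> * norm (1 - of_real r * cis s) powr (- (2 + \<beta>))" for r s
    unfolding A_def B_def A'_def B'_def norm_mult
    by (simp_all add: norm_powr_real_powr' cj norm_mult abs_mult del: of_real_add flip: of_real_minus of_real_diff)
  have pw: "(1 - r\<^sup>2) powr \<sigma> \<le> 2 powr \<sigma> * (1 - r) powr \<sigma>" "(1 - r\<^sup>2) powr \<sigma> \<ge> 0" if "1/2 \<le> r" "r < 1" for r
  proof -
    have "1 - r\<^sup>2 = (1 + r) * (1 - r)" by (simp add: power2_eq_square algebra_simps)
    also have "\<dots> \<le> 2 * (1 - r)" using that by (intro mult_right_mono) auto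
    finally have "(1 - r\<^sup>2) powr \<sigma> \<le> (2 * (1 - r)) powr \<sigma>"
      using that s0 by (intro powr_mono2) (auto simp: power_le_one)
    moreover have "(2 * (1 - r)) powr \<sigma> = 2 powr \<sigma> * (1 - r) powr \<sigma>" using that by (subst powr_mult) auto
    ultimately show "(1 - r\<^sup>2) powr \<sigma> \<le> 2 powr \<sigma> * (1 - r) powr \<sigma>" by (simp only:)
  qed simp
  show ?thesis
  proof (intro exI[of _ C] exI[of _ K'] conjI allI impI)
    show "0 \<le> C" unfolding C_def by (rule max.coboundedI1) simp
  next
    fix r s :: real assume r: "1/2 \<le> r" "r < 1"
    have "((\<lambda>s. of_real ((1 - r\<^sup>2) powr \<sigma>) * (A r s * B r s)) has_vector_derivative K' r s) (at s)"
      unfolding K'_def by (intro has_vector_derivative_mult_right has_vector_derivative_mult dA) (use r in auto)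
    then show "(ab_kernel \<alpha> \<beta> r has_vector_derivative K' r s) (at s)" by (simp only: K[symmetric])
  next
    fix r s :: real assume r: "1/2 \<le> r" "r < 1" and s: "\<bar>s\<bar> \<le> pi"
    define q where "q = norm (1 - of_real r * cis s)"
    have q: "((1 - r) + \<bar>s\<bar>) / 4 \<le> q" unfolding q_def by (rule norm_one_minus_cis_ge[OF r s])
    have pos: "0 < ((1 - r) + \<bar>s\<bar>) / 4" using r by simp
    then have q0: "q > 0" using q by simp
    have "norm (A r s * B' r s + A' r s * B r s) \<le> (\<bar>1 + \<alpha>\<bar> + \<bar>1 + \<beta>\<bar>) * q powr (- (2 + \<sigma>))"
    proof -
      have "norm (A r s * B' r s + A' r s * B r s) \<le> norm (A r s) * norm (B' r s) + norm (A' r s) * norm (B r s)"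
        by (metis norm_mult norm_triangle_ineq)
      also have "\<dots> = \<bar>r\<bar> * ((\<bar>1 + \<alpha>\<bar> + \<bar>1 + \<beta>\<bar>) * q powr (- (2 + \<sigma>)))"
      proof -
        have "q powr (- (1 + \<alpha>)) * q powr (- (2 + \<beta>)) = q powr (- (2 + \<sigma>))" "q powr (- (2 + \<alpha>)) * q powr (- (1 + \<beta>)) = q powr (- (2 + \<sigma>))"
          by (simp_all add: \<sigma>_def algebra_simps flip: powr_add)
        then show ?thesis unfolding nA q_def[symmetric] by (simp add: algebra_simps)
      qed
      also have "\<dots> \<le> 1 * ((\<bar>1 + \<alpha>\<bar> + \<bar>1 + \<beta>\<bar>) * q powr (- (2 + \<sigma>)))"
        using r by (intro mult_right_mono) auto
      finally show ?thesis by simp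
    qed
    also have "\<dots> \<le> (\<bar>1 + \<alpha>\<bar> + \<bar>1 + \<beta>\<bar>) * (4 powr (2 + \<sigma>) * ((1 - r) + \<bar>s\<bar>) powr (- (2 + \<sigma>)))"
    proof (rule mult_left_mono)
      have "q powr (- (2 + \<sigma>)) \<le> (((1 - r) + \<bar>s\<bar>) / 4) powr (- (2 + \<sigma>))"
        using s0 q pos by (intro powr_mono2') auto
      also have "\<dots> = 4 powr (2 + \<sigma>) * ((1 - r) + \<bar>s\<bar>) powr (- (2 + \<sigma>))"
      proof -
        have "(((1 - r) + \<bar>s\<bar>) / 4) powr (- (2 + \<sigma>)) = ((1 - r) + \<bar>s\<bar>) powr (- (2 + \<sigma>)) / 4 powr (- (2 + \<sigma>))"
          using r by (subst powr_divide) auto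
        also have "\<dots> = 4 powr (2 + \<sigma>) * ((1 - r) + \<bar>s\<bar>) powr (- (2 + \<sigma>))"
          by (simp only: powr_minus_divide[of 4]) simp
        finally show ?thesis .
      qed
      finally show "q powr (- (2 + \<sigma>)) \<le> 4 powr (2 + \<sigma>) * ((1 - r) + \<bar>s\<bar>) powr (- (2 + \<sigma>))" .
    qed simp
    finally have N: "norm (A r s * B' r s + A' r s * B r s) \<le> (\<bar>1 + \<alpha>\<bar> + \<bar>1 + \<beta>\<bar>) * (4 powr (2 + \<sigma>) * ((1 - r) + \<bar>s\<bar>) powr (- (2 + \<sigma>)))" .
    have "norm (K' r s) = (1 - r\<^sup>2) powr \<sigma> * norm (A r s * B' r s + A' r s * B r s)" by (simp add: K'_def norm_mult)
    also have "\<dots> \<le> (2 powr \<sigma> * (1 - r) powr \<sigma>) * ((\<bar>1 + \<alpha>\<bar> + \<bar>1 + \<beta>\<bar>) * (4 powr (2 + \<sigma>) * ((1 - r) + \<bar>s\<bar>) powr (- (2 + \<sigma>))))"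
      by (rule mult_mono[OF pw(1)[OF r] N]) auto
    also have "\<dots> = ((\<bar>1 + \<alpha>\<bar> + \<bar>1 + \<beta>\<bar>) * 2 powr \<sigma> * 4 powr (2 + \<sigma>)) * ((1 - r) powr \<sigma> * ((1 - r) + \<bar>s\<bar>) powr (- (2 + \<sigma>)))"
      by (simp only: mult_ac)
    also have "\<dots> \<le> C * ((1 - r) powr \<sigma> * ((1 - r) + \<bar>s\<bar>) powr (- (2 + \<sigma>)))"
      unfolding C_def by (intro mult_right_mono) auto
    finally show "norm (K' r s) \<le> C * (1 - r) powr (1 + \<alpha> + \<beta>) * ((1 - r) + \<bar>s\<bar>) powr (- (2 + (1 + \<alpha> + \<beta>)))"
      by (simp add: \<sigma>_def mult.assoc)
  next
    have bd: "norm (ab_kernel \<alpha> \<beta> r s) \<le> C * (1 - r) powr (1 + \<alpha> + \<beta>)" if r: "1/2 \<le> r" "r < 1" and s: "s = pi \<or> s = - pi" for r s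
    proof -
      have "norm (1 - of_real r * cis s) = 1 + r" using s r
        by (auto simp: cmod_def complex_eq_iff)
      then have "norm (A r s * B r s) = (1 + r) powr (- (1 + \<sigma>))"
      proof -
        assume 1: "norm (1 - of_real r * cis s) = 1 + r"
        have "- (1 + \<alpha>) + - (1 + \<beta>) = - (1 + \<sigma>)" by (simp add: \<sigma>_def)
        then show ?thesis unfolding norm_mult nA 1 powr_add[symmetric] by (simp only:)
      qed
      also have "\<dots> \<le> (1 + r) powr 0" using r s0 by (intro powr_mono) auto
      also have "\<dots> = 1" using r by simp
      finally have "(1 - r\<^sup>2) powr \<sigma> * norm (A r s * B r s) \<le> (2 powr \<sigma> * (1 - r) powr \<sigma>) * 1"
        by (intro mult_mono pw r) auto
      then have "norm (ab_kernel \<alpha> \<beta> r s) \<le> 2 powr \<sigma> * (1 - r) powr \<sigma>"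
        unfolding K norm_mult[of "of_real _"] by simp
      also have "\<dots> \<le> C * (1 - r) powr \<sigma>" unfolding C_def by (intro mult_right_mono) auto
      finally show ?thesis by (simp add: \<sigma>_def)
    qed
    fix r :: real assume r: "1/2 \<le> r" "r < 1"
    show "norm (ab_kernel \<alpha> \<beta> r pi) \<le> C * (1 - r) powr (1 + \<alpha> + \<beta>)" by (rule bd[OF r]) simp
    show "norm (ab_kernel \<alpha> \<beta> r (-pi)) \<le> C * (1 - r) powr (1 + \<alpha> + \<beta>)" by (rule bd[OF r]) simp
  qed
qed

text \<open>The antiderivative is explicit. What matters is that the bound does not depend on e,
  which will be 1 - r.\<close>

lemma integral_kernel_majorant:
  assumes "\<sigma> > 0" "e > 0"
  shows "(\<lambda>s. e powr \<sigma> * (e + \<bar>s\<bar>) powr (- (1 + \<sigma>))) integrable_on {-pi..pi}"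
    "integral {-pi..pi} (\<lambda>s. e powr \<sigma> * (e + \<bar>s\<bar>) powr (- (1 + \<sigma>))) \<le> 2 / \<sigma>"
proof -
  let ?f = "\<lambda>s. e powr \<sigma> * (e + \<bar>s\<bar>) powr (- (1 + \<sigma>))"
  have c: "continuous_on S ?f" for S
    by (intro continuous_intros) (use assms in \<open>auto simp: add_pos_nonneg\<close>)
  show int: "?f integrable_on {-pi..pi}" by (rule integrable_continuous_real[OF c])
  have half: "integral {0..pi} ?f \<le> 1 / \<sigma>"
  proof -
    have "((\<lambda>s. e powr \<sigma> * (e + s) powr (- (1 + \<sigma>))) has_integral
        (- (e powr \<sigma>) / \<sigma> * (e + pi) powr (- \<sigma>) - (- (e powr \<sigma>) / \<sigma> * (e + 0) powr (- \<sigma>)))) {0..pi}"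
    proof (rule fundamental_theorem_of_calculus)
      fix s assume s: "s \<in> {0..pi}"
      have "((\<lambda>s. - (e powr \<sigma>) / \<sigma> * (e + s) powr (- \<sigma>)) has_real_derivative - (e powr \<sigma>) / \<sigma> * (- \<sigma> * (e + s) powr (- \<sigma> - 1))) (at s within {0..pi})"
        using s assms by (auto intro!: derivative_eq_intros)
      then show "((\<lambda>s. - (e powr \<sigma>) / \<sigma> * (e + s) powr (- \<sigma>)) has_vector_derivative e powr \<sigma> * (e + s) powr (- (1 + \<sigma>))) (at s within {0..pi})"
      proof -
        have eq: "- \<sigma> - 1 = - (1 + \<sigma>)" "- (e powr \<sigma>) / \<sigma> * (- \<sigma> * y) = e powr \<sigma> * y" for y using assms(1) by simp_all
        assume "((\<lambda>s. - (e powr \<sigma>) / \<sigma> * (e + s) powr (- \<sigma>)) has_real_derivative - (e powr \<sigma>) / \<sigma> * (- \<sigma> * (e + s) powr (- \<sigma> - 1))) (at s within {0..pi})"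
        then show ?thesis unfolding has_real_derivative_iff_has_vector_derivative eq .
      qed
    qed simp
    note I = integral_unique[OF this]
    have "integral {0..pi} ?f = integral {0..pi} (\<lambda>s. e powr \<sigma> * (e + s) powr (- (1 + \<sigma>)))"
      by (rule integral_cong) auto
    also note I
    finally have "integral {0..pi} ?f = - (e powr \<sigma>) / \<sigma> * (e + pi) powr (- \<sigma>) - (- (e powr \<sigma>) / \<sigma> * (e + 0) powr (- \<sigma>))" .
    also have "\<dots> = 1 / \<sigma> - e powr \<sigma> / \<sigma> * (e + pi) powr (- \<sigma>)"
      using assms by (simp add: powr_minus)
    also have "\<dots> \<le> 1 / \<sigma>" using assms by simp
    finally show ?thesis .
  qed
  have "integral {-pi..pi} ?f = integral {-pi..0} ?f + integral {0..pi} ?f"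
    by (rule Henstock_Kurzweil_Integration.integral_combine[symmetric]) (use int in auto)
  also have "integral {-pi..0} ?f = integral {0..pi} ?f"
    using Henstock_Kurzweil_Integration.integral_reflect_real[of pi 0 ?f] by simp
  also have "integral {0..pi} ?f + integral {0..pi} ?f \<le> 1 / \<sigma> + 1 / \<sigma>" by (intro add_mono half)
  also have "1 / \<sigma> + 1 / \<sigma> = 2 / \<sigma>" by simp
  finally show "integral {-pi..pi} ?f \<le> 2 / \<sigma>" .
qed

text \<open>Fatou's classical argument: integrate the kernel by parts against the indefinite integral of
  the boundary data, which is \<open>o(s)\<close> after subtracting its linear part.\<close>

lemma kernel_radial_limit:
  fixes f \<Phi> :: "nat \<Rightarrow> real \<Rightarrow> complex" and F :: "real \<Rightarrow> complex" and V :: "real \<Rightarrow> complex"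
  assumes \<sigma>: "1 + \<alpha> + \<beta> > 0"
    and f: "\<And>n. continuous_on UNIV (f n)"
    and \<Phi>: "\<And>n x. \<bar>x - t\<bar> \<le> pi \<Longrightarrow> (\<Phi> n has_vector_derivative f n x) (at x)"
    and lim: "\<And>e. e > 0 \<Longrightarrow> \<exists>N. \<forall>n\<ge>N. \<forall>x. \<bar>x - t\<bar> \<le> pi \<longrightarrow> norm (\<Phi> n x - F x) < e"
    and F: "(F has_vector_derivative a) (at t)" "\<And>x. \<bar>x - t\<bar> \<le> pi \<Longrightarrow> norm (F x - F t) \<le> \<bar>x - t\<bar>"
    and V: "\<And>r. 1/2 \<le> r \<Longrightarrow> r < 1 \<Longrightarrow> (\<lambda>n. integral {-pi..pi} (\<lambda>s. ab_kernel \<alpha> \<beta> r s * f n (t - s))) \<longlonglongrightarrow> V r"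
  shows "(V \<longlongrightarrow> 2 * of_real pi * of_real (ab_limit \<alpha> \<beta>) * a) (at_left 1)"
proof -
  define \<sigma> where "\<sigma> = 1 + \<alpha> + \<beta>"
  have s0: "\<sigma> > 0" using assms(1) by (simp add: \<sigma>_def)
  obtain C K' where C: "0 \<le> C"
    and K': "\<And>r s. 1/2 \<le> r \<Longrightarrow> r < 1 \<Longrightarrow> (ab_kernel \<alpha> \<beta> r has_vector_derivative K' r s) (at s)"
    and Kb: "\<And>r s. 1/2 \<le> r \<Longrightarrow> r < 1 \<Longrightarrow> \<bar>s\<bar> \<le> pi \<Longrightarrow> norm (K' r s) \<le> C * (1 - r) powr \<sigma> * ((1 - r) + \<bar>s\<bar>) powr (- (2 + \<sigma>))"
    and Kp: "\<And>r. 1/2 \<le> r \<Longrightarrow> r < 1 \<Longrightarrow> norm (ab_kernel \<alpha> \<beta> r pi) \<le> C * (1 - r) powr \<sigma>"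
      "\<And>r. 1/2 \<le> r \<Longrightarrow> r < 1 \<Longrightarrow> norm (ab_kernel \<alpha> \<beta> r (-pi)) \<le> C * (1 - r) powr \<sigma>"
    using ab_kernel_has_derivative_bound[OF assms(1)] unfolding \<sigma>_def[symmetric] by blast
  define L where "L = 1 + norm a"
  have L: "L \<ge> 1" by (simp add: L_def)
  define H where "H = (\<lambda>s. F t - F (t - s) - of_real s * a)"
  \<comment> \<open>Integration by parts needs a derivative at every point, which
    \<open>\<Phi> n\<close> has and F need not have away from t.\<close>
  define Hn where "Hn = (\<lambda>n s. \<Phi> n t - \<Phi> n (t - s) - of_real s * a)"
  have HL: "norm (H s) \<le> L * \<bar>s\<bar>" if "\<bar>s\<bar> \<le> pi" for s
  proof -
    have "norm (H s) \<le> norm (F t - F (t - s)) + norm (of_real s * a)" unfolding H_def by (rule norm_triangle_ineq4)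
    also have "\<dots> \<le> \<bar>s\<bar> + \<bar>s\<bar> * norm a" using F(2)[of "t - s"] that by (simp add: norm_mult norm_minus_commute)
    finally show ?thesis by (simp add: L_def algebra_simps)
  qed
  have Hnlim: "\<exists>N. \<forall>n\<ge>N. \<forall>s. \<bar>s\<bar> \<le> pi \<longrightarrow> norm (Hn n s) \<le> norm (H s) + e" if e: "e > 0" for e
  proof -
    obtain N where N: "\<And>n x. n \<ge> N \<Longrightarrow> \<bar>x - t\<bar> \<le> pi \<Longrightarrow> norm (\<Phi> n x - F x) < e / 2" using lim[of "e/2"] e by auto
    show ?thesis
    proof (intro exI allI impI)
      fix n s assume n: "n \<ge> N" and s: "\<bar>s\<bar> \<le> pi"
      have "Hn n s = H s + ((\<Phi> n t - F t) - (\<Phi> n (t - s) - F (t - s)))" by (simp add: Hn_def H_def)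
      then have "norm (Hn n s) \<le> norm (H s) + norm ((\<Phi> n t - F t) - (\<Phi> n (t - s) - F (t - s)))" by (simp add: norm_triangle_ineq)
      also have "norm ((\<Phi> n t - F t) - (\<Phi> n (t - s) - F (t - s))) \<le> norm (\<Phi> n t - F t) + norm (\<Phi> n (t - s) - F (t - s))" by (rule norm_triangle_ineq4)
      also have "\<dots> \<le> e / 2 + e / 2" using N[OF n, of t] N[OF n, of "t - s"] s by (intro add_mono) auto
      finally show "norm (Hn n s) \<le> norm (H s) + e" by simp
    qed
  qed
  have small: "\<exists>\<delta>>0. \<forall>s. \<bar>s\<bar> < \<delta> \<longrightarrow> norm (H s) \<le> \<eta> * \<bar>s\<bar>" if "\<eta> > 0" for \<eta>
  proof -
    have "(F has_derivative (\<lambda>h. h *\<^sub>R a)) (at t)" using F(1) by (simp add: has_vector_derivative_def)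
    then obtain d where d: "d > 0" "\<And>y. norm (y - t) < d \<Longrightarrow> norm (F y - F t - (y - t) *\<^sub>R a) \<le> \<eta> * norm (y - t)"
      using \<open>\<eta> > 0\<close> unfolding has_derivative_at_alt by meson
    show ?thesis
    proof (intro exI[of _ d] conjI allI impI d)
      fix s :: real assume "\<bar>s\<bar> < d"
      then have "norm (F (t - s) - F t - (- s) *\<^sub>R a) \<le> \<eta> * \<bar>s\<bar>" using d(2)[of "t - s"] by simp
      moreover have "F (t - s) - F t - (- s) *\<^sub>R a = - H s" by (simp add: H_def scaleR_conv_of_real)
      ultimately show "norm (H s) \<le> \<eta> * \<bar>s\<bar>" by (simp only: norm_minus_cancel)
    qed
  qed
  have key: "norm (V r - 2 * of_real pi * of_real (kap \<alpha> \<beta> r 0) * a) \<le>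
      2 * (C * (1 - r) powr \<sigma> * (L * pi)) + C * \<eta> * (2 / \<sigma>) + C * L * \<delta> powr (- (1 + \<sigma>)) * (1 - r) powr \<sigma> * (2 * pi)"
    if r: "1/2 \<le> r" "r < 1" and \<eta>: "\<eta> > 0" and \<delta>: "\<delta> > 0" "\<And>s. \<bar>s\<bar> < \<delta> \<Longrightarrow> norm (H s) \<le> \<eta> * \<bar>s\<bar>" for r \<eta> \<delta>
  proof -
    let ?K = "ab_kernel \<alpha> \<beta> r"
    let ?R = "2 * (C * (1 - r) powr \<sigma> * (L * pi)) + C * \<eta> * (2 / \<sigma>) + C * L * \<delta> powr (- (1 + \<sigma>)) * (1 - r) powr \<sigma> * (2 * pi)"
    define e where "e = 1 - r"
    have e: "e > 0" using r by (simp add: e_def)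
    have Kc: "continuous_on S ?K" for S by (rule continuous_on_ab_kernel) (use r in auto)
    have fc: "continuous_on S (\<lambda>s. f n (t - s))" for S n
      by (rule continuous_on_compose2[OF f]) (auto intro!: continuous_intros)
    have I1: "integral {-pi..pi} (\<lambda>s. ?K s * (f n (t - s) - a)) =
       integral {-pi..pi} (\<lambda>s. ?K s * f n (t - s)) - 2 * of_real pi * of_real (kap \<alpha> \<beta> r 0) * a" for n
    proof -
      have "integral {-pi..pi} (\<lambda>s. ?K s * (f n (t - s) - a)) = integral {-pi..pi} (\<lambda>s. ?K s * f n (t - s)) - integral {-pi..pi} (\<lambda>s. ?K s * a)"
        unfolding right_diff_distrib
        by (rule integral_diff) (auto intro!: integrable_continuous_real continuous_on_mult Kc fc)
      also have "integral {-pi..pi} (\<lambda>s. ?K s * a) = 2 * of_real pi * of_real (kap \<alpha> \<beta> r 0) * a"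
        using ab_kernel_coeff[of r \<alpha> \<beta> 0] r by simp
      finally show ?thesis .
    qed
    have bound: "norm (integral {-pi..pi} (\<lambda>s. ?K s * (f n (t - s) - a))) \<le>
        2 * (C * e powr \<sigma> * (L * pi + \<epsilon>)) + C * \<eta> * (2 / \<sigma>) + C * L * \<delta> powr (- (1 + \<sigma>)) * e powr \<sigma> * (2 * pi) + C * e powr (- 2) * \<epsilon> * (2 * pi)"
      if \<epsilon>: "\<epsilon> > 0" and Hb: "\<And>s. \<bar>s\<bar> \<le> pi \<Longrightarrow> norm (Hn n s) \<le> norm (H s) + \<epsilon>" for n \<epsilon>
    proof -
      have dH: "(Hn n has_vector_derivative f n (t - s) - a) (at s within {-pi..pi})" if "s \<in> {-pi..pi}" for s
      proof -
        have "((\<Phi> n \<circ> (\<lambda>s. t - s)) has_vector_derivative ((- 1) *\<^sub>R f n (t - s))) (at s within {-pi..pi})"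
        proof (rule vector_diff_chain_within)
          show "((\<lambda>s. t - s) has_vector_derivative - 1) (at s within {-pi..pi})"
            by (auto intro!: derivative_eq_intros)
          show "(\<Phi> n has_vector_derivative f n (t - s)) (at (t - s) within (\<lambda>s. t - s) ` {-pi..pi})"
            by (rule has_vector_derivative_at_within[OF \<Phi>]) (use that in auto)
        qed
        then have 1: "((\<lambda>s. \<Phi> n (t - s)) has_vector_derivative - f n (t - s)) (at s within {-pi..pi})"
          by (simp add: o_def)
        have 2: "((\<lambda>s. s *\<^sub>R a) has_vector_derivative a) (at s within {-pi..pi})"
          by (auto intro!: derivative_eq_intros)
        have "((\<lambda>s. \<Phi> n t - \<Phi> n (t - s) - s *\<^sub>R a) has_vector_derivative (0 - - f n (t - s) - a)) (at s within {-pi..pi})"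
          by (intro has_vector_derivative_diff has_vector_derivative_const 1 2)
        then show ?thesis by (simp add: Hn_def[abs_def] scaleR_conv_of_real)
      qed
      \<comment> \<open>The product rule for the kernel times \<open>Hn n\<close>; the boundary
        values are O((1 - r)^\<sigma>).\<close>
      have FT: "((\<lambda>s. ?K s * (f n (t - s) - a) + K' r s * Hn n s) has_integral (?K pi * Hn n pi - ?K (-pi) * Hn n (-pi))) {-pi..pi}"
        by (rule fundamental_theorem_of_calculus)
           (auto intro!: has_vector_derivative_mult has_vector_derivative_at_within[OF K'] dH r)
      have IK: "(\<lambda>s. ?K s * (f n (t - s) - a)) integrable_on {-pi..pi}"
        by (intro integrable_continuous_real continuous_on_mult continuous_on_diff continuous_on_const Kc fc)
      have D: "((\<lambda>s. K' r s * Hn n s) has_integral (?K pi * Hn n pi - ?K (-pi) * Hn n (-pi) - integral {-pi..pi} (\<lambda>s. ?K s * (f n (t - s) - a)))) {-pi..pi}"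
        using has_integral_diff[OF FT integrable_integral[OF IK]] by simp
      \<comment> \<open>Three contributions: |H s| \<le> \<eta> |s| near 0, the linear bound with
        constant L outside the \<delta>-neighbourhood, and the error \<epsilon> of the
        approximants.\<close>
      define M where "M = (\<lambda>s. C * \<eta> * (e powr \<sigma> * (e + \<bar>s\<bar>) powr (- (1 + \<sigma>))) + (C * L * \<delta> powr (- (1 + \<sigma>)) * e powr \<sigma> + C * e powr (- 2) * \<epsilon>))"
      have Mi: "M integrable_on {-pi..pi}"
        unfolding M_def by (intro integrable_add integrable_const_ivl integrable_on_mult_right integral_kernel_majorant s0 e)
      have le: "norm (K' r s * Hn n s) \<le> M s" if s: "s \<in> {-pi..pi}" for s
      proof -
        have sp: "\<bar>s\<bar> \<le> pi" using s by auto
        define p where "p = e + \<bar>s\<bar>"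
        have p: "p \<ge> e" "p > 0" "p \<ge> \<bar>s\<bar>" using e by (auto simp: p_def)
        have "norm (K' r s * Hn n s) \<le> (C * e powr \<sigma> * p powr (- (2 + \<sigma>))) * (norm (H s) + \<epsilon>)"
          unfolding norm_mult using C Kb[OF r sp] Hb[OF sp] by (intro mult_mono) (auto simp: p_def e_def)
        also have "\<dots> = C * (e powr \<sigma> * (p powr (- (2 + \<sigma>)) * norm (H s))) + C * (e powr \<sigma> * p powr (- (2 + \<sigma>))) * \<epsilon>"
          by (simp add: algebra_simps)
        also have "\<dots> \<le> C * (e powr \<sigma> * (\<eta> * p powr (- (1 + \<sigma>)) + L * \<delta> powr (- (1 + \<sigma>)))) + C * (e powr (- 2)) * \<epsilon>"
        proof (intro add_mono mult_left_mono mult_right_mono C)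
          have pp: "p powr (- (2 + \<sigma>)) * p = p powr (- (1 + \<sigma>))"
            using p powr_add[of p "- (2 + \<sigma>)" 1] by (simp add: algebra_simps)
          show "p powr (- (2 + \<sigma>)) * norm (H s) \<le> \<eta> * p powr (- (1 + \<sigma>)) + L * \<delta> powr (- (1 + \<sigma>))"
          proof (cases "\<bar>s\<bar> < \<delta>")
            case True
            have "p powr (- (2 + \<sigma>)) * norm (H s) \<le> p powr (- (2 + \<sigma>)) * (\<eta> * p)"
              using \<delta>(2)[OF True] p \<eta> by (intro mult_left_mono) (auto intro: order_trans mult_left_mono)
            also have "\<dots> = \<eta> * p powr (- (1 + \<sigma>))" using pp by (simp add: mult_ac)
            finally show ?thesis using L by (simp add: add_increasing2)
          next
            case False
            have "p powr (- (2 + \<sigma>)) * norm (H s) \<le> p powr (- (2 + \<sigma>)) * (L * p)"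
              using HL[OF sp] p L by (intro mult_left_mono) (auto intro: order_trans mult_left_mono)
            also have "\<dots> = L * p powr (- (1 + \<sigma>))" using pp by (simp add: mult_ac)
            also have "\<dots> \<le> L * \<delta> powr (- (1 + \<sigma>))"
              using False p \<delta>(1) s0 L by (intro mult_left_mono powr_mono2') auto
            finally show ?thesis using \<eta> by (simp add: add_increasing)
          qed
          have "e powr \<sigma> * p powr (- (2 + \<sigma>)) \<le> e powr \<sigma> * e powr (- (2 + \<sigma>))"
            using p e s0 by (intro mult_left_mono powr_mono2') auto
          also have "\<dots> = e powr (- 2)" by (simp flip: powr_add)
          finally show "e powr \<sigma> * p powr (- (2 + \<sigma>)) \<le> e powr (- 2)" .
        qed (use \<epsilon> in auto)
        also have "\<dots> = M s" by (simp add: M_def p_def algebra_simps)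
        finally show ?thesis .
      qed
      have "norm (?K pi * Hn n pi - ?K (-pi) * Hn n (-pi) - integral {-pi..pi} (\<lambda>s. ?K s * (f n (t - s) - a))) \<le> integral {-pi..pi} M"
        using integral_norm_bound_integral[OF has_integral_integrable[OF D] Mi le] integral_unique[OF D] by simp
      also have "integral {-pi..pi} M = C * \<eta> * integral {-pi..pi} (\<lambda>s. e powr \<sigma> * (e + \<bar>s\<bar>) powr (- (1 + \<sigma>))) + (C * L * \<delta> powr (- (1 + \<sigma>)) * e powr \<sigma> + C * e powr (- 2) * \<epsilon>) * (2 * pi)"
      proof -
        have cst: "((\<lambda>s. c) has_integral (pi - (- pi)) *\<^sub>R c) {-pi..pi}" for c :: real
          using has_integral_const_real[of c "-pi" pi] by simp
        have "(M has_integral (C * \<eta> * integral {-pi..pi} (\<lambda>s. e powr \<sigma> * (e + \<bar>s\<bar>) powr (- (1 + \<sigma>))) + (pi - (- pi)) *\<^sub>R (C * L * \<delta> powr (- (1 + \<sigma>)) * e powr \<sigma> + C * e powr (- 2) * \<epsilon>))) {-pi..pi}"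
          unfolding M_def
          by (intro has_integral_add has_integral_mult_right integrable_integral integral_kernel_majorant s0 e cst)
        then show ?thesis by (simp add: integral_unique mult.commute)
      qed
      also have "\<dots> \<le> C * \<eta> * (2 / \<sigma>) + (C * L * \<delta> powr (- (1 + \<sigma>)) * e powr \<sigma> + C * e powr (- 2) * \<epsilon>) * (2 * pi)"
        by (intro add_mono mult_left_mono integral_kernel_majorant s0 e order_refl) (use C \<eta> in auto)
      finally have B: "norm (?K pi * Hn n pi - ?K (-pi) * Hn n (-pi) - integral {-pi..pi} (\<lambda>s. ?K s * (f n (t - s) - a))) \<le>
         C * \<eta> * (2 / \<sigma>) + (C * L * \<delta> powr (- (1 + \<sigma>)) * e powr \<sigma> + C * e powr (- 2) * \<epsilon>) * (2 * pi)" .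
      have bp: "norm (?K x * Hn n x) \<le> C * e powr \<sigma> * (L * pi + \<epsilon>)" if x: "x = pi \<or> x = - pi" for x
      proof -
        have "\<bar>x\<bar> = pi" using x by auto
        then have "norm (Hn n x) \<le> L * pi + \<epsilon>" using Hb[of x] HL[of x] by simp
        then show ?thesis unfolding norm_mult using Kp[OF r] x C by (intro mult_mono) (auto simp: e_def)
      qed
      have tri: "norm I \<le> norm A + norm B + norm (A - B - I)" for A B I :: complex
      proof -
        have "norm I = norm ((A - B) - (A - B - I))" by simp
        also have "\<dots> \<le> norm (A - B) + norm (A - B - I)" by (rule norm_triangle_ineq4)
        also have "\<dots> \<le> norm A + norm B + norm (A - B - I)" using norm_triangle_ineq4[of A B] by simp
        finally show ?thesis .
      qed
      show ?thesis
        using tri[of "integral {-pi..pi} (\<lambda>s. ?K s * (f n (t - s) - a))" "?K pi * Hn n pi" "?K (-pi) * Hn n (-pi)"] B bp[of pi] bp[of "-pi"]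
        by (simp add: algebra_simps)
    qed
    have lim0: "(\<lambda>n. integral {-pi..pi} (\<lambda>s. ?K s * (f n (t - s) - a))) \<longlonglongrightarrow> V r - 2 * of_real pi * of_real (kap \<alpha> \<beta> r 0) * a"
      unfolding I1 by (intro tendsto_intros V r)
    \<comment> \<open>At fixed r first n tends to infinity, then \<epsilon> tends to 0; so the
      factor e^(-2), large as it is, does no harm.\<close>
    have le\<epsilon>: "norm (V r - 2 * of_real pi * of_real (kap \<alpha> \<beta> r 0) * a) \<le>
      2 * (C * e powr \<sigma> * (L * pi + \<epsilon>)) + C * \<eta> * (2 / \<sigma>) + C * L * \<delta> powr (- (1 + \<sigma>)) * e powr \<sigma> * (2 * pi) + C * e powr (- 2) * \<epsilon> * (2 * pi)"
      if "\<epsilon> > 0" for \<epsilon>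
    proof (rule LIMSEQ_le_const2[OF tendsto_norm[OF lim0]])
      obtain N where "\<forall>n\<ge>N. \<forall>s. \<bar>s\<bar> \<le> pi \<longrightarrow> norm (Hn n s) \<le> norm (H s) + \<epsilon>" using Hnlim[OF \<open>\<epsilon> > 0\<close>] by blast
      then show "\<exists>N. \<forall>n\<ge>N. norm (integral {-pi..pi} (\<lambda>s. ?K s * (f n (t - s) - a))) \<le>
        2 * (C * e powr \<sigma> * (L * pi + \<epsilon>)) + C * \<eta> * (2 / \<sigma>) + C * L * \<delta> powr (- (1 + \<sigma>)) * e powr \<sigma> * (2 * pi) + C * e powr (- 2) * \<epsilon> * (2 * pi)"
        using bound[OF \<open>\<epsilon> > 0\<close>] by blast
    qed
    have "((\<lambda>\<epsilon>. 2 * (C * e powr \<sigma> * (L * pi + \<epsilon>)) + C * \<eta> * (2 / \<sigma>) + C * L * \<delta> powr (- (1 + \<sigma>)) * e powr \<sigma> * (2 * pi) + C * e powr (- 2) * \<epsilon> * (2 * pi)) \<longlongrightarrow>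
      2 * (C * e powr \<sigma> * (L * pi + 0)) + C * \<eta> * (2 / \<sigma>) + C * L * \<delta> powr (- (1 + \<sigma>)) * e powr \<sigma> * (2 * pi) + C * e powr (- 2) * 0 * (2 * pi)) (at_right 0)"
      by (intro tendsto_intros)
    then have "norm (V r - 2 * of_real pi * of_real (kap \<alpha> \<beta> r 0) * a) \<le>
      2 * (C * e powr \<sigma> * (L * pi + 0)) + C * \<eta> * (2 / \<sigma>) + C * L * \<delta> powr (- (1 + \<sigma>)) * e powr \<sigma> * (2 * pi) + C * e powr (- 2) * 0 * (2 * pi)"
      by (rule tendsto_lowerbound) (use le\<epsilon> in \<open>auto simp: eventually_at_right_less intro!: eventually_mono[OF eventually_at_right_less]\<close>)
    then show ?thesis by (simp add: e_def)
  qed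
  have "((\<lambda>r. V r - 2 * of_real pi * of_real (kap \<alpha> \<beta> r 0) * a) \<longlongrightarrow> 0) (at_left 1)"
  proof (rule tendstoI)
    fix \<epsilon> :: real assume \<epsilon>: "\<epsilon> > 0"
    \<comment> \<open>Chosen so that the one term that does not vanish as r tends to 1 is at most
      \<epsilon> / 2.\<close>
    define \<eta> where "\<eta> = \<epsilon> / 2 * \<sigma> / (2 * (C + 1))"
    have \<eta>: "\<eta> > 0" using \<epsilon> s0 C by (simp add: \<eta>_def)
    have C\<eta>: "C * \<eta> * (2 / \<sigma>) < \<epsilon> / 2 + \<epsilon> / 4"
    proof -
      have "C * \<eta> * (2 / \<sigma>) = \<epsilon> / 2 * (C / (C + 1))" using s0 C by (simp add: \<eta>_def field_simps)
      also have "\<dots> \<le> \<epsilon> / 2 * 1" using \<epsilon> C by (intro mult_left_mono) auto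
      finally show ?thesis using \<epsilon> by simp
    qed
    obtain \<delta> where \<delta>: "\<delta> > 0" "\<And>s. \<bar>s\<bar> < \<delta> \<Longrightarrow> norm (H s) \<le> \<eta> * \<bar>s\<bar>" using small[OF \<eta>] by blast
    have "((\<lambda>r::real. (1 - r) powr \<sigma>) \<longlongrightarrow> 0) (at_left 1)" using s0 by real_asymp
    then have "((\<lambda>r. 2 * (C * (1 - r) powr \<sigma> * (L * pi)) + C * \<eta> * (2 / \<sigma>) + C * L * \<delta> powr (- (1 + \<sigma>)) * (1 - r) powr \<sigma> * (2 * pi)) \<longlongrightarrow>
      2 * (C * 0 * (L * pi)) + C * \<eta> * (2 / \<sigma>) + C * L * \<delta> powr (- (1 + \<sigma>)) * 0 * (2 * pi)) (at_left 1)"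
      by (intro tendsto_intros)
    then have "\<forall>\<^sub>F r in at_left 1. 2 * (C * (1 - r) powr \<sigma> * (L * pi)) + C * \<eta> * (2 / \<sigma>) + C * L * \<delta> powr (- (1 + \<sigma>)) * (1 - r) powr \<sigma> * (2 * pi) < \<epsilon>"
      by (rule order_tendstoD) (use C\<eta> \<epsilon> in simp)
    moreover have "\<forall>\<^sub>F r in at_left (1::real). r \<in> {1/2<..<1}" by (rule eventually_at_left_real) simp
    ultimately show "\<forall>\<^sub>F r in at_left 1. dist (V r - 2 * of_real pi * of_real (kap \<alpha> \<beta> r 0) * a) 0 < \<epsilon>"
    proof eventually_elim
      case (elim r)
      then show ?case using key[of r \<eta> \<delta>] \<eta> \<delta> by (simp add: dist_norm)
    qed
  qed
  moreover have "((\<lambda>r. 2 * of_real pi * of_real (kap \<alpha> \<beta> r 0) * a) \<longlongrightarrow> 2 * of_real pi * of_real (ab_limit \<alpha> \<beta>) * a) (at_left 1)"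
    by (intro tendsto_intros kap_tendsto assms(1))
  ultimately have "((\<lambda>r. (V r - 2 * of_real pi * of_real (kap \<alpha> \<beta> r 0) * a) + 2 * of_real pi * of_real (kap \<alpha> \<beta> r 0) * a) \<longlongrightarrow> 0 + 2 * of_real pi * of_real (ab_limit \<alpha> \<beta>) * a) (at_left 1)"
    by (rule tendsto_add)
  then show ?thesis by simp
qed

section \<open>Fourier coefficients of u on circles\<close>

lemma not_neg_int_pochhammer:
  assumes "\<not> (\<alpha> \<in> \<int> \<and> \<alpha> < (0::real))"
  shows "pochhammer (1 + \<alpha>) n \<noteq> 0" "1 + \<alpha> \<notin> \<int>\<^sub>\<le>\<^sub>0"
proof -
  show 2: "1 + \<alpha> \<notin> \<int>\<^sub>\<le>\<^sub>0"
  proof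
    assume "1 + \<alpha> \<in> \<int>\<^sub>\<le>\<^sub>0"
    then obtain m where "1 + \<alpha> = of_int m" "m \<le> 0" by (auto elim!: nonpos_Ints_cases)
    then have "\<alpha> = of_int (m - 1)" "\<alpha> < 0" by auto
    then show False using assms by (metis Ints_of_int)
  qed
  show "pochhammer (1 + \<alpha>) n \<noteq> 0"
  proof
    assume "pochhammer (1 + \<alpha>) n = 0"
    then obtain k where "1 + \<alpha> = of_int (- int k)" by (auto simp: pochhammer_eq_0_iff)
    then have "1 + \<alpha> \<in> \<int>\<^sub>\<le>\<^sub>0" unfolding nonpos_Ints_def by (intro CollectI exI[of _ "- int k"]) auto
    then show False using 2 by simp
  qed
qed

text \<open>Up to the common factor \<open>ab_limit\<close>, the Fourier coefficients of the
  boundary function. For k = 1 and k = -1 the divisors are 1 + \<alpha> and 1 + \<beta>.\<close>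

definition ab_coeff :: "real \<Rightarrow> real \<Rightarrow> (int \<Rightarrow> complex) \<Rightarrow> int \<Rightarrow> complex" where
  "ab_coeff \<alpha> \<beta> c k =
    (if 0 \<le> k then c k / of_real (pochhammer (1 + \<alpha>) (nat k) / fact (nat k))
     else c k / of_real (pochhammer (1 + \<beta>) (nat (- k)) / fact (nat (- k))))"

text \<open>The Fourier coefficients of \<open>u\<close> on the circle of radius r; all dependence
  on r sits in \<open>kap\<close>.\<close>

definition radial_coeff :: "real \<Rightarrow> real \<Rightarrow> (int \<Rightarrow> complex) \<Rightarrow> real \<Rightarrow> int \<Rightarrow> complex" where
  "radial_coeff \<alpha> \<beta> c r k = ab_coeff \<alpha> \<beta> c k * of_real (kap \<alpha> \<beta> r k)"

lemma radial_coeff_altdef: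
  assumes "\<not> (\<alpha> \<in> \<int> \<and> \<alpha> < 0)" "\<not> (\<beta> \<in> \<int> \<and> \<beta> < 0)"
  shows "radial_coeff \<alpha> \<beta> c r (int n) = c (int n) * of_real (gauss_hypergeo (- \<alpha>) (real n - \<beta>) (real n + 1) (r\<^sup>2) * r ^ n)"
    "0 < n \<Longrightarrow> radial_coeff \<alpha> \<beta> c r (- int n) = c (- int n) * of_real (gauss_hypergeo (- \<beta>) (real n - \<alpha>) (real n + 1) (r\<^sup>2) * r ^ n)"
  using not_neg_int_pochhammer(1)[OF assms(1), of n] not_neg_int_pochhammer(1)[OF assms(2), of n]
  by (simp_all add: radial_coeff_def ab_coeff_def kap_def)

lemma expansion_coeff_bound:
  assumes "has_ab_expansion \<alpha> \<beta> u c" and q: "1 < q"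
  obtains N where "\<And>n. n \<ge> N \<Longrightarrow> norm (c (int n)) \<le> q ^ n" "\<And>n. n \<ge> N \<Longrightarrow> norm (c (- int n)) \<le> q ^ n"
proof -
  have "Limsup (filtercomap abs at_top) (\<lambda>k::int. ereal (norm (c k) powr (1 / real_of_int \<bar>k\<bar>))) < ereal q"
    using assms by (auto simp: has_ab_expansion_def one_ereal_def intro: le_less_trans)
  then have "\<forall>\<^sub>F k in filtercomap abs at_top. ereal (norm (c k) powr (1 / real_of_int \<bar>k\<bar>)) < ereal q"
    by (rule Limsup_lessD)
  then obtain M :: int where M: "\<And>k. \<bar>k\<bar> \<ge> M \<Longrightarrow> norm (c k) powr (1 / real_of_int \<bar>k\<bar>) < q"
    by (auto simp: eventually_filtercomap_at_top_linorder)
  have b: "norm (c k) \<le> q ^ n" if "\<bar>k\<bar> = int n" "int n \<ge> M" "n > 0" for k n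
  proof -
    have "(norm (c k) powr (1 / real n)) powr real n \<le> q powr real n"
      using M[of k] that by (intro powr_mono2) auto
    moreover have "(norm (c k) powr (1 / real n)) powr real n = norm (c k)"
      using that by (simp add: powr_powr)
    ultimately show ?thesis using q by (simp add: powr_realpow)
  qed
  show ?thesis by (rule that[of "max 1 (nat M)"]) (auto intro!: b)
qed

lemma summable_radial_coeff:
  assumes ab: "\<not> (\<alpha> \<in> \<int> \<and> \<alpha> < 0)" "\<not> (\<beta> \<in> \<int> \<and> \<beta> < 0)"
    and ex: "has_ab_expansion \<alpha> \<beta> u c" and r: "0 \<le> r" "r < 1"
  shows "summable (fnorm (radial_coeff \<alpha> \<beta> c r))"
proof -
  \<comment> \<open>Larger than 1, as the root bound on the coefficients needs, while q r stays
    below 1.\<close>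
  define q where "q = 2 / (1 + r)"
  have q: "1 < q" "q * r < 1" "0 \<le> q * r" using r by (auto simp: q_def field_simps)
  obtain N where N: "\<And>n. n \<ge> N \<Longrightarrow> norm (c (int n)) \<le> q ^ n" "\<And>n. n \<ge> N \<Longrightarrow> norm (c (- int n)) \<le> q ^ n"
    using expansion_coeff_bound[OF ex q(1)] by metis
  obtain M1 where M1: "0 \<le> M1" "\<And>n. \<bar>gauss_hypergeo (- \<alpha>) (real n - \<beta>) (real n + 1) (r\<^sup>2)\<bar> \<le> M1" using kap_bound[OF r] by blast
  obtain M2 where M2: "0 \<le> M2" "\<And>n. \<bar>gauss_hypergeo (- \<beta>) (real n - \<alpha>) (real n + 1) (r\<^sup>2)\<bar> \<le> M2" using kap_bound[OF r] by blast
  have "norm (fnorm (radial_coeff \<alpha> \<beta> c r) n) \<le> (M1 + M2) * (q * r) ^ n" if n: "n \<ge> max N 1" for n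
  proof -
    have "norm (radial_coeff \<alpha> \<beta> c r (int n)) \<le> q ^ n * (M1 * r ^ n)"
      unfolding radial_coeff_altdef(1)[OF ab] norm_mult norm_of_real abs_mult
      using N(1)[of n] n M1 r q(1) by (intro mult_mono) auto
    moreover have "norm (radial_coeff \<alpha> \<beta> c r (- int n)) \<le> q ^ n * (M2 * r ^ n)"
      using n by (subst radial_coeff_altdef(2)[OF ab], simp, unfold norm_mult norm_of_real abs_mult)
        (use N(2)[of n] n M2 r q(1) in \<open>intro mult_mono; auto\<close>)
    ultimately show ?thesis by (simp add: fnorm_def power_mult_distrib algebra_simps)
  qed
  moreover have "summable (\<lambda>n. (M1 + M2) * (q * r) ^ n)"
    using q by (intro summable_mult summable_geometric) auto
  ultimately show ?thesis by (rule summable_comparison_test'[rotated])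
qed

lemma expansion_fsum:
  assumes ab: "\<not> (\<alpha> \<in> \<int> \<and> \<alpha> < 0)" "\<not> (\<beta> \<in> \<int> \<and> \<beta> < 0)"
    and ex: "has_ab_expansion \<alpha> \<beta> u c" and r: "0 \<le> r" "r < 1"
  shows "u (of_real r * cis t) = fsum (radial_coeff \<alpha> \<beta> c r) t"
proof -
  define z where "z = of_real r * cis t"
  have nz: "norm z = r" using r by (simp add: z_def norm_mult)
  then have "z \<in> unit_disc" using r by simp
  then have sm: "summable (\<lambda>k. pos_term \<alpha> \<beta> c z k)" "summable (\<lambda>k. neg_term \<alpha> \<beta> c z (Suc k))"
    "u z = (\<Sum>k. pos_term \<alpha> \<beta> c z k) + (\<Sum>k. neg_term \<alpha> \<beta> c z (Suc k))"
    using ex by (auto simp: has_ab_expansion_def)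
  define g where "g = (\<lambda>k. if k = 0 then 0 else neg_term \<alpha> \<beta> c z k)"
  have "(\<lambda>k. g (Suc k)) sums (\<Sum>k. neg_term \<alpha> \<beta> c z (Suc k))" using summable_sums[OF sm(2)] by (simp add: g_def)
  then have "g sums ((\<Sum>k. neg_term \<alpha> \<beta> c z (Suc k)) + g 0)" by (simp only: sums_Suc_iff)
  then have "(\<lambda>k. pos_term \<alpha> \<beta> c z k + g k) sums u z"
    using sums_add[OF summable_sums[OF sm(1)]] sm(3) by (fastforce simp: g_def)
  moreover have "pos_term \<alpha> \<beta> c z k + g k = fterm (radial_coeff \<alpha> \<beta> c r) t k" for k
  proof -
    have p: "pos_term \<alpha> \<beta> c z k = radial_coeff \<alpha> \<beta> c r (int k) * cis (real k * t)"
      unfolding radial_coeff_altdef(1)[OF ab] pos_term_def nz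
      by (simp add: z_def power_mult_distrib Complex.DeMoivre)
    have n: "neg_term \<alpha> \<beta> c z k = radial_coeff \<alpha> \<beta> c r (- int k) * cis (- (real k * t))" if "k > 0"
      unfolding radial_coeff_altdef(2)[OF ab that] neg_term_def nz
      by (simp add: z_def power_mult_distrib cis_cnj Complex.DeMoivre)
    show ?thesis using p n by (cases "k = 0") (auto simp: g_def fterm_def)
  qed
  ultimately show ?thesis by (simp add: fsum_def sums_iff z_def)
qed

lemma fsum_tendsto:
  assumes "\<And>j. (\<lambda>n. b n j) \<longlonglongrightarrow> b' j" "\<And>n m. fnorm (b n) m \<le> M m" "summable M"
  shows "(\<lambda>n. fsum (b n) t) \<longlonglongrightarrow> fsum b' t"
proof -
  have "(\<forall>\<^sub>F n in sequentially. summable (\<lambda>k. norm (fterm (b n) t k))) \<and> summable (\<lambda>k. norm (fterm b' t k)) \<and>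
      (\<lambda>n. \<Sum>k. fterm (b n) t k) \<longlonglongrightarrow> (\<Sum>k. fterm b' t k)"
  proof (rule tannerys_theorem[where M = M])
    show "(\<lambda>n. fterm (b n) t k) \<longlonglongrightarrow> fterm b' t k" for k
      unfolding fterm_def by (cases "k = 0") (auto intro!: tendsto_intros assms(1))
    show "\<forall>\<^sub>F (k, n) in sequentially \<times>\<^sub>F sequentially. norm (fterm (b n) t k) \<le> M k"
      using order_trans[OF norm_fterm_le assms(2)] by (intro always_eventually) auto
  qed (use assms in auto)
  then show ?thesis by (simp add: fsum_def)
qed

lemma fsum_cmult:
  assumes "summable (fnorm a)"
  shows "fsum (\<lambda>k. x * a k) t = x * fsum a t"
proof -
  have "fterm (\<lambda>k. x * a k) t = (\<lambda>n. x * fterm a t n)" by (rule ext) (simp add: fterm_def algebra_simps)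
  then show ?thesis unfolding fsum_def using suminf_mult[OF summable_fterm(2)[OF assms], of x t] by simp
qed

definition radii :: "nat \<Rightarrow> real" where "radii n = 1 - 1 / (real n + 2)"

lemma radii: "1/2 \<le> radii n" "radii n < 1" "filterlim radii (at_left 1) sequentially"
proof -
  show "1/2 \<le> radii n" "radii n < 1" by (auto simp: radii_def field_simps)
  show "filterlim radii (at_left 1) sequentially" unfolding radii_def[abs_def] by real_asymp
qed

lemma cis_add_2pi: "cis (t + 2 * pi * of_int n) = cis t"
  by (simp only: cis_mult[symmetric] cis_multiple_2pi[OF Ints_of_int] mult_1_right)

text \<open>Boundary data are found through primitives. The primitives of \<open>u\<close> on
  growing circles are 1-Lipschitz, so by Arzela-Ascoli a subsequence converges uniformly to a
  Lipschitz function F. Where F is differentiable, the kernel argument shows that \<open>u\<close>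
  has a radial limit, namely the derivative of F divided by nothing further, since both sides carry
  the factor \<open>2 pi ab_limit\<close>.\<close>

lemma ab_radial_limits:
  assumes ab: "\<not> (\<alpha> \<in> \<int> \<and> \<alpha> < 0)" "\<not> (\<beta> \<in> \<int> \<and> \<beta> < 0)" "\<alpha> + \<beta> > -1"
    and ex: "has_ab_expansion \<alpha> \<beta> u c"
    and u: "continuous_on (ball 0 1) u" "\<And>z. z \<in> ball 0 1 \<Longrightarrow> norm (u z) \<le> 1"
  shows "negligible {t. \<not> (\<exists>w. ((\<lambda>r. u (of_real r * cis t)) \<longlongrightarrow> w) (at_left 1))}"
proof -
  define E where "E = {t. \<not> (\<exists>w. ((\<lambda>r. u (of_real r * cis t)) \<longlongrightarrow> w) (at_left 1))}"
  have \<sigma>: "1 + \<alpha> + \<beta> > 0" using ab(3) by simp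
  have l0: "ab_limit \<alpha> \<beta> \<noteq> 0"
    using not_neg_int_pochhammer(2)[OF ab(1)] not_neg_int_pochhammer(2)[OF ab(2)] Gamma_real_pos[OF \<sigma>]
    \<sigma> by (auto simp: ab_limit_def Gamma_eq_zero_iff dest: nonpos_Ints_nonpos)
  define f where "f = (\<lambda>n t. u (of_real (radii n) * cis t))"
  have rng: "0 \<le> radii n" "radii n < 1" for n using radii(1)[of n] radii(2)[of n] by auto
  have ball: "of_real (radii n) * cis t \<in> ball 0 1" for n t using rng[of n] by (simp add: norm_mult)
  have fc: "continuous_on S (f n)" for S n
    unfolding f_def by (rule continuous_on_compose2[OF u(1)]) (use ball in \<open>auto intro!: continuous_intros\<close>)
  have f1: "norm (f n t) \<le> 1" for n t unfolding f_def using u(2)[OF ball] .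
  have ff: "f n t = fsum (radial_coeff \<alpha> \<beta> c (radii n)) t" for n t
    unfolding f_def by (rule expansion_fsum[OF ab(1,2) ex rng])
  \<comment> \<open>Any interval containing all points within pi of [-pi, pi] would do; 10 exceeds 2
    pi.\<close>
  define \<Phi> where "\<Phi> = (\<lambda>n x. integral {-10..x} (f n))"
  have \<Phi>L: "norm (\<Phi> n x - \<Phi> n y) \<le> \<bar>x - y\<bar>" if xy: "x \<in> {-10..10}" "y \<in> {-10..10}" for n x y
  proof -
    have *: "norm (\<Phi> n y - \<Phi> n x) \<le> y - x" if "x \<le> y" "x \<in> {-10..10}" for x y
    proof -
      have "integral {-10..x} (f n) + integral {x..y} (f n) = integral {-10..y} (f n)"
        by (rule Henstock_Kurzweil_Integration.integral_combine) (use that in \<open>auto intro!: integrable_continuous_real fc\<close>)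
      then have "\<Phi> n y - \<Phi> n x = integral {x..y} (f n)" by (simp add: \<Phi>_def algebra_simps)
      also have "norm \<dots> \<le> 1 * (y - x)" by (rule integral_bound[OF that(1) fc f1])
      finally show ?thesis by simp
    qed
    show ?thesis using *[of x y] *[of y x] xy by (cases "x \<le> y") (auto simp: norm_minus_commute)
  qed
  have "\<exists>g k. continuous_on {-10..10} g \<and> strict_mono (k :: nat \<Rightarrow> nat) \<and>
     (\<forall>e>0. \<exists>N. \<forall>n x. n \<ge> N \<and> x \<in> {-10..10} \<longrightarrow> norm (\<Phi> (k n) x - g x) < e)"
  proof (rule Arzela_Ascoli[of "{-10..10::real}" \<Phi> 20])
    show "norm (\<Phi> n x) \<le> 20" if "x \<in> {-10..10}" for n x
      using \<Phi>L[of x "-10" n] that by (simp add: \<Phi>_def)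
    show "\<exists>d>0. \<forall>n y. y \<in> {-10..10} \<and> norm (x - y) < d \<longrightarrow> norm (\<Phi> n x - \<Phi> n y) < e"
      if "x \<in> {-10..10}" "0 < e" for x e
      using \<Phi>L that by (intro exI[of _ e]) (auto intro: le_less_trans)
  qed (use compact_Icc in blast)+
  then obtain g k where k: "strict_mono (k :: nat \<Rightarrow> nat)"
    and g: "\<And>e. e > 0 \<Longrightarrow> \<exists>N. \<forall>n x. n \<ge> N \<and> x \<in> {-10..10} \<longrightarrow> norm (\<Phi> (k n) x - g x) < e" by blast
  have gl: "(\<lambda>n. \<Phi> (k n) x) \<longlonglongrightarrow> g x" if x: "x \<in> {-10..10}" for x
    unfolding LIMSEQ_iff using g x by blast
  have gL: "norm (g x - g y) \<le> \<bar>x - y\<bar>" if "x \<in> {-10..10}" "y \<in> {-10..10}" for x y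
  proof (rule LIMSEQ_le_const2)
    show "(\<lambda>n. norm (\<Phi> (k n) x - \<Phi> (k n) y)) \<longlonglongrightarrow> norm (g x - g y)"
      by (intro tendsto_intros gl that)
  qed (use \<Phi>L that in blast)
  \<comment> \<open>Clamping the argument extends g to a Lipschitz function on the whole
    line.\<close>
  define F where "F = (\<lambda>x. g (max (-10) (min 10 x)))"
  have Fg: "F x = g x" if "x \<in> {-10..10}" for x using that by (simp add: F_def)
  have FL: "norm (F x - F y) \<le> \<bar>x - y\<bar>" for x y
  proof -
    have "norm (F x - F y) \<le> \<bar>max (-10) (min 10 x) - max (-10) (min 10 y)\<bar>" unfolding F_def by (rule gL) auto
    also have "\<dots> \<le> \<bar>x - y\<bar>" by linarith
    finally show ?thesis .
  qed
  define N0 where "N0 = {x. \<not> (\<lambda>x. Re (F x)) differentiable (at x)} \<union> {x. \<not> (\<lambda>x. Im (F x)) differentiable (at x)}"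
  have neg0: "negligible N0"
    unfolding N0_def
  proof (intro negligible_Un lipschitz_real_negligible_nondifferentiable[where L = 1])
    fix x y show "\<bar>Re (F x) - Re (F y)\<bar> \<le> 1 * \<bar>x - y\<bar>" "\<bar>Im (F x) - Im (F y)\<bar> \<le> 1 * \<bar>x - y\<bar>"
      using FL[of x y] abs_Re_le_cmod[of "F x - F y"] abs_Im_le_cmod[of "F x - F y"] by auto
  qed
  have good: "t \<notin> E" if t: "t \<in> {-pi..pi}" "t \<notin> N0" for t
  proof -
    obtain x y where "((\<lambda>x. Re (F x)) has_real_derivative x) (at t)" "((\<lambda>x. Im (F x)) has_real_derivative y) (at t)"
      using t(2) unfolding N0_def real_differentiable_def by blast
    then have Fa: "(F has_vector_derivative Complex x y) (at t)"
      by (simp add: has_vector_derivative_complex_iff)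
    have in10: "x \<in> {-10<..<10}" if "\<bar>x - t\<bar> \<le> pi" for x using that t(1) pi_less_4 by auto
    have "((\<lambda>r. 2 * of_real pi * of_real (ab_limit \<alpha> \<beta>) * u (of_real r * cis t)) \<longlongrightarrow> 2 * of_real pi * of_real (ab_limit \<alpha> \<beta>) * Complex x y) (at_left 1)"
    proof (rule kernel_radial_limit[OF \<sigma>, of "\<lambda>n. f (k n)" t "\<lambda>n. \<Phi> (k n)" F])
      show "continuous_on UNIV (f (k n))" for n by (rule fc)
      show "(\<Phi> (k n) has_vector_derivative f (k n) x) (at x)" if "\<bar>x - t\<bar> \<le> pi" for n x
      proof -
        have "(\<Phi> (k n) has_vector_derivative f (k n) x) (at x within {-10..10})"
          unfolding \<Phi>_def by (rule integral_has_vector_derivative[OF fc]) (use in10[OF that] in auto)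
        moreover have "at x within {-10..10} = at x" using in10[OF that] by (intro at_within_Icc_at) auto
        ultimately show ?thesis by simp
      qed
      show "\<exists>N. \<forall>n\<ge>N. \<forall>x. \<bar>x - t\<bar> \<le> pi \<longrightarrow> norm (\<Phi> (k n) x - F x) < e" if e: "e > 0" for e
      proof -
        obtain N where "\<forall>n x. n \<ge> N \<and> x \<in> {-10..10} \<longrightarrow> norm (\<Phi> (k n) x - g x) < e" using g[OF e] by blast
        moreover have "x \<in> {-10..10}" if "\<bar>x - t\<bar> \<le> pi" for x using in10[OF that] by auto
        ultimately show ?thesis using Fg by (intro exI[of _ N]) auto
      qed
      show "norm (F x - F t) \<le> \<bar>x - t\<bar>" for x by (rule FL)
      show "(\<lambda>n. integral {-pi..pi} (\<lambda>s. ab_kernel \<alpha> \<beta> r s * f (k n) (t - s))) \<longlonglongrightarrow> 2 * of_real pi * of_real (ab_limit \<alpha> \<beta>) * u (of_real r * cis t)"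
        if r: "1/2 \<le> r" "r < 1" for r
      proof -
        have r0: "0 \<le> r" using r by simp
        \<comment> \<open>Convolution with the kernel multiplies the j-th coefficient by 2 pi
          \<open>kap \<alpha> \<beta> r j\<close>. The factor already present, \<open>kap\<close> at
          \<open>radii (k n)\<close>, tends to \<open>ab_limit\<close> for every j, so the limit is
          a multiple of the expansion of \<open>u\<close> at radius r.\<close>
        define b where "b = (\<lambda>n j. radial_coeff \<alpha> \<beta> c (radii (k n)) j * (2 * of_real pi * of_real (kap \<alpha> \<beta> r j)))"
        have eq: "integral {-pi..pi} (\<lambda>s. ab_kernel \<alpha> \<beta> r s * f (k n) (t - s)) = fsum (b n) t" for n
          unfolding ff fsum_convolution[OF summable_radial_coeff[OF ab(1,2) ex rng] continuous_on_ab_kernel[OF r0 r(2)]]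
            ab_kernel_coeff[OF r0 r(2)] b_def ..
        \<comment> \<open>The bound |u| \<le> 1 controls all coefficients uniformly in n, so the
          summable sequence \<open>kap \<alpha> \<beta> r\<close> provides a majorant.\<close>
        have rc1: "norm (radial_coeff \<alpha> \<beta> c (radii (k n)) j) \<le> 1" for n j
          by (rule fsum_coeff_bound[OF summable_radial_coeff[OF ab(1,2) ex rng]]) (use f1 ff in metis)
        have "(\<lambda>n. fsum (b n) t) \<longlonglongrightarrow> fsum (\<lambda>j. 2 * of_real pi * of_real (ab_limit \<alpha> \<beta>) * radial_coeff \<alpha> \<beta> c r j) t"
        proof (rule fsum_tendsto)
          fix j
          have "filterlim (\<lambda>n. radii (k n)) (at_left 1) sequentially"
            by (rule filterlim_compose[OF radii(3) filterlim_subseq[OF k]])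
          then have "(\<lambda>n. kap \<alpha> \<beta> (radii (k n)) j) \<longlonglongrightarrow> ab_limit \<alpha> \<beta>"
            by (rule filterlim_compose[OF kap_tendsto[OF \<sigma>]])
          then have "(\<lambda>n. ab_coeff \<alpha> \<beta> c j * of_real (kap \<alpha> \<beta> (radii (k n)) j) * (2 * of_real pi * of_real (kap \<alpha> \<beta> r j))) \<longlonglongrightarrow>
            ab_coeff \<alpha> \<beta> c j * of_real (ab_limit \<alpha> \<beta>) * (2 * of_real pi * of_real (kap \<alpha> \<beta> r j))"
            by (intro tendsto_intros)
          then show "(\<lambda>n. b n j) \<longlonglongrightarrow> 2 * of_real pi * of_real (ab_limit \<alpha> \<beta>) * radial_coeff \<alpha> \<beta> c r j"
            by (simp add: b_def radial_coeff_def mult_ac)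
        next
          fix n m
          have "norm (b n j) \<le> 1 * norm (2 * of_real pi * complex_of_real (kap \<alpha> \<beta> r j))" for j
            unfolding b_def norm_mult by (intro mult_right_mono) (use rc1 in \<open>auto simp: norm_mult\<close>)
          then have "norm (b n j) \<le> 2 * pi * norm (complex_of_real (kap \<alpha> \<beta> r j))" for j by (simp add: norm_mult)
          from add_mono[OF this[of "int m"] this[of "- int m"]]
          show "fnorm (b n) m \<le> 2 * pi * fnorm (\<lambda>j. complex_of_real (kap \<alpha> \<beta> r j)) m"
            by (simp add: fnorm_def algebra_simps)
        qed (intro summable_mult summable_kap r0 r)
        moreover have "fsum (\<lambda>j. 2 * of_real pi * of_real (ab_limit \<alpha> \<beta>) * radial_coeff \<alpha> \<beta> c r j) t =
            2 * of_real pi * of_real (ab_limit \<alpha> \<beta>) * u (of_real r * cis t)"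
          unfolding expansion_fsum[OF ab(1,2) ex r0 r(2)] by (rule fsum_cmult[OF summable_radial_coeff[OF ab(1,2) ex r0 r(2)]])
        ultimately show ?thesis unfolding eq by simp
      qed
    qed (rule Fa)
    then have "((\<lambda>r. (2 * of_real pi * of_real (ab_limit \<alpha> \<beta>) * u (of_real r * cis t)) / (2 * of_real pi * of_real (ab_limit \<alpha> \<beta>))) \<longlongrightarrow>
       (2 * of_real pi * of_real (ab_limit \<alpha> \<beta>) * Complex x y) / (2 * of_real pi * of_real (ab_limit \<alpha> \<beta>))) (at_left 1)"
      by (intro tendsto_intros) (use l0 in auto)
    then have "((\<lambda>r. u (of_real r * cis t)) \<longlongrightarrow> Complex x y) (at_left 1)" using l0 by simp
    then show ?thesis unfolding E_def by blast
  qed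
  \<comment> \<open>The exceptional set is periodic, so translates of the one null set cover
    it.\<close>
  have "E \<subseteq> (\<Union>n::int. (+) (2 * pi * of_int n) ` N0)"
  proof
    fix t assume t: "t \<in> E"
    define n where "n = \<lfloor>(t + pi) / (2 * pi)\<rfloor>"
    define s where "s = t - 2 * pi * of_int n"
    have "of_int n \<le> (t + pi) / (2 * pi)" "(t + pi) / (2 * pi) < of_int n + 1" unfolding n_def by linarith+
    then have s: "s \<in> {-pi..pi}" by (auto simp: s_def field_simps)
    have "cis t = cis s" using cis_add_2pi[of s n] by (simp add: s_def)
    then have "s \<in> E" using t by (simp add: E_def)
    then have "s \<in> N0" using good[OF s] by blast
    then show "t \<in> (\<Union>n::int. (+) (2 * pi * of_int n) ` N0)" by (auto simp: s_def image_iff intro!: exI[of _ n] bexI[of _ s])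
  qed
  moreover have "negligible (\<Union>n::int. (+) (2 * pi * of_int n) ` N0)"
    by (rule negligible_countable_Union) (use negligible_translation[OF neg0] in auto)
  ultimately show ?thesis unfolding E_def[symmetric] by (rule negligible_subset[rotated])
qed

text \<open>The coefficients on growing circles converge to \<open>ab_coeff\<close> times
  \<open>ab_limit\<close>, so the inequality for boundary functions, applied to \<open>w\<close>,
  already is the claim. Properness of \<open>u\<close> makes the mean squares tend to 1.\<close>

theorem heinz_lower_bound:
  assumes ab: "\<not> (\<alpha> \<in> \<int> \<and> \<alpha> < 0)" "\<not> (\<beta> \<in> \<int> \<and> \<beta> < 0)" "\<alpha> + \<beta> > -1"
    and ex: "has_ab_expansion \<alpha> \<beta> u c"
    and u: "continuous_on (ball 0 1) u" "inj_on u (ball 0 1)" "u ` ball 0 1 = ball 0 1"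
  shows "27 / (4 * pi\<^sup>2) \<le> heinz_functional \<alpha> \<beta> c"
proof -
  have \<sigma>: "1 + \<alpha> + \<beta> > 0" using ab(3) by simp
  have u1: "norm (u z) < 1" if "z \<in> ball 0 1" for z using u(3) that by (metis imageI mem_ball_0)
  define N where "N = {t. \<not> (\<exists>w. ((\<lambda>r. u (of_real r * cis t)) \<longlongrightarrow> w) (at_left 1))}"
  have negN: "negligible N" unfolding N_def by (rule ab_radial_limits[OF ab ex u(1)]) (use u1 in \<open>auto intro: less_imp_le\<close>)
  \<comment> \<open>On N the value is arbitrary; every later use stays off N.\<close>
  define w where "w = (\<lambda>t. Lim (at_left 1) (\<lambda>r. u (of_real r * cis t)))"
  have w: "((\<lambda>r. u (of_real r * cis t)) \<longlongrightarrow> w t) (at_left 1)" if tN: "t \<notin> N" for t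
  proof -
    obtain l where "((\<lambda>r. u (of_real r * cis t)) \<longlongrightarrow> l) (at_left 1)" using tN by (auto simp: N_def)
    then show ?thesis unfolding w_def by (metis tendsto_Lim trivial_limit_at_left_real)
  qed
  have rng: "0 \<le> radii n" "radii n < 1" for n using radii(1)[of n] radii(2)[of n] by auto
  have ball: "of_real (radii n) * cis t \<in> ball 0 1" for n t using rng[of n] by (simp add: norm_mult)
  let ?a = "\<lambda>n. radial_coeff \<alpha> \<beta> c (radii n)"
  have fs: "fsum (?a n) s = u (of_real (radii n) * cis s)" for n s
    using expansion_fsum[OF ab(1,2) ex rng] by simp
  have C: "(\<lambda>n. ?a n j) \<longlonglongrightarrow> ab_coeff \<alpha> \<beta> c j * of_real (ab_limit \<alpha> \<beta>)" for j
    unfolding radial_coeff_def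
    by (intro tendsto_intros filterlim_compose[OF kap_tendsto[OF \<sigma>] radii(3)])
  have cont: "continuous_on S (\<lambda>s. u (of_real (radii n) * cis s))" for S n
    by (rule continuous_on_compose2[OF u(1)]) (use ball in \<open>auto intro!: continuous_intros\<close>)
  have "27 / (4 * pi^2) \<le> (norm (ab_coeff \<alpha> \<beta> c 1 * of_real (ab_limit \<alpha> \<beta>)))^2
     + 3 * sqrt 3 / pi * (norm (ab_coeff \<alpha> \<beta> c 0 * of_real (ab_limit \<alpha> \<beta>)))^2
     + (norm (ab_coeff \<alpha> \<beta> c (-1) * of_real (ab_limit \<alpha> \<beta>)))^2"
  proof (rule hall_inequality[of ?a N w])
    show "summable (fnorm (?a n))" for n by (rule summable_radial_coeff[OF ab(1,2) ex rng])
    show "norm (fsum (?a n) s) \<le> 1" for n s unfolding fs using u1[OF ball] by (rule less_imp_le)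
    show "(\<lambda>n. fsum (?a n) s) \<longlonglongrightarrow> w s" if "s \<notin> N" for s
      unfolding fs by (rule filterlim_compose[OF w[OF that] radii(3)])
    show "(\<Sum>i<m. (norm (w (t (Suc i mod m)) - w (t i)))^2) \<le> 9"
      if "0 < m" "\<And>i j. i < j \<Longrightarrow> j < m \<Longrightarrow> t i < t j" "\<And>i. i < m \<Longrightarrow> t i < t 0 + 2 * pi" "\<And>i. i < m \<Longrightarrow> t i \<notin> N" for m t
      by (rule ray_limits_polygon[where u = u and t = t and w = "\<lambda>i. w (t i)"]) (use u that w in blast)+
    have "(\<lambda>n. integral {-pi..pi} (\<lambda>s. (norm (fsum (?a n) s))^2)) \<longlonglongrightarrow> integral {-pi..pi} (\<lambda>s. 1)"
    proof (rule dominated_convergence_ae_interval(2)[where N = "{}" and B = 1])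
      show "(\<lambda>s. (norm (fsum (?a n) s))^2) integrable_on {-pi..pi}" for n
        unfolding fs by (intro integrable_continuous_real continuous_intros cont)
      show "norm ((norm (fsum (?a n) s))^2) \<le> 1" for n s
        unfolding fs using u1[OF ball[of n s]] by (simp add: power_le_one)
      show "(\<lambda>n. (norm (fsum (?a n) s))^2) \<longlonglongrightarrow> 1" for s
      proof -
        have "(\<lambda>n. norm (fsum (?a n) s)) \<longlonglongrightarrow> 1"
        proof (rule order_tendstoI)
          fix \<rho> :: real assume "\<rho> < 1"
          then obtain R where R: "R < 1" "\<And>z. z \<in> ball 0 1 \<Longrightarrow> norm z > R \<Longrightarrow> norm (u z) > \<rho>"
            using homeo_disc_norm_tendsto_1[OF u] by metis
          have "\<forall>\<^sub>F r in at_left 1. R < (r::real)" using eventually_at_left_real[OF R(1)] by (auto elim: eventually_mono)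
          then have "\<forall>\<^sub>F n in sequentially. R < radii n" using radii(3) by (rule eventually_compose_filterlim)
          then show "\<forall>\<^sub>F n in sequentially. \<rho> < norm (fsum (?a n) s)"
          proof eventually_elim
            case (elim n)
            then show ?case unfolding fs using R(2)[OF ball] rng(1)[of n] by (simp add: norm_mult)
          qed
        next
          fix \<rho> :: real assume "1 < \<rho>"
          then show "\<forall>\<^sub>F n in sequentially. norm (fsum (?a n) s) < \<rho>"
            unfolding fs using u1[OF ball] by (intro always_eventually) (auto intro: less_trans)
        qed
        then have "(\<lambda>n. (norm (fsum (?a n) s))^2) \<longlonglongrightarrow> 1^2" by (intro tendsto_intros)
        then show ?thesis by simp
      qed
    qed auto
    then show "(\<lambda>n. integral {-pi..pi} (\<lambda>s. (norm (fsum (?a n) s))^2)) \<longlonglongrightarrow> 2 * pi" by simp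
  qed (rule negN C)+
  also have "\<dots> = heinz_functional \<alpha> \<beta> c"
  proof -
    have "ab_coeff \<alpha> \<beta> c 1 = c 1 / of_real (1 + \<alpha>)" "ab_coeff \<alpha> \<beta> c (-1) = c (-1) / of_real (1 + \<beta>)" "ab_coeff \<alpha> \<beta> c 0 = c 0"
      by (simp_all add: ab_coeff_def)
    then have "norm (ab_coeff \<alpha> \<beta> c 1) = norm (c 1) / \<bar>1 + \<alpha>\<bar>" "norm (ab_coeff \<alpha> \<beta> c (-1)) = norm (c (-1)) / \<bar>1 + \<beta>\<bar>" "ab_coeff \<alpha> \<beta> c 0 = c 0"
      by (simp_all only: norm_divide norm_of_real)
    moreover have "heinz_functional \<alpha> \<beta> c = (ab_limit \<alpha> \<beta>)\<^sup>2 *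
      ((norm (c 1))\<^sup>2 / (1 + \<alpha>)\<^sup>2 + 3 * sqrt 3 / pi * (norm (c 0))\<^sup>2 + (norm (c (-1)))\<^sup>2 / (1 + \<beta>)\<^sup>2)"
      by (simp only: heinz_functional_def ab_limit_def)
    ultimately show ?thesis
      by (simp add: norm_mult power_mult_distrib power_divide algebra_simps)
  qed
  finally show ?thesis .
qed

subsection \<open>The Kneser argument\<close>

text \<open>Measured from the midpoint of the zeros the function is P cos + Q sin + d; vanishing at
  both \<delta> and -\<delta> forces Q = 0 and d = -P cos \<delta>. The factored form displays every
  sign change.\<close>

lemma trig_two_zeros:
  fixes p q d :: real
  assumes z: "p * cos t1 + q * sin t1 + d = 0" "p * cos t2 + q * sin t2 + d = 0" and t: "t1 < t2" "t2 < t1 + 2 * pi"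
  obtains k where "\<And>t. p * cos t + q * sin t + d = k * (sin ((t - t1) / 2) * sin ((t - t2) / 2))"
proof -
  define m where "m = (t1 + t2) / 2"
  define \<delta> where "\<delta> = (t2 - t1) / 2"
  have \<delta>: "0 < \<delta>" "\<delta> < pi" using t by (auto simp: \<delta>_def)
  have t12: "t1 = m - \<delta>" "t2 = m + \<delta>" by (auto simp: m_def \<delta>_def field_simps)
  define P where "P = p * cos m + q * sin m"
  define Q where "Q = q * cos m - p * sin m"
  have A: "p * cos t + q * sin t + d = P * cos (t - m) + Q * sin (t - m) + d" for t
  proof -
    have "P * cos (t - m) + Q * sin (t - m) = (p * cos t + q * sin t) * ((cos m)^2 + (sin m)^2)"
      by (simp only: P_def Q_def cos_diff sin_diff) algebra
    then show ?thesis by simp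
  qed
  have e: "P * cos \<delta> - Q * sin \<delta> + d = 0" "P * cos \<delta> + Q * sin \<delta> + d = 0"
    using z unfolding A by (simp_all add: t12)
  have "Q * sin \<delta> = 0" using e by linarith
  moreover have "d = - P * cos \<delta>" using e by simp
  moreover have "sin \<delta> > 0" using \<delta> by (rule sin_gt_zero)
  ultimately have Q: "Q = 0" and d: "d = - P * cos \<delta>" by auto
  show thesis
  proof (rule that[of "- 2 * P"])
    fix t
    have e1: "(t - t1) / 2 = (t - m) / 2 + \<delta> / 2" and e2: "(t - t2) / 2 = (t - m) / 2 - \<delta> / 2" by (auto simp: t12 field_simps)
    have "2 * (sin ((t - t1) / 2) * sin ((t - t2) / 2)) = cos \<delta> - cos (t - m)"
    proof -
      have "2 * (sin (x + y) * sin (x - y)) = cos (2 * y) - cos (2 * x)" for x y :: real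
        unfolding sin_add sin_diff cos_double_sin using sin_cos_squared_add[of x] sin_cos_squared_add[of y] by algebra
      moreover have "2 * (\<delta> / 2) = \<delta>" "2 * ((t - m) / 2) = t - m" by auto
      ultimately show ?thesis unfolding e1 e2 by (simp only:)
    qed
    then have "- 2 * P * (sin ((t - t1) / 2) * sin ((t - t2) / 2)) = P * cos (t - m) + d" using d by algebra
    then show "p * cos t + q * sin t + d = - 2 * P * (sin ((t - t1) / 2) * sin ((t - t2) / 2))"
      using A[of t] Q by simp
  qed
qed

text \<open>Within one full turn the sine of the half angle has a fixed sign.\<close>

lemma sin_half_same_turn:
  fixes n :: int
  assumes "2 * pi * n \<le> x" "x \<le> 2 * pi * (n + 1)" "2 * pi * n \<le> y" "y \<le> 2 * pi * (n + 1)"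
  shows "0 \<le> sin (x / 2) * sin (y / 2)"
    "2 * pi * n < x \<Longrightarrow> x < 2 * pi * (n + 1) \<Longrightarrow> 2 * pi * n < y \<Longrightarrow> y < 2 * pi * (n + 1) \<Longrightarrow> 0 < sin (x / 2) * sin (y / 2)"
proof -
  define x' y' where "x' = x / 2 - pi * n" and "y' = y / 2 - pi * n"
  have sn: "sin (pi * real_of_int n) = 0" by (rule sin_npi_int)
  have cs: "(cos (pi * real_of_int n))^2 = 1" using sin_cos_squared_add[of "pi * real_of_int n"] sn by simp
  have "sin (x / 2) = sin (x' + pi * n)" "sin (y / 2) = sin (y' + pi * n)" by (simp_all add: x'_def y'_def)
  then have e: "sin (x / 2) * sin (y / 2) = sin x' * sin y' * (cos (pi * real_of_int n))^2"
    by (simp add: sin_add sn power2_eq_square)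
  have r: "0 \<le> x'" "x' \<le> pi" "0 \<le> y'" "y' \<le> pi" using assms by (auto simp: x'_def y'_def algebra_simps)
  show "0 \<le> sin (x / 2) * sin (y / 2)"
    unfolding e cs using sin_ge_zero[OF r(1,2)] sin_ge_zero[OF r(3,4)] by simp
  show "0 < sin (x / 2) * sin (y / 2)" if "2 * pi * n < x" "x < 2 * pi * (n + 1)" "2 * pi * n < y" "y < 2 * pi * (n + 1)"
  proof -
    have "0 < x'" "x' < pi" "0 < y'" "y' < pi" using that by (auto simp: x'_def y'_def algebra_simps)
    then show ?thesis unfolding e cs using sin_gt_zero[of x'] sin_gt_zero[of y'] by simp
  qed
qed

text \<open>The lift to the real line of an orientation-preserving homeomorphism of the
  circle.\<close>

locale circle_homeo =
  fixes \<phi> :: "real \<Rightarrow> real"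
  assumes cont: "continuous_on UNIV \<phi>" and mono: "strict_mono \<phi>" and turn: "\<And>t. \<phi> (t + 2 * pi) = \<phi> t + 2 * pi"
begin

lemma turn_int: "\<phi> (t + 2 * pi * of_int n) = \<phi> t + 2 * pi * of_int n"
proof (induction n rule: int_induct[where k=0])
  case (step1 i) then show ?case using turn[of "t + 2 * pi * of_int i"] by (simp add: algebra_simps)
next
  case (step2 i) then show ?case using turn[of "t + 2 * pi * (of_int i - 1)"] by (simp add: algebra_simps)
qed simp

lemma less_iff: "\<phi> s < \<phi> t \<longleftrightarrow> s < t" using mono by (simp add: strict_mono_less)
lemma le_iff: "\<phi> s \<le> \<phi> t \<longleftrightarrow> s \<le> t" using mono by (simp add: strict_mono_less_eq)

lemma surj: "\<exists>t. \<phi> t = y"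
proof -
  define n where "n = \<lfloor>(y - \<phi> 0) / (2 * pi)\<rfloor>"
  have "of_int n \<le> (y - \<phi> 0) / (2 * pi)" "(y - \<phi> 0) / (2 * pi) \<le> of_int (n + 1)" unfolding n_def by linarith+
  then have "\<phi> (2 * pi * of_int n) \<le> y" "y \<le> \<phi> (2 * pi * of_int (n + 1))"
    using turn_int[of 0 n] turn_int[of 0 "n + 1"] by (auto simp: field_simps)
  then show ?thesis
    using IVT'[of \<phi> "2 * pi * of_int n" y "2 * pi * of_int (n + 1)"] continuous_on_subset[OF cont] by auto
qed

definition \<psi> where "\<psi> = inv \<phi>"

lemma \<phi>\<psi>[simp]: "\<phi> (\<psi> y) = y"
  unfolding \<psi>_def using surj by (metis f_inv_into_f rangeI)

lemma \<psi>\<phi>[simp]: "\<psi> (\<phi> t) = t"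
  unfolding \<psi>_def using mono by (simp add: strict_mono_imp_inj_on)

lemma continuous_\<psi>: "continuous_on UNIV \<psi>"
proof (rule continuous_at_imp_continuous_on, rule ballI)
  fix y
  have "isCont \<psi> (\<phi> (\<psi> y))"
    by (rule isCont_inverse_function[of 1]) (use cont in \<open>auto simp: continuous_on_eq_continuous_at\<close>)
  then show "isCont \<psi> y" by simp
qed

text \<open>Because \<open>\<phi>\<close> commutes with full turns, t - s and
  \<open>\<phi> t - \<phi> s\<close> lie between the same consecutive multiples of 2 pi. This
  matches the sign changes at preimages with those at images.\<close>

lemma sin_half_product:
  "0 \<le> sin ((t - s) / 2) * sin ((\<phi> t - \<phi> s) / 2)"
  "cis t \<noteq> cis s \<Longrightarrow> 0 < sin ((t - s) / 2) * sin ((\<phi> t - \<phi> s) / 2)"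
proof -
  define n where "n = \<lfloor>(t - s) / (2 * pi)\<rfloor>"
  have "of_int n \<le> (t - s) / (2 * pi)" "(t - s) / (2 * pi) < of_int n + 1" unfolding n_def by linarith+
  then have n: "s + 2 * pi * of_int n \<le> t" "t < s + 2 * pi * of_int (n + 1)"
    by (simp_all add: field_simps)
  then have \<phi>n: "\<phi> s + 2 * pi * of_int n \<le> \<phi> t" "\<phi> t < \<phi> s + 2 * pi * of_int (n + 1)"
    using less_iff le_iff turn_int[of s n] turn_int[of s "n + 1"] by metis+
  show "0 \<le> sin ((t - s) / 2) * sin ((\<phi> t - \<phi> s) / 2)"
    by (rule sin_half_same_turn(1)[of n]) (use n \<phi>n in auto)
  assume "cis t \<noteq> cis s"
  moreover have "cis (s + 2 * pi * of_int n) = cis s" by (simp only: cis_mult[symmetric] cis_multiple_2pi[OF Ints_of_int] mult_1_right)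
  ultimately have "s + 2 * pi * of_int n \<noteq> t" by auto
  then have n': "s + 2 * pi * of_int n < t" using n by simp
  then have "\<phi> s + 2 * pi * of_int n < \<phi> t" using less_iff turn_int[of s n] by metis
  then show "0 < sin ((t - s) / 2) * sin ((\<phi> t - \<phi> s) / 2)"
    by (intro sin_half_same_turn(2)[of n]) (use n n' \<phi>n in auto)
qed

text \<open>Kneser's argument. The chord through \<open>c\<close> is rotated until \<open>X / Y\<close> takes the same value \<open>l\<close> at the
  preimages of its two endpoints; then \<open>X - l Y\<close> and the component of \<open>cis \<phi> - c\<close> normal to the chord
  change sign at exactly the same points.\<close>

lemma no_common_chord:
  fixes X Y :: "real \<Rightarrow> real"
  assumes X: "continuous_on UNIV X" "\<And>t. X (t + 2 * pi) = X t"
    and Y: "continuous_on UNIV Y" "\<And>t. Y (t + 2 * pi) = Y t" "\<And>t. Y t > 0"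
    and affine: "\<And>l. \<exists>p q d m. \<forall>t. m t > (0::real) \<and> X t - l * Y t = (p * cos t + q * sin t + d) * m t"
    and nonprop: "\<And>l. \<exists>t. X t \<noteq> l * Y t"
    and c: "norm c < 1"
    and IX: "integral {-pi..pi} (\<lambda>t. (cis (\<phi> t) - c) * of_real (X t)) = 0"
    and IY: "integral {-pi..pi} (\<lambda>t. (cis (\<phi> t) - c) * of_real (Y t)) = 0"
  shows False
proof -
  \<comment> \<open>The chord from \<open>cis \<theta>\<close> through c leaves the disc at
    \<open>cis (T \<theta>)\<close>. As \<open>qq\<close> has positive real part, its principal
    argument is continuous and below pi/2 in modulus, which makes T a continuous lift with values
    between \<theta> and \<theta> + 2 pi.\<close>
  define qq where "qq = (\<lambda>\<theta>. 1 - c * cis (- \<theta>))"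
  define T where "T = (\<lambda>\<theta>. \<theta> + pi + 2 * Im (Ln (qq \<theta>)))"
  have qRe: "Re (qq \<theta>) > 0" for \<theta>
    using complex_Re_le_cmod[of "c * cis (- \<theta>)"] c by (simp add: qq_def norm_mult)
  then have q0: "qq \<theta> \<noteq> 0" and qn: "qq \<theta> \<notin> \<real>\<^sub>\<le>\<^sub>0" for \<theta> by (metis less_irrefl zero_complex.sel(1)) (metis complex_nonpos_Reals_iff qRe not_less)
  have Tc: "continuous_on UNIV T"
  proof -
    have "continuous_on UNIV qq" unfolding qq_def by (intro continuous_intros)
    then show ?thesis unfolding T_def using qn by (intro continuous_intros) auto
  qed
  have Tb: "\<theta> < T \<theta>" "T \<theta> < \<theta> + 2 * pi" for \<theta>
    using Re_Ln_pos_lt_imp[OF qRe[of \<theta>]] q0[of \<theta>] by (auto simp: T_def abs_less_iff)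
  have cisT: "cis (T \<theta>) * cnj (qq \<theta>) = - cis \<theta> * qq \<theta>" for \<theta>
  proof -
    define l where "l = Ln (qq \<theta>)"
    have l: "exp l = qq \<theta>" using q0 by (simp add: l_def)
    have "cis (2 * Im l) = exp l / cnj (exp l)"
    proof -
      have "exp l = of_real (exp (Re l)) * cis (Im l)" "cnj (exp l) = of_real (exp (Re l)) * cis (- Im l)"
        by (simp_all add: exp_eq_polar cis_cnj)
      then have "exp l / cnj (exp l) = cis (Im l) / cis (- Im l)" by simp
      also have "\<dots> = cis (2 * Im l)" by (simp add: cis_divide)
      finally show ?thesis by simp
    qed
    then have "cis (2 * Im l) * cnj (qq \<theta>) = qq \<theta>" unfolding l using q0 by simp
    moreover have "cis (T \<theta>) = - cis \<theta> * cis (2 * Im l)"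
      by (simp add: T_def l_def cis_mult[symmetric])
    ultimately show ?thesis by (simp add: mult.assoc)
  qed
  define K where "K = 1 - (norm c)^2"
  have K: "K > 0" using c by (simp add: K_def power_less_one_iff abs_square_less_1)
  have cc: "c * cnj c = of_real (1 - K)" by (simp add: K_def complex_norm_square[symmetric])
  \<comment> \<open>Since cis \<theta> - c = cis \<theta> \<open>qq \<theta>\<close>, this says that
    the two ends lie on opposite sides of c on one line; K is the power of the point c.\<close>
  have chord: "(cis (T \<theta>) - c) * cnj (qq \<theta>) = - of_real K * cis \<theta>" for \<theta>
  proof -
    have "(cis (T \<theta>) - c) * cnj (qq \<theta>) = - cis \<theta> * qq \<theta> - c * cnj (qq \<theta>)" using cisT[of \<theta>] by (simp add: left_diff_distrib)
    also have "\<dots> = - cis \<theta> + c * (cis \<theta> * cis (- \<theta>)) - c + (c * cnj c) * cis \<theta>" by (simp add: qq_def cis_cnj algebra_simps)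
    also have "\<dots> = - of_real K * cis \<theta>" unfolding cc by (simp add: cis_mult algebra_simps)
    finally show ?thesis .
  qed
  \<comment> \<open>Following the same chord back returns to the start, one full turn later.\<close>
  have TT: "T (T \<theta>) = \<theta> + 2 * pi" for \<theta>
  proof -
    let ?s = "T \<theta>"
    have a: "cis ?s * qq ?s = cis ?s - c" by (simp add: qq_def algebra_simps cis_mult)
    have b: "cis (- ?s) * cnj (qq ?s) = cnj (cis ?s - c)" using a by (metis cis_cnj complex_cnj_mult)
    have "cis (T ?s) * cnj (cis ?s - c) = (cis (T ?s) * cnj (qq ?s)) * cis (- ?s)"
      unfolding b[symmetric] by (simp only: mult_ac)
    also have "\<dots> = - (cis ?s - c) * cis (- ?s)" unfolding cisT a[symmetric] by simp
    finally have TTs: "cis (T ?s) * cnj (cis ?s - c) = - (cis ?s - c) * cis (- ?s)" .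
    have "(- A * B) * (q * r) = - (A * r) * (q * B)" for A B q r :: complex by simp
    then have E1: "cis (T ?s) * cnj (cis ?s - c) * (qq \<theta> * cnj (qq \<theta>)) = - ((cis ?s - c) * cnj (qq \<theta>)) * (qq \<theta> * cis (- ?s))"
      unfolding TTs .
    have E2: "cnj (cis ?s - c) * qq \<theta> = - of_real K * cis (- \<theta>)"
      using arg_cong[OF chord[of \<theta>], of cnj] by (simp add: cis_cnj)
    have "cis (T ?s) * (cnj (cis ?s - c) * qq \<theta>) * cnj (qq \<theta>) = - ((cis ?s - c) * cnj (qq \<theta>)) * (qq \<theta> * cis (- ?s))"
      unfolding E1[symmetric] by (simp only: mult.assoc)
    then have "cis (T ?s) * (- of_real K * cis (- \<theta>)) * cnj (qq \<theta>) = of_real K * cis \<theta> * (qq \<theta> * cis (- ?s))"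
      unfolding E2 chord by simp
    then have "of_real K * (cis (T ?s) * cis (- \<theta>) * cnj (qq \<theta>)) = of_real K * (- cis \<theta> * qq \<theta> * cis (- ?s))"
      by algebra
    then have "cis (T ?s) * cis (- \<theta>) * cnj (qq \<theta>) = - cis \<theta> * qq \<theta> * cis (- ?s)"
      by (rule mult_left_cancel[THEN iffD1, rotated]) (use K in simp)
    also have "\<dots> = cis ?s * cnj (qq \<theta>) * cis (- ?s)" by (simp only: cisT)
    also have "\<dots> = (cis ?s * cis (- ?s)) * cnj (qq \<theta>)" by (simp add: mult_ac)
    finally have "cis (T ?s) * cis (- \<theta>) = 1" using q0[of \<theta>] by (simp add: cis_mult)
    then have "cis (T ?s - \<theta>) = 1" by (simp add: cis_mult)
    then have "cis (T ?s - \<theta> - 2 * pi) = cis 0" by (simp add: cis_divide[symmetric])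
    moreover have "\<bar>T ?s - \<theta> - 2 * pi - 0\<bar> < 2 * pi" using Tb[of \<theta>] Tb[of ?s] by (auto simp: abs_less_iff)
    ultimately have "T ?s - \<theta> - 2 * pi = 0" by (rule cis_eqD)
    then show ?thesis by simp
  qed
  define R where "R = (\<lambda>t. X t / Y t)"
  have Rc: "continuous_on UNIV R" unfolding R_def using Y(3) by (intro continuous_intros X Y) (metis less_irrefl)
  have Rp: "R (t + 2 * pi) = R t" for t by (simp add: R_def X Y)
  \<comment> \<open>The passage to the other end of the chord, transported to the parameter
    t.\<close>
  define S where "S = (\<lambda>t. \<psi> (T (\<phi> t)))"
  have Sc: "continuous_on UNIV S"
    unfolding S_def by (intro continuous_on_compose2[OF continuous_\<psi>] continuous_on_compose2[OF Tc] cont) auto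
  have Sb: "t < S t" "S t < t + 2 * pi" for t
  proof -
    have "\<phi> t < \<phi> (S t)" "\<phi> (S t) < \<phi> (t + 2 * pi)" using Tb[of "\<phi> t"] by (simp_all add: S_def turn)
    then show "t < S t" "S t < t + 2 * pi" by (simp_all add: less_iff)
  qed
  have SS: "S (S t) = t + 2 * pi" for t
  proof -
    have "\<phi> (S (S t)) = \<phi> (t + 2 * pi)" by (simp add: S_def TT turn)
    then show ?thesis by (metis \<psi>\<phi>)
  qed
  \<comment> \<open>Passing to the other end changes the sign of h at 0, so h has a zero by the
    intermediate value theorem.\<close>
  define h where "h = (\<lambda>t. R t - R (S t))"
  have hc: "continuous_on A h" for A
    unfolding h_def by (intro continuous_intros continuous_on_compose2[OF Rc] continuous_on_subset[OF Rc] continuous_on_subset[OF Sc]) auto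
  have "h (S 0) = - h 0" by (simp add: h_def SS) (use Rp[of 0] in simp)
  then have "\<exists>t. h t = 0"
    using IVT'[of h 0 0 "S 0", OF _ _ _ hc] IVT2'[of h "S 0" 0 0, OF _ _ _ hc] Sb[of 0] by (cases "h 0 \<le> 0") force+
  then obtain t1 where t1: "h t1 = 0" by blast
  define t2 where "t2 = S t1"
  define l where "l = R t1"
  have t12: "t1 < t2" "t2 < t1 + 2 * pi" using Sb[of t1] by (auto simp: t2_def)
  have \<phi>t2: "\<phi> t2 = T (\<phi> t1)" by (simp add: t2_def S_def)
  have XY: "X t1 - l * Y t1 = 0" "X t2 - l * Y t2 = 0"
  proof -
    have "l = R t1" "l = R t2" using t1 by (auto simp: l_def h_def t2_def)
    then have "l = X t1 / Y t1" "l = X t2 / Y t2" unfolding R_def .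
    then show "X t1 - l * Y t1 = 0" "X t2 - l * Y t2 = 0" using Y(3)[of t1] Y(3)[of t2] by (metis (no_types) diff_self less_irrefl nonzero_eq_divide_eq)+
  qed
  obtain p q d m where pqd: "\<And>t. m t > 0" "\<And>t. X t - l * Y t = (p * cos t + q * sin t + d) * m t"
    using affine[of l] by metis
  have "p * cos t1 + q * sin t1 + d = 0" "p * cos t2 + q * sin t2 + d = 0"
    using XY pqd(1)[of t1] pqd(1)[of t2] unfolding pqd(2) by auto
  then obtain k where k: "\<And>t. p * cos t + q * sin t + d = k * (sin ((t - t1) / 2) * sin ((t - t2) / 2))"
    using trig_two_zeros[OF _ _ t12] by metis
  have "k \<noteq> 0"
  proof
    assume "k = 0"
    then have "X t = l * Y t" for t using pqd(2)[of t] k[of t] by simp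
    then show False using nonprop[of l] by simp
  qed
  define \<nu> where "\<nu> = cis (\<phi> t1) - c"
  have \<nu>0: "\<nu> \<noteq> 0" using c by (auto simp: \<nu>_def)
  \<comment> \<open>Up to the factor |\<nu>|, the component of cis x - c normal to the chord; it
    vanishes at both ends.\<close>
  define U where "U = (\<lambda>x. Im ((cis x - c) * cnj \<nu>))"
  have Uform: "U x = (- Im \<nu>) * cos x + Re \<nu> * sin x + (- Im (c * cnj \<nu>))" for x
    by (simp add: U_def algebra_simps)
  have "U (\<phi> t1) = 0" by (simp add: U_def \<nu>_def algebra_simps)
  moreover have "U (\<phi> t2) = 0"
  proof -
    let ?\<theta> = "\<phi> t1"
    have \<nu>q: "\<nu> = cis ?\<theta> * qq ?\<theta>" by (simp add: \<nu>_def qq_def algebra_simps cis_mult)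
    have "(cis (\<phi> t2) - c) * cnj \<nu> = ((cis (T ?\<theta>) - c) * cnj (qq ?\<theta>)) * cis (- ?\<theta>)" unfolding \<nu>q \<phi>t2 by (simp add: cis_cnj mult_ac)
    also have "\<dots> = - of_real K" unfolding chord by (simp add: cis_mult mult.assoc)
    finally have "U (\<phi> t2) = Im (- of_real K)" unfolding U_def by (rule arg_cong)
    then show ?thesis by simp
  qed
  moreover have "\<phi> t1 < \<phi> t2" "\<phi> t2 < \<phi> t1 + 2 * pi" using Tb by (auto simp: \<phi>t2)
  ultimately obtain k' where k': "\<And>x. U x = k' * (sin ((x - \<phi> t1) / 2) * sin ((x - \<phi> t2) / 2))"
    unfolding Uform using trig_two_zeros[of "- Im \<nu>" "\<phi> t1" "Re \<nu>" "- Im (c * cnj \<nu>)" "\<phi> t2"] by metis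
  have "k' \<noteq> 0"
  proof
    assume "k' = 0"
    then have "U x = 0" for x using k' by simp
    from this[of 0] this[of pi] this[of "pi/2"] this[of "-(pi/2)"] have "Im \<nu> = 0" "Re \<nu> = 0" unfolding Uform by auto
    then show False using \<nu>0 by (simp add: complex_eq_iff)
  qed
  define I where "I = (\<lambda>t. U (\<phi> t) * (X t - l * Y t))"
  have Ic: "continuous_on A I" for A
    unfolding I_def U_def
    by (intro continuous_intros continuous_on_subset[OF cont] continuous_on_subset[OF X(1)] continuous_on_subset[OF Y(1)]) auto
  have Iform: "I t = k * k' * m t * ((sin ((t - t1) / 2) * sin ((\<phi> t - \<phi> t1) / 2)) * (sin ((t - t2) / 2) * sin ((\<phi> t - \<phi> t2) / 2)))" for t
    unfolding I_def k' pqd(2) k by (simp add: mult_ac)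
  have int: "(\<lambda>t. (cis (\<phi> t) - c) * of_real (Z t)) integrable_on {-pi..pi}" if "continuous_on UNIV Z" for Z :: "real \<Rightarrow> real"
    by (intro integrable_continuous_real continuous_intros continuous_on_subset[OF cont] continuous_on_subset[OF that]) auto
  \<comment> \<open>Both hypotheses on the integrals enter here; by the sign statement below, the
    integrand then has to vanish identically.\<close>
  have "integral {-pi..pi} I = 0"
  proof -
    have "((\<lambda>t. (cis (\<phi> t) - c) * of_real (X t) - of_real l * ((cis (\<phi> t) - c) * of_real (Y t))) has_integral (0 - of_real l * 0)) {-pi..pi}"
      using integrable_integral[OF int[OF X(1)]] integrable_integral[OF int[OF Y(1)]] unfolding IX IY
      by (intro has_integral_diff has_integral_mult_right)
    then have "((\<lambda>t. Im (((cis (\<phi> t) - c) * of_real (X t) - of_real l * ((cis (\<phi> t) - c) * of_real (Y t))) * cnj \<nu>)) has_integral Im ((0 - of_real l * 0) * cnj \<nu>)) {-pi..pi}"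
      by (intro has_integral_Im has_integral_mult_left)
    moreover have "Im (((cis (\<phi> t) - c) * of_real (X t) - of_real l * ((cis (\<phi> t) - c) * of_real (Y t))) * cnj \<nu>) = I t" for t
      by (simp add: I_def U_def algebra_simps)
    ultimately show ?thesis by (simp add: integral_unique)
  qed
  have sgn: "0 \<le> (k * k') * I t" "cis t \<noteq> cis t1 \<Longrightarrow> cis t \<noteq> cis t2 \<Longrightarrow> 0 < (k * k') * I t" for t
  proof -
    have e: "(k * k') * I t = (k * k')^2 * m t * ((sin ((t - t1) / 2) * sin ((\<phi> t - \<phi> t1) / 2)) * (sin ((t - t2) / 2) * sin ((\<phi> t - \<phi> t2) / 2)))"
      unfolding Iform power2_eq_square by (simp only: mult_ac)
    have "(k * k')^2 * m t > 0" using \<open>k \<noteq> 0\<close> \<open>k' \<noteq> 0\<close> pqd(1)[of t] by simp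
    then show "0 \<le> (k * k') * I t" "cis t \<noteq> cis t1 \<Longrightarrow> cis t \<noteq> cis t2 \<Longrightarrow> 0 < (k * k') * I t"
      unfolding e using sin_half_product[of t t1] sin_half_product[of t t2] by (simp_all add: mult_pos_pos mult_nonneg_nonneg less_imp_le)
  qed
  have "integral {-pi..pi} (\<lambda>t. (k * k') * I t) = 0" using \<open>integral {-pi..pi} I = 0\<close> by simp
  then have z: "(k * k') * I t = 0" if "t \<in> {-pi..pi}" for t
  proof -
    have "continuous_on {-pi..pi} (\<lambda>t. (k * k') * I t)" by (intro continuous_intros Ic)
    from integral_eq_0_iff[OF this _ sgn(1)] show ?thesis
      using \<open>integral {-pi..pi} (\<lambda>t. (k * k') * I t) = 0\<close> that by auto
  qed
  \<comment> \<open>Among three distinct points of the circle one differs from both ends of the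
    chord, and there the integrand is nonzero.\<close>
  have "cis (0::real) \<noteq> cis 1" "cis (0::real) \<noteq> cis 2" "cis (1::real) \<noteq> cis 2"
    using cis_eqD[of 0 1] cis_eqD[of 0 2] cis_eqD[of 1 2] pi_gt3 by auto
  then have "\<exists>t\<in>{0,1,2::real}. cis t \<noteq> cis t1 \<and> cis t \<noteq> cis t2" by (metis insertCI)
  then obtain t where "t \<in> {0,1,2::real}" "cis t \<noteq> cis t1" "cis t \<noteq> cis t2" by blast
  then show False using sgn(2)[of t] z[of t] pi_gt3 by auto
qed

end

subsection \<open>Poisson extensions of circle homeomorphisms\<close>

lemma has_derivative_harmonic:
  assumes H: "H holomorphic_on ball 0 1" and G: "G holomorphic_on ball 0 1"
    and f: "\<And>z. z \<in> ball 0 1 \<Longrightarrow> f z = H z + cnj (G z)" and z: "z \<in> ball 0 1"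
  shows "(f has_derivative (\<lambda>e. deriv H z * e + cnj (deriv G z * e))) (at z)"
    "partial_x f z = deriv H z + cnj (deriv G z)" "partial_y f z = \<i> * deriv H z + cnj (\<i> * deriv G z)"
proof -
  have "(H has_derivative (\<lambda>e. deriv H z * e)) (at z)" "(G has_derivative (\<lambda>e. deriv G z * e)) (at z)"
    using holomorphic_derivI[OF H open_ball z] holomorphic_derivI[OF G open_ball z] by (simp_all add: has_field_derivative_def)
  then have "((\<lambda>z. H z + cnj (G z)) has_derivative (\<lambda>e. deriv H z * e + cnj (deriv G z * e))) (at z)"
    by (intro derivative_intros)
  then show D: "(f has_derivative (\<lambda>e. deriv H z * e + cnj (deriv G z * e))) (at z)"
    by (rule has_derivative_transform_within_open[OF _ open_ball z]) (simp add: f)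
  show "partial_x f z = deriv H z + cnj (deriv G z)" "partial_y f z = \<i> * deriv H z + cnj (\<i> * deriv G z)"
    unfolding partial_x_def partial_y_def frechet_derivative_at[OF D, symmetric] by (simp_all add: mult.commute)
qed

lemma wirtinger_harmonic:
  assumes "H holomorphic_on ball 0 1" "G holomorphic_on ball 0 1"
    and "\<And>z. z \<in> ball 0 1 \<Longrightarrow> f z = H z + cnj (G z)" and "z \<in> ball 0 1"
  shows "wirtinger_z f z = deriv H z" "wirtinger_zbar f z = cnj (deriv G z)"
proof -
  have p: "partial_x f z = deriv H z + cnj (deriv G z)" "partial_y f z = \<i> * deriv H z + cnj (\<i> * deriv G z)"
    using has_derivative_harmonic(2,3)[of H G f z] assms by blast+
  show "wirtinger_z f z = deriv H z" "wirtinger_zbar f z = cnj (deriv G z)"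
    unfolding wirtinger_z_def wirtinger_zbar_def p by (simp_all add: algebra_simps)
qed

lemma C1_on_harmonic:
  assumes "H holomorphic_on ball 0 1" "G holomorphic_on ball 0 1"
    and "\<And>z. z \<in> ball 0 1 \<Longrightarrow> f z = H z + cnj (G z)"
  shows "C1_on (ball 0 1) f"
proof -
  have c: "continuous_on (ball 0 1) (deriv H)" "continuous_on (ball 0 1) (deriv G)"
    using assms by (auto intro!: holomorphic_on_imp_continuous_on holomorphic_deriv)
  show ?thesis
    unfolding C1_on_def
  proof (intro conjI ballI)
    fix z :: complex assume z: "z \<in> ball 0 1"
    show "f differentiable (at z)" using has_derivative_harmonic(1)[OF assms z] by (auto simp: differentiable_def)
  next
    have "continuous_on (ball 0 1) (\<lambda>z. deriv H z + cnj (deriv G z))" by (intro continuous_intros c)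
    then show "continuous_on (ball 0 1) (partial_x f)"
      by (rule continuous_on_eq) (rule has_derivative_harmonic(2)[OF assms, symmetric])
    have "continuous_on (ball 0 1) (\<lambda>z. \<i> * deriv H z + cnj (\<i> * deriv G z))" by (intro continuous_intros c)
    then show "continuous_on (ball 0 1) (partial_y f)"
      by (rule continuous_on_eq) (rule has_derivative_harmonic(3)[OF assms, symmetric])
  qed
qed

lemma ab_harmonic_holomorphic_sum:
  assumes H: "H holomorphic_on ball 0 1" and G: "G holomorphic_on ball 0 1"
    and f: "\<And>z. z \<in> ball 0 1 \<Longrightarrow> f z = H z + cnj (G z)"
  shows "ab_harmonic 0 0 f"
  unfolding ab_harmonic_0_0 C2_on_def
proof (intro conjI ballI)
  have dH: "deriv H holomorphic_on ball 0 1" "deriv G holomorphic_on ball 0 1"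
    using H G by (auto intro: holomorphic_deriv)
  show "C1_on (ball 0 1) f" by (rule C1_on_harmonic[OF assms])
  show "C1_on (ball 0 1) (partial_x f)"
    by (rule C1_on_harmonic[OF dH]) (rule has_derivative_harmonic(2)[OF assms])
  show "C1_on (ball 0 1) (partial_y f)"
    by (rule C1_on_harmonic[of "\<lambda>z. \<i> * deriv H z" "\<lambda>z. \<i> * deriv G z"])
       (intro holomorphic_intros dH has_derivative_harmonic(3)[OF assms]; assumption)+
  fix z :: complex assume z: "z \<in> ball 0 1"
  \<comment> \<open>\<open>wirtinger_zbar f\<close> is the conjugate of the holomorphic function
    \<open>deriv G\<close>, so the same lemma applies to it with holomorphic part 0.\<close>
  have "wirtinger_z (wirtinger_zbar f) z = deriv (\<lambda>_. 0) z"
    by (rule wirtinger_harmonic(1)[of "\<lambda>_. 0" "deriv G"]) (use wirtinger_harmonic(2)[OF assms] z in \<open>auto simp: dH\<close>)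
  then show "wirtinger_z (wirtinger_zbar f) z = 0" by simp
qed

section \<open>The Poisson kernel and its derivative as Fourier series\<close>

definition poisson :: "complex \<Rightarrow> real \<Rightarrow> real" where
  "poisson z s = (1 - (norm z)\<^sup>2) / (norm (cis s - z))\<^sup>2"

text \<open>The coefficients refer to the boundary variable s. The kernel is a series in
  \<open>z cis (- s)\<close> and its conjugate, so powers of z sit at negative indices.\<close>

definition poisson_coeff :: "complex \<Rightarrow> int \<Rightarrow> complex" where
  "poisson_coeff z k = (if k \<le> 0 then z ^ nat (- k) else cnj z ^ nat k)"

text \<open>The derivative of the Poisson kernel at \<open>z\<close> in direction \<open>e\<close>.\<close>

definition poisson_deriv :: "complex \<Rightarrow> complex \<Rightarrow> real \<Rightarrow> real" where
  "poisson_deriv z e s = 2 * Re (e * cis s / (cis s - z)\<^sup>2)"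

definition poisson_deriv_coeff :: "complex \<Rightarrow> complex \<Rightarrow> int \<Rightarrow> complex" where
  "poisson_deriv_coeff z e k =
    (if k < 0 then of_nat (nat (- k)) * z ^ (nat (- k) - 1) * e else cnj (of_nat (nat k) * z ^ (nat k - 1) * e))"

lemma norm_cis_minus_sq: "(norm (cis t - z))\<^sup>2 = 1 + (norm z)\<^sup>2 - 2 * (Re z * cos t + Im z * sin t)"
proof -
  have "(norm (cis t - z))\<^sup>2 = ((cos t)\<^sup>2 + (sin t)\<^sup>2) + ((Re z)\<^sup>2 + (Im z)\<^sup>2) - 2 * (Re z * cos t + Im z * sin t)"
    unfolding cmod_power2 by (simp add: power2_eq_square algebra_simps)
  then show ?thesis by (simp add: cmod_power2)
qed

lemma cis_minus_nz: "norm z < 1 \<Longrightarrow> cis t - z \<noteq> 0"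
  by auto

lemma poisson_pos: "norm z < 1 \<Longrightarrow> poisson z s > 0"
  using cis_minus_nz[of z s] by (simp add: poisson_def power_less_one_iff abs_square_less_1)

lemma continuous_on_poisson: "norm z < 1 \<Longrightarrow> continuous_on S (poisson z)"
  unfolding poisson_def using cis_minus_nz by (intro continuous_intros) auto

lemma continuous_on_poisson_deriv: "norm z < 1 \<Longrightarrow> continuous_on S (poisson_deriv z e)"
  unfolding poisson_deriv_def using cis_minus_nz by (intro continuous_intros) auto

lemma summable_poisson_coeff:
  assumes "norm z < 1" shows "summable (fnorm (poisson_coeff z))"
proof -
  have "fnorm (poisson_coeff z) = (\<lambda>n. 2 * norm z ^ n)"
    by (rule ext) (simp add: fnorm_def poisson_coeff_def norm_power)
  moreover have "summable (\<lambda>n. 2 * norm z ^ n)" using assms by (intro summable_mult summable_geometric) simp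
  ultimately show ?thesis by simp
qed

lemma fsum_poisson_coeff:
  assumes "norm z < 1"
  shows "fsum (poisson_coeff z) s = of_real (poisson z s)"
proof -
  define v where "v = z * cis (- s)"
  have v: "norm v < 1" using assms by (simp add: v_def norm_mult)
  then have v1: "1 - v \<noteq> 0" by auto
  have "(\<lambda>n. v ^ n) sums (1 / (1 - v))" by (rule geometric_sums[OF v])
  moreover from this have "(\<lambda>n. cnj (v ^ n)) sums cnj (1 / (1 - v))" by (simp only: sums_cnj)
  moreover have "(\<lambda>n. if n = 0 then 1 else 0 :: complex) sums 1" using sums_single[of 0 "\<lambda>_. 1::complex"] by simp
  ultimately have "(\<lambda>n. v ^ n + cnj (v ^ n) - (if n = 0 then 1 else 0)) sums (1 / (1 - v) + cnj (1 / (1 - v)) - 1)"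
    by (intro sums_diff sums_add)
  moreover have "v ^ n + cnj (v ^ n) - (if n = 0 then 1 else 0) = fterm (poisson_coeff z) s n" for n
    by (auto simp: fterm_def poisson_coeff_def v_def power_mult_distrib cis_cnj Complex.DeMoivre)
  ultimately have "fsum (poisson_coeff z) s = 1 / (1 - v) + cnj (1 / (1 - v)) - 1" by (simp add: fsum_def sums_iff)
  also have "\<dots> = (1 - v * cnj v) / ((1 - v) * cnj (1 - v))"
  proof -
    have "1 - cnj v \<noteq> 0" using v1 by (metis complex_cnj_cnj complex_cnj_diff complex_cnj_one complex_cnj_zero)
    then show ?thesis using v1 by (simp add: divide_simps) algebra
  qed
  also have "(1 - v) * cnj (1 - v) = of_real ((norm (1 - v))\<^sup>2)" by (simp only: complex_norm_square)
  also have "v * cnj v = of_real ((norm z)\<^sup>2)" by (simp only: complex_norm_square[symmetric]) (simp add: v_def norm_mult)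
  also have "norm (1 - v) = norm (cis s - z)"
  proof -
    have "1 - v = (cis s - z) * cis (- s)" by (simp add: v_def algebra_simps cis_mult)
    then show ?thesis by (simp add: norm_mult)
  qed
  finally show ?thesis by (simp add: poisson_def)
qed

lemma summable_poisson_deriv_coeff:
  assumes "norm z < 1" shows "summable (fnorm (poisson_deriv_coeff z e))"
proof -
  have "fnorm (poisson_deriv_coeff z e) (Suc n) = 2 * norm e * (of_nat (Suc n) * norm z ^ n)" for n
    by (simp add: fnorm_def poisson_deriv_coeff_def norm_mult norm_power nat_add_distrib del: of_nat_Suc)
  moreover have "summable (\<lambda>n. 2 * norm e * (of_nat (Suc n) * norm z ^ n))"
    using geometric_deriv_sums[of "norm z"] assms by (intro summable_mult) (auto simp: sums_iff)
  ultimately have "summable (\<lambda>n. fnorm (poisson_deriv_coeff z e) (Suc n))" by simp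
  then show ?thesis by (simp only: summable_Suc_iff)
qed

lemma fsum_poisson_deriv_coeff:
  assumes "norm z < 1"
  shows "fsum (poisson_deriv_coeff z e) s = of_real (poisson_deriv z e s)"
proof -
  define v where "v = z * cis (- s)"
  define y where "y = (\<lambda>n. of_nat n * z ^ (n - 1) * e * cis (- (real n * s)))"
  have v: "norm v < 1" using assms by (simp add: v_def norm_mult)
  have "(\<lambda>n. e * cis (- s) * (of_nat (Suc n) * v ^ n)) sums (e * cis (- s) * (1 / (1 - v)\<^sup>2))"
    by (intro sums_mult geometric_deriv_sums v)
  moreover have "y (Suc n) = e * cis (- s) * (of_nat (Suc n) * v ^ n)" for n
  proof -
    have "cis (- (real (Suc n) * s)) = cis (- s) * cis (- s) ^ n"
      by (simp add: Complex.DeMoivre cis_mult algebra_simps)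
    then show ?thesis by (simp add: y_def v_def power_mult_distrib del: of_nat_Suc)
  qed
  ultimately have "(\<lambda>n. y (Suc n)) sums (e * cis (- s) * (1 / (1 - v)\<^sup>2))" by simp
  then have "y sums (e * cis (- s) * (1 / (1 - v)\<^sup>2) + y 0)" by (simp only: sums_Suc_iff)
  moreover have "e * cis (- s) * (1 / (1 - v)\<^sup>2) + y 0 = e * cis s / (cis s - z)\<^sup>2"
  proof -
    have "cis s - z = cis s * (1 - v)" by (simp add: v_def algebra_simps cis_mult)
    then have "e * cis s / (cis s - z)\<^sup>2 = e * (cis s / (cis s)\<^sup>2) * (1 / (1 - v)\<^sup>2)" by (simp add: power_mult_distrib)
    also have "cis s / (cis s)\<^sup>2 = cis (- s)" by (simp add: power2_eq_square cis_divide[symmetric] flip: cis_inverse) (simp add: field_simps)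
    finally show ?thesis by (simp add: y_def)
  qed
  ultimately have Y: "y sums (e * cis s / (cis s - z)\<^sup>2)" by simp
  then have "(\<lambda>n. y n + cnj (y n)) sums (e * cis s / (cis s - z)\<^sup>2 + cnj (e * cis s / (cis s - z)\<^sup>2))"
    by (intro sums_add) (simp_all only: sums_cnj)
  moreover have "y n + cnj (y n) = fterm (poisson_deriv_coeff z e) s n" for n
    by (auto simp: fterm_def poisson_deriv_coeff_def y_def cis_cnj)
  ultimately have "fsum (poisson_deriv_coeff z e) s = e * cis s / (cis s - z)\<^sup>2 + cnj (e * cis s / (cis s - z)\<^sup>2)"
    by (simp add: fsum_def sums_iff)
  also have "\<dots> = of_real (poisson_deriv z e s)" unfolding poisson_deriv_def by (rule complex_add_cnj)
  finally show ?thesis .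
qed

lemma poisson_integrals:
  assumes "norm z < 1"
  shows "integral {-pi..pi} (\<lambda>s. complex_of_real (poisson z s) * cis (- (of_int m * s))) = 2 * of_real pi * poisson_coeff z m"
    "integral {-pi..pi} (\<lambda>s. complex_of_real (poisson_deriv z e s) * cis (- (of_int m * s))) = 2 * of_real pi * poisson_deriv_coeff z e m"
  using fsum_coeff[OF summable_poisson_coeff[OF assms], of m] fsum_coeff[OF summable_poisson_deriv_coeff[OF assms], of e m]
  by (simp_all add: fsum_poisson_coeff fsum_poisson_deriv_coeff assms)

text \<open>A Poisson kernel is a constant over |cis t - z|^2, which is affine in cos t and sin t.
  Over the positive common denominator the difference has an affine numerator, as Kneser's argument
  requires.\<close>

lemma poisson_affine:
  assumes z: "norm z < 1" "norm z' < 1"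
  shows "\<exists>p q d m. \<forall>t. m t > (0::real) \<and> poisson z t - l * poisson z' t = (p * cos t + q * sin t + d) * m t"
proof -
  define a b where "a = 1 - (norm z)\<^sup>2" and "b = l * (1 - (norm z')\<^sup>2)"
  define N N' where "N = (\<lambda>t. (norm (cis t - z))\<^sup>2)" and "N' = (\<lambda>t. (norm (cis t - z'))\<^sup>2)"
  have pos: "N t > 0" "N' t > 0" for t using cis_minus_nz[OF z(1)] cis_minus_nz[OF z(2)] by (auto simp: N_def N'_def)
  have "poisson z t - l * poisson z' t = (a * N' t - b * N t) * (1 / (N t * N' t))" for t
  proof -
    have "poisson z t = a / N t" "l * poisson z' t = b / N' t" by (simp_all add: poisson_def a_def b_def N_def N'_def)
    then show ?thesis using pos[of t] by (simp add: field_simps)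
  qed
  moreover have "a * N' t - b * N t = (2 * b * Re z - 2 * a * Re z') * cos t + (2 * b * Im z - 2 * a * Im z') * sin t
      + (a * (1 + (norm z')\<^sup>2) - b * (1 + (norm z)\<^sup>2))" for t
    unfolding N_def N'_def norm_cis_minus_sq by (simp add: algebra_simps)
  ultimately show ?thesis using pos
    by (intro exI[of _ "2 * b * Re z - 2 * a * Re z'"] exI[of _ "2 * b * Im z - 2 * a * Im z'"]
      exI[of _ "a * (1 + (norm z')\<^sup>2) - b * (1 + (norm z)\<^sup>2)"] exI[of _ "\<lambda>t. 1 / (N t * N' t)"]) auto
qed

text \<open>Multiplying by the squared conjugate makes the denominator real and positive. The
  numerator e cis t (cis(-t) - cnj z)^2 then involves only the frequencies -1, 0 and 1, so it is
  affine in cos t and sin t.\<close>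

lemma poisson_deriv_affine:
  assumes z: "norm z < 1"
  shows "\<exists>p q d m. \<forall>t. m t > (0::real) \<and> poisson_deriv z e t - l * poisson z t = (p * cos t + q * sin t + d) * m t"
proof -
  define b where "b = l * (1 - (norm z)\<^sup>2)"
  define y where "y = e * (cnj z)\<^sup>2"
  define N where "N = (\<lambda>t. (norm (cis t - z))\<^sup>2)"
  have pos: "N t > 0" for t using cis_minus_nz[OF z(1)] by (auto simp: N_def)
  have "poisson_deriv z e t = 2 * (Re e * cos t + Im e * sin t - 2 * Re (e * cnj z) + Re y * cos t - Im y * sin t) / (N t)\<^sup>2" for t
  proof -
    have "e * cis t / (cis t - z)\<^sup>2 = e * cis t * (cnj (cis t - z))\<^sup>2 / of_real ((N t)\<^sup>2)"
    proof -
      have "of_real ((N t)\<^sup>2) = (cis t - z)\<^sup>2 * (cnj (cis t - z))\<^sup>2"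
      proof -
        have "complex_of_real (N t) = (cis t - z) * cnj (cis t - z)" unfolding N_def by (rule complex_norm_square)
        then show ?thesis by (simp only: of_real_power power_mult_distrib)
      qed
      then show ?thesis using cis_minus_nz[OF z, of t] by (simp add: field_simps)
    qed
    also have "e * cis t * (cnj (cis t - z))\<^sup>2 = e * (cis t * cis (- t)) * cis (- t) - 2 * (e * cnj z) * (cis t * cis (- t)) + y * cis t"
      by (simp add: y_def cis_cnj power2_eq_square algebra_simps)
    also have "\<dots> = e * cis (- t) - 2 * (e * cnj z) + y * cis t" by (simp add: cis_mult)
    finally have "poisson_deriv z e t = 2 * Re ((e * cis (- t) - 2 * (e * cnj z) + y * cis t) / of_real ((N t)\<^sup>2))"
      by (simp only: poisson_deriv_def)
    then show ?thesis by (simp only: Re_divide_of_real) (simp add: algebra_simps)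
  qed
  moreover have "l * poisson z t = b * N t / (N t)\<^sup>2" for t
    using pos[of t] by (simp add: poisson_def b_def N_def power2_eq_square)
  ultimately have "poisson_deriv z e t - l * poisson z t =
     (2 * (Re e * cos t + Im e * sin t - 2 * Re (e * cnj z) + Re y * cos t - Im y * sin t) - b * N t) * (1 / (N t)\<^sup>2)" for t
    by (simp add: diff_divide_distrib)
  moreover have "2 * (Re e * cos t + Im e * sin t - 2 * Re (e * cnj z) + Re y * cos t - Im y * sin t) - b * N t =
    (2 * Re e + 2 * Re y + 2 * b * Re z) * cos t + (2 * Im e - 2 * Im y + 2 * b * Im z) * sin t + (- 4 * Re (e * cnj z) - b * (1 + (norm z)\<^sup>2))" for t
    unfolding N_def norm_cis_minus_sq by (simp add: algebra_simps)
  ultimately have E: "poisson_deriv z e t - l * poisson z t =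
      ((2 * Re e + 2 * Re y + 2 * b * Re z) * cos t + (2 * Im e - 2 * Im y + 2 * b * Im z) * sin t
        + (- 4 * Re (e * cnj z) - b * (1 + (norm z)\<^sup>2))) * (1 / (N t)\<^sup>2)" for t by (simp only:)
  have "1 / (N t)\<^sup>2 > 0" for t using pos[of t] by simp
  with E show ?thesis
    by (intro exI[of _ "2 * Re e + 2 * Re y + 2 * b * Re z"] exI[of _ "2 * Im e - 2 * Im y + 2 * b * Im z"]
      exI[of _ "- 4 * Re (e * cnj z) - b * (1 + (norm z)\<^sup>2)"] exI[of _ "\<lambda>t. 1 / (N t)\<^sup>2"]) blast
qed

lemma bounded_power_series:
  fixes h :: "nat \<Rightarrow> complex"
  assumes h: "\<And>n. norm (h n) \<le> 1" and z: "norm z < 1"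
  shows "summable (\<lambda>n. h n * z ^ n)"
    "((\<lambda>z. \<Sum>n. h n * z ^ n) has_field_derivative (\<Sum>n. diffs h n * z ^ n)) (at z)"
    "(\<lambda>n. of_nat n * h n * z ^ (n - 1)) sums deriv (\<lambda>z. \<Sum>n. h n * z ^ n) z"
proof -
  have s: "summable (\<lambda>n. h n * y ^ n)" if y: "norm y < 1" for y
  proof (rule summable_comparison_test'[where N = 0])
    show "summable (\<lambda>n. norm y ^ n)" using y by (intro summable_geometric) simp
    show "norm (h n * y ^ n) \<le> norm y ^ n" for n
      using h[of n] by (simp add: norm_mult norm_power mult_left_le_one_le)
  qed
  show "summable (\<lambda>n. h n * z ^ n)" by (rule s[OF z])
  define K where "K = complex_of_real ((1 + norm z) / 2)"
  have nK: "norm K = (1 + norm z) / 2" unfolding K_def norm_of_real by (rule abs_of_nonneg) (simp add: add_nonneg_nonneg)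
  then have K: "norm K < 1" "norm z < norm K" using z by (auto simp: field_simps)
  show d: "((\<lambda>z. \<Sum>n. h n * z ^ n) has_field_derivative (\<Sum>n. diffs h n * z ^ n)) (at z)"
    by (rule termdiffs_strong[OF s[OF K(1)] K(2)])
  have "summable (\<lambda>n. diffs h n * z ^ n)" by (rule termdiff_converges[of z 1]) (use z s in auto)
  then have "(\<lambda>n. diffs h n * z ^ n) sums deriv (\<lambda>z. \<Sum>n. h n * z ^ n) z"
    using DERIV_imp_deriv[OF d] by (simp add: summable_sums)
  then have "(\<lambda>n. of_nat (Suc n) * h (Suc n) * z ^ (Suc n - 1)) sums deriv (\<lambda>z. \<Sum>n. h n * z ^ n) z"
    by (simp only: diffs_def diff_Suc_1)
  then have "(\<lambda>n. of_nat n * h n * z ^ (n - 1)) sums (deriv (\<lambda>z. \<Sum>n. h n * z ^ n) z + of_nat 0 * h 0 * z ^ (0 - 1))"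
    by (simp only: sums_Suc_iff[of "\<lambda>n. of_nat n * h n * z ^ (n - 1)"])
  then show "(\<lambda>n. of_nat n * h n * z ^ (n - 1)) sums deriv (\<lambda>z. \<Sum>n. h n * z ^ n) z" by simp
qed

lemma poisson_rotate:
  assumes "0 \<le> r" "r < 1"
  shows "ab_kernel 0 0 r (t - s) = of_real (poisson (of_real r * cis t) s)"
proof -
  have n: "norm (of_real r * cis (t - s)) < 1" using assms by (simp add: norm_mult)
  define v where "v = of_real r * cis (t - s)"
  have nv: "norm v = r" "norm (cnj v) = r" using n assms by (auto simp: v_def norm_mult)
  have v: "1 - v \<noteq> 0" "1 - cnj v \<noteq> 0" using nv assms by (metis eq_iff_diff_eq_0 norm_one less_irrefl)+
  have r2: "1 - r\<^sup>2 > 0" using assms by (simp add: power_less_one_iff abs_square_less_1)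
  have "ab_kernel 0 0 r (t - s) = of_real (1 - r\<^sup>2) / ((1 - v) * cnj (1 - v))"
    using v r2 by (simp add: ab_kernel_def v_def powr_minus cis_cnj divide_inverse)
  also have "(1 - v) * cnj (1 - v) = of_real ((norm (1 - v))\<^sup>2)" by (simp only: complex_norm_square)
  also have "norm (1 - v) = norm (cis s - of_real r * cis t)"
  proof -
    have "cis s - of_real r * cis t = cis s * (1 - v)" by (simp add: v_def algebra_simps cis_mult)
    then show ?thesis by (simp add: norm_mult)
  qed
  finally show ?thesis using assms by (simp add: poisson_def norm_mult)
qed

context circle_homeo
begin

definition w :: "real \<Rightarrow> complex" where "w t = cis (\<phi> t)"

definition coeff :: "int \<Rightarrow> complex" where
  "coeff k = integral {-pi..pi} (\<lambda>s. w s * cis (- (of_int k * s))) / (2 * of_real pi)"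

definition hol :: "complex \<Rightarrow> complex" where "hol z = (\<Sum>n. coeff (int n) * z ^ n)"

text \<open>Conjugated coefficients make this holomorphic; its conjugate carries the negative
  frequencies. The constant term is left to \<open>hol\<close>.\<close>

definition antihol :: "complex \<Rightarrow> complex" where
  "antihol z = (\<Sum>n. (if n = 0 then 0 else cnj (coeff (- int n))) * z ^ n)"

definition ext :: "complex \<Rightarrow> complex" where "ext z = hol z + cnj (antihol z)"

lemma continuous_on_w: "continuous_on S w"
  unfolding w_def by (intro continuous_intros continuous_on_subset[OF cont]) simp

lemma w_periodic: "w (t + 2 * pi) = w t"
  by (simp add: w_def turn cis_mult[symmetric])

lemma norm_w [simp]: "norm (w t) = 1"
  by (simp add: w_def)

lemma integral_w: "integral {-pi..pi} (\<lambda>s. w s * cis (of_int k * s)) = 2 * of_real pi * coeff (- k)"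
  by (simp add: coeff_def)

lemma norm_coeff_le: "norm (coeff k) \<le> 1"
proof -
  have "norm (integral {-pi..pi} (\<lambda>s. w s * cis (- (of_int k * s)))) \<le> integral {-pi..pi} (\<lambda>s. 1)"
    by (rule integral_norm_bound_integral)
       (auto intro!: integrable_continuous_real continuous_intros continuous_on_w simp: norm_mult)
  then show ?thesis by (simp add: coeff_def norm_divide)
qed

lemma norm_antihol_coeff_le: "norm (if n = 0 then 0 else cnj (coeff (- int n))) \<le> 1"
  using norm_coeff_le by simp

lemma holomorphic_on_hol: "hol holomorphic_on ball 0 1" "antihol holomorphic_on ball 0 1"
  unfolding hol_def[abs_def] antihol_def[abs_def]
  using bounded_power_series(2)[of "\<lambda>n. coeff (int n)"] bounded_power_series(2)[of "\<lambda>n. if n = 0 then 0 else cnj (coeff (- int n))"]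
    norm_coeff_le norm_antihol_coeff_le
  by (auto simp: holomorphic_on_open intro!: exI)

lemma ab_harmonic_ext: "ab_harmonic 0 0 ext"
  by (rule ab_harmonic_holomorphic_sum[OF holomorphic_on_hol]) (simp add: ext_def)

lemma has_ab_expansion_ext: "has_ab_expansion 0 0 ext coeff"
  unfolding has_ab_expansion_def pos_term_0_0 neg_term_0_0
proof (intro conjI ballI)
  have "norm (coeff k) powr (1 / real_of_int \<bar>k\<bar>) \<le> 1" for k
  proof -
    have "norm (coeff k) powr (1 / real_of_int \<bar>k\<bar>) \<le> 1 powr (1 / real_of_int \<bar>k\<bar>)"
      by (rule powr_mono2) (auto simp: norm_coeff_le)
    then show ?thesis by simp
  qed
  then show "Limsup (filtercomap abs at_top) (\<lambda>k::int. ereal (norm (coeff k) powr (1 / real_of_int \<bar>k\<bar>))) \<le> 1"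
    by (intro Limsup_bounded always_eventually) simp
  fix z :: complex assume "z \<in> ball 0 1"
  then have z: "norm z < 1" by simp
  let ?g = "\<lambda>n. (if n = 0 then 0 else cnj (coeff (- int n)))"
  show "summable (\<lambda>k. coeff (int k) * z ^ k)"
    by (rule bounded_power_series(1)[OF norm_coeff_le z])
  have "(\<lambda>n. ?g n * z ^ n) sums antihol z"
    unfolding antihol_def by (rule summable_sums[OF bounded_power_series(1)[OF norm_antihol_coeff_le z]])
  then have "(\<lambda>n. cnj (?g n * z ^ n)) sums (cnj (antihol z))" by (simp only: sums_cnj)
  then have "(\<lambda>n. cnj (?g (Suc n) * z ^ Suc n)) sums (cnj (antihol z) - cnj (?g 0 * z ^ 0))"
    by (subst sums_Suc_iff) simp
  then have a: "(\<lambda>k. coeff (- int (Suc k)) * cnj z ^ Suc k) sums cnj (antihol z)" by simp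
  then show "summable (\<lambda>k. coeff (- int (Suc k)) * cnj z ^ Suc k)" by (rule sums_summable)
  show "ext z = (\<Sum>k. coeff (int k) * z ^ k) + (\<Sum>k. coeff (- int (Suc k)) * cnj z ^ Suc k)"
    using sums_unique[OF a] by (simp only: ext_def hol_def)
qed

lemma poisson_integral:
  assumes z: "norm z < 1"
  shows "integral {-pi..pi} (\<lambda>s. w s * of_real (poisson z s)) = 2 * of_real pi * ext z"
proof -
  let ?g = "\<lambda>n. (if n = 0 then 0 else cnj (coeff (- int n)))"
  have "fterm (\<lambda>k. poisson_coeff z k * integral {-pi..pi} (\<lambda>s. w s * cis (of_int k * s))) 0 sums
      integral {-pi..pi} (\<lambda>s. w s * fsum (poisson_coeff z) s)"
    by (rule fsum_integral_sums[OF summable_poisson_coeff[OF z] continuous_on_w])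
  moreover have "fterm (\<lambda>k. poisson_coeff z k * integral {-pi..pi} (\<lambda>s. w s * cis (of_int k * s))) 0 =
      (\<lambda>n. 2 * of_real pi * (coeff (int n) * z ^ n + cnj (?g n * z ^ n)))"
    unfolding integral_w by (rule HOL.ext) (auto simp: fterm_def poisson_coeff_def algebra_simps)
  moreover have "(\<lambda>n. 2 * of_real pi * (coeff (int n) * z ^ n + cnj (?g n * z ^ n))) sums (2 * of_real pi * (hol z + cnj (antihol z)))"
  proof (intro sums_mult sums_add)
    show "(\<lambda>n. coeff (int n) * z ^ n) sums hol z"
      unfolding hol_def by (rule summable_sums[OF bounded_power_series(1)[OF norm_coeff_le z]])
    have "(\<lambda>n. ?g n * z ^ n) sums antihol z"
      unfolding antihol_def by (rule summable_sums[OF bounded_power_series(1)[OF norm_antihol_coeff_le z]])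
    then show "(\<lambda>n. cnj (?g n * z ^ n)) sums (cnj (antihol z))" by (simp only: sums_cnj)
  qed
  ultimately show ?thesis by (simp add: fsum_poisson_coeff[OF z] ext_def sums_iff)
qed

lemma poisson_deriv_integral:
  assumes z: "norm z < 1"
  shows "integral {-pi..pi} (\<lambda>s. w s * of_real (poisson_deriv z e s)) = 2 * of_real pi * (deriv hol z * e + cnj (deriv antihol z * e))"
proof -
  let ?g = "\<lambda>n. (if n = 0 then 0 else cnj (coeff (- int n)))"
  let ?s = "\<lambda>n. 2 * of_real pi * (of_nat n * coeff (int n) * z ^ (n - 1) * e + cnj (of_nat n * ?g n * z ^ (n - 1) * e))"
  have "fterm (\<lambda>k. poisson_deriv_coeff z e k * integral {-pi..pi} (\<lambda>s. w s * cis (of_int k * s))) 0 sums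
      integral {-pi..pi} (\<lambda>s. w s * fsum (poisson_deriv_coeff z e) s)"
    by (rule fsum_integral_sums[OF summable_poisson_deriv_coeff[OF z] continuous_on_w])
  moreover have "fterm (\<lambda>k. poisson_deriv_coeff z e k * integral {-pi..pi} (\<lambda>s. w s * cis (of_int k * s))) 0 = ?s"
    unfolding integral_w by (rule HOL.ext) (auto simp: fterm_def poisson_deriv_coeff_def algebra_simps)
  moreover have "?s sums (2 * of_real pi * (deriv hol z * e + cnj (deriv antihol z * e)))"
  proof (intro sums_mult sums_add sums_mult2)
    show "(\<lambda>n. of_nat n * coeff (int n) * z ^ (n - 1)) sums deriv hol z"
      unfolding hol_def[abs_def] by (rule bounded_power_series(3)[OF norm_coeff_le z])
    have "(\<lambda>n. of_nat n * ?g n * z ^ (n - 1) * e) sums (deriv antihol z * e)"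
      unfolding antihol_def[abs_def] by (rule sums_mult2[OF bounded_power_series(3)[OF norm_antihol_coeff_le z]])
    then show "(\<lambda>n. cnj (of_nat n * ?g n * z ^ (n - 1) * e)) sums (cnj (deriv antihol z * e))" by (simp only: sums_cnj)
  qed
  ultimately show ?thesis by (simp add: fsum_poisson_deriv_coeff[OF z] sums_iff)
qed

end

section \<open>Kneser's theorem for the Poisson extension\<close>

context circle_homeo
begin

lemma integral_poisson_diff:
  assumes z: "norm z < 1"
  shows "integral {-pi..pi} (\<lambda>t. (cis (\<phi> t) - c) * of_real (poisson z t)) = 2 * of_real pi * (ext z - c)"
    "integral {-pi..pi} (\<lambda>t. (cis (\<phi> t) - c) * of_real (poisson_deriv z e t)) =
      2 * of_real pi * (deriv hol z * e + cnj (deriv antihol z * e))"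
proof -
  have i: "integral {-pi..pi} (\<lambda>t. (w t - c) * of_real (g t)) =
      integral {-pi..pi} (\<lambda>t. w t * of_real (g t)) - c * integral {-pi..pi} (\<lambda>t. of_real (g t))"
    if "continuous_on {-pi..pi} g" for g :: "real \<Rightarrow> real"
    unfolding left_diff_distrib integral_mult_right[symmetric]
    by (rule Henstock_Kurzweil_Integration.integral_diff)
       (auto intro!: integrable_continuous_real continuous_intros continuous_on_w that)
  show "integral {-pi..pi} (\<lambda>t. (cis (\<phi> t) - c) * of_real (poisson z t)) = 2 * of_real pi * (ext z - c)"
    using poisson_integrals(1)[OF z, of 0] i[OF continuous_on_poisson[OF z]]
    by (simp add: w_def[symmetric] poisson_integral[OF z] poisson_coeff_def algebra_simps)
  show "integral {-pi..pi} (\<lambda>t. (cis (\<phi> t) - c) * of_real (poisson_deriv z e t)) =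
      2 * of_real pi * (deriv hol z * e + cnj (deriv antihol z * e))"
    using poisson_integrals(2)[OF z, of e 0] i[OF continuous_on_poisson_deriv[OF z]]
    by (simp add: w_def[symmetric] poisson_deriv_integral[OF z] poisson_deriv_coeff_def)
qed

lemma poisson_eq_iff:
  assumes z: "norm z < 1" "norm z' < 1" and eq: "\<And>t. poisson z t = l * poisson z' t"
  shows "z = z'"
proof -
  have "integral {-pi..pi} (\<lambda>s. complex_of_real (poisson z s) * cis (- (of_int m * s))) =
      of_real l * integral {-pi..pi} (\<lambda>s. complex_of_real (poisson z' s) * cis (- (of_int m * s)))" for m
    unfolding integral_mult_right[symmetric] by (simp add: eq mult.assoc)
  then have "poisson_coeff z m = of_real l * poisson_coeff z' m" for m
    by (simp add: poisson_integrals z)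
  \<comment> \<open>Index 0 gives l = 1, and then index -1 gives z = z'.\<close>
  from this[of 0] this[of "-1"] show ?thesis by (simp add: poisson_coeff_def)
qed

lemma poisson_deriv_not_multiple:
  assumes z: "norm z < 1" and e: "e \<noteq> 0"
  shows "\<exists>t. poisson_deriv z e t \<noteq> l * poisson z t"
proof (rule ccontr)
  assume "\<nexists>t. poisson_deriv z e t \<noteq> l * poisson z t"
  then have eq: "poisson_deriv z e t = l * poisson z t" for t by blast
  have "integral {-pi..pi} (\<lambda>s. complex_of_real (poisson_deriv z e s) * cis (- (of_int m * s))) =
      of_real l * integral {-pi..pi} (\<lambda>s. complex_of_real (poisson z s) * cis (- (of_int m * s)))" for m
    unfolding integral_mult_right[symmetric] by (simp add: eq mult.assoc)
  then have "poisson_deriv_coeff z e m = of_real l * poisson_coeff z m" for m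
    by (simp add: poisson_integrals z)
  \<comment> \<open>Index 0 gives l = 0, and then index -1 gives e = 0.\<close>
  from this[of 0] this[of "-1"] show False using e by (simp add: poisson_coeff_def poisson_deriv_coeff_def)
qed

lemma poisson_periodic: "poisson z (t + 2 * pi) = poisson z t" "poisson_deriv z e (t + 2 * pi) = poisson_deriv z e t"
  by (simp_all add: poisson_def poisson_deriv_def cis_mult[symmetric])

text \<open>Let q be the direction of \<open>ext z\<close>. The nonnegative function (1 - Re(cnj q
  w)) times the kernel has integral 2 pi (1 - |ext z|). If this were at most 0 the function would
  vanish, and \<open>w\<close> would be constant.\<close>

lemma norm_ext_less:
  assumes z: "norm z < 1" shows "norm (ext z) < 1"
proof (rule ccontr)
  assume "\<not> norm (ext z) < 1"
  then have n: "norm (ext z) \<ge> 1" by simp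
  define q where "q = sgn (ext z)"
  have q: "norm q = 1" "cnj q * ext z = of_real (norm (ext z))"
  proof -
    have "ext z \<noteq> 0" using n by auto
    then show "norm q = 1" by (simp add: q_def norm_sgn)
    have "cnj (sgn (ext z)) * ext z = (ext z * cnj (ext z)) / of_real (norm (ext z))" by (simp add: sgn_eq)
    also have "\<dots> = of_real (norm (ext z))"
      unfolding complex_norm_square[symmetric] using \<open>ext z \<noteq> 0\<close> by (simp add: power2_eq_square)
    finally show "cnj q * ext z = of_real (norm (ext z))" by (simp add: q_def)
  qed
  define h where "h = (\<lambda>t. (1 - Re (cnj q * w t)) * poisson z t)"
  have hc: "continuous_on {-pi..pi} h"
    unfolding h_def by (intro continuous_intros continuous_on_w continuous_on_poisson z)
  have le: "Re (cnj q * w t) \<le> 1" for t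
    using complex_Re_le_cmod[of "cnj q * w t"] q by (simp add: norm_mult)
  then have h0: "h t \<ge> 0" for t using poisson_pos[OF z, of t] by (simp add: h_def)
  have "integral {-pi..pi} h = - Re (integral {-pi..pi} (\<lambda>t. cnj q * ((cis (\<phi> t) - q) * of_real (poisson z t))))"
  proof -
    have "h t = - Re (cnj q * ((cis (\<phi> t) - q) * of_real (poisson z t)))" for t
    proof -
      have "cnj q * q = of_real ((norm q)\<^sup>2)" by (simp only: complex_norm_square mult.commute)
      then have "cnj q * q = 1" using q by simp
      then have "cnj q * ((cis (\<phi> t) - q) * of_real (poisson z t)) = (cnj q * w t - 1) * of_real (poisson z t)"
        by (simp add: w_def algebra_simps)
      then show ?thesis by (simp only: h_def Re_complex_of_real times_complex.sel Im_complex_of_real) (simp add: algebra_simps)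
    qed
    moreover have "(\<lambda>t. cnj q * ((cis (\<phi> t) - q) * of_real (poisson z t))) integrable_on {-pi..pi}"
      unfolding w_def[symmetric]
      by (intro integrable_continuous_real continuous_intros continuous_on_w continuous_on_poisson z)
    moreover from calculation(1) have "h = (\<lambda>t. - Re (cnj q * ((cis (\<phi> t) - q) * of_real (poisson z t))))" by blast
    ultimately show ?thesis
      using integral_linear[OF _ bounded_linear_Re, of "\<lambda>t. cnj q * ((cis (\<phi> t) - q) * of_real (poisson z t))" "{-pi..pi}"]
      by (simp only: o_def Henstock_Kurzweil_Integration.integral_neg)
  qed
  also have "\<dots> = - Re (cnj q * (2 * of_real pi * (ext z - q)))"
    by (simp only: integral_mult_right integral_poisson_diff[OF z])
  also have "cnj q * (2 * of_real pi * (ext z - q)) = 2 * of_real pi * (cnj q * ext z - q * cnj q)"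
    by (simp add: algebra_simps)
  also have "\<dots> = of_real (2 * pi * (norm (ext z) - 1))"
    unfolding q(2) complex_norm_square[symmetric] using q(1) by simp
  finally have "integral {-pi..pi} h = 2 * pi * (1 - norm (ext z))" by (simp add: algebra_simps)
  moreover have "integral {-pi..pi} h \<ge> 0" by (rule integral_nonneg[OF integrable_continuous_real[OF hc]]) (rule h0)
  ultimately have "integral {-pi..pi} h = 0" using n pi_gt_zero by (auto simp: zero_le_mult_iff simp del: pi_gt_zero)
  then have h: "h t = 0" if "t \<in> {-pi..pi}" for t
    using integral_eq_0_iff[OF hc _ h0] that by simp
  have wq: "w t = q" if "t \<in> {-pi..pi}" for t
  proof -
    have "Re (cnj q * w t) = 1" using h[OF that] poisson_pos[OF z, of t] by (simp add: h_def)
    moreover have "norm (cnj q * w t) = 1" using q by (simp add: norm_mult)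
    ultimately have "cnj q * w t = 1" using cmod_power2[of "cnj q * w t"] by (simp add: complex_eq_iff)
    then have "q * (cnj q * w t) = q" by simp
    moreover have "q * cnj q = 1" using q by (simp add: complex_norm_square[symmetric])
    ultimately show ?thesis by (simp flip: mult.assoc)
  qed
  have "cis (\<phi> 0) = cis (\<phi> 1)" using wq[of 0] wq[of 1] pi_gt3 by (simp add: w_def)
  moreover have "\<phi> 0 < \<phi> 1" "\<phi> 1 < \<phi> 0 + 2 * pi" using less_iff[of 0 1] less_iff[of 1 "0 + 2 * pi"] turn[of 0] pi_gt3 by auto
  ultimately show False using cis_eqD[of "\<phi> 0" "\<phi> 1"] by auto
qed

text \<open>Two points with the same image c would make the integrals of w - c against both Poisson
  kernels vanish.\<close>

lemma inj_on_ext: "inj_on ext (ball 0 1)"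
proof (rule inj_onI, rule ccontr)
  fix z z' assume "z \<in> ball 0 1" "z' \<in> ball 0 1" and eq: "ext z = ext z'" and ne: "z \<noteq> z'"
  then have z: "norm z < 1" "norm z' < 1" by auto
  show False
  proof (rule no_common_chord[where X = "poisson z" and Y = "poisson z'" and c = "ext z"])
    show "\<exists>t. poisson z t \<noteq> l * poisson z' t" for l using poisson_eq_iff[OF z, of l] ne by blast
    show "\<exists>p q d m. \<forall>t. m t > (0::real) \<and> poisson z t - l * poisson z' t = (p * cos t + q * sin t + d) * m t" for l
      by (rule poisson_affine[OF z])
  qed (use z eq in \<open>auto simp: continuous_on_poisson poisson_periodic poisson_pos norm_ext_less integral_poisson_diff\<close>)
qed

text \<open>The infinitesimal form of injectivity: equal norms give a direction e in which the
  derivative of \<open>ext\<close> vanishes, and the derivative of the Poisson kernel in that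
  direction takes the place of the second kernel.\<close>

lemma norm_deriv_ne:
  assumes z: "norm z < 1"
  shows "norm (deriv hol z) \<noteq> norm (deriv antihol z)"
proof
  assume n: "norm (deriv hol z) = norm (deriv antihol z)"
  have "\<exists>e. e \<noteq> 0 \<and> deriv hol z * e + cnj (deriv antihol z * e) = 0"
  proof (cases "deriv hol z = 0")
    case True then show ?thesis using n by (intro exI[of _ 1]) auto
  next
    case False
    \<comment> \<open>The square root has norm 1, so cnj e = 1 / e and the real-linear equation
      reduces to one for e^2.\<close>
    define e where "e = csqrt (- cnj (deriv antihol z) / deriv hol z)"
    have e2: "e\<^sup>2 = - cnj (deriv antihol z) / deriv hol z" by (simp add: e_def)
    have "(norm e)\<^sup>2 = norm (e\<^sup>2)" by (simp add: norm_power)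
    also have "\<dots> = 1" unfolding e2 using False n by (simp add: norm_divide) (metis norm_eq_zero)
    finally have "e * cnj e = 1" by (simp add: complex_norm_square[symmetric])
    then have "deriv hol z * e + cnj (deriv antihol z * e) = cnj e * (deriv hol z * e\<^sup>2 + cnj (deriv antihol z))"
      by (simp add: power2_eq_square algebra_simps)
    also have "\<dots> = 0" unfolding e2 using False by simp
    finally show ?thesis using \<open>e * cnj e = 1\<close> by (intro exI[of _ e]) auto
  qed
  then obtain e where e: "e \<noteq> 0" "deriv hol z * e + cnj (deriv antihol z * e) = 0" by blast
  show False
  proof (rule no_common_chord[where X = "poisson_deriv z e" and Y = "poisson z" and c = "ext z"])
    show "\<exists>t. poisson_deriv z e t \<noteq> l * poisson z t" for l by (rule poisson_deriv_not_multiple[OF z e(1)])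
    show "\<exists>p q d m. \<forall>t. m t > (0::real) \<and> poisson_deriv z e t - l * poisson z t = (p * cos t + q * sin t + d) * m t" for l
      by (rule poisson_deriv_affine[OF z])
    show "integral {-pi..pi} (\<lambda>t. (cis (\<phi> t) - ext z) * complex_of_real (poisson_deriv z e t)) = 0"
      by (simp only: integral_poisson_diff(2)[OF z] e(2)) simp
  qed (use z in \<open>auto simp: continuous_on_poisson continuous_on_poisson_deriv poisson_periodic poisson_pos norm_ext_less integral_poisson_diff(1)\<close>)
qed

text \<open>The difference of the two norms is continuous and never 0 on the connected disc. At the
  origin the antiholomorphic derivative is the conjugate of \<open>coeff (-1)\<close>, so the
  difference is positive there.\<close>

lemma sense_preserving_ext:
  assumes "coeff (-1) = 0"
  shows "sense_preserving ext"
proof -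
  define J where "J = (\<lambda>z. norm (deriv hol z) - norm (deriv antihol z))"
  have Jc: "continuous_on (ball 0 1) J"
    unfolding J_def
    by (intro continuous_intros holomorphic_on_imp_continuous_on holomorphic_deriv holomorphic_on_hol open_ball)
  have "deriv antihol 0 = 0"
  proof -
    have "(\<lambda>n. of_nat n * (if n = 0 then 0 else cnj (coeff (- int n))) * 0 ^ (n - 1)) sums deriv antihol 0"
      unfolding antihol_def[abs_def] by (rule bounded_power_series(3)[OF norm_antihol_coeff_le]) simp
    moreover have "of_nat n * (if n = 0 then 0 else cnj (coeff (- int n))) * 0 ^ (n - 1) = 0" for n
      using assms by (cases "n = 1") auto
    ultimately have "(\<lambda>n. 0) sums deriv antihol 0" by (simp only:)
    then show ?thesis by (simp add: sums_iff)
  qed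
  then have J0: "J 0 > 0" using norm_deriv_ne[of 0] by (simp add: J_def)
  have "J z > 0" if z: "z \<in> ball 0 1" for z
  proof (rule ccontr)
    assume "\<not> J z > 0"
    then have "{J z..J 0} \<subseteq> J ` ball 0 1"
      by (intro connected_contains_Icc connected_continuous_image Jc) (use z in auto)
    then have "0 \<in> J ` ball 0 1" using J0 \<open>\<not> J z > 0\<close> by auto
    then show False using norm_deriv_ne by (auto simp: J_def)
  qed
  moreover have "wirtinger_z ext z = deriv hol z" "wirtinger_zbar ext z = cnj (deriv antihol z)" if "z \<in> ball 0 1" for z
    using wirtinger_harmonic[OF holomorphic_on_hol _ that, of ext] by (auto simp: ext_def)
  ultimately show ?thesis by (simp add: sense_preserving_def J_def)
qed

section \<open>Boundary values and surjectivity\<close>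

lemma continuous_on_ext:
  assumes sm: "summable (fnorm coeff)"
  shows "continuous_on (cball 0 1) ext"
proof -
  have "continuous_on (cball 0 1) (\<lambda>z::complex. \<Sum>n. b n * z ^ n)" if b: "\<And>n. norm (b n) \<le> fnorm coeff n" for b
  proof -
    have "uniform_limit (cball 0 1) (\<lambda>N z::complex. \<Sum>n<N. b n * z ^ n) (\<lambda>z. \<Sum>n. b n * z ^ n) sequentially"
    proof (rule Weierstrass_m_test[OF _ sm])
      fix n and z :: complex assume "z \<in> cball 0 1"
      then have "norm (b n) * norm z ^ n \<le> fnorm coeff n * 1" by (intro mult_mono b power_le_one fnorm_nonneg) auto
      then show "norm (b n * z ^ n) \<le> fnorm coeff n" by (simp add: norm_mult norm_power)
    qed
    then show ?thesis by (rule uniform_limit_theorem[rotated]) (auto intro!: always_eventually continuous_intros)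
  qed
  then show ?thesis
    unfolding ext_def[abs_def] hol_def[abs_def] antihol_def[abs_def]
    by (intro continuous_intros) (auto simp: fnorm_def)
qed

text \<open>The radial limit lemma with \<alpha> = \<beta> = 0 is applied to the constant sequence
  \<open>w\<close>, whose primitive is differentiable everywhere. Continuity on the closed disc
  identifies the radial limit with the boundary value.\<close>

lemma ext_boundary:
  assumes sm: "summable (fnorm coeff)"
  shows "ext (cis t) = w t"
proof -
  have c: "((\<lambda>r. ext (of_real r * cis t)) \<longlongrightarrow> ext (cis t)) (at_left 1)"
  proof -
    have "((\<lambda>r. of_real r * cis t) \<longlongrightarrow> of_real 1 * cis t) (at_left 1)" by (intro tendsto_intros)
    then have "((\<lambda>r. of_real r * cis t) \<longlongrightarrow> cis t) (at_left 1)" by simp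
    moreover have "eventually (\<lambda>r::real. 0 < r \<and> r < 1) (at_left 1)"
      by (rule eventually_at_leftI[of 0]) auto
    then have "eventually (\<lambda>r. of_real r * cis t \<in> cball 0 1) (at_left 1)"
      by eventually_elim (auto simp: norm_mult)
    ultimately show ?thesis by (intro continuous_on_tendsto_compose[OF continuous_on_ext[OF sm]]) simp_all
  qed
  have V: "integral {-pi..pi} (\<lambda>s. ab_kernel 0 0 r s * w (t - s)) = 2 * of_real pi * ext (of_real r * cis t)"
    if r: "1/2 \<le> r" "r < 1" for r
  proof -
    have r0: "0 \<le> r" using r by simp
    let ?k = "\<lambda>s. ab_kernel 0 0 r (t - s) * w s"
    have kc: "continuous_on UNIV ?k"
      by (intro continuous_intros continuous_on_w continuous_on_compose2[OF continuous_on_ab_kernel[OF r0 r(2), of UNIV]]) auto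
    have kp: "?k (s + 2 * pi) = ?k s" for s
      by (simp add: poisson_rotate[OF r0 r(2)] poisson_periodic w_periodic)
    have "integral {-pi..pi} (\<lambda>s. ab_kernel 0 0 r s * w (t - s)) = integral {-pi..pi} (\<lambda>s. ?k (- s + t))"
      by simp
    also have "\<dots> = integral {-pi..pi} (\<lambda>s. ?k (s + t))"
      using Henstock_Kurzweil_Integration.integral_reflect_real[of pi "-pi" "\<lambda>s. ?k (s + t)"] by simp
    also have "\<dots> = integral {-pi..pi} ?k" by (rule integral_periodic_shift[OF kc kp])
    also have "\<dots> = 2 * of_real pi * ext (of_real r * cis t)"
      using poisson_integral[of "of_real r * cis t"] r r0
      by (simp add: poisson_rotate[OF r0 r(2)] norm_mult mult.commute)
    finally show ?thesis .
  qed
  define F where "F = (\<lambda>x. integral {t - 5..x} w)"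
  have Fd: "(F has_vector_derivative w x) (at x)" if "\<bar>x - t\<bar> \<le> pi" for x
  proof -
    have b: "t - 5 < x" "x < t + 5" using that pi_less_4 by auto
    have "(F has_vector_derivative w x) (at x within {t - 5..t + 5})"
      unfolding F_def by (rule integral_has_vector_derivative[OF continuous_on_w]) (use b in auto)
    moreover have "at x within {t - 5..t + 5} = at x" using b by (intro at_within_Icc_at) auto
    ultimately show ?thesis by simp
  qed
  have "((\<lambda>r. 2 * of_real pi * ext (of_real r * cis t)) \<longlongrightarrow> 2 * of_real pi * of_real (ab_limit 0 0) * w t) (at_left 1)"
  proof (rule kernel_radial_limit[where f = "\<lambda>n. w" and \<Phi> = "\<lambda>n. F" and F = F and t = t and \<alpha> = 0 and \<beta> = 0
      and V = "\<lambda>r. 2 * of_real pi * ext (of_real r * cis t)"])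
    show "(0::real) < 1 + 0 + 0" by simp
    show "continuous_on UNIV w" by (rule continuous_on_w)
    show "(F has_vector_derivative w x) (at x)" if "\<bar>x - t\<bar> \<le> pi" for x by (rule Fd[OF that])
    show "(F has_vector_derivative w t) (at t)" by (rule Fd) simp
    show "\<exists>N. \<forall>n\<ge>N. \<forall>x. \<bar>x - t\<bar> \<le> pi \<longrightarrow> norm (F x - F x) < e" if "e > 0" for e :: real using that by simp
    show "(\<lambda>n. integral {-pi..pi} (\<lambda>s. ab_kernel 0 0 r s * w (t - s))) \<longlonglongrightarrow> 2 * of_real pi * ext (of_real r * cis t)"
      if "1/2 \<le> r" "r < 1" for r unfolding V[OF that] by (rule tendsto_const)
    show "norm (F x - F t) \<le> \<bar>x - t\<bar>" if x: "\<bar>x - t\<bar> \<le> pi" for x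
    proof -
      have "norm (F x - F t) \<le> 1 * norm (x - t)"
      proof (rule differentiable_bound[where f' = "\<lambda>y h. h *\<^sub>R w y" and S = "cball t pi"])
        show "(F has_derivative (\<lambda>h. h *\<^sub>R w y)) (at y within cball t pi)" if "y \<in> cball t pi" for y
        proof -
          have "\<bar>y - t\<bar> \<le> pi" using that by (simp add: dist_real_def abs_minus_commute)
          from Fd[OF this] show ?thesis unfolding has_vector_derivative_def by (rule has_derivative_at_withinI)
        qed
        show "onorm (\<lambda>h. h *\<^sub>R w y) \<le> 1" for y by (rule onorm_le) simp
        show "x \<in> cball t pi" using x by (simp add: dist_real_def abs_minus_commute)
      qed simp_all
      then show ?thesis by simp
    qed
  qed
  moreover have "((\<lambda>r. 2 * of_real pi * ext (of_real r * cis t)) \<longlongrightarrow> 2 * of_real pi * ext (cis t)) (at_left 1)"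
    by (intro tendsto_intros c)
  ultimately have "2 * of_real pi * of_real (ab_limit 0 0) * w t = 2 * of_real pi * ext (cis t)"
    by (rule tendsto_unique[rotated]) simp
  then show ?thesis by (simp add: ab_limit_def)
qed

text \<open>The image is open by invariance of domain. It is also closed in the disc: the closed
  disc has compact image, and boundary points go to the circle. Connectedness does the rest.\<close>

lemma ext_image:
  assumes sm: "summable (fnorm coeff)"
  shows "ext ` ball 0 1 = ball 0 1"
proof -
  have sub: "ext ` ball 0 1 \<subseteq> ball 0 1" using norm_ext_less by auto
  have "open (ext ` ball 0 1)"
    by (rule invariance_of_domain[OF _ open_ball inj_on_ext]) (rule continuous_on_subset[OF continuous_on_ext[OF sm]], auto)
  then have "openin (top_of_set (ball 0 1)) (ext ` ball 0 1)" using sub by (simp add: openin_open_eq)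
  moreover have "closedin (top_of_set (ball 0 1)) (ext ` ball 0 1)"
  proof -
    have "compact (ext ` cball 0 1)" by (rule compact_continuous_image[OF continuous_on_ext[OF sm] compact_cball])
    moreover have "ext ` ball 0 1 = ball 0 1 \<inter> ext ` cball 0 1"
    proof
      show "ball 0 1 \<inter> ext ` cball 0 1 \<subseteq> ext ` ball 0 1"
      proof clarify
        fix z :: complex assume z: "z \<in> cball 0 1" "ext z \<in> ball 0 1"
        have "norm z < 1"
        proof (rule ccontr)
          assume "\<not> norm z < 1"
          then have "norm z = 1" using z by simp
          then have "z = cis (Arg z)" using rcis_cmod_Arg[of z] by (simp add: rcis_def)
          then have "norm (ext z) = 1" using ext_boundary[OF sm] norm_w by metis
          then show False using z by simp
        qed
        then show "ext z \<in> ext ` ball 0 1" by auto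
      qed
    qed (use sub in auto)
    ultimately show ?thesis using compact_imp_closed by (auto simp: closedin_closed)
  qed
  ultimately have "ext ` ball 0 1 = {} \<or> ext ` ball 0 1 = ball 0 1"
    using connected_ball[of "0::complex" 1] unfolding connected_clopen by blast
  then show ?thesis by auto
qed

end

subsection \<open>The extremal family\<close>

lemma has_vector_derivative_cis_comp:
  assumes "(f has_real_derivative d) (at t)"
  shows "((\<lambda>t. cis (f t)) has_vector_derivative of_real d * (\<i> * cis (f t))) (at t)"
  unfolding has_vector_derivative_complex_iff using assms
  by (auto intro!: derivative_eq_intros simp: has_real_derivative_iff_has_vector_derivative[symmetric])

lemma fourier_integral_deriv:
  assumes d: "\<And>x. (g has_vector_derivative g' x) (at x)" and per: "g pi = g (- pi)" and c: "continuous_on UNIV g'"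
  shows "\<i> * of_int k * integral {-pi..pi} (\<lambda>s. g s * cis (- (of_int k * s))) =
    integral {-pi..pi} (\<lambda>s. g' s * cis (- (of_int k * s)))"
proof -
  have gc: "continuous_on S g" for S
    using d by (auto intro!: continuous_at_imp_continuous_on has_vector_derivative_continuous)
  have g'c: "continuous_on S g'" for S by (rule continuous_on_subset[OF c]) simp
  have e: "((\<lambda>s. cis (- (of_int k * s))) has_vector_derivative - \<i> * of_int k * cis (- (of_int k * x))) (at x)" for x
  proof -
    have "((\<lambda>s. - (of_int k * s)) has_real_derivative - of_int k) (at x)" by (auto intro!: derivative_eq_intros)
    from has_vector_derivative_cis_comp[OF this] show ?thesis by (simp add: mult_ac)
  qed
  have "((\<lambda>s. g' s * cis (- (of_int k * s)) - \<i> * of_int k * (g s * cis (- (of_int k * s)))) has_integral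
      (g pi * cis (- (of_int k * pi)) - g (-pi) * cis (- (of_int k * - pi)))) {-pi..pi}"
  proof (rule fundamental_theorem_of_calculus)
    show "((\<lambda>s. g s * cis (- (of_int k * s))) has_vector_derivative
        g' x * cis (- (of_int k * x)) - \<i> * of_int k * (g x * cis (- (of_int k * x)))) (at x within {-pi..pi})" for x
      by (rule has_vector_derivative_at_within, rule has_vector_derivative_eq_rhs[OF has_vector_derivative_mult[OF d e]])
         (simp add: algebra_simps)
  qed simp
  moreover have "cis (- (of_int k * pi)) = cis (- (of_int k * - pi))"
    using sin_npi_int[of k] by (simp add: complex_eq_iff mult.commute)
  ultimately have "integral {-pi..pi} (\<lambda>s. g' s * cis (- (of_int k * s)) - \<i> * of_int k * (g s * cis (- (of_int k * s)))) = 0"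
    using per by (simp add: integral_unique)
  moreover have "integral {-pi..pi} (\<lambda>s. g' s * cis (- (of_int k * s)) - \<i> * of_int k * (g s * cis (- (of_int k * s)))) =
      integral {-pi..pi} (\<lambda>s. g' s * cis (- (of_int k * s))) - integral {-pi..pi} (\<lambda>s. \<i> * of_int k * (g s * cis (- (of_int k * s))))"
    by (rule Henstock_Kurzweil_Integration.integral_diff) (auto intro!: integrable_continuous_real continuous_intros gc g'c)
  ultimately show ?thesis by simp
qed

text \<open>The boundary function is \<open>cis (phase a t) = \<zeta> (1 + a \<zeta>\<^sup>-\<^sup>3)\<^sup>1\<^sup>/\<^sup>3 (1 + a \<zeta>\<^sup>3)\<^sup>-\<^sup>1\<^sup>/\<^sup>3\<close> with \<open>\<zeta> = cis t\<close>. As \<open>a \<rightarrow> 1\<close> it tends to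
  the step function with values the cube roots of unity, the extremal case of the polygon inequality.\<close>

definition phase :: "real \<Rightarrow> real \<Rightarrow> real" where
  "phase a t = t - 2/3 * arctan (a * sin (3 * t) / (1 + a * cos (3 * t)))"

text \<open>The Poisson kernel of radius a at the angle 3 t + pi, hence positive.\<close>

definition phase_deriv :: "real \<Rightarrow> real \<Rightarrow> real" where
  "phase_deriv a t = (1 - a\<^sup>2) / (1 + a\<^sup>2 + 2 * a * cos (3 * t))"

context
  fixes a :: real
  assumes a: "0 \<le> a" "a < 1"
begin

lemma phase_denominators: "1 + a * cos x > 0" "1 + a\<^sup>2 + 2 * a * cos x > 0"
proof -
  have "a * (- cos x) \<le> a * 1" using a by (intro mult_left_mono) (use cos_ge_minus_one[of x] in linarith)+
  then show "1 + a * cos x > 0" using a by simp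
  have "1 + a\<^sup>2 + 2 * a * cos x = (1 - a)\<^sup>2 + 2 * (a * (1 + cos x))" by (simp add: power2_eq_square algebra_simps)
  moreover have "(1 - a)\<^sup>2 > 0" using a by simp
  moreover have "a * (1 + cos x) \<ge> 0" using a cos_ge_minus_one[of x] by (intro mult_nonneg_nonneg) linarith+
  ultimately show "1 + a\<^sup>2 + 2 * a * cos x > 0" by linarith
qed

lemma has_derivative_phase: "(phase a has_real_derivative phase_deriv a t) (at t)"
proof -
  define c s where "c = cos (3 * t)" and "s = sin (3 * t)"
  have s2: "s\<^sup>2 + c\<^sup>2 = 1" by (simp add: c_def s_def)
  have p: "1 + a * c > 0" "1 + a\<^sup>2 + 2 * a * c > 0" unfolding c_def by (rule phase_denominators)+
  define D where "D = 1 - 2/3 * (1 / (1 + (a * s / (1 + a * c))\<^sup>2) *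
      ((a * (c * 3) * (1 + a * c) - a * s * (a * (- s * 3))) / ((1 + a * c) * (1 + a * c))))"
  have "(phase a has_real_derivative D) (at t)"
  proof -
    have "((\<lambda>t. a * sin (3 * t)) has_real_derivative a * (c * 3)) (at t)"
      "((\<lambda>t. 1 + a * cos (3 * t)) has_real_derivative a * (- s * 3)) (at t)"
      by (auto intro!: derivative_eq_intros simp: c_def s_def)
    then have "((\<lambda>t. a * sin (3 * t) / (1 + a * cos (3 * t))) has_real_derivative
        (a * (c * 3) * (1 + a * c) - a * s * (a * (- s * 3))) / ((1 + a * c) * (1 + a * c))) (at t)"
      using p(1) unfolding c_def s_def by (intro DERIV_divide) simp_all
    from DERIV_chain2[OF DERIV_arctan this] show ?thesis
      unfolding phase_def[abs_def] D_def
      by (intro DERIV_diff DERIV_ident DERIV_cmult) (simp only: c_def s_def inverse_eq_divide)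
  qed
  also have "D = phase_deriv a t"
  proof -
    have e: "(1 + a * c)\<^sup>2 + (a * s)\<^sup>2 = 1 + a\<^sup>2 + 2 * a * c"
      using s2 by algebra
    have "1 / (1 + (a * s / (1 + a * c))\<^sup>2) = (1 + a * c)\<^sup>2 / ((1 + a * c)\<^sup>2 + (a * s)\<^sup>2)"
      using p by (simp add: power_divide add_divide_eq_iff)
    moreover have "a * (c * 3) * (1 + a * c) - a * s * (a * (- s * 3)) = 3 * a * (c + a)" using s2 by algebra
    ultimately have "D = 1 - 2/3 * ((1 + a * c)\<^sup>2 / (1 + a\<^sup>2 + 2 * a * c) * (3 * a * (c + a) / (1 + a * c)\<^sup>2))"
      unfolding D_def e by (simp add: power2_eq_square)
    also have "\<dots> = 1 - 2 * a * (c + a) / (1 + a\<^sup>2 + 2 * a * c)" using p by simp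
    also have "\<dots> = phase_deriv a t" unfolding phase_deriv_def c_def[symmetric] using p by (simp add: field_simps power2_eq_square)
    finally show ?thesis .
  qed
  finally show ?thesis .
qed

lemma phase_deriv_pos: "phase_deriv a t > 0"
  using phase_denominators a by (simp add: phase_deriv_def power_less_one_iff abs_square_less_1)

lemma phase_shift: "phase a (t + 2 * pi / 3) = phase a t + 2 * pi / 3"
proof -
  have "3 * (t + 2 * pi / 3) = 3 * t + 2 * pi" by simp
  then show ?thesis unfolding phase_def by (simp only: sin_periodic cos_periodic)
qed

lemma circle_homeo_phase: "circle_homeo (phase a)"
proof
  show "continuous_on UNIV (phase a)"
    using has_derivative_phase by (auto intro!: continuous_at_imp_continuous_on DERIV_isCont)
  show "strict_mono (phase a)"
    by (rule strict_monoI, rule DERIV_pos_imp_increasing, assumption)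
       (use has_derivative_phase phase_deriv_pos in blast)
  show "phase a (t + 2 * pi) = phase a t + 2 * pi" for t
  proof -
    have "phase a (t + 2 * pi / 3 + 2 * pi / 3 + 2 * pi / 3) = phase a t + 2 * pi / 3 + 2 * pi / 3 + 2 * pi / 3"
      by (simp only: phase_shift)
    moreover have "x + 2 * pi / 3 + 2 * pi / 3 + 2 * pi / 3 = x + 2 * pi" for x by simp
    ultimately show ?thesis by (simp only:)
  qed
qed

interpretation circle_homeo "phase a" by (rule circle_homeo_phase)

lemma w_shift: "w (t + 2 * pi / 3) = cis (2 * pi / 3) * w t"
  by (simp add: w_def phase_shift cis_mult add.commute)

text \<open>A rotation by 2 pi / 3 multiplies \<open>w\<close> by the same rotation, so a
  coefficient can be nonzero only for k congruent to 1 modulo 3.\<close>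

lemma coeff_phase_eq_0:
  assumes "k = 0 \<or> k = -1"
  shows "coeff k = 0"
proof -
  let ?g = "\<lambda>s. w s * cis (- (of_int k * s))"
  have c: "continuous_on UNIV ?g" by (intro continuous_intros continuous_on_w)
  have "?g (s + 2 * pi) = ?g s" for s using assms by (auto simp: w_periodic cis_mult[symmetric])
  then have "integral {-pi..pi} ?g = integral {-pi..pi} (\<lambda>s. ?g (s + 2 * pi / 3))"
    by (rule integral_periodic_shift[OF c, symmetric])
  also have "\<dots> = integral {-pi..pi} (\<lambda>s. cis (2 * pi / 3 * (1 - of_int k)) * ?g s)"
  proof (rule integral_cong)
    fix s
    have "2 * pi / 3 + (- (of_int k * (s + 2 * pi / 3))) = 2 * pi / 3 * (1 - of_int k) + (- (of_int k * s))"
      by (simp add: field_simps)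
    then have "cis (2 * pi / 3) * cis (- (of_int k * (s + 2 * pi / 3))) = cis (2 * pi / 3 * (1 - of_int k)) * cis (- (of_int k * s))"
      by (simp only: cis_mult)
    then show "?g (s + 2 * pi / 3) = cis (2 * pi / 3 * (1 - of_int k)) * ?g s" unfolding w_shift by algebra
  qed
  also have "\<dots> = cis (2 * pi / 3 * (1 - of_int k)) * integral {-pi..pi} ?g" by (rule integral_mult_right)
  finally have "integral {-pi..pi} ?g * (1 - cis (2 * pi / 3 * (1 - of_int k))) = 0"
    by algebra
  moreover have "cis (2 * pi / 3 * (1 - of_int k)) \<noteq> 1"
  proof
    assume "cis (2 * pi / 3 * (1 - of_int k)) = 1"
    then have "cis (2 * pi / 3 * (1 - of_int k)) = cis 0" by simp
    then have "2 * pi / 3 * (1 - of_int k) = 0" by (rule cis_eqD) (use assms in auto)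
    then show False using assms by auto
  qed
  ultimately show ?thesis by (simp add: coeff_def)
qed

text \<open>Two integrations by parts give decay 1 / k^2. Summability is what carries the extension
  continuously to the boundary.\<close>

lemma summable_coeff_phase: "summable (fnorm coeff)"
proof -
  define d2 where "d2 = (\<lambda>t. (1 - a\<^sup>2) * (6 * a * sin (3 * t)) / (1 + a\<^sup>2 + 2 * a * cos (3 * t))\<^sup>2)"
  define w' where "w' = (\<lambda>t. of_real (phase_deriv a t) * (\<i> * w t))"
  define w'' where "w'' = (\<lambda>t. of_real (phase_deriv a t) * (\<i> * w' t) + of_real (d2 t) * (\<i> * w t))"
  have nz: "1 + a\<^sup>2 + 2 * a * cos x \<noteq> 0" for x using phase_denominators(2)[of x] by simp
  have d2: "(phase_deriv a has_real_derivative d2 t) (at t)" for t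
  proof -
    have "((\<lambda>t. 1 + a\<^sup>2 + 2 * a * cos (3 * t)) has_real_derivative 2 * a * (- sin (3 * t) * 3)) (at t)"
      by (auto intro!: derivative_eq_intros)
    from DERIV_divide[OF DERIV_const[of "1 - a\<^sup>2"] this nz] show ?thesis
      unfolding phase_deriv_def[abs_def] d2_def
      by (rule DERIV_cong) (simp add: power2_eq_square[of "_ + _"])
  qed
  have D1: "(w has_vector_derivative w' t) (at t)" for t
    unfolding w_def[abs_def] w'_def by (rule has_vector_derivative_cis_comp[OF has_derivative_phase])
  have D2: "(w' has_vector_derivative w'' t) (at t)" for t
  proof -
    have "((\<lambda>t. complex_of_real (phase_deriv a t)) has_vector_derivative of_real (d2 t)) (at t)"
      using d2 by (intro has_vector_derivative_of_real) (simp add: has_real_derivative_iff_has_vector_derivative)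
    then show ?thesis unfolding w'_def w''_def
      by (intro has_vector_derivative_mult has_vector_derivative_mult_right D1[unfolded w'_def])
  qed
  have dc: "continuous_on S (phase_deriv a)" "continuous_on S d2" for S
    unfolding phase_deriv_def[abs_def] d2_def by (intro continuous_intros; use nz in auto)+
  have wc: "continuous_on S w'" "continuous_on S w''" for S
    unfolding w'_def w''_def by (intro continuous_intros continuous_on_w dc)+
  have per: "w pi = w (- pi)" "w' pi = w' (- pi)"
    using w_periodic[of "- pi"] by (simp_all add: w'_def phase_deriv_def)
  have K: "of_int k * of_int k * coeff k = - integral {-pi..pi} (\<lambda>s. w'' s * cis (- (of_int k * s))) / (2 * of_real pi)" for k
  proof -
    have "\<i> * of_int k * (\<i> * of_int k * (2 * of_real pi * coeff k)) = integral {-pi..pi} (\<lambda>s. w'' s * cis (- (of_int k * s)))"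
      using fourier_integral_deriv[OF D1 per(1) wc(1), of k] fourier_integral_deriv[OF D2 per(2) wc(2), of k] by (simp add: coeff_def)
    moreover have "\<i> * of_int k * (\<i> * of_int k * (2 * of_real pi * coeff k)) = (\<i> * \<i>) * (of_int k * of_int k * coeff k * (2 * of_real pi))"
      by (simp only: mult_ac)
    ultimately have "integral {-pi..pi} (\<lambda>s. w'' s * cis (- (of_int k * s))) = - (of_int k * of_int k * coeff k * (2 * of_real pi))"
      by (simp only: i_squared mult_minus1)
    then show ?thesis by (simp only: minus_minus) simp
  qed
  have "bounded (w'' ` {-pi..pi})" by (intro compact_imp_bounded compact_continuous_image wc compact_Icc)
  then obtain M where "\<forall>s\<in>{-pi..pi}. norm (w'' s) \<le> M" unfolding bounded_iff by blast
  then have M: "norm (w'' s) \<le> M" if "s \<in> {-pi..pi}" for s using that by blast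
  have "(real_of_int k)\<^sup>2 * norm (coeff k) \<le> M" for k
  proof -
    have "norm (integral {-pi..pi} (\<lambda>s. w'' s * cis (- (of_int k * s)))) \<le> integral {-pi..pi} (\<lambda>s. M)"
      by (rule integral_norm_bound_integral)
         (auto intro!: integrable_continuous_real continuous_intros wc simp: norm_mult M)
    then have "norm (of_int k * of_int k * coeff k) \<le> M" unfolding K by (simp add: norm_divide field_simps)
    then show ?thesis by (simp add: norm_mult power2_eq_square)
  qed
  note kM = this
  have "norm (fnorm coeff n) \<le> 2 * M * (1 / (real n)\<^sup>2)" if "n \<ge> 1" for n
    using kM[of "int n"] kM[of "- int n"] that by (simp add: fnorm_def field_simps)
  moreover have "summable (\<lambda>n. 2 * M * (1 / (real n)\<^sup>2))"
    using inverse_power_summable[of 2, where 'a = real] by (intro summable_mult) (simp add: inverse_eq_divide)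
  ultimately show ?thesis by (rule summable_comparison_test'[rotated])
qed

text \<open>The integrand has period 2 pi / 3, so three sectors contribute equally; on the one
  around 0 the limiting phase is simply 0.\<close>

lemma coeff_phase_1: "coeff 1 = 3 * integral {-(pi/3)..pi/3} (\<lambda>s. cis (phase a s - s)) / (2 * of_real pi)"
proof -
  define h where "h = (\<lambda>s. cis (phase a s - s))"
  have hc: "continuous_on S h" for S
    unfolding h_def by (intro continuous_intros continuous_on_subset[OF cont]) simp
  have hp: "h (s + 2 * pi / 3) = h s" for s by (simp add: h_def phase_shift)
  have hi: "h integrable_on {x..y}" for x y by (rule integrable_continuous_real[OF hc])
  have s: "integral {x..y} h = integral {x + 2 * pi / 3..y + 2 * pi / 3} h" for x y
    using integral_shift_real_ivl[of "x + 2 * pi / 3" "2 * pi / 3" "y + 2 * pi / 3" h] by (simp add: hp)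
  have "integral {-pi..pi} h = integral {-pi..-(pi/3)} h + (integral {-(pi/3)..pi/3} h + integral {pi/3..pi} h)"
    using Henstock_Kurzweil_Integration.integral_combine[of "-pi" "-(pi/3)" pi h]
      Henstock_Kurzweil_Integration.integral_combine[of "-(pi/3)" "pi/3" pi h] hi pi_gt_zero by (simp del: pi_gt_zero)
  also have "integral {-pi..-(pi/3)} h = integral {-(pi/3)..pi/3} h" using s[of "-pi" "-(pi/3)"] by (simp add: field_simps)
  also have "integral {pi/3..pi} h = integral {-(pi/3)..pi/3} h" using s[of "-(pi/3)" "pi/3"] by (simp add: field_simps)
  finally have "integral {-pi..pi} h = 3 * integral {-(pi/3)..pi/3} h" by simp
  moreover have "(\<lambda>s. w s * cis (- (of_int 1 * s))) = h" by (rule HOL.ext) (simp add: w_def h_def cis_mult)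
  ultimately show ?thesis unfolding coeff_def h_def by (simp only:)
qed

end


lemma integral_cis_third: "integral {-(pi/3)..pi/3} (\<lambda>s. cis (- s)) = of_real (sqrt 3)"
proof -
  have "((\<lambda>s. cis (- s)) has_integral (\<i> * cis (- (pi/3)) - \<i> * cis (- (- (pi/3))))) {-(pi/3)..pi/3}"
  proof (rule fundamental_theorem_of_calculus)
    fix x :: real
    have "((\<lambda>s. cis (- s)) has_vector_derivative of_real (- 1) * (\<i> * cis (- x))) (at x)"
      by (rule has_vector_derivative_cis_comp) (auto intro!: derivative_eq_intros)
    then have "((\<lambda>s. \<i> * cis (- s)) has_vector_derivative \<i> * (of_real (- 1) * (\<i> * cis (- x)))) (at x)"
      by (rule has_vector_derivative_mult_right)
    then show "((\<lambda>s. \<i> * cis (- s)) has_vector_derivative cis (- x)) (at x within {-(pi/3)..pi/3})"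
      by (rule has_vector_derivative_at_within[OF has_vector_derivative_eq_rhs]) (simp flip: mult.assoc)
  qed simp
  then show ?thesis by (simp add: has_integral_iff complex_eq_iff sin_60)
qed

lemma coeff_phase_tendsto:
  "(\<lambda>n. circle_homeo.coeff (phase (real n / (real n + 1))) 1) \<longlonglongrightarrow> of_real (3 * sqrt 3 / (2 * pi))"
proof -
  define r where "r = (\<lambda>n. real n / (real n + 1))"
  have r: "0 \<le> r n" "r n < 1" for n by (auto simp: r_def)
  have rl: "r \<longlonglongrightarrow> 1" unfolding r_def using LIMSEQ_n_over_Suc_n by (simp add: add.commute)
  have "(\<lambda>n. integral {-(pi/3)..pi/3} (\<lambda>s. cis (phase (r n) s - s))) \<longlonglongrightarrow> integral {-(pi/3)..pi/3} (\<lambda>s. cis (- s))"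
  proof (rule dominated_convergence_ae_interval(2)[where B = 1 and N = "{-(pi/3), pi/3}"])
    fix n
    have "continuous_on UNIV (phase (r n))"
      using has_derivative_phase[OF r] by (auto intro!: continuous_at_imp_continuous_on DERIV_isCont)
    then show "(\<lambda>s. cis (phase (r n) s - s)) integrable_on {-(pi/3)..pi/3}"
      by (intro integrable_continuous_real continuous_intros) (rule continuous_on_subset, auto)
  next
    fix s assume "s \<in> {-(pi/3)..pi/3} - {-(pi/3), pi/3}"
    then have s: "- (pi / 2) < 3 * s / 2" "3 * s / 2 < pi / 2" by auto
    have "cos (3 * s / 2) > 0" using s by (intro cos_gt_zero_pi) auto
    moreover have "cos (3 * s) = 2 * (cos (3 * s / 2))\<^sup>2 - 1" using cos_double_cos[of "3 * s / 2"] by simp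
    ultimately have c: "1 + 1 * cos (3 * s) \<noteq> 0" by simp
    have "(\<lambda>n. phase (r n) s - s) \<longlonglongrightarrow> s - 2/3 * arctan (1 * sin (3 * s) / (1 + 1 * cos (3 * s))) - s"
      unfolding phase_def using c by (intro tendsto_intros rl)
    \<comment> \<open>The quotient is tan(3 s / 2), and 3 s / 2 lies in the principal range of
      arctan exactly on this sector.\<close>
    also have "arctan (1 * sin (3 * s) / (1 + 1 * cos (3 * s))) = 3 * s / 2"
      using tan_half[of "3 * s / 2"] arctan_tan[OF s] by (simp add: add.commute)
    finally have "(\<lambda>n. phase (r n) s - s) \<longlonglongrightarrow> - s" by simp
    then show "(\<lambda>n. cis (phase (r n) s - s)) \<longlonglongrightarrow> cis (- s)" by (rule tendsto_cis)
  qed auto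
  then have "(\<lambda>n. 3 * integral {-(pi/3)..pi/3} (\<lambda>s. cis (phase (r n) s - s)) / (2 * of_real pi)) \<longlonglongrightarrow>
      3 * of_real (sqrt 3) / (2 * of_real pi)"
    unfolding integral_cis_third by (intro tendsto_intros) auto
  then have "(\<lambda>n. circle_homeo.coeff (phase (r n)) 1) \<longlonglongrightarrow> of_real (3 * sqrt 3 / (2 * pi))"
    by (simp add: coeff_phase_1[OF r])
  then show ?thesis by (simp only: r_def)
qed

text \<open>For the phase family c_0 = c_(-1) = 0, so the functional is |c_1|^2, which tends to (3
  sqrt 3 / (2 pi))^2.\<close>

lemma heinz_bound_sharp:
  assumes C: "C > 27 / (4 * pi\<^sup>2)"
  shows "\<exists>u c. ab_harmonic 0 0 u \<and> has_ab_expansion 0 0 u c \<and> inj_on u unit_disc \<and> sense_preserving u \<and>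
    u ` unit_disc = unit_disc \<and> heinz_functional 0 0 c < C"
proof -
  have "(\<lambda>n. (norm (circle_homeo.coeff (phase (real n / (real n + 1))) 1))\<^sup>2) \<longlonglongrightarrow>
      (norm (complex_of_real (3 * sqrt 3 / (2 * pi))))\<^sup>2"
    by (intro tendsto_intros coeff_phase_tendsto)
  also have "(norm (complex_of_real (3 * sqrt 3 / (2 * pi))))\<^sup>2 = 27 / (4 * pi\<^sup>2)"
    unfolding norm_of_real by (simp add: power_divide power_mult_distrib)
  finally have "\<forall>\<^sub>F n in sequentially. (norm (circle_homeo.coeff (phase (real n / (real n + 1))) 1))\<^sup>2 < C"
    using C by (rule order_tendstoD(2))
  then obtain n where n: "(norm (circle_homeo.coeff (phase (real n / (real n + 1))) 1))\<^sup>2 < C"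
    by (auto dest: eventually_happens)
  define a where "a = real n / (real n + 1)"
  have a: "0 \<le> a" "a < 1" by (auto simp: a_def)
  interpret circle_homeo "phase a" by (rule circle_homeo_phase[OF a])
  have "coeff 0 = 0" "coeff (-1) = 0" using coeff_phase_eq_0[OF a] by auto
  moreover from this have "heinz_functional 0 0 coeff < C"
    using n unfolding heinz_functional_0_0 by (simp flip: a_def)
  ultimately show ?thesis
    using ab_harmonic_ext has_ab_expansion_ext inj_on_ext sense_preserving_ext ext_image summable_coeff_phase[OF a] by blast
qed

theorem theorem2p1:
  shows "(\<forall>(\<alpha>::real) (\<beta>::real) (u :: complex \<Rightarrow> complex) (c :: int \<Rightarrow> complex).
            \<not> (\<alpha> \<in> \<int> \<and> \<alpha> < 0) \<and> \<not> (\<beta> \<in> \<int> \<and> \<beta> < 0) \<and> \<alpha> + \<beta> > -1 \<and>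
            ab_harmonic \<alpha> \<beta> u \<and> has_ab_expansion \<alpha> \<beta> u c \<and>
            inj_on u unit_disc \<and> sense_preserving u \<and> u ` unit_disc = unit_disc
            \<longrightarrow> heinz_functional \<alpha> \<beta> c \<ge> 27 / (4 * pi\<^sup>2))
       \<and> (\<forall>C::real. C > 27 / (4 * pi\<^sup>2) \<longrightarrow>
            (\<exists>(u :: complex \<Rightarrow> complex) (c :: int \<Rightarrow> complex).
               ab_harmonic 0 0 u \<and> has_ab_expansion 0 0 u c \<and>
               inj_on u unit_disc \<and> sense_preserving u \<and> u ` unit_disc = unit_disc \<and>
               heinz_functional 0 0 c < C))"
proof (intro conjI allI impI; (elim conjE)?)
  fix \<alpha> \<beta> :: real and u :: "complex \<Rightarrow> complex" and c :: "int \<Rightarrow> complex"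
  assume ab: "\<not> (\<alpha> \<in> \<int> \<and> \<alpha> < 0)" "\<not> (\<beta> \<in> \<int> \<and> \<beta> < 0)" "\<alpha> + \<beta> > -1"
    and u: "ab_harmonic \<alpha> \<beta> u" "has_ab_expansion \<alpha> \<beta> u c" "inj_on u unit_disc" "u ` unit_disc = unit_disc"
  have "continuous_on unit_disc u"
    using u(1) by (auto simp: ab_harmonic_def C2_on_def C1_on_def intro!: continuous_at_imp_continuous_on differentiable_imp_continuous_within)
  then show "heinz_functional \<alpha> \<beta> c \<ge> 27 / (4 * pi\<^sup>2)"
    using heinz_lower_bound ab u(2-4) by blast
next
  fix C :: real assume "C > 27 / (4 * pi\<^sup>2)"
  then show "\<exists>u c. ab_harmonic 0 0 u \<and> has_ab_expansion 0 0 u c \<and> inj_on u unit_disc \<and> sense_preserving u \<and>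
    u ` unit_disc = unit_disc \<and> heinz_functional 0 0 c < C"
    by (rule heinz_bound_sharp)
qed

end
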